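(* Let $\Omega\subseteq\mathbb{C}$ be a lattice, with associated Weierstrass function $\wp=\wp_\Omega$, and let $\omega_1,\omega_2$ be a basis of $\Omega$ such that $\tau=\omega_2/\omega_1$ lies in the upper half plane and satisfies $|\Re(\tau)|\le\frac12$ and $|\tau|\ge 1$. Let $\mathfrak{F}_\Omega=\{r_1\omega_1+r_2\omega_2 : r_1,r_2\in[0,1),\ r_1^2+r_2^2\ne 0\}$. Then the graph of $\wp|_{\mathfrak{F}_\Omega}$ (a subset of $\mathbb{C}^2=\mathbb{R}^4$) is a piecewise semipfaffian set of format $(7,9,1,4,144503,2)$.
   Context: $\mathbb{C}$ is identified with $\mathbb{R}^2$. The Weierstrass function is $\wp_\Omega(z)=\frac1{z^2}+\sum_{\omega\in\Omega\setminus\{0\}}\left(\frac1{(z-\omega)^2}-\frac1{\omega^2}\right)$. Pfaffian functions: a sequence $f_1,\dots,f_l:U\to\mathbb{R}$ of analytic functions on an open set $U\subseteq\mathbb{R}^n$ is a pfaffian chain if for $i=1,\dots,l$, $j=1,\dots,n$ there are real polynomials $p_{i,j}$ in $n+i$ indeterminates such that $\frac{\partial f_i}{\partial x_j}(x)=p_{i,j}(x,f_1(x),\dots,f_i(x))$ on $U$. A function $f$ on $U$ is pfaffian (with this chain) if $f(x)=p(x,f_1(x),\dots,f_l(x))$ for some polynomial $p$; it has order $l$ and degree $(\alpha,\beta)$, where $\alpha$ is a bound on the degrees of the $p_{i,j}$ and $\beta$ is a bound on the degree of $p$. A set $U\subseteq\mathbb{R}^n$ is a simple domain if it is the image of a product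 of open intervals under an invertible affine transformation. A set $X\subseteq\mathbb{R}^n$ is piecewise semipfaffian of format $(r,\alpha,\beta,n,L,M)$ if there are simple domains $U_1,\dots,U_L\subseteq\mathbb{R}^n$ and, for each $i$, pfaffian functions $f_{i,1},\dots,f_{i,m_i}:U_i\to\mathbb{R}$ with a common chain, of order $r$ and degree $(\alpha,\beta)$, with $m_i\le M$, such that $X=\bigcup_{i=1}^L\{x\in U_i: f_{i,1}(x)=\cdots=f_{i,m_i}(x)=0\}$. *)

theory Defs
  imports "HOL-Analysis.Analysis" "HOL-Library.Poly_Mapping"
begin

type_synonym 'v real_mpoly = "('v \<Rightarrow>\<^sub>0 nat) \<Rightarrow>\<^sub>0 real"

definition mpoly_eval :: "'v real_mpoly \<Rightarrow> ('v \<Rightarrow> real) \<Rightarrow> real" where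
  "mpoly_eval p v =
     (\<Sum>m\<in>Poly_Mapping.keys p.
        Poly_Mapping.lookup p m *
        (\<Prod>k\<in>Poly_Mapping.keys m. v k ^ Poly_Mapping.lookup m k))"

definition mpoly_in :: "'v set \<Rightarrow> 'v real_mpoly \<Rightarrow> bool" where
  "mpoly_in V p \<longleftrightarrow> (\<forall>m\<in>Poly_Mapping.keys p. Poly_Mapping.keys m \<subseteq> V)"

definition mpoly_deg_le :: "nat \<Rightarrow> 'v real_mpoly \<Rightarrow> bool" where
  "mpoly_deg_le d p \<longleftrightarrow>
     (\<forall>m\<in>Poly_Mapping.keys p. (\<Sum>k\<in>Poly_Mapping.keys m. Poly_Mapping.lookup m k) \<le> d)"

text \<open>
  Real analyticity in several variables: at each point of the set, a power series over
  multi-indices that converges (unconditionally, hence absolutely) to the function nearby.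
\<close>

definition real_analytic_on :: "(real^'n \<Rightarrow> real) \<Rightarrow> (real^'n) set \<Rightarrow> bool" where
  "real_analytic_on f U \<longleftrightarrow>
     (\<forall>a\<in>U. \<exists>c :: ('n \<Rightarrow> nat) \<Rightarrow> real. \<exists>e>0. \<forall>x\<in>ball a e.
        ((\<lambda>m. c m * (\<Prod>k\<in>UNIV. (x $ k - a $ k) ^ m k)) has_sum f x) UNIV)"

text \<open>
  A chain of order \<open>l\<close> is given by \<open>f 1, \<dots>, f l\<close>; the values of \<open>f\<close> at other indices
  are irrelevant. In the polynomials, the indeterminate \<open>Inl k\<close> stands for the coordinate
  \<open>x $ k\<close> and \<open>Inr k\<close> for \<open>f k x\<close>. Hence a polynomial in \<open>chain_vars i\<close> has \<open>n + i\<close>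
  indeterminates, where \<open>n = CARD('n)\<close>.
\<close>

definition chain_vars :: "nat \<Rightarrow> ('n + nat) set" where
  "chain_vars i = range Inl \<union> Inr ` {1..i}"

definition chain_point :: "(nat \<Rightarrow> real^'n \<Rightarrow> real) \<Rightarrow> real^'n \<Rightarrow> 'n + nat \<Rightarrow> real" where
  "chain_point f x = case_sum (\<lambda>k. x $ k) (\<lambda>k. f k x)"

definition pfaffian_chain ::
    "nat \<Rightarrow> nat \<Rightarrow> (real^'n) set \<Rightarrow> (nat \<Rightarrow> real^'n \<Rightarrow> real) \<Rightarrow> bool" where
  "pfaffian_chain l \<alpha> U f \<longleftrightarrow>
     open U \<and>
     (\<forall>i\<in>{1..l}. real_analytic_on (f i) U) \<and>
     (\<forall>i\<in>{1..l}. \<forall>j. \<exists>p. mpoly_in (chain_vars i) p \<and> mpoly_deg_le \<alpha> p \<and>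
        (\<forall>x\<in>U. ((\<lambda>t. f i (x + t *\<^sub>R axis j 1)) has_real_derivative
                  mpoly_eval p (chain_point f x)) (at 0)))"

text \<open>\<open>g\<close> is pfaffian on \<open>U\<close> with chain \<open>f\<close>, of order \<open>l\<close> and degree \<open>(\<alpha>, \<beta>)\<close>.\<close>

definition pfaffian ::
    "nat \<Rightarrow> nat \<Rightarrow> nat \<Rightarrow> (real^'n) set \<Rightarrow> (nat \<Rightarrow> real^'n \<Rightarrow> real) \<Rightarrow>
     (real^'n \<Rightarrow> real) \<Rightarrow> bool" where
  "pfaffian l \<alpha> \<beta> U f g \<longleftrightarrow>
     pfaffian_chain l \<alpha> U f \<and>
     (\<exists>p. mpoly_in (chain_vars l) p \<and> mpoly_deg_le \<beta> p \<and>
        (\<forall>x\<in>U. g x = mpoly_eval p (chain_point f x)))"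

text \<open>Open intervals are nonempty and may be unbounded.\<close>

definition open_interval :: "real set \<Rightarrow> bool" where
  "open_interval I \<longleftrightarrow> open I \<and> is_interval I \<and> I \<noteq> {}"

definition simple_domain :: "(real^'n) set \<Rightarrow> bool" where
  "simple_domain U \<longleftrightarrow>
     (\<exists>(I :: 'n \<Rightarrow> real set) (A :: real^'n^'n) (b :: real^'n).
        (\<forall>k. open_interval (I k)) \<and> invertible A \<and>
        U = (\<lambda>x. A *v x + b) ` {x. \<forall>k. x $ k \<in> I k})"

definition piecewise_semipfaffian ::
    "nat \<Rightarrow> nat \<Rightarrow> nat \<Rightarrow> nat \<Rightarrow> nat \<Rightarrow> nat \<Rightarrow> (real^'n) set \<Rightarrow> bool" where
  "piecewise_semipfaffian r \<alpha> \<beta> n L M X \<longleftrightarrow>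
     n = CARD('n) \<and>
     (\<exists>(U :: nat \<Rightarrow> (real^'n) set) (m :: nat \<Rightarrow> nat) (f :: nat \<Rightarrow> nat \<Rightarrow> real^'n \<Rightarrow> real).
        (\<forall>i\<in>{1..L}. simple_domain (U i) \<and> m i \<le> M \<and>
           (\<exists>c. pfaffian_chain r \<alpha> (U i) c \<and>
                (\<forall>j\<in>{1..m i}. pfaffian r \<alpha> \<beta> (U i) c (f i j)))) \<and>
        X = (\<Union>i\<in>{1..L}. {x\<in>U i. \<forall>j\<in>{1..m i}. f i j x = 0}))"

definition lattice_basis :: "complex set \<Rightarrow> complex \<Rightarrow> complex \<Rightarrow> bool" where
  "lattice_basis \<Omega> \<omega>1 \<omega>2 \<longleftrightarrow>
     \<omega>1 \<noteq> \<omega>2 \<and> independent {\<omega>1, \<omega>2} \<and>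
     \<Omega> = {of_int a * \<omega>1 + of_int b * \<omega>2 | a b :: int. True}"

definition complex_lattice :: "complex set \<Rightarrow> bool" where
  "complex_lattice \<Omega> \<longleftrightarrow> (\<exists>\<omega>1 \<omega>2. lattice_basis \<Omega> \<omega>1 \<omega>2)"

definition weierstrass_p :: "complex set \<Rightarrow> complex \<Rightarrow> complex" where
  "weierstrass_p \<Omega> z =
     1 / z\<^sup>2 + (\<Sum>\<^sub>\<infinity>\<omega>\<in>\<Omega> - {0}. 1 / (z - \<omega>)\<^sup>2 - 1 / \<omega>\<^sup>2)"

definition fundamental_domain :: "complex \<Rightarrow> complex \<Rightarrow> complex set" where
  "fundamental_domain \<omega>1 \<omega>2 =
     {of_real r1 * \<omega>1 + of_real r2 * \<omega>2 | r1 r2 :: real.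
        r1 \<in> {0..<1} \<and> r2 \<in> {0..<1} \<and> r1\<^sup>2 + r2\<^sup>2 \<noteq> 0}"

definition real_graph :: "(complex \<Rightarrow> complex) \<Rightarrow> complex set \<Rightarrow> (real^4) set" where
  "real_graph f S = (\<lambda>z. vector [Re z, Im z, Re (f z), Im (f z)]) ` S"

end

theory Submission imports Defs "HOL-Complex_Analysis.Complex_Analysis" begin

text \<open>
  An inverse branch \<open>u\<close> of \<open>wp\<close> on a convex set \<open>S\<close> that avoids the roots \<open>e1, e2, e3\<close> satisfies
  \<open>u' = \<epsilon> * exp L\<close> with \<open>L = - (Ln (n1 * (w - e1)) + Ln (n2 * (w - e2)) + Ln (n3 * (w - e3))) / 2\<close>. If every
  factor stays in a half plane, then \<open>\<bar>Im L\<bar> < 3/4 * pi\<close>, and \<open>exp (4 * Re L)\<close>, \<open>exp (Re L)\<close>,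
  \<open>tan (Im L / 2)\<close>, \<open>(cos (Im L / 2))\<^sup>2\<close>, \<open>Re u\<close>, \<open>Im u\<close> is a pfaffian chain. Appending the sum of squares
  that vanishes exactly on the desired piece of the graph of \<open>u\<close> gives order 7 and a single equation.

  For a suitable direction, ten vertical strips and half strips cover the plane minus the roots. On
  each of them the branches with a given derivative differ by lattice vectors and tend to lattice
  points along vertical rays. Bounding the displacement along such a ray leaves 16 values for the
  \<open>\<omega>2\<close>-coordinate of the limit and then 143 values for the \<open>\<omega>1\<close>-coordinate. The displacement is
  compared with half periods, since the segment from \<open>0\<close> to \<open>\<omega>/2\<close> is mapped to a path from infinity
  to a root; when two roots nearly collide, only its component along \<open>\<omega>1\<close> stays bounded, and this
  uses an explicit approximation of \<open>u\<close> near the colliding pair. With two signs, the interior and two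
  edges of the fundamental domain, and the three half periods, this makes
  \<open>10 * 2 * 3 * 16 * 143 + 3 = 137283\<close> pieces.
\<close>

text \<open>The format dictates the chain. Equations of degree 1 are affine in the chain functions,
  so the sum of squares must be the last chain function itself. The derivative of \<open>L\<close>
  is rational; with \<open>1 / Q = cnj Q / (cmod Q)^2\<close> for the product \<open>Q\<close> of
  the three factors, its only denominator has the inverse \<open>exp (4 * Re L)\<close>. Using the
  fourth power of \<open>exp (Re L)\<close> instead would raise degrees above 9. Sine and cosine
  differentiate into each other, against the triangular form of a chain; \<open>tan\<close> and the
  squared cosine of the half angle respect it, and \<open>\<bar>Im L\<bar> < pi\<close> keeps the
  half angle between the poles of \<open>tan\<close>.

  The count must be uniform in the lattice. As \<open>\<omega>2 / \<omega>1\<close> moves up,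
  \<open>root2\<close> and \<open>root3\<close> collide and the length of a ray is bounded only by a
  multiple of \<open>cmod \<omega>2\<close>. That settles the \<open>\<omega>2\<close>-coordinate.
  For the other one, the large part of the displacement is an imaginary multiple of
  \<open>\<omega>1\<close>, coming from the modulus of \<open>w - e2\<close>, and what has to be
  estimated is the real multiple, coming from its argument.\<close>

no_notation fps_nth (infixl \<open>$\<close> 75)

section \<open>Polynomial functions of bounded degree\<close>

text \<open>Polynomials enter through the functions they induce, so that variable sets and degree
  bounds follow from closure rules instead of explicit \<open>Poly_Mapping\<close> terms.\<close>

definition polyfun :: "'v set \<Rightarrow> nat \<Rightarrow> (('v \<Rightarrow> real) \<Rightarrow> real) \<Rightarrow> bool" where
  "polyfun V d g \<longleftrightarrow> (\<exists>p. mpoly_in V p \<and> mpoly_deg_le d p \<and> (\<forall>v. mpoly_eval p v = g v))"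

definition monom_eval :: "('v \<Rightarrow>\<^sub>0 nat) \<Rightarrow> ('v \<Rightarrow> real) \<Rightarrow> real" where
  "monom_eval m v = (\<Prod>k\<in>Poly_Mapping.keys m. v k ^ Poly_Mapping.lookup m k)"

definition monom_deg :: "('v \<Rightarrow>\<^sub>0 nat) \<Rightarrow> nat" where
  "monom_deg m = (\<Sum>k\<in>Poly_Mapping.keys m. Poly_Mapping.lookup m k)"

text \<open>Indices outside the keys contribute \<open>v k ^ 0\<close>. A common index set for two
  monomials is what additivity needs.\<close>

lemma monom_eval_superset:
  assumes "finite K" "Poly_Mapping.keys m \<subseteq> K"
  shows "monom_eval m v = (\<Prod>k\<in>K. v k ^ Poly_Mapping.lookup m k)"
  unfolding monom_eval_def
  by (rule prod.mono_neutral_left) (use assms in \<open>auto simp: in_keys_iff\<close>)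

lemma monom_deg_superset:
  assumes "finite K" "Poly_Mapping.keys m \<subseteq> K"
  shows "monom_deg m = (\<Sum>k\<in>K. Poly_Mapping.lookup m k)"
  unfolding monom_deg_def
  by (rule sum.mono_neutral_left) (use assms in \<open>auto simp: in_keys_iff\<close>)

lemma monom_eval_add: "monom_eval (m + n) v = monom_eval m v * monom_eval n v"
proof -
  let ?K = "Poly_Mapping.keys m \<union> Poly_Mapping.keys n"
  have "Poly_Mapping.keys (m + n) \<subseteq> ?K" by (rule Poly_Mapping.keys_add)
  then show ?thesis
    by (simp add: monom_eval_superset[of ?K] lookup_add power_add prod.distrib)
qed

lemma monom_deg_add: "monom_deg (m + n) = monom_deg m + monom_deg n"
proof -
  let ?K = "Poly_Mapping.keys m \<union> Poly_Mapping.keys n"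
  have "Poly_Mapping.keys (m + n) \<subseteq> ?K" by (rule Poly_Mapping.keys_add)
  then show ?thesis
    by (simp add: monom_deg_superset[of ?K] lookup_add sum.distrib)
qed

lemma mpoly_eval_superset:
  assumes "finite K" "Poly_Mapping.keys p \<subseteq> K"
  shows "mpoly_eval p v = (\<Sum>m\<in>K. Poly_Mapping.lookup p m * monom_eval m v)"
  unfolding mpoly_eval_def monom_eval_def
  by (rule sum.mono_neutral_left) (use assms in \<open>auto simp: in_keys_iff\<close>)

lemma polyfun_monom:
  assumes "Poly_Mapping.keys m \<subseteq> V" "monom_deg m \<le> d"
  shows "polyfun V d (\<lambda>v. c * monom_eval m v)"
  unfolding polyfun_def
proof (intro exI conjI allI)
  let ?p = "Poly_Mapping.single m c"
  show "mpoly_in V ?p" "mpoly_deg_le d ?p"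
    using assms by (auto simp: mpoly_in_def mpoly_deg_le_def monom_deg_def)
  show "mpoly_eval ?p v = c * monom_eval m v" for v
    by (subst mpoly_eval_superset[of "{m}"]) auto
qed

lemma polyfun_add:
  assumes "polyfun V d f" "polyfun V d g"
  shows "polyfun V d (\<lambda>v. f v + g v)"
proof -
  obtain p q where p: "mpoly_in V p" "mpoly_deg_le d p" "\<forall>v. mpoly_eval p v = f v"
    and q: "mpoly_in V q" "mpoly_deg_le d q" "\<forall>v. mpoly_eval q v = g v"
    using assms unfolding polyfun_def by blast
  let ?K = "Poly_Mapping.keys p \<union> Poly_Mapping.keys q"
  have K: "Poly_Mapping.keys (p + q) \<subseteq> ?K" by (rule Poly_Mapping.keys_add)
  have "mpoly_eval (p + q) v = f v + g v" for v
  proof -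
    have "mpoly_eval (p + q) v = mpoly_eval p v + mpoly_eval q v"
      using K by (simp add: mpoly_eval_superset[of ?K] lookup_add ring_distribs sum.distrib)
    then show ?thesis using p(3) q(3) by simp
  qed
  moreover have "mpoly_in V (p + q)" "mpoly_deg_le d (p + q)"
    using K p q unfolding mpoly_in_def mpoly_deg_le_def by blast+
  ultimately show ?thesis unfolding polyfun_def by blast
qed

lemma polyfun_const: "polyfun V d (\<lambda>v. c)"
  using polyfun_monom[of 0 V d c] by (simp add: monom_deg_def monom_eval_def)

lemma polyfun_sum:
  assumes "finite I" "\<And>i. i \<in> I \<Longrightarrow> polyfun V d (f i)"
  shows "polyfun V d (\<lambda>v. \<Sum>i\<in>I. f i v)"
  using assms by (induction I rule: finite_induct) (auto intro: polyfun_const polyfun_add)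

lemma polyfun_mono: "polyfun V d f \<Longrightarrow> V \<subseteq> V' \<Longrightarrow> d \<le> d' \<Longrightarrow> polyfun V' d' f"
proof -
  assume *: "polyfun V d f" "V \<subseteq> V'" "d \<le> d'"
  then obtain p where "mpoly_in V p" "mpoly_deg_le d p" "\<forall>v. mpoly_eval p v = f v"
    unfolding polyfun_def by blast
  moreover have "mpoly_in V' p" using calculation(1) *(2) unfolding mpoly_in_def by blast
  moreover have "mpoly_deg_le d' p" using calculation(2) *(3) unfolding mpoly_deg_le_def by fastforce
  ultimately show ?thesis unfolding polyfun_def by blast
qed

lemma polyfun_var: "k \<in> V \<Longrightarrow> d \<ge> 1 \<Longrightarrow> polyfun V d (\<lambda>v. v k)"
  using polyfun_monom[of "Poly_Mapping.single k 1" V d 1]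
  by (simp add: monom_deg_def monom_eval_def)

text \<open>Expanded into a double sum of monomials, the product is covered by
  \<open>polyfun_sum\<close> and \<open>polyfun_monom\<close>; coefficients of \<open>p * q\<close>
  and their possible cancellation are never examined.\<close>

lemma polyfun_mult:
  assumes "polyfun V d f" "polyfun V e g"
  shows "polyfun V (d + e) (\<lambda>v. f v * g v)"
proof -
  obtain p q where p: "mpoly_in V p" "mpoly_deg_le d p" "\<forall>v. mpoly_eval p v = f v"
    and q: "mpoly_in V q" "mpoly_deg_le e q" "\<forall>v. mpoly_eval q v = g v"
    using assms unfolding polyfun_def by blast
  have "f v * g v = (\<Sum>m\<in>Poly_Mapping.keys p. \<Sum>n\<in>Poly_Mapping.keys q.
      (Poly_Mapping.lookup p m * Poly_Mapping.lookup q n) * monom_eval (m + n) v)" for v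
  proof -
    have "f v * g v = (\<Sum>m\<in>Poly_Mapping.keys p. Poly_Mapping.lookup p m * monom_eval m v) *
        (\<Sum>n\<in>Poly_Mapping.keys q. Poly_Mapping.lookup q n * monom_eval n v)"
      using mpoly_eval_superset[OF finite_keys order_refl, of p v]
        mpoly_eval_superset[OF finite_keys order_refl, of q v] p(3) q(3) by simp
    then show ?thesis
      unfolding sum_product by (simp add: monom_eval_add mult_ac)
  qed
  moreover have "polyfun V (d + e) (\<lambda>v. (\<Sum>m\<in>Poly_Mapping.keys p. \<Sum>n\<in>Poly_Mapping.keys q.
      (Poly_Mapping.lookup p m * Poly_Mapping.lookup q n) * monom_eval (m + n) v))"
  proof (intro polyfun_sum finite_keys polyfun_monom)
    fix m n assume mn: "m \<in> Poly_Mapping.keys p" "n \<in> Poly_Mapping.keys q"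
    show "Poly_Mapping.keys (m + n) \<subseteq> V"
      using p(1) q(1) mn Poly_Mapping.keys_add[of m n] unfolding mpoly_in_def by blast
    show "monom_deg (m + n) \<le> d + e"
      using p(2) q(2) mn unfolding mpoly_deg_le_def monom_deg_def[symmetric]
      by (auto simp: monom_deg_add intro: add_mono)
  qed
  ultimately show ?thesis by simp
qed

text \<open>The variables are real, so these functions are closed under \<open>cnj\<close> as well;
  the derivative of \<open>log_root\<close> will contain a conjugated factor.\<close>

definition cpolyfun :: "'v set \<Rightarrow> nat \<Rightarrow> (('v \<Rightarrow> real) \<Rightarrow> complex) \<Rightarrow> bool" where
  "cpolyfun V d g \<longleftrightarrow> polyfun V d (\<lambda>v. Re (g v)) \<and> polyfun V d (\<lambda>v. Im (g v))"

lemma polyfun_minus: "polyfun V d f \<Longrightarrow> polyfun V d (\<lambda>v. - f v)"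
  using polyfun_mult[OF polyfun_const[of V 0 "-1"]] by simp

lemma polyfun_diff: "polyfun V d f \<Longrightarrow> polyfun V d g \<Longrightarrow> polyfun V d (\<lambda>v. f v - g v)"
  using polyfun_add[OF _ polyfun_minus] by fastforce

lemma cpolyfun_add: "cpolyfun V d f \<Longrightarrow> cpolyfun V d g \<Longrightarrow> cpolyfun V d (\<lambda>v. f v + g v)"
  by (simp add: cpolyfun_def polyfun_add)

lemma cpolyfun_diff: "cpolyfun V d f \<Longrightarrow> cpolyfun V d g \<Longrightarrow> cpolyfun V d (\<lambda>v. f v - g v)"
  by (simp add: cpolyfun_def polyfun_diff)

lemma cpolyfun_mult: "cpolyfun V d f \<Longrightarrow> cpolyfun V e g \<Longrightarrow> cpolyfun V (d + e) (\<lambda>v. f v * g v)"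
  by (auto simp: cpolyfun_def intro!: polyfun_add polyfun_diff polyfun_mult)

lemma cpolyfun_cnj: "cpolyfun V d f \<Longrightarrow> cpolyfun V d (\<lambda>v. cnj (f v))"
  by (simp add: cpolyfun_def polyfun_minus)

lemma cpolyfun_const: "cpolyfun V d (\<lambda>v. c)"
  by (simp add: cpolyfun_def polyfun_const)

lemma cpolyfun_Complex: "polyfun V d f \<Longrightarrow> polyfun V d g \<Longrightarrow> cpolyfun V d (\<lambda>v. Complex (f v) (g v))"
  by (simp add: cpolyfun_def)

section \<open>Power series in several real variables\<close>

definition real_monom :: "real^'n \<Rightarrow> ('n \<Rightarrow> nat) \<Rightarrow> real" where
  "real_monom y m = (\<Prod>k\<in>UNIV. (y $ k) ^ m k)"

text \<open>For a fixed radius the weighted coefficient sum is a Banach algebra norm and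
  \<open>M\<close> an upper bound for it. Its submultiplicativity is what allows substitution into a
  power series. The coefficients are complex so that holomorphic functions can be composed; real
  parts are taken at the end.\<close>

definition expansion ::
    "(('n::finite \<Rightarrow> nat) \<Rightarrow> complex) \<Rightarrow> real \<Rightarrow> real \<Rightarrow> (real^'n \<Rightarrow> complex) \<Rightarrow> real^'n \<Rightarrow> bool" where
  "expansion c \<rho> M g a \<longleftrightarrow>
     (\<lambda>m. norm (c m) * \<rho> ^ sum m UNIV) summable_on UNIV \<and>
     (\<Sum>\<^sub>\<infinity>m. norm (c m) * \<rho> ^ sum m UNIV) \<le> M \<and>
     (\<forall>x. (\<forall>k. \<bar>x $ k - a $ k\<bar> \<le> \<rho>) \<longrightarrow>
        ((\<lambda>m. c m * of_real (real_monom (x - a) m)) has_sum g x) UNIV)"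

definition expandable :: "(real^'n::finite \<Rightarrow> complex) \<Rightarrow> real^'n \<Rightarrow> bool" where
  "expandable g a \<longleftrightarrow> (\<exists>c \<rho> M. \<rho> > 0 \<and> expansion c \<rho> M g a)"

lemma abs_real_monom_le:
  assumes "\<And>k. \<bar>y $ k\<bar> \<le> \<rho>"
  shows "\<bar>real_monom y m\<bar> \<le> \<rho> ^ sum m UNIV"
proof -
  have "\<bar>real_monom y m\<bar> = (\<Prod>k\<in>UNIV. \<bar>y $ k\<bar> ^ m k)"
    by (simp add: real_monom_def abs_prod power_abs)
  also have "\<dots> \<le> (\<Prod>k\<in>UNIV. \<rho> ^ m k)"
    by (intro prod_mono) (use assms in \<open>auto intro: power_mono\<close>)
  finally show ?thesis by (simp add: power_sum)
qed

lemma expansion_norm_le: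
  assumes "expansion c \<rho> M g a" "\<And>k. \<bar>x $ k - a $ k\<bar> \<le> \<rho>"
  shows "norm (g x) \<le> M"
proof -
  have 1: "((\<lambda>m. c m * of_real (real_monom (x - a) m)) has_sum g x) UNIV"
    and 2: "(\<lambda>m. norm (c m) * \<rho> ^ sum m UNIV) summable_on UNIV"
    and 3: "(\<Sum>\<^sub>\<infinity>m. norm (c m) * \<rho> ^ sum m UNIV) \<le> M"
    using assms unfolding expansion_def by auto
  have "norm (g x) \<le> (\<Sum>\<^sub>\<infinity>m. norm (c m) * \<rho> ^ sum m UNIV)"
  proof (rule norm_infsum_le[OF 1 has_sum_infsum[OF 2]])
    show "norm (c m * of_real (real_monom (x - a) m)) \<le> norm (c m) * \<rho> ^ sum m UNIV" for m
      using abs_real_monom_le[of "x - a" \<rho> m] assms(2) by (auto simp: norm_mult intro!: mult_left_mono)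
  qed
  with 3 show ?thesis by simp
qed

lemma expansion_const: "\<rho> > 0 \<Longrightarrow> expansion (\<lambda>m. if m = (\<lambda>_. 0) then z else 0) \<rho> (norm z) (\<lambda>_. z) a"
proof -
  assume "\<rho> > 0"
  have 1: "((\<lambda>m::'a\<Rightarrow>nat. norm (if m = (\<lambda>_. 0) then z else 0) * \<rho> ^ sum m UNIV) has_sum norm z) UNIV"
    by (rule has_sum_finite_neutralI[of "{\<lambda>_. 0}"]) auto
  have 2: "((\<lambda>m. (if m = (\<lambda>_. 0) then z else 0) * of_real (real_monom (x - a) m)) has_sum z) UNIV" for x
    by (rule has_sum_finite_neutralI[of "{\<lambda>_. 0}"]) (auto simp: real_monom_def)
  show ?thesis
    using 1 2 unfolding expansion_def by (auto simp: has_sum_iff)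
qed

lemma expandable_const: "expandable (\<lambda>_. z) a"
  using expansion_const[of 1 z a] unfolding expandable_def by (meson zero_less_one)

lemma expansion_shrink:
  assumes "expansion c \<rho> M g a" "0 < \<rho>'" "\<rho>' \<le> \<rho>"
  shows "expansion c \<rho>' M g a"
proof -
  have s: "(\<lambda>m. norm (c m) * \<rho> ^ sum m UNIV) summable_on UNIV"
    using assms unfolding expansion_def by auto
  have le: "norm (c m) * \<rho>' ^ sum m UNIV \<le> norm (c m) * \<rho> ^ sum m UNIV" for m
    using assms by (auto intro!: mult_left_mono power_mono)
  have s': "(\<lambda>m. norm (c m) * \<rho>' ^ sum m UNIV) summable_on UNIV"
    by (rule summable_on_comparison_test[OF s]) (use le assms in auto)
  have "(\<Sum>\<^sub>\<infinity>m. norm (c m) * \<rho>' ^ sum m UNIV) \<le> (\<Sum>\<^sub>\<infinity>m. norm (c m) * \<rho> ^ sum m UNIV)"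
    by (rule infsum_mono[OF s' s le])
  then show ?thesis
    using assms s' unfolding expansion_def by (fastforce intro: order_trans)
qed

lemma expansion_add:
  assumes "expansion c \<rho> M g a" "expansion d \<rho> N h a" "\<rho> > 0"
  shows "expansion (\<lambda>m. c m + d m) \<rho> (M + N) (\<lambda>x. g x + h x) a"
proof -
  have c: "(\<lambda>m. norm (c m) * \<rho> ^ sum m UNIV) summable_on UNIV"
    and d: "(\<lambda>m. norm (d m) * \<rho> ^ sum m UNIV) summable_on UNIV"
    using assms unfolding expansion_def by auto
  have le: "norm (c m + d m) * \<rho> ^ sum m UNIV \<le> norm (c m) * \<rho> ^ sum m UNIV + norm (d m) * \<rho> ^ sum m UNIV" for m
    using assms(3) norm_triangle_ineq[of "c m" "d m"]
    by (simp add: mult_right_mono flip: distrib_right)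
  have s: "(\<lambda>m. norm (c m + d m) * \<rho> ^ sum m UNIV) summable_on UNIV"
    by (rule summable_on_comparison_test[OF summable_on_add[OF c d]]) (use le assms(3) in auto)
  have "(\<Sum>\<^sub>\<infinity>m. norm (c m + d m) * \<rho> ^ sum m UNIV) \<le> M + N"
    using infsum_mono[OF s summable_on_add[OF c d] le] infsum_add[OF c d] assms
    unfolding expansion_def by force
  moreover have "((\<lambda>m. (c m + d m) * of_real (real_monom (x - a) m)) has_sum (g x + h x)) UNIV"
    if "\<forall>k. \<bar>x $ k - a $ k\<bar> \<le> \<rho>" for x
    using that assms has_sum_add unfolding expansion_def ring_distribs by blast
  ultimately show ?thesis using s unfolding expansion_def by blast
qed

lemma finite_le_fun: "finite {p :: 'n::finite \<Rightarrow> nat. \<forall>k. p k \<le> m k}"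
proof -
  have "{p. \<forall>k. p k \<le> m k} = PiE UNIV (\<lambda>k. {..m k})" by (auto simp: PiE_def)
  then show ?thesis by (simp add: finite_PiE)
qed

text \<open>The pairs \<open>(p, q)\<close> are regrouped by \<open>m = p + q\<close>; since
  summation is unordered, the bijection with pairs \<open>p \<le> m\<close> suffices, and each fibre
  is finite.\<close>

lemma has_sum_cauchy_product:
  fixes F :: "('n::finite \<Rightarrow> nat) \<Rightarrow> ('n \<Rightarrow> nat) \<Rightarrow> 'a :: banach"
  assumes "((\<lambda>(p, q). F p q) has_sum S) (UNIV \<times> UNIV)"
  shows "((\<lambda>m. \<Sum>p | \<forall>k. p k \<le> m k. F p (\<lambda>k. m k - p k)) has_sum S) UNIV"
proof -
  have "((\<lambda>(m, p). F p (\<lambda>k. m k - p k)) has_sum S) (SIGMA m:UNIV. {p. \<forall>k. p k \<le> m k})"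
    by (rule iffD2[OF has_sum_reindex_bij_witness[of _ "\<lambda>(p, q). (\<lambda>k. p k + q k, p)" "\<lambda>(m, p). (p, \<lambda>k. m k - p k)", OF _ _ _ _ _ refl] assms])
       (auto simp: fun_eq_iff)
  then show ?thesis
    by (rule has_sum_SigmaD) (auto intro!: has_sum_finiteI finite_le_fun)
qed

text \<open>The double series of weighted norms converges to the product of the two norm sums; it
  dominates both the Cauchy product coefficients and the evaluated double series.\<close>

lemma expansion_mult:
  assumes "expansion c \<rho> M g a" "expansion d \<rho> N h a" "\<rho> > 0"
  shows "\<exists>e. expansion e \<rho> (M * N) (\<lambda>x. g x * h x) a"
proof -
  define e where "e = (\<lambda>m. \<Sum>p | \<forall>k. p k \<le> m k. c p * d (\<lambda>k. m k - p k))"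
  let ?w = "\<lambda>m::'a\<Rightarrow>nat. \<rho> ^ sum m UNIV"
  have c: "(\<lambda>m. norm (c m) * ?w m) summable_on UNIV"
    and d: "(\<lambda>m. norm (d m) * ?w m) summable_on UNIV"
    using assms unfolding expansion_def by auto
  define A B where "A = (\<Sum>\<^sub>\<infinity>m. norm (c m) * ?w m)" and "B = (\<Sum>\<^sub>\<infinity>m. norm (d m) * ?w m)"
  have A: "((\<lambda>m. norm (c m) * ?w m) has_sum A) UNIV" and B: "((\<lambda>m. norm (d m) * ?w m) has_sum B) UNIV"
    using c d by (auto simp: A_def B_def)
  have AB: "((\<lambda>(p, q). (norm (c p) * ?w p) * (norm (d q) * ?w q)) has_sum A * B) (UNIV \<times> UNIV)"
  proof (rule has_sum_SigmaI)
    show "((\<lambda>q. case (p, q) of (p, q) \<Rightarrow> norm (c p) * ?w p * (norm (d q) * ?w q)) has_sum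
       (norm (c p) * ?w p) * B) UNIV" for p
      using has_sum_cmult_right[OF B] by simp
    show "((\<lambda>p. (norm (c p) * ?w p) * B) has_sum A * B) UNIV" by (rule has_sum_cmult_left[OF A])
    show "(\<lambda>(p, q). (norm (c p) * ?w p) * (norm (d q) * ?w q)) summable_on UNIV \<times> UNIV"
      by (rule summable_on_SigmaI[where g = "\<lambda>p. (norm (c p) * ?w p) * B"])
         (use assms(3) has_sum_cmult_right[OF B] summable_on_cmult_left[OF c] in auto)
  qed
  have wadd: "?w p * ?w (\<lambda>k. m k - p k) = ?w m" if "\<forall>k. p k \<le> m k" for p m
    using that by (simp flip: power_add sum.distrib)
  have E: "((\<lambda>m. \<Sum>p | \<forall>k. p k \<le> m k. (norm (c p) * ?w p) * (norm (d (\<lambda>k. m k - p k)) * ?w (\<lambda>k. m k - p k))) has_sum A * B) UNIV"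
    by (rule has_sum_cauchy_product[OF AB])
  have le: "norm (e m) * ?w m \<le> (\<Sum>p | \<forall>k. p k \<le> m k. (norm (c p) * ?w p) * (norm (d (\<lambda>k. m k - p k)) * ?w (\<lambda>k. m k - p k)))" for m
  proof -
    have "norm (e m) * ?w m \<le> (\<Sum>p | \<forall>k. p k \<le> m k. norm (c p * d (\<lambda>k. m k - p k))) * ?w m"
      unfolding e_def using assms(3) by (intro mult_right_mono norm_sum) auto
    also have "\<dots> = (\<Sum>p | \<forall>k. p k \<le> m k. (norm (c p) * ?w p) * (norm (d (\<lambda>k. m k - p k)) * ?w (\<lambda>k. m k - p k)))"
      unfolding sum_distrib_right
    proof (rule sum.cong[OF refl])
      fix p assume "p \<in> {p. \<forall>k. p k \<le> m k}"
      then have "?w m = ?w p * ?w (\<lambda>k. m k - p k)" using wadd[of p m] by simp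
      then show "norm (c p * d (\<lambda>k. m k - p k)) * ?w m = (norm (c p) * ?w p) * (norm (d (\<lambda>k. m k - p k)) * ?w (\<lambda>k. m k - p k))"
        by (simp add: norm_mult)
    qed
    finally show ?thesis .
  qed
  have s: "(\<lambda>m. norm (e m) * ?w m) summable_on UNIV"
    by (rule summable_on_comparison_test[OF has_sum_imp_summable[OF E]]) (use le assms(3) in auto)
  have "(\<Sum>\<^sub>\<infinity>m. norm (e m) * ?w m) \<le> A * B"
    using infsum_mono[OF s has_sum_imp_summable[OF E] le] infsumI[OF E] by simp
  also have "\<dots> \<le> M * N"
  proof (rule mult_mono)
    show "A \<le> M" "B \<le> N" using assms unfolding expansion_def A_def B_def by auto
    show "0 \<le> B" unfolding B_def by (rule infsum_nonneg) (use assms(3) in auto)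
    have "0 \<le> A" unfolding A_def by (rule infsum_nonneg) (use assms(3) in auto)
    then show "0 \<le> M" using \<open>A \<le> M\<close> by simp
  qed
  finally have *: "(\<Sum>\<^sub>\<infinity>m. norm (e m) * ?w m) \<le> M * N" .
  have "((\<lambda>m. e m * of_real (real_monom (x - a) m)) has_sum (g x * h x)) UNIV"
    if x: "\<forall>k. \<bar>x $ k - a $ k\<bar> \<le> \<rho>" for x
  proof -
    let ?r = "\<lambda>m. of_real (real_monom (x - a) m) :: complex"
    have g: "((\<lambda>m. c m * ?r m) has_sum g x) UNIV" and h: "((\<lambda>m. d m * ?r m) has_sum h x) UNIV"
      using assms x unfolding expansion_def by auto
    have rle: "norm (?r m) \<le> ?w m" for m
      using abs_real_monom_le[of "x - a" \<rho> m] x by auto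
    have "((\<lambda>(p, q). (c p * ?r p) * (d q * ?r q)) has_sum g x * h x) (UNIV \<times> UNIV)"
    proof (rule has_sum_SigmaI)
      show "((\<lambda>q. case (p, q) of (p, q) \<Rightarrow> (c p * ?r p) * (d q * ?r q)) has_sum (c p * ?r p) * h x) UNIV" for p
        using has_sum_cmult_right[OF h] by simp
      show "((\<lambda>p. (c p * ?r p) * h x) has_sum g x * h x) UNIV" by (rule has_sum_cmult_left[OF g])
      show "(\<lambda>(p, q). (c p * ?r p) * (d q * ?r q)) summable_on UNIV \<times> UNIV"
      proof (rule abs_summable_summable, rule Infinite_Sum.abs_summable_on_comparison_test'[OF has_sum_imp_summable[OF AB]])
        fix z :: "('a \<Rightarrow> nat) \<times> ('a \<Rightarrow> nat)"
        obtain p q where z: "z = (p, q)" by force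
        show "norm (case z of (p, q) \<Rightarrow> (c p * ?r p) * (d q * ?r q)) \<le> (case z of (p, q) \<Rightarrow> (norm (c p) * ?w p) * (norm (d q) * ?w q))"
          unfolding z prod.case norm_mult
          by (intro mult_mono mult_nonneg_nonneg rle[simplified]) (use assms(3) rle in auto)
      qed
    qed
    then have "((\<lambda>m. \<Sum>p | \<forall>k. p k \<le> m k. (c p * ?r p) * (d (\<lambda>k. m k - p k) * ?r (\<lambda>k. m k - p k))) has_sum g x * h x) UNIV"
      by (rule has_sum_cauchy_product)
    moreover have "(\<Sum>p | \<forall>k. p k \<le> m k. (c p * ?r p) * (d (\<lambda>k. m k - p k) * ?r (\<lambda>k. m k - p k))) = e m * ?r m" for m
      unfolding e_def sum_distrib_right
    proof (rule sum.cong[OF refl])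
      fix p assume p: "p \<in> {p. \<forall>k. p k \<le> m k}"
      have "real_monom (x - a) p * real_monom (x - a) (\<lambda>k. m k - p k) = real_monom (x - a) m"
        unfolding real_monom_def prod.distrib[symmetric] power_add[symmetric] using p by simp
      then show "(c p * ?r p) * (d (\<lambda>k. m k - p k) * ?r (\<lambda>k. m k - p k)) = c p * d (\<lambda>k. m k - p k) * ?r m"
        by (metis (no_types, lifting) mult.assoc mult.left_commute of_real_mult)
    qed
    ultimately show ?thesis by simp
  qed
  with s * show ?thesis unfolding expansion_def by blast
qed


lemma expansion_power:
  assumes "expansion c \<rho> M g a" "\<rho> > 0"
  shows "\<exists>e. expansion e \<rho> (M ^ n) (\<lambda>x. g x ^ n) a"
proof (induction n)
  case 0
  show ?case using expansion_const[OF assms(2), of 1 a] by auto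
next
  case (Suc n)
  then obtain e where "expansion e \<rho> (M ^ n) (\<lambda>x. g x ^ n) a" by blast
  from expansion_mult[OF assms(1) this assms(2)] show ?case by simp
qed

text \<open>Without constant term every occurring multi-index has total degree at least 1, so
  shrinking the radius by the factor \<theta> shrinks the norm sum by at least \<theta>. Composition
  needs this norm to be small.\<close>

lemma expansion_diff_base:
  assumes "expandable g a" "s > 0"
  shows "\<exists>c \<rho>. \<rho> > 0 \<and> expansion c \<rho> s (\<lambda>x. g x - g a) a"
proof -
  obtain c0 \<rho> M where \<rho>: "\<rho> > 0" and c0: "expansion c0 \<rho> M g a"
    using assms(1) unfolding expandable_def by blast
  have "((\<lambda>m. c0 m * of_real (real_monom (a - a) m)) has_sum g a) UNIV"
  proof -
    have "\<forall>x. (\<forall>k. \<bar>x $ k - a $ k\<bar> \<le> \<rho>) \<longrightarrow>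
        ((\<lambda>m. c0 m * of_real (real_monom (x - a) m)) has_sum g x) UNIV"
      using c0 unfolding expansion_def by blast
    from this[rule_format, of a] \<rho> show ?thesis by simp
  qed
  moreover have "((\<lambda>m. c0 m * of_real (real_monom (a - a) m)) has_sum c0 (\<lambda>_. 0)) UNIV"
  proof (rule has_sum_finite_neutralI[of "{\<lambda>_. 0}"])
    fix m :: "'a \<Rightarrow> nat" assume "m \<in> UNIV - {\<lambda>_. 0}"
    then obtain k where "m k \<noteq> 0" by (auto simp: fun_eq_iff)
    then have "real_monom (a - a) m = 0" by (auto simp: real_monom_def)
    then show "c0 m * of_real (real_monom (a - a) m) = 0" by (simp del: diff_self)
  qed (auto simp: real_monom_def)
  ultimately have ga: "g a = c0 (\<lambda>_. 0)" by (rule has_sum_unique)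
  define c where "c = (\<lambda>m::'a\<Rightarrow>nat. c0 m + (if m = (\<lambda>_. 0) then - g a else 0))"
  define K where "K = M + norm (- g a)"
  have c: "expansion c \<rho> K (\<lambda>x. g x - g a) a"
    using expansion_add[OF c0 expansion_const[OF \<rho>, of "- g a" a] \<rho>] by (simp add: c_def K_def)
  have c_0: "c (\<lambda>_. 0) = 0" by (simp add: c_def ga)
  have sc: "(\<lambda>m. norm (c m) * \<rho> ^ sum m UNIV) summable_on UNIV"
    and Kc: "(\<Sum>\<^sub>\<infinity>m. norm (c m) * \<rho> ^ sum m UNIV) \<le> K"
    using c unfolding expansion_def by auto
  have "0 \<le> (\<Sum>\<^sub>\<infinity>m. norm (c m) * \<rho> ^ sum m UNIV)" by (rule infsum_nonneg) (use \<rho> in auto)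
  with Kc have K: "K \<ge> 0" by simp
  \<comment> \<open>\<open>K + 1\<close> keeps the denominator positive when
    \<open>K = 0\<close>.\<close>
  define \<theta> where "\<theta> = min 1 (s / (K + 1))"
  have \<theta>: "0 < \<theta>" "\<theta> \<le> 1" "\<theta> * K \<le> s"
  proof -
    show "0 < \<theta>" "\<theta> \<le> 1" using assms(2) K by (auto simp: \<theta>_def)
    have "\<theta> * K \<le> (s / (K + 1)) * K" using K by (intro mult_right_mono) (auto simp: \<theta>_def)
    also have "\<dots> \<le> s" using K assms(2) by (simp add: field_simps)
    finally show "\<theta> * K \<le> s" .
  qed
  have c\<theta>: "expansion c (\<theta> * \<rho>) K (\<lambda>x. g x - g a) a"
    by (rule expansion_shrink[OF c]) (use \<theta> \<rho> in \<open>auto simp: mult_le_cancel_right1\<close>)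
  have le: "norm (c m) * (\<theta> * \<rho>) ^ sum m UNIV \<le> \<theta> * (norm (c m) * \<rho> ^ sum m UNIV)" for m
  proof (cases "m = (\<lambda>_. 0)")
    case False
    then obtain k where "m k \<noteq> 0" by (auto simp: fun_eq_iff)
    then have "sum m UNIV \<noteq> 0" by auto
    then have "\<theta> ^ sum m UNIV \<le> \<theta>" using \<theta> by (metis less_eq_real_def power_decreasing power_one_right One_nat_def Suc_leI neq0_conv)
    then have "\<theta> ^ sum m UNIV * (norm (c m) * \<rho> ^ sum m UNIV) \<le> \<theta> * (norm (c m) * \<rho> ^ sum m UNIV)"
      using \<rho> by (intro mult_right_mono) auto
    then show ?thesis by (simp add: power_mult_distrib mult_ac)
  qed (simp add: c_0)
  have sc': "(\<lambda>m. norm (c m) * (\<theta> * \<rho>) ^ sum m UNIV) summable_on UNIV"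
    using c\<theta> unfolding expansion_def by auto
  have "(\<Sum>\<^sub>\<infinity>m. norm (c m) * (\<theta> * \<rho>) ^ sum m UNIV) \<le> (\<Sum>\<^sub>\<infinity>m. \<theta> * (norm (c m) * \<rho> ^ sum m UNIV))"
    by (rule infsum_mono[OF sc' summable_on_cmult_right[OF sc] le])
  also have "\<dots> = \<theta> * (\<Sum>\<^sub>\<infinity>m. norm (c m) * \<rho> ^ sum m UNIV)" by (rule infsum_cmult_right[OF sc])
  also have "\<dots> \<le> \<theta> * K" using Kc \<theta> by (intro mult_left_mono) auto
  finally have "(\<Sum>\<^sub>\<infinity>m. norm (c m) * (\<theta> * \<rho>) ^ sum m UNIV) \<le> s" using \<theta> by simp
  then have "expansion c (\<theta> * \<rho>) s (\<lambda>x. g x - g a) a"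
    using c\<theta> unfolding expansion_def by blast
  then show ?thesis using \<theta> \<rho> by (intro exI[of _ c] exI[of _ "\<theta> * \<rho>"]) auto
qed

text \<open>The powers of \<open>g x - g a\<close> have norm sums at most \<open>s ^ n\<close> with
  \<open>s\<close> inside the disc of convergence of \<open>f\<close> at \<open>g a\<close>. The
  double series over the power and the multi-index is therefore absolutely convergent and may be
  summed in either order.\<close>

lemma expandable_compose:
  assumes "expandable g a" "f holomorphic_on A" "open A" "g a \<in> A"
  shows "expandable (\<lambda>x. f (g x)) a"
proof -
  obtain r where r: "r > 0" "ball (g a) r \<subseteq> A"
    using assms(3,4) openE by blast
  define s where "s = r / 2"
  define b where "b = (\<lambda>n. (deriv ^^ n) f (g a) / fact n)"
  have fb: "(\<lambda>n. b n * (w - g a) ^ n) sums f w" if "w \<in> ball (g a) r" for w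
    unfolding b_def by (rule holomorphic_power_series[OF holomorphic_on_subset[OF assms(2) r(2)] that])
  have s: "0 < s" "s < r" using r by (auto simp: s_def)
  \<comment> \<open>Convergence at the larger radius \<open>t < r\<close> yields absolute
    convergence at \<open>s\<close>.\<close>
  define t where "t = (s + r) / 2"
  have t: "s < t" "t < r" using s by (auto simp: t_def)
  have "g a + of_real t \<in> ball (g a) r" using s t by (auto simp: dist_norm)
  from fb[OF this] have "summable (\<lambda>n. b n * of_real t ^ n)" by (simp add: sums_iff)
  then have "summable (\<lambda>n. norm (b n * of_real s ^ n))"
    by (rule powser_insidea) (use s t in auto)
  then have bs: "(\<lambda>n. norm (b n) * s ^ n) summable_on UNIV"
    using s by (subst summable_on_UNIV_nonneg_real_iff) (auto simp: norm_mult norm_power)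
  obtain c \<rho> where \<rho>: "\<rho> > 0" and c: "expansion c \<rho> s (\<lambda>x. g x - g a) a"
    using expansion_diff_base[OF assms(1) s(1)] by blast
  have "\<forall>n. \<exists>e. expansion e \<rho> (s ^ n) (\<lambda>x. (g x - g a) ^ n) a"
    using expansion_power[OF c \<rho>] by blast
  then obtain e where e: "\<And>n. expansion (e n) \<rho> (s ^ n) (\<lambda>x. (g x - g a) ^ n) a" by metis
  let ?w = "\<lambda>m::'a\<Rightarrow>nat. \<rho> ^ sum m UNIV"
  have es: "(\<lambda>m. norm (e n m) * ?w m) summable_on UNIV" and
    el: "(\<Sum>\<^sub>\<infinity>m. norm (e n m) * ?w m) \<le> s ^ n" for n
    using e[of n] unfolding expansion_def by auto
  define F where "F = (\<lambda>(n, m). norm (b n * e n m) * ?w m)"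
  have Fs: "F summable_on UNIV \<times> UNIV"
  proof (rule summable_on_SigmaI)
    show "((\<lambda>m. F (n, m)) has_sum norm (b n) * (\<Sum>\<^sub>\<infinity>m. norm (e n m) * ?w m)) UNIV" for n
      using has_sum_cmult_right[OF has_sum_infsum[OF es], of "norm (b n)" n]
      by (simp add: F_def norm_mult mult_ac)
    show "(\<lambda>n. norm (b n) * (\<Sum>\<^sub>\<infinity>m. norm (e n m) * ?w m)) summable_on UNIV"
    proof (rule summable_on_comparison_test[OF bs])
      show "norm (b n) * (\<Sum>\<^sub>\<infinity>m. norm (e n m) * ?w m) \<le> norm (b n) * s ^ n" for n
        using el by (intro mult_left_mono) auto
      show "0 \<le> norm (b n) * (\<Sum>\<^sub>\<infinity>m. norm (e n m) * ?w m)" for n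
        by (intro mult_nonneg_nonneg infsum_nonneg) (use \<rho> in auto)
    qed
    show "0 \<le> F (n, m)" for n m using \<rho> by (simp add: F_def)
  qed
  have Fs': "(\<lambda>(m, n). F (n, m)) summable_on UNIV \<times> UNIV"
    using Fs by (subst (asm) summable_on_swap) (simp add: case_prod_unfold)
  have Fm: "(\<lambda>n. F (n, m)) summable_on UNIV" for m
    using summable_on_SigmaD1[of "\<lambda>m n. F (n, m)", OF Fs'] by simp
  have Fw: "F (n, m) = norm (b n * e n m) * ?w m" for n m by (simp add: F_def)
  have bem: "(\<lambda>n. norm (b n * e n m)) summable_on UNIV" for m
    using Fm[of m] \<rho> unfolding Fw by (subst (asm) summable_on_cmult_left') auto
  define C where "C = (\<lambda>m. \<Sum>\<^sub>\<infinity>n. b n * e n m)"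
  have C: "((\<lambda>n. b n * e n m) has_sum C m) UNIV" for m
    unfolding C_def by (rule has_sum_infsum[OF abs_summable_summable[OF bem]])
  have "expansion C \<rho> (\<Sum>\<^sub>\<infinity>m. norm (C m) * ?w m) (\<lambda>x. f (g x)) a"
    unfolding expansion_def
  proof (intro conjI allI impI order_refl)
    have "(\<lambda>m. \<Sum>\<^sub>\<infinity>n. F (n, m)) summable_on UNIV"
      using summable_on_SigmaD[of "\<lambda>(m, n). F (n, m)" UNIV "\<lambda>_. UNIV"] Fs' Fm by simp
    then show "(\<lambda>m. norm (C m) * ?w m) summable_on UNIV"
    proof (rule summable_on_comparison_test)
      show "norm (C m) * ?w m \<le> (\<Sum>\<^sub>\<infinity>n. F (n, m))" for m
      proof -
        have "norm (C m) \<le> (\<Sum>\<^sub>\<infinity>n. norm (b n * e n m))"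
          unfolding C_def by (rule norm_infsum_bound[OF bem])
        then have "norm (C m) * ?w m \<le> (\<Sum>\<^sub>\<infinity>n. norm (b n * e n m)) * ?w m"
          using \<rho> by (intro mult_right_mono) auto
        also have "\<dots> = (\<Sum>\<^sub>\<infinity>n. F (n, m))" unfolding Fw by (rule infsum_cmult_left'[symmetric])
        finally show ?thesis .
      qed
    qed (use \<rho> in auto)
  next
    fix x assume x: "\<forall>k. \<bar>x $ k - a $ k\<bar> \<le> \<rho>"
    let ?r = "\<lambda>m. of_real (real_monom (x - a) m) :: complex"
    have "norm (g x - g a) \<le> s" using expansion_norm_le[OF c] x by blast
    then have gx: "g x \<in> ball (g a) r" using s by (auto simp: dist_norm norm_minus_commute)
    have pw: "((\<lambda>m. e n m * ?r m) has_sum (g x - g a) ^ n) UNIV" for n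
      using e[of n] x unfolding expansion_def by auto
    define G where "G = (\<lambda>(n, m). b n * e n m * ?r m)"
    have "(\<lambda>z. norm (G z)) summable_on UNIV \<times> UNIV"
    proof (rule Infinite_Sum.abs_summable_on_comparison_test'[OF Fs])
      fix z :: "nat \<times> ('a \<Rightarrow> nat)"
      obtain n m where z: "z = (n, m)" by force
      show "norm (G z) \<le> F z"
        using abs_real_monom_le[of "x - a" \<rho> m] x
        unfolding z G_def F_def by (auto simp: norm_mult intro!: mult_left_mono)
    qed
    then have Gs: "G summable_on UNIV \<times> UNIV" by (rule abs_summable_summable)
    have Gn: "((\<lambda>m. G (n, m)) has_sum b n * (g x - g a) ^ n) UNIV" for n
      using has_sum_cmult_right[OF pw] by (simp add: G_def mult.assoc)
    have Gtot: "(G has_sum infsum G (UNIV \<times> UNIV)) (UNIV \<times> UNIV)" using Gs by (rule has_sum_infsum)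
    have "((\<lambda>n. b n * (g x - g a) ^ n) has_sum infsum G (UNIV \<times> UNIV)) UNIV"
      by (rule has_sum_SigmaD[OF Gtot Gn])
    then have "infsum G (UNIV \<times> UNIV) = f (g x)"
      using has_sum_imp_sums fb[OF gx] sums_unique2 by blast
    then have "((\<lambda>(m, n). G (n, m)) has_sum f (g x)) (UNIV \<times> UNIV)"
      using Gtot by (subst (asm) has_sum_swap) (simp add: case_prod_unfold)
    then show "((\<lambda>m. C m * ?r m) has_sum f (g x)) UNIV"
    proof (rule has_sum_SigmaD)
      show "((\<lambda>n. case (m, n) of (m, n) \<Rightarrow> G (n, m)) has_sum C m * ?r m) UNIV" for m
        using has_sum_cmult_left[OF C] by (simp add: G_def)
    qed
  qed
  with \<rho> show ?thesis unfolding expandable_def by blast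
qed

lemma expandable_add:
  assumes "expandable f a" "expandable g a"
  shows "expandable (\<lambda>x. f x + g x) a"
proof -
  obtain c \<rho> M d \<rho>' N where 1: "\<rho> > 0" "expansion c \<rho> M f a" and 2: "\<rho>' > 0" "expansion d \<rho>' N g a"
    using assms unfolding expandable_def by blast
  then show ?thesis
    using expansion_add[OF expansion_shrink[OF 1(2)] expansion_shrink[OF 2(2)], of "min \<rho> \<rho>'"]
    unfolding expandable_def by (intro exI[of _ "\<lambda>m. c m + d m"] exI[of _ "min \<rho> \<rho>'"] exI[of _ "M + N"]) auto
qed

lemma expandable_mult:
  assumes "expandable f a" "expandable g a"
  shows "expandable (\<lambda>x. f x * g x) a"
proof -
  obtain c \<rho> M d \<rho>' N where 1: "\<rho> > 0" "expansion c \<rho> M f a" and 2: "\<rho>' > 0" "expansion d \<rho>' N g a"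
    using assms unfolding expandable_def by blast
  then have "expansion c (min \<rho> \<rho>') M f a" "expansion d (min \<rho> \<rho>') N g a" "min \<rho> \<rho>' > 0"
    by (auto intro: expansion_shrink)
  from expansion_mult[OF this] this(3) show ?thesis
    unfolding expandable_def by blast
qed

text \<open>The monomials are real, so the real part acts on the coefficients. Together with
  \<open>expandable_compose\<close> this reaches functions such as \<open>exp (Re (L w))\<close>,
  which are real analytic but not holomorphic.\<close>

lemma expandable_Re:
  assumes "expandable g a"
  shows "expandable (\<lambda>x. of_real (Re (g x))) a"
proof -
  obtain c \<rho> M where \<rho>: "\<rho> > 0" and c: "expansion c \<rho> M g a"
    using assms unfolding expandable_def by blast
  have s: "(\<lambda>m. norm (complex_of_real (Re (c m))) * \<rho> ^ sum m UNIV) summable_on UNIV"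
    by (rule summable_on_comparison_test[of "\<lambda>m. norm (c m) * \<rho> ^ sum m UNIV"])
       (use c \<rho> in \<open>auto simp: expansion_def abs_Re_le_cmod mult_right_mono\<close>)
  have "((\<lambda>m. of_real (Re (c m)) * of_real (real_monom (x - a) m)) has_sum complex_of_real (Re (g x))) UNIV"
    if "\<forall>k. \<bar>x $ k - a $ k\<bar> \<le> \<rho>" for x
  proof -
    have "((\<lambda>m. c m * of_real (real_monom (x - a) m)) has_sum g x) UNIV"
      using c that unfolding expansion_def by blast
    from has_sum_of_real[OF has_sum_Re[OF this]] show ?thesis by simp
  qed
  then have "expansion (\<lambda>m. of_real (Re (c m))) \<rho> (\<Sum>\<^sub>\<infinity>m. norm (complex_of_real (Re (c m))) * \<rho> ^ sum m UNIV) (\<lambda>x. of_real (Re (g x))) a"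
    using s unfolding expansion_def by blast
  with \<rho> show ?thesis unfolding expandable_def by blast
qed

lemma expandable_coordinate: "expandable (\<lambda>x. of_real (x $ j)) a"
proof -
  define e where "e = (\<lambda>k. if k = j then 1 else (0::nat))"
  define c where "c = (\<lambda>m::'a\<Rightarrow>nat. if m = e then 1 else 0 :: complex)"
  have e: "sum e UNIV = 1" "e \<noteq> (\<lambda>_. 0)" by (auto simp: e_def fun_eq_iff)
  have re: "real_monom y e = y $ j" for y
    unfolding real_monom_def e_def by (simp add: if_distrib[of "\<lambda>n. _ ^ n"] prod.delta cong: if_cong)
  have "((\<lambda>m. norm (c m) * 1 ^ sum m UNIV) has_sum 1) UNIV"
    by (rule has_sum_finite_neutralI[of "{e}"]) (auto simp: c_def)
  moreover have "((\<lambda>m. c m * of_real (real_monom (x - a) m)) has_sum of_real ((x - a) $ j)) UNIV" for x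
    by (rule has_sum_finite_neutralI[of "{e}"]) (auto simp: c_def re)
  ultimately have "expansion c 1 1 (\<lambda>x. of_real ((x - a) $ j)) a"
    unfolding expansion_def by (auto simp: has_sum_iff)
  then have "expandable (\<lambda>x. of_real ((x - a) $ j)) a"
    unfolding expandable_def by (meson zero_less_one)
  from expandable_add[OF this expandable_const[of "of_real (a $ j)"]] show ?thesis by simp
qed

lemma real_analytic_onI:
  assumes "\<And>a. a \<in> U \<Longrightarrow> \<exists>g. expandable g a \<and> (\<forall>x\<in>U. Re (g x) = f x)" "open U"
  shows "real_analytic_on f U"
  unfolding real_analytic_on_def
proof
  fix a assume a: "a \<in> U"
  then obtain g where g: "expandable g a" "\<forall>x\<in>U. Re (g x) = f x" using assms(1) by blast
  then obtain c \<rho> M where \<rho>: "\<rho> > 0" and c: "expansion c \<rho> M g a" unfolding expandable_def by blast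
  obtain d where d: "d > 0" "ball a d \<subseteq> U" using a assms(2) openE by blast
  have "((\<lambda>m. Re (c m) * (\<Prod>k\<in>UNIV. (x $ k - a $ k) ^ m k)) has_sum f x) UNIV"
    if x: "x \<in> ball a (min \<rho> d)" for x
  proof -
    have "\<bar>x $ k - a $ k\<bar> \<le> \<rho>" for k
      using component_le_norm_cart[of "x - a" k] x by (simp add: dist_norm norm_minus_commute)
    then have "((\<lambda>m. c m * of_real (real_monom (x - a) m)) has_sum g x) UNIV"
      using c unfolding expansion_def by blast
    from has_sum_Re[OF this]
    have "((\<lambda>m. Re (c m) * real_monom (x - a) m) has_sum Re (g x)) UNIV" by simp
    moreover have "Re (g x) = f x" using g(2) d(2) x by auto
    ultimately show ?thesis by (simp add: real_monom_def)
  qed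
  then show "\<exists>c. \<exists>e>0. \<forall>x\<in>ball a e. ((\<lambda>m. c m * (\<Prod>k\<in>UNIV. (x $ k - a $ k) ^ m k)) has_sum f x) UNIV"
    using \<rho> d(1) by (intro exI[of _ "\<lambda>m. Re (c m)"] exI[of _ "min \<rho> d"]) auto
qed

section \<open>The Weierstrass function\<close>

locale period_lattice =
  fixes \<Omega> :: "complex set" and \<omega>1 \<omega>2 :: complex
  assumes lattice: "\<Omega> = {of_int a * \<omega>1 + of_int b * \<omega>2 | a b :: int. True}"
    and Im_pos: "Im (\<omega>2 / \<omega>1) > 0"
begin

abbreviation wp where "wp \<equiv> weierstrass_p \<Omega>"

lemma \<omega>1_nonzero: "\<omega>1 \<noteq> 0"
  using Im_pos by auto

lemma lattice_zero [simp]: "0 \<in> \<Omega>"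
  unfolding lattice by (rule CollectI, rule exI[of _ 0], rule exI[of _ 0]) simp

lemma lattice_basis1 [simp]: "\<omega>1 \<in> \<Omega>"
  unfolding lattice by (rule CollectI, rule exI[of _ 1], rule exI[of _ 0]) simp

lemma lattice_basis2 [simp]: "\<omega>2 \<in> \<Omega>"
  unfolding lattice by (rule CollectI, rule exI[of _ 0], rule exI[of _ 1]) simp

lemma lattice_add: "x \<in> \<Omega> \<Longrightarrow> y \<in> \<Omega> \<Longrightarrow> x + y \<in> \<Omega>"
proof -
  assume "x \<in> \<Omega>" "y \<in> \<Omega>"
  then obtain a b c d where "x = of_int a * \<omega>1 + of_int b * \<omega>2" "y = of_int c * \<omega>1 + of_int d * \<omega>2"
    unfolding lattice by blast
  then have "x + y = of_int (a + c) * \<omega>1 + of_int (b + d) * \<omega>2" by (simp add: algebra_simps)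
  then show ?thesis unfolding lattice by blast
qed

lemma lattice_uminus: "x \<in> \<Omega> \<Longrightarrow> - x \<in> \<Omega>"
proof -
  assume "x \<in> \<Omega>"
  then obtain a b where "x = of_int a * \<omega>1 + of_int b * \<omega>2" unfolding lattice by blast
  then have "- x = of_int (- a) * \<omega>1 + of_int (- b) * \<omega>2" by simp
  then show ?thesis unfolding lattice by blast
qed

lemma lattice_diff: "x \<in> \<Omega> \<Longrightarrow> y \<in> \<Omega> \<Longrightarrow> x - y \<in> \<Omega>"
  using lattice_add[OF _ lattice_uminus] by fastforce

lemma lattice_add_iff: "x \<in> \<Omega> \<Longrightarrow> z + x \<in> \<Omega> \<longleftrightarrow> z \<in> \<Omega>"
  using lattice_add lattice_diff by fastforce

lemma lattice_uminus_iff: "- x \<in> \<Omega> \<longleftrightarrow> x \<in> \<Omega>"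
  using lattice_uminus by fastforce

text \<open>Real coordinates in the basis \<open>\<omega>1, \<omega>2\<close>, read off after
  division by \<open>\<omega>1\<close>, which turns the basis into \<open>1, \<tau>\<close>.\<close>

definition coord1 :: "complex \<Rightarrow> real" where
  "coord1 z = Re (z / \<omega>1) - Re (\<omega>2 / \<omega>1) * (Im (z / \<omega>1) / Im (\<omega>2 / \<omega>1))"

definition coord2 :: "complex \<Rightarrow> real" where
  "coord2 z = Im (z / \<omega>1) / Im (\<omega>2 / \<omega>1)"

lemma coord_decomp: "of_real (coord1 z) * \<omega>1 + of_real (coord2 z) * \<omega>2 = z"
proof -
  have "of_real (Re w - Re t * (Im w / Im t)) + of_real (Im w / Im t) * t = w" if "Im t > 0" for w t
    using that by (simp add: complex_eq_iff)
  from this[OF Im_pos, of "z / \<omega>1"]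
  have "of_real (coord1 z) + of_real (coord2 z) * (\<omega>2 / \<omega>1) = z / \<omega>1"
    unfolding coord1_def coord2_def .
  then have "(of_real (coord1 z) + of_real (coord2 z) * (\<omega>2 / \<omega>1)) * \<omega>1 = z"
    using \<omega>1_nonzero by simp
  then show ?thesis using \<omega>1_nonzero by (simp add: distrib_right)
qed

lemma coord_comb [simp]:
  "coord1 (of_real x * \<omega>1 + of_real y * \<omega>2) = x" "coord2 (of_real x * \<omega>1 + of_real y * \<omega>2) = y"
proof -
  have "(of_real x * \<omega>1 + of_real y * \<omega>2) / \<omega>1 = of_real x + of_real y * (\<omega>2 / \<omega>1)"
    using \<omega>1_nonzero by (simp add: add_divide_distrib)
  moreover have "Re (of_real x + of_real y * t) - Re t * (Im (of_real x + of_real y * t) / Im t) = x"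
    "Im (of_real x + of_real y * t) / Im t = y" if "Im t > 0" for t
    using that by simp_all
  ultimately show "coord2 (of_real x * \<omega>1 + of_real y * \<omega>2) = y"
    "coord1 (of_real x * \<omega>1 + of_real y * \<omega>2) = x"
    using Im_pos unfolding coord1_def coord2_def by metis+
qed

lemma coord_scale: "coord1 (of_real t * z) = t * coord1 z" "coord2 (of_real t * z) = t * coord2 z"
proof -
  have "of_real t * z / \<omega>1 = of_real t * (z / \<omega>1)" by simp
  moreover have "Re (of_real t * w) - Re u * (Im (of_real t * w) / Im u) = t * (Re w - Re u * (Im w / Im u))"
    "Im (of_real t * w) / Im u = t * (Im w / Im u)" for u w by (simp_all add: algebra_simps)
  ultimately show "coord2 (of_real t * z) = t * coord2 z" "coord1 (of_real t * z) = t * coord1 z"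
    unfolding coord1_def coord2_def by metis+
qed

lemma lattice_iff: "z \<in> \<Omega> \<longleftrightarrow> coord1 z \<in> \<int> \<and> coord2 z \<in> \<int>"
proof
  assume "z \<in> \<Omega>"
  then obtain a b :: int where "z = of_real (of_int a) * \<omega>1 + of_real (of_int b) * \<omega>2"
    unfolding lattice by auto
  then show "coord1 z \<in> \<int> \<and> coord2 z \<in> \<int>" by (simp only: coord_comb) simp
next
  assume "coord1 z \<in> \<int> \<and> coord2 z \<in> \<int>"
  then obtain a b :: int where "coord1 z = of_int a" "coord2 z = of_int b" by (auto elim!: Ints_cases)
  then have "z = of_int a * \<omega>1 + of_int b * \<omega>2" using coord_decomp[of z] by simp
  then show "z \<in> \<Omega>" unfolding lattice by blast
qed

text \<open>The sum of a bound for \<open>coord2\<close> and a bound for \<open>coord1\<close>, so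
  that one constant serves both coordinates.\<close>

definition coord_bound :: real where
  "coord_bound = (1 / Im (\<omega>2 / \<omega>1) + 1 + cmod (\<omega>2 / \<omega>1) / Im (\<omega>2 / \<omega>1)) / cmod \<omega>1"

lemma coord_bound_pos: "coord_bound > 0"
  unfolding coord_bound_def using Im_pos \<omega>1_nonzero by (auto intro!: divide_pos_pos add_pos_nonneg)

lemma coord_le: "\<bar>coord1 z\<bar> \<le> coord_bound * cmod z" "\<bar>coord2 z\<bar> \<le> coord_bound * cmod z"
proof -
  let ?\<tau> = "\<omega>2 / \<omega>1" let ?n = "cmod (z / \<omega>1)"
  have k: "coord_bound * cmod z = (1 / Im ?\<tau> + 1 + cmod ?\<tau> / Im ?\<tau>) * ?n"
    by (simp add: coord_bound_def norm_divide)
  have c2: "\<bar>coord2 z\<bar> \<le> (1 / Im ?\<tau>) * ?n"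
    unfolding coord2_def using Im_pos abs_Im_le_cmod[of "z / \<omega>1"] by (simp add: divide_right_mono)
  have c2': "\<bar>coord2 z\<bar> \<le> ?n / Im ?\<tau>" using c2 by simp
  have "\<bar>coord1 z\<bar> \<le> \<bar>Re (z / \<omega>1)\<bar> + \<bar>Re ?\<tau>\<bar> * \<bar>coord2 z\<bar>"
    unfolding coord1_def coord2_def[symmetric] using abs_triangle_ineq4 by (metis abs_mult)
  also have "\<dots> \<le> ?n + cmod ?\<tau> * (?n / Im ?\<tau>)"
    by (intro add_mono mult_mono abs_Re_le_cmod c2') auto
  finally have c1: "\<bar>coord1 z\<bar> \<le> (1 + cmod ?\<tau> / Im ?\<tau>) * ?n" by (simp add: distrib_right)
  have p: "0 \<le> (1 / Im ?\<tau>) * ?n" "0 \<le> (1 + cmod ?\<tau> / Im ?\<tau>) * ?n" using Im_pos by auto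
  show "\<bar>coord1 z\<bar> \<le> coord_bound * cmod z" "\<bar>coord2 z\<bar> \<le> coord_bound * cmod z"
    unfolding k using c1 c2 p by (simp_all add: distrib_right del: times_divide_eq_left)
qed

lemma inj_lattice_map: "inj (\<lambda>(a :: int, b :: int). of_int a * \<omega>1 + of_int b * \<omega>2)"
proof (rule injI, clarify)
  fix a b c d :: int assume "of_int a * \<omega>1 + of_int b * \<omega>2 = of_int c * \<omega>1 + of_int d * \<omega>2"
  then have "of_real (of_int a) * \<omega>1 + of_real (of_int b) * \<omega>2 = of_real (of_int c) * \<omega>1 + of_real (of_int d) * \<omega>2"
    by simp
  then have "(of_int a :: real) = of_int c \<and> (of_int b :: real) = of_int d"
    by (metis coord_comb)
  then show "a = c \<and> b = d" by simp
qed

lemma lattice_image: "\<Omega> = (\<lambda>(a :: int, b :: int). of_int a * \<omega>1 + of_int b * \<omega>2) ` UNIV"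
  unfolding lattice by auto

lemma countable_lattice: "countable \<Omega>"
  unfolding lattice_image by (rule countable_image) auto

lemma finite_lattice_bounded: "finite {x \<in> \<Omega>. cmod x \<le> R}"
proof -
  let ?N = "\<lceil>coord_bound * R\<rceil>"
  have "{x \<in> \<Omega>. cmod x \<le> R} \<subseteq>
      (\<lambda>(a :: int, b :: int). of_int a * \<omega>1 + of_int b * \<omega>2) ` ({-?N..?N} \<times> {-?N..?N})"
  proof
    fix x assume x: "x \<in> {x \<in> \<Omega>. cmod x \<le> R}"
    then obtain a b :: int where ab: "x = of_int a * \<omega>1 + of_int b * \<omega>2" unfolding lattice by blast
    then have x': "x = of_real (of_int a) * \<omega>1 + of_real (of_int b) * \<omega>2" by simp
    have "coord_bound * cmod x \<le> coord_bound * R" using x coord_bound_pos by simp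
    moreover have "\<bar>of_int a :: real\<bar> \<le> coord_bound * cmod x" "\<bar>of_int b :: real\<bar> \<le> coord_bound * cmod x"
      using coord_le[of x] unfolding x' by (simp_all only: coord_comb)
    ultimately have "\<bar>of_int a :: real\<bar> \<le> of_int ?N" "\<bar>of_int b :: real\<bar> \<le> of_int ?N" by linarith+
    then have "a \<in> {-?N..?N}" "b \<in> {-?N..?N}" by (auto simp: abs_le_iff simp flip: of_int_minus)
    then show "x \<in> (\<lambda>(a :: int, b :: int). of_int a * \<omega>1 + of_int b * \<omega>2) ` ({-?N..?N} \<times> {-?N..?N})"
      using ab by force
  qed
  then show ?thesis by (rule finite_subset) simp
qed

end

section \<open>Convergence, evenness and periodicity of the lattice series\<close>

lemma summable_on_int_powr: "(\<lambda>a::int. (1 + \<bar>of_int a\<bar> :: real) powr (- (3/2))) summable_on UNIV"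
proof -
  let ?f = "\<lambda>a::int. (1 + \<bar>of_int a\<bar> :: real) powr (- (3/2))"
  have "summable (\<lambda>n. real n powr (- (3/2)))" by (subst summable_real_powr_iff) auto
  then have "summable (\<lambda>n. real (Suc n) powr (- (3/2)))" by (subst summable_Suc_iff)
  then have n: "(\<lambda>n. real (Suc n) powr (- (3/2))) summable_on UNIV"
    by (subst summable_on_UNIV_nonneg_real_iff) auto
  have "?f summable_on (int ` UNIV)"
    using n by (subst summable_on_reindex) (auto simp: o_def)
  moreover have "?f summable_on ((\<lambda>n. - int n) ` UNIV)"
    using n by (subst summable_on_reindex) (auto simp: o_def inj_on_def)
  ultimately have "?f summable_on (int ` UNIV \<union> (\<lambda>n. - int n) ` UNIV)" by (rule summable_on_union)
  moreover have "int ` UNIV \<union> (\<lambda>n. - int n) ` UNIV = UNIV"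
    by (auto simp: image_iff) (metis int_cases2)
  ultimately show ?thesis by simp
qed

context period_lattice
begin

text \<open>If both coordinates are at most \<open>y\<close> and \<open>y \<ge> 1\<close>, then
  \<open>(2 * y) powr (-3/2)\<close> lies below each one-dimensional term, so
  \<open>1 / (2 * y) ^ 3\<close> lies below a product of two convergent series. The exponent 3/2 is
  half of 3 and still exceeds 1.\<close>

lemma summable_inverse_cube: "(\<lambda>x. 1 / cmod x ^ 3) summable_on \<Omega>"
proof -
  let ?f = "\<lambda>a::int. (1 + \<bar>of_int a\<bar> :: real) powr (- (3/2))"
  let ?\<phi> = "\<lambda>(a :: int, b :: int). of_int a * \<omega>1 + of_int b * \<omega>2"
  define K where "K = (2 * coord_bound) ^ 3"
  have prod: "(\<lambda>(a, b). ?f a * ?f b) summable_on UNIV \<times> UNIV"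
  proof (rule summable_on_SigmaI)
    show "((\<lambda>b. case (a, b) of (a, b) \<Rightarrow> ?f a * ?f b) has_sum ?f a * infsum ?f UNIV) UNIV" for a
      using has_sum_cmult_right[OF has_sum_infsum[OF summable_on_int_powr]] by simp
    show "(\<lambda>a. ?f a * infsum ?f UNIV) summable_on UNIV"
      by (rule summable_on_cmult_left[OF summable_on_int_powr])
  qed auto
  have "(\<lambda>(a, b). K * (?f a * ?f b)) summable_on UNIV \<times> UNIV"
    using summable_on_cmult_right[OF prod] by (simp add: case_prod_unfold)
  then have "((\<lambda>x. 1 / cmod x ^ 3) \<circ> ?\<phi>) summable_on UNIV \<times> UNIV"
  proof (rule summable_on_comparison_test)
    fix p :: "int \<times> int"
    obtain a b where p: "p = (a, b)" by force
    let ?x = "of_int a * \<omega>1 + of_int b * \<omega>2"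
    show "((\<lambda>x. 1 / cmod x ^ 3) \<circ> ?\<phi>) p \<le> (case p of (a, b) \<Rightarrow> K * (?f a * ?f b))"
    proof (cases "a = 0 \<and> b = 0")
      \<comment> \<open>For the zero vector the term is \<open>1 / 0 = 0\<close>, so
        \<open>0\<close> may stay in the index set.\<close>
      case True
      then show ?thesis using coord_bound_pos by (simp add: p K_def)
    next
      case False
      have x': "?x = of_real (of_int a) * \<omega>1 + of_real (of_int b) * \<omega>2" by simp
      define y where "y = coord_bound * cmod ?x"
      have ab: "\<bar>of_int a :: real\<bar> \<le> y" "\<bar>of_int b :: real\<bar> \<le> y"
        using coord_le[of ?x] unfolding x' y_def by (simp_all only: coord_comb)
      have "1 \<le> \<bar>a\<bar> \<or> 1 \<le> \<bar>b\<bar>" using False by auto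
      then have y: "1 \<le> y"
      proof
        assume "1 \<le> \<bar>a\<bar>"
        then have "(of_int 1 :: real) \<le> of_int \<bar>a\<bar>" by (simp only: of_int_le_iff)
        then show ?thesis using ab(1) by simp
      next
        assume "1 \<le> \<bar>b\<bar>"
        then have "(of_int 1 :: real) \<le> of_int \<bar>b\<bar>" by (simp only: of_int_le_iff)
        then show ?thesis using ab(2) by simp
      qed
      then have ny: "cmod ?x > 0" unfolding y_def by (metis mult_zero_right norm_ge_zero not_one_le_zero order_le_less)
      have le2: "(2 * y) powr (- (3/2)) \<le> ?f c" if "\<bar>of_int c\<bar> \<le> y" for c
        using that y by (intro powr_mono2') auto
      have "(2 * y) powr (- (3/2)) * (2 * y) powr (- (3/2)) \<le> ?f a * ?f b"
        by (intro mult_mono le2 ab) auto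
      moreover have "(2 * y) powr (- (3/2)) * (2 * y) powr (- (3/2)) = 1 / (2 * y) ^ 3"
      proof -
        have "(2 * y) powr (- (3/2)) * (2 * y) powr (- (3/2)) = (2 * y) powr (- 3)"
          by (subst powr_add[symmetric]) simp
        also have "\<dots> = inverse ((2 * y) powr 3)" by (rule powr_minus)
        also have "(2 * y) powr 3 = (2 * y) ^ 3" using y powr_realpow[of "2 * y" 3] by simp
        also have "inverse ((2 * y) ^ 3) = 1 / (2 * y) ^ 3" by (rule inverse_eq_divide)
        finally show ?thesis .
      qed
      ultimately have "K * (1 / (2 * y) ^ 3) \<le> K * (?f a * ?f b)"
        using coord_bound_pos unfolding K_def by (intro mult_left_mono) auto
      moreover have "K * (1 / (2 * y) ^ 3) = 1 / cmod ?x ^ 3"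
        using coord_bound_pos ny unfolding K_def y_def by (simp add: power_mult_distrib)
      ultimately show ?thesis by (simp add: p)
    qed
  qed auto
  then show ?thesis
    unfolding lattice_image by (subst summable_on_reindex) (use inj_lattice_map in auto)
qed

text \<open>At \<open>x = 0\<close> the convention \<open>1 / 0 = 0\<close> leaves
  \<open>1 / z^2\<close>, so the principal part of \<open>wp\<close> becomes an ordinary term of a
  sum over the whole lattice.\<close>

definition wp_term :: "complex \<Rightarrow> complex \<Rightarrow> complex" where
  "wp_term z x = 1 / (z - x)\<^sup>2 - 1 / x\<^sup>2"

text \<open>The difference of squares gains one power: the numerator becomes
  \<open>z * (2 * x - z)\<close>, and \<open>cmod x > 2 * R\<close> keeps
  \<open>cmod (z - x)\<close> above \<open>cmod x / 2\<close>. Hence 12 = 3 * 4.\<close>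

lemma wp_term_bound:
  assumes "cmod z \<le> R" "cmod x > 2 * R" "R > 0"
  shows "cmod (wp_term z x) \<le> 12 * R * (1 / cmod x ^ 3)"
proof -
  have x0: "x \<noteq> 0" using assms by auto
  have "cmod x \<le> cmod (z - x) + cmod z" by (metis norm_minus_commute norm_triangle_sub add.commute)
  then have zx: "cmod (z - x) \<ge> cmod x / 2" using assms by linarith
  then have zx0: "z - x \<noteq> 0" using x0 by auto
  have "wp_term z x = (x\<^sup>2 - (z - x)\<^sup>2) / ((z - x)\<^sup>2 * x\<^sup>2)"
    using x0 zx0 unfolding wp_term_def by (subst diff_frac_eq) auto
  then have eq: "wp_term z x = z * (2 * x - z) / (x\<^sup>2 * (z - x)\<^sup>2)"
    by (simp add: power2_eq_square algebra_simps)
  have "cmod (2 * x - z) \<le> 3 * cmod x"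
    using norm_triangle_ineq4[of "2 * x" z] assms by (simp add: norm_mult)
  then have num: "cmod (z * (2 * x - z)) \<le> R * (3 * cmod x)"
    unfolding norm_mult using assms by (intro mult_mono) auto
  have den: "cmod (x\<^sup>2 * (z - x)\<^sup>2) \<ge> cmod x ^ 2 * (cmod x / 2)\<^sup>2"
    unfolding norm_mult norm_power using zx by (intro mult_left_mono power_mono) auto
  have "cmod (wp_term z x) \<le> R * (3 * cmod x) / (cmod x ^ 2 * (cmod x / 2)\<^sup>2)"
    unfolding eq norm_divide by (rule frac_le) (use num den x0 assms in auto)
  also have "\<dots> = 12 * R * (1 / cmod x ^ 3)"
    using x0 by (simp add: field_simps power2_eq_square power3_eq_cube)
  finally show ?thesis .
qed

definition tail_lattice where "tail_lattice R = {x \<in> \<Omega>. cmod x > 2 * R}"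

lemma tail_summable: "(\<lambda>x. 12 * R * (1 / cmod x ^ 3)) summable_on tail_lattice R"
  by (intro summable_on_cmult_right summable_on_subset_banach[OF summable_inverse_cube])
     (auto simp: tail_lattice_def)

lemma wp_term_summable: "wp_term z summable_on \<Omega>"
proof -
  define R where "R = cmod z + 1"
  have R: "cmod z \<le> R" "R > 0" unfolding R_def by (auto intro: add_nonneg_pos)
  have "(\<lambda>x. norm (wp_term z x)) summable_on tail_lattice R"
    by (rule Infinite_Sum.abs_summable_on_comparison_test'[OF tail_summable])
       (use wp_term_bound R in \<open>auto simp: tail_lattice_def\<close>)
  then have 1: "wp_term z summable_on tail_lattice R" by (rule abs_summable_summable)
  have "finite {x \<in> \<Omega>. cmod x \<le> 2 * R}" by (rule finite_lattice_bounded)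
  then have "wp_term z summable_on {x \<in> \<Omega>. cmod x \<le> 2 * R}" by simp
  from summable_on_union[OF this 1] show ?thesis
    by (rule back_subst[of "\<lambda>S. wp_term z summable_on S"]) (auto simp: tail_lattice_def)
qed

lemma wp_eq_infsum: "wp z = (\<Sum>\<^sub>\<infinity>x\<in>\<Omega>. wp_term z x)"
proof -
  have "(wp_term z has_sum infsum (wp_term z) (\<Omega> - {0})) (\<Omega> - {0})"
    by (intro has_sum_infsum summable_on_subset_banach[OF wp_term_summable]) auto
  from has_sum_insert[OF _ this, of 0]
  have "(wp_term z has_sum (wp_term z 0 + infsum (wp_term z) (\<Omega> - {0}))) (insert 0 (\<Omega> - {0}))" by simp
  moreover have "insert 0 (\<Omega> - {0}) = \<Omega>" by auto
  moreover have "infsum (wp_term z) (\<Omega> - {0}) = (\<Sum>\<^sub>\<infinity>x\<in>\<Omega> - {0}. 1 / (z - x)\<^sup>2 - 1 / x\<^sup>2)"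
    by (simp add: wp_term_def[abs_def])
  moreover have "wp_term z 0 = 1 / z\<^sup>2" by (simp add: wp_term_def)
  ultimately show ?thesis
    unfolding weierstrass_p_def using infsumI by (metis (no_types, lifting))
qed

lemma wp_minus: "wp (- z) = wp z"
proof -
  have "(\<Sum>\<^sub>\<infinity>x\<in>\<Omega>. wp_term (- z) x) = (\<Sum>\<^sub>\<infinity>x\<in>\<Omega>. wp_term z x)"
  proof (rule infsum_reindex_bij_witness[of _ uminus uminus])
    show "wp_term z (- x) = wp_term (- z) x" for x
      unfolding wp_term_def by (simp add: power2_eq_square algebra_simps)
  qed (auto simp: lattice_uminus)
  then show ?thesis by (simp add: wp_eq_infsum)
qed

text \<open>Termwise, the series of \<open>wp (z + p)\<close> is the shifted series of
  \<open>wp z\<close> plus \<open>1 / (x - p)^2 - 1 / x^2\<close>. The reflection of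
  \<open>x\<close> to \<open>p - x\<close> changes the sign of the extra term, so its sum vanishes.
  No derivative is involved.\<close>

lemma wp_periodic:
  assumes "p \<in> \<Omega>"
  shows "wp (z + p) = wp z"
proof -
  have bij: "bij_betw (\<lambda>x. x - p) \<Omega> \<Omega>"
    by (rule bij_betwI[of _ _ _ "\<lambda>x. x + p"]) (use assms lattice_add lattice_diff in auto)
  have s1: "wp_term (z + p) summable_on \<Omega>" by (rule wp_term_summable)
  have s2: "(\<lambda>x. wp_term z (x - p)) summable_on \<Omega>"
    using summable_on_reindex_bij_betw[OF bij, of "wp_term z"] wp_term_summable by simp
  define c where "c = (\<lambda>x. 1 / (x - p)\<^sup>2 - 1 / x\<^sup>2)"
  have c: "c x = wp_term (z + p) x - wp_term z (x - p)" for x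
    unfolding c_def wp_term_def by (simp add: algebra_simps)
  have cs: "c summable_on \<Omega>"
  proof -
    have "(\<lambda>x. - wp_term z (x - p)) summable_on \<Omega>" using s2 by (simp only: summable_on_uminus)
    from summable_on_add[OF s1 this] show ?thesis by (simp add: c[abs_def])
  qed
  have "infsum c \<Omega> = infsum (\<lambda>x. - c x) \<Omega>"
  proof (rule infsum_reindex_bij_witness[of _ "\<lambda>x. p - x" "\<lambda>x. p - x"])
    show "- c (p - x) = c x" for x
      unfolding c_def by (simp add: power2_eq_square algebra_simps)
  qed (use assms lattice_diff in auto)
  then have "infsum c \<Omega> = 0" by (simp add: infsum_uminus)
  moreover have "wp (z + p) = (\<Sum>\<^sub>\<infinity>x\<in>\<Omega>. c x + wp_term z (x - p))"
    unfolding wp_eq_infsum by (simp add: c)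
  moreover have "\<dots> = infsum c \<Omega> + (\<Sum>\<^sub>\<infinity>x\<in>\<Omega>. wp_term z (x - p))"
    by (rule infsum_add[OF cs s2])
  moreover have "(\<Sum>\<^sub>\<infinity>x\<in>\<Omega>. wp_term z (x - p)) = wp z"
    unfolding wp_eq_infsum by (rule infsum_reindex_bij_betw[OF bij])
  ultimately show ?thesis by simp
qed

end

text \<open>By the Leibniz rule the equation expresses each derivative at the centre of order at
  least 2 through lower ones, so by induction the whole Taylor series of \<open>d\<close>
  vanishes.\<close>

lemma linear_ode_zero:
  fixes d A B :: "complex \<Rightarrow> complex"
  assumes hol: "d holomorphic_on ball c r" "A holomorphic_on ball c r" "B holomorphic_on ball c r"
    and ode: "\<And>z. z \<in> ball c r \<Longrightarrow> deriv (deriv d) z = A z * d z + B z * deriv d z"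
    and init: "d c = 0" "deriv d c = 0" and w: "w \<in> ball c r"
  shows "d w = 0"
proof -
  have r: "r > 0" using w by (metis ball_eq_empty empty_iff not_le)
  then have c: "c \<in> ball c r" by simp
  have hd: "deriv d holomorphic_on ball c r" using hol(1) by (rule holomorphic_deriv) simp
  have "(deriv ^^ n) d c = 0" for n
  proof (induction n rule: less_induct)
    case (less n)
    consider "n = 0" | "n = 1" | m where "n = Suc (Suc m)" by (metis One_nat_def not0_implies_Suc)
    then show ?case
    proof cases
      case 3
      have "(deriv ^^ n) d c = (deriv ^^ m) (deriv (deriv d)) c"
        unfolding 3 funpow_Suc_right by simp
      also have "\<dots> = (deriv ^^ m) (\<lambda>z. A z * d z + B z * deriv d z) c"
        by (rule higher_deriv_transform_within_open[of _ "ball c r"])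
           (use ode c hol hd in \<open>auto intro!: holomorphic_intros\<close>)
      also have "\<dots> = (deriv ^^ m) (\<lambda>z. A z * d z) c + (deriv ^^ m) (\<lambda>z. B z * deriv d z) c"
        by (rule higher_deriv_add[of _ "ball c r"]) (use c hol hd in \<open>auto intro!: holomorphic_intros\<close>)
      also have "(deriv ^^ m) (\<lambda>z. A z * d z) c =
          (\<Sum>i = 0..m. of_nat (m choose i) * (deriv ^^ i) A c * (deriv ^^ (m - i)) d c)"
        by (rule higher_deriv_mult[of _ "ball c r"]) (use c hol in auto)
      also have "\<dots> = 0"
        by (rule sum.neutral) (use less.IH 3 in auto)
      also have "(deriv ^^ m) (\<lambda>z. B z * deriv d z) c =
          (\<Sum>i = 0..m. of_nat (m choose i) * (deriv ^^ i) B c * (deriv ^^ (m - i)) (deriv d) c)"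
        by (rule higher_deriv_mult[of _ "ball c r"]) (use c hol hd in auto)
      also have "\<dots> = 0"
      proof (rule sum.neutral, rule ballI)
        fix i assume "i \<in> {0..m}"
        have "(deriv ^^ (m - i)) (deriv d) c = (deriv ^^ (Suc (m - i))) d c"
          by (simp add: funpow_Suc_right del: funpow.simps)
        also have "\<dots> = 0" by (rule less.IH) (use 3 in simp)
        finally show "of_nat (m choose i) * (deriv ^^ i) B c * (deriv ^^ (m - i)) (deriv d) c = 0" by simp
      qed
      finally show ?thesis by simp
    qed (use init in auto)
  qed
  then show ?thesis using holomorphic_fun_eq_0_on_ball[OF hol(1) w] by blast
qed

section \<open>Holomorphy of \<open>wp\<close>, its differential equations, and injectivity modulo
  periods\<close>

context period_lattice
begin

lemma tail_holomorphic:
  assumes "R > 0"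
  shows "(\<lambda>z. infsum (wp_term z) (tail_lattice R)) holomorphic_on ball 0 R"
proof -
  have ul: "uniform_limit (cball 0 R) (\<lambda>X z. \<Sum>x\<in>X. wp_term z x) (\<lambda>z. infsum (wp_term z) (tail_lattice R))
      (finite_subsets_at_top (tail_lattice R))"
    by (rule Weierstrass_m_test_general[OF _ tail_summable])
       (use wp_term_bound assms in \<open>auto simp: tail_lattice_def\<close>)
  have hol: "(\<lambda>z. \<Sum>x\<in>X. wp_term z x) holomorphic_on cball 0 R"
    if "X \<subseteq> tail_lattice R" for X
    unfolding wp_term_def
    by (intro holomorphic_intros) (use that assms in \<open>auto simp: tail_lattice_def\<close>)
  have ev: "\<forall>\<^sub>F X in finite_subsets_at_top (tail_lattice R).
      continuous_on (cball 0 R) (\<lambda>z. \<Sum>x\<in>X. wp_term z x) \<and> (\<lambda>z. \<Sum>x\<in>X. wp_term z x) holomorphic_on ball 0 R"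
    using hol by (intro eventually_finite_subsets_at_top_weakI conjI holomorphic_on_imp_continuous_on
        holomorphic_on_subset[OF _ ball_subset_cball]) auto
  show ?thesis by (rule holomorphic_uniform_limit[OF ev ul]) auto
qed

text \<open>A quarter of a lower bound for the nonzero lattice vectors, so that
  \<open>tail_lattice near_radius\<close> is all of \<open>\<Omega> - {0}\<close>.\<close>

definition near_radius :: real where "near_radius = 1 / (4 * coord_bound)"

lemma near_radius_pos: "near_radius > 0"
  using coord_bound_pos by (simp add: near_radius_def)

lemma lattice_norm_gt:
  assumes "x \<in> \<Omega>" "x \<noteq> 0"
  shows "cmod x > 2 * near_radius"
proof -
  have "coord1 x \<in> \<int>" "coord2 x \<in> \<int>" using assms lattice_iff by auto
  moreover have "coord1 x \<noteq> 0 \<or> coord2 x \<noteq> 0" using coord_decomp[of x] assms by auto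
  ultimately have "1 \<le> \<bar>coord1 x\<bar> \<or> 1 \<le> \<bar>coord2 x\<bar>" by (metis Ints_nonzero_abs_ge1)
  then have "1 \<le> coord_bound * cmod x" using coord_le[of x] by linarith
  then show ?thesis using coord_bound_pos by (simp add: near_radius_def field_simps)
qed

lemma closed_lattice: "closed \<Omega>"
proof (rule discrete_imp_closed)
  show "0 < 2 * near_radius" using near_radius_pos by simp
  show "\<forall>x\<in>\<Omega>. \<forall>y\<in>\<Omega>. dist y x < 2 * near_radius \<longrightarrow> y = x"
    using lattice_norm_gt lattice_diff by (fastforce simp: dist_norm)
qed

lemma open_compl_lattice: "open (- \<Omega>)"
  using closed_lattice by blast

lemma wp_split:
  assumes "X \<subseteq> \<Omega>" "finite (\<Omega> - X)"
  shows "wp z = (\<Sum>x\<in>\<Omega> - X. wp_term z x) + infsum (wp_term z) X"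
proof -
  have "infsum (wp_term z) ((\<Omega> - X) \<union> X) = infsum (wp_term z) (\<Omega> - X) + infsum (wp_term z) X"
    by (rule infsum_Un_disjoint) (use assms in \<open>auto intro: summable_on_subset_banach[OF wp_term_summable]\<close>)
  moreover have "(\<Omega> - X) \<union> X = \<Omega>" using assms by auto
  ultimately show ?thesis using assms by (simp add: wp_eq_infsum)
qed

lemma wp_holomorphic: "wp holomorphic_on - \<Omega>"
proof -
  have "wp field_differentiable at z" if z: "z \<in> - \<Omega>" for z
  proof -
    define R where "R = cmod z + 1"
    have R: "R > 0" "z \<in> ball 0 R" by (auto simp: R_def intro: add_nonneg_pos)
    have fin: "finite (\<Omega> - tail_lattice R)"
      by (rule finite_subset[OF _ finite_lattice_bounded[of "2 * R"]]) (auto simp: tail_lattice_def)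
    have "(\<lambda>z. (\<Sum>x\<in>\<Omega> - tail_lattice R. wp_term z x) + infsum (wp_term z) (tail_lattice R))
        holomorphic_on (ball 0 R - \<Omega>)"
      by (intro holomorphic_intros holomorphic_on_subset[OF tail_holomorphic[OF R(1)]])
         (auto simp: wp_term_def intro!: holomorphic_intros)
    then have "wp holomorphic_on (ball 0 R - \<Omega>)"
      by (rule holomorphic_transform) (use wp_split[OF _ fin] in \<open>auto simp: tail_lattice_def\<close>)
    moreover have "open (ball 0 R - \<Omega>)" using closed_lattice by (simp add: open_Diff)
    ultimately show ?thesis using z R holomorphic_on_imp_differentiable_at by blast
  qed
  then show ?thesis by (simp add: holomorphic_on_def field_differentiable_at_within)
qed

lemma wp_has_deriv: "z \<notin> \<Omega> \<Longrightarrow> (wp has_field_derivative deriv wp z) (at z)"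
  using wp_holomorphic open_compl_lattice holomorphic_derivI by blast

lemma wp_deriv_holomorphic: "deriv wp holomorphic_on - \<Omega>"
  by (rule holomorphic_deriv[OF wp_holomorphic open_compl_lattice])

lemma wp_deriv_has_deriv: "z \<notin> \<Omega> \<Longrightarrow> (deriv wp has_field_derivative deriv (deriv wp) z) (at z)"
  using wp_deriv_holomorphic open_compl_lattice holomorphic_derivI by blast

lemma periodic_deriv:
  assumes "f holomorphic_on - \<Omega>" "\<And>z. z \<notin> \<Omega> \<Longrightarrow> f (z + p) = f z" "p \<in> \<Omega>" "z \<notin> \<Omega>"
  shows "deriv f (z + p) = deriv f z"
proof -
  have "z + p \<notin> \<Omega>" using assms by (simp add: lattice_add_iff)
  then have "(f has_field_derivative deriv f (z + p)) (at (z + p))"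
    using assms open_compl_lattice holomorphic_derivI by blast
  then have "((\<lambda>z. f (z + p)) has_field_derivative deriv f (z + p)) (at z)" by (simp add: DERIV_shift)
  then have "(f has_field_derivative deriv f (z + p)) (at z)"
    by (rule has_field_derivative_transform_within_open[OF _ open_compl_lattice]) (use assms in auto)
  then show ?thesis by (simp add: DERIV_imp_deriv)
qed

lemma wp_deriv_periodic: "p \<in> \<Omega> \<Longrightarrow> z \<notin> \<Omega> \<Longrightarrow> deriv wp (z + p) = deriv wp z"
  by (rule periodic_deriv[OF wp_holomorphic]) (auto simp: wp_periodic)

lemma wp_deriv_minus:
  assumes "z \<notin> \<Omega>"
  shows "deriv wp (- z) = - deriv wp z"
proof -
  have "- z \<notin> \<Omega>" using assms by (simp add: lattice_uminus_iff)
  from wp_has_deriv[OF this] have "(wp has_field_derivative deriv wp (- z)) (at (- z))" .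
  from DERIV_chain2[OF this DERIV_minus[OF DERIV_ident]]
  have "((\<lambda>z. wp (- z)) has_field_derivative - deriv wp (- z)) (at z)" by simp
  then have "(wp has_field_derivative - deriv wp (- z)) (at z)" by (simp add: wp_minus)
  then show ?thesis using DERIV_imp_deriv by fastforce
qed

definition wp_regular :: "complex \<Rightarrow> complex" where
  "wp_regular z = infsum (wp_term z) (\<Omega> - {0})"

lemma wp_near_zero: "wp z = 1 / z\<^sup>2 + wp_regular z"
  using wp_split[of "\<Omega> - {0}" z] by (simp add: wp_regular_def wp_term_def double_diff)

lemma wp_regular_holomorphic: "wp_regular holomorphic_on ball 0 near_radius"
proof -
  have "tail_lattice near_radius = \<Omega> - {0}"
    using lattice_norm_gt near_radius_pos by (auto simp: tail_lattice_def)
  then show ?thesis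
    using tail_holomorphic[OF near_radius_pos] by (simp add: wp_regular_def[abs_def])
qed

lemma not_lattice_near: "z \<in> ball 0 near_radius \<Longrightarrow> z \<noteq> 0 \<Longrightarrow> z \<notin> \<Omega>"
  using lattice_norm_gt near_radius_pos by force

lemma wp_at_zero: "filterlim wp at_infinity (at 0)"
proof -
  have "filterlim (\<lambda>z::complex. 1 / z\<^sup>2) at_infinity (at 0)"
    by (rule filterlim_divide_at_infinity[OF tendsto_const]) (auto intro!: tendsto_eq_intros simp: filterlim_at eventually_at_filter)
  moreover have "(wp_regular \<longlongrightarrow> wp_regular 0) (at 0)"
    using wp_regular_holomorphic near_radius_pos
    by (metis at_within_open centre_in_ball continuous_on_def holomorphic_on_imp_continuous_on open_ball)
  ultimately have "filterlim (\<lambda>z. wp_regular z + 1 / z\<^sup>2) at_infinity (at 0)"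
    by (intro tendsto_add_filterlim_at_infinity)
  then show ?thesis by (simp add: wp_near_zero[abs_def] add.commute)
qed

lemma wp_at_lattice:
  assumes "p \<in> \<Omega>"
  shows "filterlim wp at_infinity (at p)"
proof -
  have "filterlim (\<lambda>z. wp (z + p)) at_infinity (at 0)"
    using wp_at_zero assms by (simp add: wp_periodic)
  then show ?thesis by (simp add: filterlim_shift_iff[of wp p _ 0] at_to_0[of p] filterlim_filtermap add.commute)
qed

text \<open>Liouville's theorem: \<open>wp'' - 6 * wp^2\<close> is periodic, and at \<open>0\<close>
  its poles cancel because the regular part of \<open>wp\<close> is even and vanishes there.
  Extended over the lattice it is entire and bounded.\<close>

lemma wp_second_order:
  obtains C where "\<And>z. z \<notin> \<Omega> \<Longrightarrow> deriv (deriv wp) z = 6 * (wp z)\<^sup>2 + C"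
proof -
  let ?B = "ball (0::complex) near_radius"
  have z0: "0 \<in> interior ?B" using near_radius_pos by simp
  note hol = wp_regular_holomorphic
  have "wp_term 0 = (\<lambda>_. 0)" by (simp add: wp_term_def fun_eq_iff)
  then have h0: "wp_regular 0 = 0" by (simp add: wp_regular_def)
  have heven: "wp_regular (- z) = wp_regular z" for z
    using wp_minus[of z] by (simp add: wp_near_zero)
  have dh: "(wp_regular has_field_derivative deriv wp_regular z) (at z)" if "z \<in> ?B" for z
    using hol that holomorphic_derivI by blast
  have h'0: "deriv wp_regular 0 = 0"
  proof -
    have "(wp_regular has_field_derivative deriv wp_regular (- 0)) (at (- 0))"
      using dh[of 0] near_radius_pos by simp
    from DERIV_chain2[OF this DERIV_minus[OF DERIV_ident]]
    have "(wp_regular has_field_derivative - deriv wp_regular 0) (at 0)" by (simp add: heven)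
    moreover have "(wp_regular has_field_derivative deriv wp_regular 0) (at 0)"
      using dh[of 0] near_radius_pos by simp
    ultimately have "- deriv wp_regular 0 = deriv wp_regular 0" by (rule DERIV_unique)
    then show ?thesis by simp
  qed
  \<comment> \<open>Removing the singularity twice yields \<open>k\<close> with
    \<open>wp_regular z = z^2 * k z\<close>. It makes the cross term
    \<open>2 * wp_regular z / z^2\<close> of \<open>(wp z)^2\<close> holomorphic at
    \<open>0\<close>.\<close>
  define k1 where "k1 = (\<lambda>z. if z = 0 then deriv wp_regular 0 else (wp_regular z - wp_regular 0) / (z - 0))"
  have k1: "k1 holomorphic_on ?B" unfolding k1_def by (rule pole_lemma[OF hol z0])
  define k where "k = (\<lambda>z. if z = 0 then deriv k1 0 else (k1 z - k1 0) / (z - 0))"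
  have k: "k holomorphic_on ?B" unfolding k_def by (rule pole_lemma[OF k1 z0])
  have kz: "wp_regular z = z\<^sup>2 * k z" if "z \<noteq> 0" for z
    using that by (simp add: k_def k1_def h0 h'0 power2_eq_square)
  define G where "G = (\<lambda>z. deriv (deriv wp) z - 6 * (wp z)\<^sup>2)"
  define G0 where "G0 = (\<lambda>z. deriv (deriv wp_regular) z - 12 * k z - 6 * (wp_regular z)\<^sup>2)"
  have G0: "G0 holomorphic_on ?B"
    unfolding G0_def by (intro holomorphic_intros hol k) auto
  have GG0: "G z = G0 z" if z: "z \<in> ?B - {0}" for z
  proof -
    have op: "open (?B - {0})" by auto
    have d1: "deriv wp w = - 2 / w ^ 3 + deriv wp_regular w" if w: "w \<in> ?B - {0}" for w
    proof -
      have "((\<lambda>w. 1 / w\<^sup>2 + wp_regular w) has_field_derivative (- 2 / w ^ 3 + deriv wp_regular w)) (at w)"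
        using w dh[of w] by (auto intro!: derivative_eq_intros simp: field_simps power2_eq_square power3_eq_cube)
      then show ?thesis by (simp add: wp_near_zero[abs_def] DERIV_imp_deriv)
    qed
    have "((\<lambda>w. - 2 / w ^ 3 + deriv wp_regular w) has_field_derivative (6 / z ^ 4 + deriv (deriv wp_regular) z)) (at z)"
    proof -
      have "(deriv wp_regular has_field_derivative deriv (deriv wp_regular) z) (at z)"
        using holomorphic_deriv[OF hol] z holomorphic_derivI by blast
      moreover have "((\<lambda>w. - 2 / w ^ 3) has_field_derivative 6 / z ^ 4) (at z)"
        using z by (auto intro!: derivative_eq_intros simp: field_simps eval_nat_numeral)
      ultimately show ?thesis by (rule DERIV_add[rotated])
    qed
    then have "(deriv wp has_field_derivative (6 / z ^ 4 + deriv (deriv wp_regular) z)) (at z)"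
      by (rule has_field_derivative_transform_within_open[OF _ op z]) (simp add: d1)
    then have d2: "deriv (deriv wp) z = 6 / z ^ 4 + deriv (deriv wp_regular) z" by (rule DERIV_imp_deriv)
    have "6 * (wp z)\<^sup>2 = 6 / z ^ 4 + 12 * k z + 6 * (wp_regular z)\<^sup>2"
    proof -
      have "(wp z)\<^sup>2 = (1 / z\<^sup>2)\<^sup>2 + 2 * (1 / z\<^sup>2) * wp_regular z + (wp_regular z)\<^sup>2"
        by (simp add: wp_near_zero power2_sum)
      also have "2 * (1 / z\<^sup>2) * wp_regular z = 2 * k z" using z kz[of z] by auto
      also have "(1 / z\<^sup>2)\<^sup>2 = 1 / z ^ 4" by (simp add: power_divide flip: power_mult)
      finally show ?thesis by (simp add: ring_distribs)
    qed
    then show ?thesis by (simp add: G_def G0_def d2)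
  qed
  have Ghol: "G holomorphic_on - \<Omega>"
    unfolding G_def
    by (intro holomorphic_intros wp_holomorphic wp_deriv_holomorphic open_compl_lattice)
  have Gper: "G (z + p) = G z" if "p \<in> \<Omega>" "z \<notin> \<Omega>" for z p
    unfolding G_def using that
    by (simp add: wp_periodic periodic_deriv[OF wp_deriv_holomorphic wp_deriv_periodic])
  define H where "H = (\<lambda>z. if z \<in> \<Omega> then G0 0 else G z)"
  have Hper: "H (z + p) = H z" if "p \<in> \<Omega>" for z p
    using that Gper by (simp add: H_def lattice_add_iff)
  have "H field_differentiable at z" for z
  proof (cases "z \<in> \<Omega>")
    case False
    then have "(G has_field_derivative deriv G z) (at z)" using Ghol open_compl_lattice holomorphic_derivI by blast
    then have "(H has_field_derivative deriv G z) (at z)"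
      by (rule has_field_derivative_transform_within_open[OF _ open_compl_lattice]) (use False in \<open>auto simp: H_def\<close>)
    then show ?thesis by (auto simp: field_differentiable_def)
  next
    case True
    have H0: "H w = G0 w" if "w \<in> ?B" for w
      using that GG0 not_lattice_near by (cases "w = 0") (auto simp: H_def)
    have "(G0 has_field_derivative deriv G0 0) (at 0)"
      using G0 near_radius_pos holomorphic_derivI[of G0 ?B 0] by simp
    then have "(H has_field_derivative deriv G0 0) (at 0)"
      by (rule has_field_derivative_transform_within_open[of _ _ _ ?B]) (use near_radius_pos H0 in auto)
    then obtain D where "(H has_field_derivative D) (at (z + (- z)))" by auto
    then have "((\<lambda>w. H (w + (- z))) has_field_derivative D) (at z)" by (simp only: DERIV_shift)
    moreover have "H (w + (- z)) = H w" for w by (rule Hper) (use True lattice_uminus in auto)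
    ultimately show ?thesis by (auto simp: field_differentiable_def)
  qed
  then have Hhol: "H holomorphic_on UNIV" by (simp add: holomorphic_on_def)
  have "bounded (range H)"
  proof -
    \<comment> \<open>The closed period parallelogram; passing to fractional parts of the
      coordinates moves every point into it.\<close>
    define K where "K = (\<lambda>(x, y). of_real x * \<omega>1 + of_real y * \<omega>2) ` ({0..1} \<times> {0..1::real})"
    have "compact K" unfolding K_def
      by (intro compact_continuous_image compact_Times) (auto intro!: continuous_intros simp: case_prod_unfold)
    then have "compact (H ` K)"
      using Hhol by (intro compact_continuous_image continuous_on_subset[OF holomorphic_on_imp_continuous_on]) auto
    moreover have "range H \<subseteq> H ` K"
    proof clarify
      fix z
      define p where "p = of_int \<lfloor>coord1 z\<rfloor> * \<omega>1 + of_int \<lfloor>coord2 z\<rfloor> * \<omega>2"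
      have p: "- p \<in> \<Omega>" unfolding lattice_uminus_iff p_def unfolding lattice by blast
      have "z + (- p) = of_real (frac (coord1 z)) * \<omega>1 + of_real (frac (coord2 z)) * \<omega>2"
        using coord_decomp[of z] by (simp add: p_def frac_def algebra_simps)
      then have "z + (- p) \<in> K"
        unfolding K_def by (intro image_eqI[of _ _ "(frac (coord1 z), frac (coord2 z))"]) (auto simp: less_imp_le frac_lt_1)
      moreover have "H z = H (z + (- p))" using Hper[OF p] by simp
      ultimately show "H z \<in> H ` K" by (metis imageI)
    qed
    ultimately show ?thesis using compact_imp_bounded bounded_subset by blast
  qed
  then have "H constant_on UNIV" using Liouville_theorem[OF Hhol] by blast
  then obtain C where "\<And>z. H z = C" unfolding constant_on_def by auto
  then have "deriv (deriv wp) z = 6 * (wp z)\<^sup>2 + C" if "z \<notin> \<Omega>" for z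
    using that unfolding H_def G_def by (metis add.commute diff_add_cancel)
  then show ?thesis using that by blast
qed

text \<open>In classical notation \<open>wp_C\<close> is \<open>- g2 / 2\<close>, and
  \<open>wp_K\<close> below is \<open>- g3\<close>.\<close>

definition wp_C :: complex where
  "wp_C = (SOME C. \<forall>z. z \<notin> \<Omega> \<longrightarrow> deriv (deriv wp) z = 6 * (wp z)\<^sup>2 + C)"

lemma wp_ode2: "z \<notin> \<Omega> \<Longrightarrow> deriv (deriv wp) z = 6 * (wp z)\<^sup>2 + wp_C"
proof -
  have "\<exists>C. \<forall>z. z \<notin> \<Omega> \<longrightarrow> deriv (deriv wp) z = 6 * (wp z)\<^sup>2 + C" using wp_second_order by metis
  from someI_ex[OF this] show "z \<notin> \<Omega> \<Longrightarrow> deriv (deriv wp) z = 6 * (wp z)\<^sup>2 + wp_C"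
    unfolding wp_C_def by blast
qed

lemma connected_compl_lattice: "connected (- \<Omega>)"
  using connected_open_diff_countable[OF _ open_UNIV connected_UNIV countable_lattice]
  by (simp add: Compl_eq_Diff_UNIV)

text \<open>By \<open>wp_ode2\<close> the derivative of the difference of both sides cancels, and
  the complement of the countable lattice is connected.\<close>

lemma wp_first_order: "\<exists>K. \<forall>z. z \<notin> \<Omega> \<longrightarrow> (deriv wp z)\<^sup>2 = 4 * wp z ^ 3 + 2 * wp_C * wp z + K"
proof -
  define f where "f = (\<lambda>z. (deriv wp z)\<^sup>2 - 4 * wp z ^ 3 - 2 * wp_C * wp z)"
  have "(f has_field_derivative 0) (at z)" if "z \<in> - \<Omega>" for z
    unfolding f_def
    using that wp_has_deriv[of z] wp_deriv_has_deriv[of z] wp_ode2[of z]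
    by (auto intro!: derivative_eq_intros simp: algebra_simps power2_eq_square)
  moreover have "continuous_on (- \<Omega>) f"
    unfolding f_def
    by (intro continuous_intros holomorphic_on_imp_continuous_on wp_holomorphic wp_deriv_holomorphic)
  ultimately obtain c where "\<And>z. z \<in> - \<Omega> \<Longrightarrow> f z = c"
    using DERIV_zero_connected_constant[OF connected_compl_lattice open_compl_lattice finite.emptyI, of f] by auto
  then show ?thesis
    unfolding f_def by (intro exI[of _ c]) (auto simp: algebra_simps)
qed

definition wp_K :: complex where
  "wp_K = (SOME K. \<forall>z. z \<notin> \<Omega> \<longrightarrow> (deriv wp z)\<^sup>2 = 4 * wp z ^ 3 + 2 * wp_C * wp z + K)"

lemma wp_ode1: "z \<notin> \<Omega> \<Longrightarrow> (deriv wp z)\<^sup>2 = 4 * wp z ^ 3 + 2 * wp_C * wp z + wp_K"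
  using someI_ex[OF wp_first_order] unfolding wp_K_def by blast

text \<open>Uniqueness for the second order equation makes the translates by \<open>a\<close> and
  \<open>b\<close> agree near \<open>s = 0\<close>, hence wherever both are regular. At
  \<open>s = - a\<close> the translate by \<open>a\<close> has a pole, while the other one is
  continuous unless \<open>b - a\<close> is a period. This takes the place of counting zeros of
  elliptic functions.\<close>

lemma wp_agree_imp_lattice:
  assumes a: "a \<notin> \<Omega>" and b: "b \<notin> \<Omega>" and eq: "wp a = wp b" "deriv wp a = deriv wp b"
  shows "b - a \<in> \<Omega>"
proof (rule ccontr)
  assume ba: "b - a \<notin> \<Omega>"
  define V where "V = {s. a + s \<notin> \<Omega> \<and> b + s \<notin> \<Omega>}"
  have V: "V = UNIV - ((\<lambda>x. x - a) ` \<Omega> \<union> (\<lambda>x. x - b) ` \<Omega>)"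
    unfolding V_def by (auto simp: image_iff algebra_simps)
  have Vopen: "open V"
  proof -
    have "V = (\<lambda>s. a + s) -` (- \<Omega>) \<inter> (\<lambda>s. b + s) -` (- \<Omega>)" by (auto simp: V_def)
    then show ?thesis
      by (simp only:) (intro open_Int open_vimage open_compl_lattice continuous_intros)
  qed
  have Vconn: "connected V"
    unfolding V by (rule connected_open_diff_countable) (auto simp: countable_lattice)
  have hol: "(\<lambda>s. wp (a + s)) holomorphic_on V" "(\<lambda>s. wp (b + s)) holomorphic_on V"
    by (rule holomorphic_on_compose_gen[OF _ wp_holomorphic, unfolded o_def], auto intro!: holomorphic_intros simp: V_def)+
  have d1: "((\<lambda>s. wp (x + s)) has_field_derivative deriv wp (x + s)) (at s)"
    and d2: "((\<lambda>s. deriv wp (x + s)) has_field_derivative (6 * (wp (x + s))\<^sup>2 + wp_C)) (at s)"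
    if "x + s \<notin> \<Omega>" for x s
    using wp_has_deriv[OF that] wp_deriv_has_deriv[OF that] wp_ode2[OF that]
    by (simp_all add: DERIV_shift[of _ _ s x, simplified add.commute[of _ x]] )
  define d where "d = (\<lambda>s. wp (a + s) - wp (b + s))"
  have dV: "d holomorphic_on V" unfolding d_def by (intro holomorphic_intros hol)
  have "0 \<in> V" using a b by (simp add: V_def)
  then obtain r where r: "r > 0" "ball 0 r \<subseteq> V" using Vopen openE by blast
  have dd: "deriv d s = deriv wp (a + s) - deriv wp (b + s)" if "s \<in> V" for s
    unfolding d_def using that d1 by (intro DERIV_imp_deriv DERIV_diff) (auto simp: V_def)
  \<comment> \<open>The difference of the two squares factors, so the nonlinear equation for
    \<open>wp\<close> becomes linear for \<open>d\<close>.\<close>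
  have ddd: "deriv (deriv d) s = 6 * (wp (a + s) + wp (b + s)) * d s + 0 * deriv d s" if s: "s \<in> V" for s
  proof -
    have "((\<lambda>s. deriv wp (a + s) - deriv wp (b + s)) has_field_derivative
       (6 * (wp (a + s))\<^sup>2 + wp_C) - (6 * (wp (b + s))\<^sup>2 + wp_C)) (at s)"
      using s by (intro DERIV_diff d2) (auto simp: V_def)
    then have "(deriv d has_field_derivative (6 * (wp (a + s))\<^sup>2 + wp_C) - (6 * (wp (b + s))\<^sup>2 + wp_C)) (at s)"
      by (rule has_field_derivative_transform_within_open[OF _ Vopen s]) (simp add: dd)
    then show ?thesis by (simp add: DERIV_imp_deriv d_def power2_eq_square algebra_simps)
  qed
  have "d s = 0" if "s \<in> ball 0 r" for s
  proof (rule linear_ode_zero[where d = d and w = s and c = 0 and r = r and A = "\<lambda>s. 6 * (wp (a + s) + wp (b + s))" and B = "\<lambda>_. 0"])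
    show "d holomorphic_on ball 0 r" using dV r holomorphic_on_subset by blast
    show "(\<lambda>s. 6 * (wp (a + s) + wp (b + s))) holomorphic_on ball 0 r"
      by (intro holomorphic_intros holomorphic_on_subset[OF hol(1) r(2)] holomorphic_on_subset[OF hol(2) r(2)])
    show "deriv d 0 = 0" using dd[OF \<open>0 \<in> V\<close>] eq by simp
    show "d 0 = 0" using eq by (simp add: d_def)
  qed (use ddd r that in auto)
  then have dzero: "d s = 0" if "s \<in> V" for s
    using analytic_continuation_open[of "ball 0 r" V d "\<lambda>_. 0" s] that r Vopen Vconn dV by auto
  have ev: "\<forall>\<^sub>F s in at (- a). wp (a + s) = wp (b + s)"
  proof -
    define W where "W = (\<lambda>s. b + s) -` (- \<Omega>) \<inter> ball (- a) near_radius"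
    have "open W" unfolding W_def
      by (intro open_Int open_vimage open_compl_lattice continuous_intros) auto
    moreover have "- a \<in> W" using ba near_radius_pos by (simp add: W_def)
    ultimately have "\<forall>\<^sub>F s in at (- a). s \<in> W - {- a}" by (rule eventually_at_in_open)
    then show ?thesis
    proof eventually_elim
      case (elim s)
      then have "a + s \<in> ball 0 near_radius" "a + s \<noteq> 0"
        by (auto simp: W_def dist_norm norm_minus_commute add_eq_0_iff add.commute)
      then have "s \<in> V" using elim not_lattice_near by (auto simp: V_def W_def)
      then show ?case using dzero by (simp add: d_def)
    qed
  qed
  have "filterlim (\<lambda>s. wp (a + s)) at_infinity (at (- a))"
  proof -
    have "filterlim (\<lambda>s. a + s) (at 0) (at (- a))"
      unfolding filterlim_at by (auto intro!: tendsto_eq_intros simp: eventually_at_filter add_eq_0_iff)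
    then show ?thesis by (rule filterlim_compose[OF wp_at_zero])
  qed
  then have "filterlim (\<lambda>s. wp (b + s)) at_infinity (at (- a))"
    by (simp add: filterlim_cong[OF refl refl ev])
  moreover have "((\<lambda>s. wp (b + s)) \<longlongrightarrow> wp (b + - a)) (at (- a))"
  proof -
    have "isCont (\<lambda>s. wp (b + s)) (- a)"
      using d1[of b "- a"] ba DERIV_isCont by fastforce
    then show ?thesis by (simp add: isCont_def)
  qed
  ultimately show False
    using not_tendsto_and_filterlim_at_infinity[of "at (- a)"] by (metis trivial_limit_at)
qed

end

section \<open>Half periods, the roots of the cubic, and inverse branches\<close>

context period_lattice
begin

definition wp_poly :: "complex \<Rightarrow> complex" where
  "wp_poly w = 4 * w ^ 3 + 2 * wp_C * w + wp_K"

lemma wp_ode: "z \<notin> \<Omega> \<Longrightarrow> (deriv wp z)\<^sup>2 = wp_poly (wp z)"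
  using wp_ode1 by (simp add: wp_poly_def)

lemma wp_poly_deriv: "(wp_poly has_field_derivative 12 * w\<^sup>2 + 2 * wp_C) (at w)"
  unfolding wp_poly_def by (auto intro!: derivative_eq_intros simp: power2_eq_square)

text \<open>\<open>wp\<close> is even and its derivative odd: where the derivative vanishes,
  \<open>z\<close> and \<open>- z\<close> agree in value and derivative, hence are
  congruent.\<close>

lemma wp_deriv_zero_iff:
  assumes "z \<notin> \<Omega>"
  shows "deriv wp z = 0 \<longleftrightarrow> 2 * z \<in> \<Omega>"
proof
  assume 0: "deriv wp z = 0"
  have "z - (- z) \<in> \<Omega>"
    by (rule wp_agree_imp_lattice) (use assms 0 in \<open>auto simp: lattice_uminus_iff wp_minus wp_deriv_minus\<close>)
  then show "2 * z \<in> \<Omega>" by simp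
next
  assume 2: "2 * z \<in> \<Omega>"
  have "- z + 2 * z = z" by simp
  then have "deriv wp z = deriv wp (- z)"
    using wp_deriv_periodic[OF 2, of "- z"] assms by (simp add: lattice_uminus_iff)
  then show "deriv wp z = 0" using wp_deriv_minus[OF assms] by simp
qed

definition half1 :: complex where "half1 = \<omega>1 / 2"
definition half2 :: complex where "half2 = \<omega>2 / 2"
definition half3 :: complex where "half3 = (\<omega>1 + \<omega>2) / 2"

definition root1 :: complex where "root1 = wp half1"
definition root2 :: complex where "root2 = wp half2"
definition root3 :: complex where "root3 = wp half3"

lemma coord_halves [simp]:
  "coord1 half1 = 1/2" "coord2 half1 = 0" "coord1 half2 = 0" "coord2 half2 = 1/2"
  "coord1 half3 = 1/2" "coord2 half3 = 1/2"
proof -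
  have "half1 = of_real (1/2) * \<omega>1 + of_real 0 * \<omega>2" "half2 = of_real 0 * \<omega>1 + of_real (1/2) * \<omega>2"
    "half3 = of_real (1/2) * \<omega>1 + of_real (1/2) * \<omega>2"
    by (simp_all add: half1_def half2_def half3_def add_divide_distrib)
  then show "coord1 half1 = 1/2" "coord2 half1 = 0" "coord1 half2 = 0" "coord2 half2 = 1/2"
    "coord1 half3 = 1/2" "coord2 half3 = 1/2" by (metis coord_comb)+
qed

lemma half_not_int: "(1/2 :: real) \<notin> \<int>" "(-1/2 :: real) \<notin> \<int>"
proof -
  show "(1/2 :: real) \<notin> \<int>" by (auto elim!: Ints_cases simp: field_simps)
  then show "(-1/2 :: real) \<notin> \<int>" using minus_in_Ints_iff by fastforce
qed

lemma coord_diff: "coord1 (z - w) = coord1 z - coord1 w" "coord2 (z - w) = coord2 z - coord2 w"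
  by (auto simp: coord1_def coord2_def diff_divide_distrib algebra_simps)

lemma halves_not_lattice: "half1 \<notin> \<Omega>" "half2 \<notin> \<Omega>" "half3 \<notin> \<Omega>"
  using half_not_int by (auto simp: lattice_iff)

lemma halves_distinct: "half1 - half2 \<notin> \<Omega>" "half1 - half3 \<notin> \<Omega>" "half2 - half3 \<notin> \<Omega>"
  using half_not_int by (auto simp: lattice_iff coord_diff)

lemma halves_deriv: "deriv wp half1 = 0" "deriv wp half2 = 0" "deriv wp half3 = 0"
proof -
  have "2 * half1 = \<omega>1" "2 * half2 = \<omega>2" "2 * half3 = \<omega>1 + \<omega>2"
    by (simp_all add: half1_def half2_def half3_def)
  then show "deriv wp half1 = 0" "deriv wp half2 = 0" "deriv wp half3 = 0"
    using halves_not_lattice by (simp_all add: wp_deriv_zero_iff lattice_add)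
qed

lemma roots_distinct: "root1 \<noteq> root2" "root1 \<noteq> root3" "root2 \<noteq> root3"
proof -
  have "a - b \<in> \<Omega>" if "wp a = wp b" "deriv wp a = 0" "deriv wp b = 0" "a \<notin> \<Omega>" "b \<notin> \<Omega>" for a b
    using wp_agree_imp_lattice[of b a] that by simp
  then show "root1 \<noteq> root2" "root1 \<noteq> root3" "root2 \<noteq> root3"
    unfolding root1_def root2_def root3_def
    using halves_deriv halves_not_lattice halves_distinct by blast+
qed

lemma wp_poly_roots: "wp_poly root1 = 0" "wp_poly root2 = 0" "wp_poly root3 = 0"
  using wp_ode halves_not_lattice halves_deriv
  unfolding root1_def root2_def root3_def by (metis power_zero_numeral)+

text \<open>Subtracting the equations of two roots and cancelling their difference determines
  \<open>C\<close>; repeating this gives \<open>a + b + c = 0\<close>. The coefficients are then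
  polynomials in the roots.\<close>

lemma wp_poly_factor: "wp_poly w = 4 * (w - root1) * (w - root2) * (w - root3)"
proof -
  have gen: "4 * w ^ 3 + 2 * C * w + K = 4 * (w - a) * (w - b) * (w - c)"
    if "4 * a ^ 3 + 2 * C * a + K = 0" "4 * b ^ 3 + 2 * C * b + K = 0" "4 * c ^ 3 + 2 * C * c + K = 0"
      "a \<noteq> b" "a \<noteq> c" "b \<noteq> c" for a b c C K :: complex
  proof -
    have "(a - b) * (4 * (a\<^sup>2 + a * b + b\<^sup>2) + 2 * C) = 0"
      using that(1,2) by (simp add: power2_eq_square power3_eq_cube) algebra
    then have ab: "4 * (a\<^sup>2 + a * b + b\<^sup>2) + 2 * C = 0" using that by simp
    have "(a - c) * (4 * (a\<^sup>2 + a * c + c\<^sup>2) + 2 * C) = 0"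
      using that(1,3) by (simp add: power2_eq_square power3_eq_cube) algebra
    then have ac: "4 * (a\<^sup>2 + a * c + c\<^sup>2) + 2 * C = 0" using that by simp
    have "(b - c) * (a + b + c) = 0" using ab ac by (simp add: power2_eq_square) algebra
    then have "a + b + c = 0" using that by simp
    then have c: "c = - a - b" by (simp add: eq_neg_iff_add_eq_0 algebra_simps)
    have C: "C = - 2 * (a\<^sup>2 + a * b + b\<^sup>2)" using ab by algebra
    have K: "K = - 4 * a ^ 3 - 2 * C * a" using that(1) by algebra
    show ?thesis unfolding K C c by algebra
  qed
  show ?thesis
    unfolding wp_poly_def
    by (rule gen) (use wp_poly_roots roots_distinct in \<open>simp_all add: wp_poly_def\<close>)
qed

lemma wp_eq_root:
  assumes "z \<notin> \<Omega>"
  shows "wp z = root1 \<Longrightarrow> z - half1 \<in> \<Omega>" "wp z = root2 \<Longrightarrow> z - half2 \<in> \<Omega>" "wp z = root3 \<Longrightarrow> z - half3 \<in> \<Omega>"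
proof -
  have *: "z - h \<in> \<Omega>" if "wp z = wp h" "h \<notin> \<Omega>" "deriv wp h = 0" for h
  proof -
    have "(deriv wp z)\<^sup>2 = (deriv wp h)\<^sup>2" unfolding wp_ode[OF assms] wp_ode[OF that(2)] that(1) ..
    then have "deriv wp z = deriv wp h" using that by simp
    then show ?thesis using wp_agree_imp_lattice[of h z] that assms by simp
  qed
  show "wp z = root1 \<Longrightarrow> z - half1 \<in> \<Omega>" "wp z = root2 \<Longrightarrow> z - half2 \<in> \<Omega>" "wp z = root3 \<Longrightarrow> z - half3 \<in> \<Omega>"
    using * halves_deriv halves_not_lattice unfolding root1_def root2_def root3_def by blast+
qed

text \<open>
  The local identity is uniqueness for a second order linear equation satisfied by
  \<open>wp (U \<theta>) - w \<theta>\<close>; it spreads because \<open>U\<close> cannot reach a pole of \<open>wp\<close> while \<open>w\<close> stays finite.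
\<close>

lemma wp_inverse_identity:
  assumes T: "connected T" "open T" and U: "U holomorphic_on T" and w: "w holomorphic_on T"
    and ode: "\<And>x. x \<in> T \<Longrightarrow> (deriv U x)\<^sup>2 * wp_poly (w x) = (deriv w x)\<^sup>2"
    and x0: "x0 \<in> T" "U x0 \<notin> \<Omega>" "wp (U x0) = w x0"
    and init: "deriv wp (U x0) * deriv U x0 = deriv w x0" "deriv w x0 \<noteq> 0"
    and x: "x \<in> T"
  shows "U x \<notin> \<Omega> \<and> wp (U x) = w x"
proof -
  have Ud: "(U has_field_derivative deriv U y) (at y)" "(deriv U has_field_derivative deriv (deriv U) y) (at y)"
    and wd: "(w has_field_derivative deriv w y) (at y)" "(deriv w has_field_derivative deriv (deriv w) y) (at y)"
    if "y \<in> T" for y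
    using that U w T holomorphic_deriv holomorphic_derivI by blast+
  have hU: "deriv U holomorphic_on T" "deriv w holomorphic_on T"
    using U w T holomorphic_deriv by blast+
  have hwpU: "(\<lambda>y. wp (U y)) holomorphic_on B" if "B \<subseteq> T" "\<And>y. y \<in> B \<Longrightarrow> U y \<notin> \<Omega>" for B
    by (rule holomorphic_on_compose_gen[OF holomorphic_on_subset[OF U that(1)] wp_holomorphic, unfolded o_def])
       (use that in auto)
  \<comment> \<open>The identity is required on a whole disc, so that analytic continuation can
    carry it to neighbouring discs.\<close>
  define Q where "Q = (\<lambda>y. \<exists>r>0. ball y r \<subseteq> T \<and> (\<forall>v\<in>ball y r. U v \<notin> \<Omega> \<and> wp (U v) = w v))"
  have Qx0: "Q x0"
  proof -
    define N where "N = T \<inter> U -` (- \<Omega>) \<inter> (T \<inter> deriv U -` (- {0})) \<inter> (T \<inter> deriv w -` (- {0}))"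
    have "open N" unfolding N_def
      using T U hU open_compl_lattice
      by (intro open_Int continuous_open_preimage holomorphic_on_imp_continuous_on) auto
    moreover have "x0 \<in> N" using x0 init by (auto simp: N_def)
    ultimately obtain r where r: "r > 0" "ball x0 r \<subseteq> N" using openE by blast
    have rT: "ball x0 r \<subseteq> T" and rO: "\<And>y. y \<in> ball x0 r \<Longrightarrow> U y \<notin> \<Omega>"
      and rU: "\<And>y. y \<in> ball x0 r \<Longrightarrow> deriv U y \<noteq> 0" and rw: "\<And>y. y \<in> ball x0 r \<Longrightarrow> deriv w y \<noteq> 0"
      using r by (auto simp: N_def)
    define d where "d = (\<lambda>y. wp (U y) - w y)"
    have hd: "d holomorphic_on ball x0 r" unfolding d_def
      using rT rO w by (intro holomorphic_intros hwpU holomorphic_on_subset[OF w]) auto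
    have d1: "deriv d y = deriv wp (U y) * deriv U y - deriv w y" if y: "y \<in> ball x0 r" for y
    proof -
      have "((\<lambda>y. wp (U y)) has_field_derivative deriv wp (U y) * deriv U y) (at y)"
        by (rule DERIV_chain2[OF wp_has_deriv Ud(1)]) (use y rT rO in auto)
      then show ?thesis
        unfolding d_def using y rT by (intro DERIV_imp_deriv DERIV_diff wd) auto
    qed
    \<comment> \<open>The second derivative of \<open>w\<close> is eliminated by differentiating
      \<open>ode\<close>; what remains is linear in \<open>d\<close> and its derivative.\<close>
    have d2: "deriv (deriv d) y = (6 * (deriv U y)\<^sup>2 * (wp (U y) + w y)) * d y + (deriv (deriv U) y / deriv U y) * deriv d y"
      if y: "y \<in> ball x0 r" for y
    proof -
      have yT: "y \<in> T" using y rT by auto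
      have 1: "((\<lambda>y. deriv wp (U y)) has_field_derivative (6 * (wp (U y))\<^sup>2 + wp_C) * deriv U y) (at y)"
        using wp_deriv_has_deriv[OF rO[OF y]] wp_ode2[OF rO[OF y]] Ud(1)[OF yT] DERIV_chain2 by fastforce
      have "((\<lambda>y. deriv wp (U y) * deriv U y - deriv w y) has_field_derivative
          ((6 * (wp (U y))\<^sup>2 + wp_C) * deriv U y) * deriv U y + deriv (deriv U) y * deriv wp (U y) - deriv (deriv w) y) (at y)"
        by (intro DERIV_diff DERIV_mult 1 Ud wd yT)
      then have "(deriv d has_field_derivative
          ((6 * (wp (U y))\<^sup>2 + wp_C) * deriv U y) * deriv U y + deriv (deriv U) y * deriv wp (U y) - deriv (deriv w) y) (at y)"
        by (rule has_field_derivative_transform_within_open[OF _ open_ball y]) (simp add: d1)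
      then have A: "deriv (deriv d) y = ((6 * (wp (U y))\<^sup>2 + wp_C) * deriv U y) * deriv U y + deriv (deriv U) y * deriv wp (U y) - deriv (deriv w) y"
        by (rule DERIV_imp_deriv)
      have "((\<lambda>y. (deriv U y)\<^sup>2 * wp_poly (w y)) has_field_derivative
          2 * deriv U y * deriv (deriv U) y * wp_poly (w y) + (deriv U y)\<^sup>2 * ((12 * (w y)\<^sup>2 + 2 * wp_C) * deriv w y)) (at y)"
        by (rule derivative_eq_intros DERIV_chain2[OF wp_poly_deriv] Ud wd yT refl)+ (simp add: algebra_simps)
      then have "((\<lambda>y. (deriv w y)\<^sup>2) has_field_derivative
          2 * deriv U y * deriv (deriv U) y * wp_poly (w y) + (deriv U y)\<^sup>2 * ((12 * (w y)\<^sup>2 + 2 * wp_C) * deriv w y)) (at y)"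
        by (rule has_field_derivative_transform_within_open[OF _ T(2) yT]) (rule ode)
      moreover have "((\<lambda>y. (deriv w y)\<^sup>2) has_field_derivative 2 * deriv w y * deriv (deriv w) y) (at y)"
        by (rule derivative_eq_intros wd yT refl)+ simp
      ultimately have B: "2 * deriv U y * deriv (deriv U) y * wp_poly (w y) + (deriv U y)\<^sup>2 * ((12 * (w y)\<^sup>2 + 2 * wp_C) * deriv w y) = 2 * deriv w y * deriv (deriv w) y"
        by (rule DERIV_unique)
      \<comment> \<open>The logarithmic derivative of \<open>deriv U\<close>. In terms of
        \<open>q\<close>, equation \<open>B\<close> has the factor \<open>2 * deriv w y\<close>,
        which is nonzero near \<open>x0\<close> and can be cancelled.\<close>
      define q where "q = deriv (deriv U) y / deriv U y"
      have q: "deriv (deriv U) y = q * deriv U y" using rU[OF y] by (simp add: q_def)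
      have "2 * deriv w y * deriv (deriv w) y = 2 * q * ((deriv U y)\<^sup>2 * wp_poly (w y)) + (deriv U y)\<^sup>2 * ((12 * (w y)\<^sup>2 + 2 * wp_C) * deriv w y)"
        using B unfolding q by (simp add: algebra_simps power2_eq_square)
      also have "\<dots> = 2 * q * (deriv w y)\<^sup>2 + (deriv U y)\<^sup>2 * ((12 * (w y)\<^sup>2 + 2 * wp_C) * deriv w y)"
        by (simp add: ode[OF yT])
      finally have "2 * deriv w y * (deriv (deriv w) y - (q * deriv w y + (deriv U y)\<^sup>2 * (6 * (w y)\<^sup>2 + wp_C))) = 0"
        by (simp add: algebra_simps power2_eq_square)
      then have Cc: "deriv (deriv w) y = q * deriv w y + (deriv U y)\<^sup>2 * (6 * (w y)\<^sup>2 + wp_C)"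
        using rw[OF y] by simp
      show ?thesis
        unfolding A Cc d1[OF y] q_def[symmetric] unfolding q d_def by (simp add: algebra_simps power2_eq_square)
    qed
    have "d v = 0" if v: "v \<in> ball x0 r" for v
    proof (rule linear_ode_zero[where d = d and w = v and c = x0 and r = r and
        A = "\<lambda>y. 6 * (deriv U y)\<^sup>2 * (wp (U y) + w y)" and B = "\<lambda>y. deriv (deriv U) y / deriv U y"])
      show "(\<lambda>y. 6 * (deriv U y)\<^sup>2 * (wp (U y) + w y)) holomorphic_on ball x0 r"
        using rT rO by (intro holomorphic_intros hwpU holomorphic_on_subset[OF w] holomorphic_on_subset[OF U]) auto
      show "(\<lambda>y. deriv (deriv U) y / deriv U y) holomorphic_on ball x0 r"
        using rT rU by (intro holomorphic_intros holomorphic_on_subset[OF U]) auto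
      show "d x0 = 0" "deriv d x0 = 0" using x0 init d1[of x0] r by (auto simp: d_def)
    qed (use hd d2 v in auto)
    then show ?thesis unfolding Q_def d_def using r rT rO by (intro exI[of _ r]) auto
  qed
  have "Q x"
  proof (rule connected_induction_simple[where P = Q, OF T(1) x0(1) x Qx0])
    fix a assume a: "a \<in> T"
    show "\<exists>N. openin (top_of_set T) N \<and> a \<in> N \<and> (\<forall>x\<in>N. \<forall>y\<in>N. Q x \<longrightarrow> Q y)"
    proof (cases "U a \<in> \<Omega>")
      case False
      have "open (T \<inter> U -` (- \<Omega>))"
        using T U open_compl_lattice by (intro continuous_open_preimage holomorphic_on_imp_continuous_on) auto
      then obtain r where r: "r > 0" "ball a r \<subseteq> T \<inter> U -` (- \<Omega>)" using False a openE
        by (metis ComplI IntI vimageI)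
      have "Q z" if y: "y \<in> ball a r" "Q y" and z: "z \<in> ball a r" for y z
      proof -
        obtain s where s: "s > 0" "\<forall>v\<in>ball y s. U v \<notin> \<Omega> \<and> wp (U v) = w v" using y unfolding Q_def by blast
        have "wp (U v) = w v" if "v \<in> ball a r" for v
        proof (rule analytic_continuation_open[of "ball y s \<inter> ball a r" "ball a r" "\<lambda>v. wp (U v)" w])
          show "ball y s \<inter> ball a r \<noteq> {}" using y s by (metis IntI centre_in_ball empty_iff)
          show "(\<lambda>v. wp (U v)) holomorphic_on ball a r" using r by (intro hwpU) auto
          show "w holomorphic_on ball a r" using r w holomorphic_on_subset by blast
        qed (use s that in auto)
        moreover obtain t where "t > 0" "ball z t \<subseteq> ball a r" using z openE open_ball by blast
        ultimately show "Q z" unfolding Q_def using r by (intro exI[of _ t]) auto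
      qed
      moreover have "openin (top_of_set T) (ball a r)" "a \<in> ball a r"
        using r T(2) by (auto simp: openin_open_eq)
      ultimately show ?thesis by blast
    next
      \<comment> \<open>Near a point with \<open>U a\<close> in the lattice, \<open>U y\<close>
        either equals \<open>U a\<close> or makes \<open>wp (U y)\<close> larger than
        \<open>w y\<close>. So \<open>Q\<close> fails on a whole neighbourhood.\<close>
      case True
      have "isCont w a" using wd(1)[OF a] DERIV_isCont by blast
      then have "filterlim w (nhds (w a)) (nhds a)" by (simp add: isCont_def tendsto_at_iff_tendsto_nhds)
      then have "\<forall>\<^sub>F y in nhds a. dist (w y) (w a) < 1" by (rule tendstoD) simp
      then have "\<forall>\<^sub>F y in nhds a. cmod (w y - w a) < 1" by (simp add: dist_norm)
      then have e1: "\<forall>\<^sub>F y in nhds a. cmod (w y) < cmod (w a) + 1"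
      proof eventually_elim
        case (elim y)
        then show ?case using norm_triangle_sub[of "w y" "w a"] by simp
      qed
      have "\<forall>\<^sub>F v in at (U a). cmod (wp v) \<ge> cmod (w a) + 1"
        using wp_at_lattice[OF True] filterlim_at_infinity[OF order_refl, of wp "at (U a)"]
        by (auto simp: add_nonneg_pos)
      then have "\<forall>\<^sub>F v in nhds (U a). v \<noteq> U a \<longrightarrow> cmod (wp v) \<ge> cmod (w a) + 1"
        by (simp add: eventually_at_filter)
      moreover have "filterlim U (nhds (U a)) (nhds a)"
        using Ud(1)[OF a] DERIV_isCont unfolding isCont_def tendsto_at_iff_tendsto_nhds by blast
      ultimately have e2: "\<forall>\<^sub>F y in nhds a. U y \<noteq> U a \<longrightarrow> cmod (wp (U y)) \<ge> cmod (w a) + 1"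
        by (rule eventually_compose_filterlim)
      have "\<forall>\<^sub>F y in nhds a. y \<in> T" using a T eventually_nhds_in_open by blast
      with e1 e2 have "\<forall>\<^sub>F y in nhds a. \<not> Q y \<and> y \<in> T"
      proof eventually_elim
        case (elim y)
        have "\<not> Q y"
        proof
          assume "Q y"
          then have "U y \<notin> \<Omega>" "wp (U y) = w y" unfolding Q_def by (metis centre_in_ball)+
          then show False using elim True by auto
        qed
        then show ?case using elim by blast
      qed
      then obtain N where "open N" "a \<in> N" "\<forall>y\<in>N. \<not> Q y \<and> y \<in> T" unfolding eventually_nhds by blast
      then have "openin (top_of_set T) N" using T(2) by (auto simp: openin_open_eq)
      then show ?thesis using \<open>a \<in> N\<close> \<open>\<forall>y\<in>N. \<not> Q y \<and> y \<in> T\<close> by blast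
    qed
  qed
  then show ?thesis unfolding Q_def by (metis centre_in_ball)
qed

text \<open>A primitive of \<open>\<sigma> * v\<close>, normalised at \<open>wp z0\<close>, is put
  into \<open>wp_inverse_identity\<close> with \<open>w\<close> the identity. The sign is the one
  for which \<open>\<sigma> * v\<close> is the inverse of the derivative of \<open>wp\<close> at
  \<open>z0\<close>.\<close>

lemma wp_branch_exists:
  assumes S: "convex S" "open S" and v: "v holomorphic_on S"
    and v2: "\<And>w. w \<in> S \<Longrightarrow> (v w)\<^sup>2 * wp_poly w = 1"
    and z0: "z0 \<notin> \<Omega>" "wp z0 \<in> S"
  shows "\<exists>\<sigma>\<in>{1, -1}. \<exists>u. u holomorphic_on S \<and> (\<forall>w\<in>S. (u has_field_derivative \<sigma> * v w) (at w)) \<and>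
           u (wp z0) = z0 \<and> (\<forall>w\<in>S. u w \<notin> \<Omega> \<and> wp (u w) = w)"
proof -
  have "(v (wp z0) * deriv wp z0)\<^sup>2 = 1"
    using v2[OF z0(2)] wp_ode[OF z0(1)] by (simp add: power_mult_distrib)
  then have "v (wp z0) * deriv wp z0 = 1 \<or> v (wp z0) * deriv wp z0 = - 1" by (simp add: power2_eq_1_iff)
  then have "deriv wp z0 * (1 * v (wp z0)) = 1 \<or> deriv wp z0 * (- 1 * v (wp z0)) = 1"
    by (auto simp: mult.commute)
  then obtain \<sigma> where \<sigma>: "\<sigma> \<in> {1, -1}" "deriv wp z0 * (\<sigma> * v (wp z0)) = 1" by blast
  have hv: "(\<lambda>w. \<sigma> * v w) holomorphic_on S" by (intro holomorphic_intros v)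
  have fd: "(\<lambda>w. \<sigma> * v w) field_differentiable at x" if "x \<in> interior S - {}" for x
    using hv S(2) that holomorphic_on_imp_differentiable_at by (metis Diff_empty interior_open)
  have "\<exists>g. \<forall>x\<in>S. (g has_field_derivative \<sigma> * v x) (at x within S)"
  proof (rule holomorphic_convex_primitive[OF S(1) finite.emptyI holomorphic_on_imp_continuous_on[OF hv] fd])
    fix g assume "\<And>x. x \<in> S \<Longrightarrow> (g has_field_derivative \<sigma> * v x) (at x within S)"
    then show ?thesis by (intro exI[of _ g] ballI)
  qed
  then obtain g where g: "\<And>x. x \<in> S \<Longrightarrow> (g has_field_derivative \<sigma> * v x) (at x within S)" by blast
  define u where "u = (\<lambda>w. g w - g (wp z0) + z0)"
  have ud: "(u has_field_derivative \<sigma> * v w) (at w)" if "w \<in> S" for w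
  proof -
    have "(g has_field_derivative \<sigma> * v w) (at w)"
      using g[OF that] at_within_open[OF that S(2)] by simp
    from DERIV_add[OF this DERIV_const[of "z0 - g (wp z0)"]] show ?thesis
      by (simp add: u_def[abs_def] algebra_simps)
  qed
  then have uh: "u holomorphic_on S" using S(2) holomorphic_on_open by blast
  have du: "deriv u w = \<sigma> * v w" if "w \<in> S" for w using ud[OF that] by (rule DERIV_imp_deriv)
  have "u w \<notin> \<Omega> \<and> wp (u w) = w" if w: "w \<in> S" for w
  proof (rule wp_inverse_identity[OF convex_connected[OF S(1)] S(2) uh holomorphic_on_ident _ z0(2) _ _ _ _ w])
    show "(deriv u x)\<^sup>2 * wp_poly x = (deriv (\<lambda>x. x) x)\<^sup>2" if "x \<in> S" for x
      using that v2 \<sigma>(1) by (auto simp: du power_mult_distrib)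
  qed (use z0 \<sigma> du in \<open>auto simp: u_def\<close>)
  then show ?thesis using \<sigma>(1) uh ud by (intro bexI[of _ \<sigma>] exI[of _ u]) (auto simp: u_def)
qed

text \<open>Equal derivatives make the difference constant, and by the chain rule \<open>wp\<close>
  has the same derivative at both images of \<open>w0\<close>; \<open>wp_agree_imp_lattice\<close>
  then identifies the constant as a period.\<close>

lemma wp_branch_unique:
  assumes S: "convex S" "open S" "w0 \<in> S"
    and u: "\<And>w. w \<in> S \<Longrightarrow> (u has_field_derivative d w) (at w)" "\<And>w. w \<in> S \<Longrightarrow> u w \<notin> \<Omega> \<and> wp (u w) = w"
    and u': "\<And>w. w \<in> S \<Longrightarrow> (u' has_field_derivative d w) (at w)" "\<And>w. w \<in> S \<Longrightarrow> u' w \<notin> \<Omega> \<and> wp (u' w) = w"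
  shows "\<exists>p\<in>\<Omega>. \<forall>w\<in>S. u' w = u w + p"
proof -
  have "((\<lambda>w. u' w - u w) has_field_derivative 0) (at w within S)" if "w \<in> S" for w
    using DERIV_diff[OF u'(1)[OF that] u(1)[OF that]] by (auto intro: has_field_derivative_at_within)
  then have "\<exists>c. \<forall>w\<in>S. u' w - u w = c"
    by (rule has_field_derivative_zero_constant[OF S(1)])
  then obtain c where c: "\<And>w. w \<in> S \<Longrightarrow> u' w - u w = c" by blast
  have dd: "deriv wp (y w0) * d w0 = 1"
    if y: "\<And>w. w \<in> S \<Longrightarrow> (y has_field_derivative d w) (at w)" "\<And>w. w \<in> S \<Longrightarrow> y w \<notin> \<Omega> \<and> wp (y w) = w" for y
  proof -
    have "((\<lambda>w. wp (y w)) has_field_derivative deriv wp (y w0) * d w0) (at w0)"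
      using y S by (intro DERIV_chain2[OF wp_has_deriv]) auto
    then have "((\<lambda>w. w) has_field_derivative deriv wp (y w0) * d w0) (at w0)"
      by (rule has_field_derivative_transform_within_open[OF _ S(2,3)]) (use y in auto)
    then show ?thesis using DERIV_unique DERIV_ident by blast
  qed
  have "deriv wp (u w0) = deriv wp (u' w0)"
    using dd[OF u] dd[OF u'] by (metis mult_cancel_right mult_zero_right zero_neq_one)
  then have "u' w0 - u w0 \<in> \<Omega>"
    using u(2)[OF S(3)] u'(2)[OF S(3)] by (intro wp_agree_imp_lattice) auto
  then have "c \<in> \<Omega>" using c[OF S(3)] by simp
  then show ?thesis using c by (intro bexI[of _ c]) (auto simp: algebra_simps)
qed

end

section \<open>Length estimates along lines\<close>

text \<open>\<open>H\<close> is a bounded primitive of the density \<open>h\<close>. Only continuity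
  is asked at \<open>0\<close>, because \<open>h\<close> blows up there when the line meets a branch
  point.\<close>

definition majorant :: "(real \<Rightarrow> real) \<Rightarrow> (real \<Rightarrow> real) \<Rightarrow> real \<Rightarrow> bool" where
  "majorant H h B \<longleftrightarrow> continuous_on {0..} H \<and> H 0 = 0 \<and> (\<forall>s>0. (H has_real_derivative h s) (at s)) \<and>
     (\<forall>s\<ge>0. 0 \<le> H s \<and> H s \<le> B)"

text \<open>Shifted by \<open>c\<close>, this is a primitive of \<open>h \<bar>t - c\<bar>\<close>
  on both sides of the singular parameter \<open>c\<close>.\<close>

definition odd_ext :: "(real \<Rightarrow> real) \<Rightarrow> real \<Rightarrow> real" where
  "odd_ext H t = sgn t * H \<bar>t\<bar>"

lemma odd_ext_bounds:
  assumes "majorant H h B"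
  shows "odd_ext H t \<le> B" "- B \<le> odd_ext H t"
proof -
  have H: "0 \<le> H \<bar>t\<bar>" "H \<bar>t\<bar> \<le> B" using assms by (auto simp: majorant_def)
  then show "odd_ext H t \<le> B" "- B \<le> odd_ext H t"
    by (cases t "0 :: real" rule: linorder_cases; simp add: odd_ext_def)+
qed

lemma odd_ext_continuous:
  assumes "majorant H h B"
  shows "continuous_on A (odd_ext H)"
proof -
  have cH: "continuous_on {0..} H" and H0: "H 0 = 0" using assms by (auto simp: majorant_def)
  have "continuous_on {..0} (odd_ext H)"
  proof (rule continuous_on_eq)
    show "continuous_on {..0} (\<lambda>t. - H (- t))"
      by (intro continuous_intros continuous_on_compose2[OF cH]) auto
    show "- H (- t) = odd_ext H t" if "t \<in> {..0}" for t
      using that by (cases "t = 0") (auto simp: odd_ext_def H0)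
  qed
  moreover have "continuous_on {0..} (odd_ext H)"
    by (rule continuous_on_eq[OF cH]) (auto simp: odd_ext_def H0 sgn_if)
  ultimately have "continuous_on ({..0} \<union> {0..}) (odd_ext H)"
    by (intro continuous_on_closed_Un) auto
  then show ?thesis by (rule continuous_on_subset) auto
qed

lemma odd_ext_deriv:
  assumes "majorant H h B" "t \<noteq> 0"
  shows "(odd_ext H has_real_derivative h \<bar>t\<bar>) (at t)"
proof -
  have dH: "\<And>s. s > 0 \<Longrightarrow> (H has_real_derivative h s) (at s)" using assms by (auto simp: majorant_def)
  consider "t > 0" | "t < 0" using assms(2) by linarith
  then show ?thesis
  proof cases
    case 1
    have "(H has_real_derivative h t) (at t)" by (rule dH[OF 1])
    then have "(odd_ext H has_real_derivative h t) (at t)"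
      by (rule has_field_derivative_transform_within_open[of _ _ _ "{0<..}"]) (use 1 in \<open>auto simp: odd_ext_def\<close>)
    then show ?thesis using 1 by simp
  next
    case 2
    have "(H has_real_derivative h (- t)) (at (- t))" using 2 by (intro dH) simp
    from DERIV_minus[OF DERIV_chain2[OF this DERIV_minus[OF DERIV_ident]]]
    have "((\<lambda>t. - H (- t)) has_real_derivative h (- t)) (at t)" by simp
    then have "(odd_ext H has_real_derivative h (- t)) (at t)"
      by (rule has_field_derivative_transform_within_open[of _ _ _ "{..<0}"]) (use 2 in \<open>auto simp: odd_ext_def\<close>)
    then show ?thesis using 2 by simp
  qed
qed

text \<open>The increment of \<open>y\<close> is the integral of its velocity, and the sum of the
  odd extensions integrates the bound for the velocity across all singular parameters.\<close>

lemma majorant_path: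
  fixes y :: "real \<Rightarrow> 'a::banach" and H h :: "'i \<Rightarrow> real \<Rightarrow> real"
  assumes "finite I" "a \<le> b" and maj: "\<And>i. i \<in> I \<Longrightarrow> majorant (H i) (h i) (B i)"
    and y: "\<And>t. t \<in> {a..b} \<Longrightarrow> (y has_vector_derivative y' t) (at t)"
    and le: "\<And>t. t \<in> {a..b} \<Longrightarrow> t \<notin> c ` I \<Longrightarrow> norm (y' t) \<le> (\<Sum>i\<in>I. h i \<bar>t - c i\<bar>)"
  shows "norm (y b - y a) \<le> (\<Sum>i\<in>I. odd_ext (H i) (b - c i)) - (\<Sum>i\<in>I. odd_ext (H i) (a - c i))"
proof -
  define G where "G = (\<lambda>t. \<Sum>i\<in>I. odd_ext (H i) (t - c i))"
  define g where "g = (\<lambda>t. \<Sum>i\<in>I. h i \<bar>t - c i\<bar>)"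
  have "continuous_on {a..b} G"
    unfolding G_def
    by (intro continuous_intros continuous_on_compose2[OF odd_ext_continuous[OF maj, of _ UNIV]]) auto
  moreover have "(G has_vector_derivative g t) (at t)" if "t \<in> {a<..<b} - c ` I" for t
    unfolding G_def g_def has_real_derivative_iff_has_vector_derivative[symmetric]
  proof (rule DERIV_sum)
    fix i assume i: "i \<in> I"
    have "(odd_ext (H i) has_real_derivative h i \<bar>t - c i\<bar>) (at (t - c i))"
      by (rule odd_ext_deriv[OF maj[OF i]]) (use that i in auto)
    moreover have "((\<lambda>t. t - c i) has_real_derivative 1) (at t)" by (auto intro!: derivative_eq_intros)
    ultimately have "((\<lambda>t. odd_ext (H i) (t - c i)) has_real_derivative h i \<bar>t - c i\<bar> * 1) (at t)"
      by (rule DERIV_chain2[where g = "\<lambda>t. t - c i"])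
    then show "((\<lambda>t. odd_ext (H i) (t - c i)) has_real_derivative h i \<bar>t - c i\<bar>) (at t)" by simp
  qed
  ultimately have G: "(g has_integral (G b - G a)) {a..b}"
    using fundamental_theorem_of_calculus_interior_strong[of "c ` I" a b G g] assms(1,2) by auto
  \<comment> \<open>At the finitely many singular parameters the bound is replaced by the norm
    itself, so that the comparison holds everywhere with the same integral.\<close>
  define g' where "g' = (\<lambda>t. if t \<in> c ` I then norm (y' t) else g t)"
  have G': "(g' has_integral (G b - G a)) {a..b}"
    by (rule has_integral_spike_finite[OF _ _ G, of "c ` I"]) (use assms(1) in \<open>auto simp: g'_def\<close>)
  have Y: "(y' has_integral (y b - y a)) {a..b}"
    by (rule fundamental_theorem_of_calculus[OF assms(2)]) (use y in \<open>auto intro: has_vector_derivative_at_within\<close>)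
  have "norm (integral {a..b} y') \<le> integral {a..b} g'"
    by (rule integral_norm_bound_integral) (use Y G' le in \<open>auto simp: g'_def g_def integrable_on_def\<close>)
  then show ?thesis using integral_unique[OF Y] integral_unique[OF G'] by (simp add: G_def)
qed

text \<open>Each odd extension rises at most from \<open>- B i\<close> to \<open>B i\<close>; this
  is the factor 2.\<close>

lemma majorant_path_bound:
  fixes y :: "real \<Rightarrow> 'a::banach"
  assumes "finite I" "a \<le> b" "\<And>i. i \<in> I \<Longrightarrow> majorant (H i) (h i) (B i)"
    "\<And>t. t \<in> {a..b} \<Longrightarrow> (y has_vector_derivative y' t) (at t)"
    "\<And>t. t \<in> {a..b} \<Longrightarrow> t \<notin> c ` I \<Longrightarrow> norm (y' t) \<le> (\<Sum>i\<in>I. h i \<bar>t - c i\<bar>)"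
  shows "norm (y b - y a) \<le> 2 * (\<Sum>i\<in>I. B i)"
proof -
  have "norm (y b - y a) \<le> (\<Sum>i\<in>I. odd_ext (H i) (b - c i)) - (\<Sum>i\<in>I. odd_ext (H i) (a - c i))"
    by (rule majorant_path) (use assms in auto)
  also have "\<dots> \<le> (\<Sum>i\<in>I. B i) - (\<Sum>i\<in>I. - B i)"
    by (intro diff_mono sum_mono odd_ext_bounds) (use assms in auto)
  finally show ?thesis by (simp add: sum_negf)
qed

text \<open>The sum of the odd extensions is bounded and increasing along the ray, so its increments
  become small, and with them those of \<open>y\<close>.\<close>

lemma majorant_path_converges:
  fixes y :: "real \<Rightarrow> 'a::banach"
  assumes fin: "finite I" and maj: "\<And>i. i \<in> I \<Longrightarrow> majorant (H i) (h i) (B i)"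
    and y: "\<And>t. t \<ge> 0 \<Longrightarrow> (y has_vector_derivative y' t) (at t)"
    and le: "\<And>t. t \<ge> 0 \<Longrightarrow> t \<notin> c ` I \<Longrightarrow> norm (y' t) \<le> (\<Sum>i\<in>I. h i \<bar>t - c i\<bar>)"
  shows "\<exists>l. (y \<longlongrightarrow> l) at_top"
proof -
  define G where "G = (\<lambda>t. \<Sum>i\<in>I. odd_ext (H i) (t - c i))"
  have yG: "norm (y b - y a) \<le> G b - G a" if "0 \<le> a" "a \<le> b" for a b
    unfolding G_def by (rule majorant_path[where y' = y' and h = h and B = B]) (use assms that in auto)
  have mono: "G a \<le> G b" if "0 \<le> a" "a \<le> b" for a b
    using yG[OF that] norm_ge_zero[of "y b - y a"] by linarith
  have bd: "G t \<le> sum B I" for t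
    unfolding G_def by (intro sum_mono odd_ext_bounds) (use maj in auto)
  obtain g where g: "(\<lambda>n. G (real n)) \<longlonglongrightarrow> g" "\<And>n. G (real n) \<le> g"
    using incseq_convergent[of "\<lambda>n. G (real n)" "sum B I"] mono bd by (auto simp: incseq_def)
  have near: "\<exists>N. \<forall>a\<ge>real N. \<forall>b\<ge>a. norm (y b - y a) < e" if e: "e > 0" for e
  proof -
    obtain N where N: "G (real N) > g - e"
      using order_tendstoD(1)[OF g(1), of "g - e"] e by (auto simp: eventually_sequentially)
    have "norm (y b - y a) < e" if "a \<ge> real N" "b \<ge> a" for a b
    proof -
      have "G b \<le> G (real (nat \<lceil>b\<rceil>))" by (rule mono) (use that in linarith)+
      also have "\<dots> \<le> g" by (rule g(2))
      finally have "G b \<le> g" .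
      moreover have "G a \<ge> G (real N)" using that by (intro mono) auto
      moreover have "norm (y b - y a) \<le> G b - G a" using that by (intro yG) auto
      ultimately show ?thesis using N by linarith
    qed
    then show ?thesis by blast
  qed
  have "Cauchy (\<lambda>n. y (real n))"
  proof (rule CauchyI)
    fix e :: real assume "e > 0"
    then obtain N where N: "\<forall>a\<ge>real N. \<forall>b\<ge>a. norm (y b - y a) < e" using near by blast
    have "norm (y (real m) - y (real n)) < e" if "m \<ge> N" "n \<ge> N" for m n
    proof (cases "m \<le> n")
      case True
      then have "norm (y (real n) - y (real m)) < e" using that N by simp
      then show ?thesis by (simp add: norm_minus_commute)
    qed (use that N in simp)
    then show "\<exists>M. \<forall>m\<ge>M. \<forall>n\<ge>M. norm (y (real m) - y (real n)) < e" by blast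
  qed
  then obtain l where l: "(\<lambda>n. y (real n)) \<longlonglongrightarrow> l" using convergent_eq_Cauchy convergent_def by blast
  have "(y \<longlongrightarrow> l) at_top"
  proof (rule tendstoI)
    fix e :: real assume e: "e > 0"
    then obtain N where N: "\<forall>a\<ge>real N. \<forall>b\<ge>a. norm (y b - y a) < e / 2" using near[of "e/2"] by auto
    have "norm (l - y a) < e" if "a \<ge> real N" for a
    proof -
      have "norm (l - y a) \<le> e / 2"
      proof (rule tendsto_upperbound)
        show "((\<lambda>n. norm (y (real n) - y a)) \<longlongrightarrow> norm (l - y a)) sequentially"
          by (intro tendsto_intros l)
        show "\<forall>\<^sub>F n in sequentially. norm (y (real n) - y a) \<le> e / 2"
          unfolding eventually_sequentially
        proof (intro exI[of _ "nat \<lceil>a\<rceil>"] allI impI)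
          fix n assume "nat \<lceil>a\<rceil> \<le> n"
          then have "a \<le> real n" by linarith
          then show "norm (y (real n) - y a) \<le> e / 2" using N that by (auto intro: less_imp_le)
        qed
      qed auto
      then show ?thesis using e by linarith
    qed
    then show "\<forall>\<^sub>F x in at_top. dist (y x) l < e"
      unfolding eventually_at_top_linorder by (auto simp: dist_norm norm_minus_commute)
  qed
  then show ?thesis by blast
qed

text \<open>Half the length of a path from \<open>0\<close> to \<open>s\<close> for the density \<open>1 / sqrt (s * (s + d) * (s + d'))\<close>,
  written after the substitution \<open>s = y\<^sup>2\<close>, which removes the singularity at \<open>0\<close>.\<close>

definition arc_len :: "real \<Rightarrow> real \<Rightarrow> real \<Rightarrow> real" where
  "arc_len d d' s = integral {0..sqrt s} (\<lambda>y. 1 / sqrt ((y\<^sup>2 + d) * (y\<^sup>2 + d')))"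

lemma arc_len_0 [simp]: "arc_len d d' 0 = 0"
  by (simp add: arc_len_def)

lemma arc_len_integrand_continuous:
  assumes "d > 0" "d' > 0"
  shows "continuous_on A (\<lambda>y::real. 1 / sqrt ((y\<^sup>2 + d) * (y\<^sup>2 + d')))"
proof -
  have "(y\<^sup>2 + d) * (y\<^sup>2 + d') > 0" for y :: real
    using assms by (intro mult_pos_pos add_nonneg_pos) auto
  then have "sqrt ((y\<^sup>2 + d) * (y\<^sup>2 + d')) \<noteq> 0" for y :: real
    using less_imp_neq by (metis real_sqrt_eq_zero_cancel_iff)
  then show ?thesis by (intro continuous_intros) auto
qed

lemma arc_len_continuous:
  assumes "d > 0" "d' > 0"
  shows "continuous_on {0..} (arc_len d d')"
proof -
  let ?f = "\<lambda>y::real. 1 / sqrt ((y\<^sup>2 + d) * (y\<^sup>2 + d'))"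
  have "continuous (at s within {0..}) (arc_len d d')" if s: "s \<ge> 0" for s
  proof -
    have "continuous_on {0..sqrt (s + 1)} (\<lambda>x. integral {0..x} ?f)"
      by (intro indefinite_integral_continuous_1 integrable_continuous_interval arc_len_integrand_continuous assms)
    then have "continuous_on {0..s + 1} (arc_len d d')"
      unfolding arc_len_def by (rule continuous_on_compose2) (auto intro!: continuous_intros)
    then have "continuous (at s within {0..s + 1}) (arc_len d d')"
      using s by (simp add: continuous_on_eq_continuous_within)
    moreover have "at s within {0..s + 1} = at s within {0..}"
      by (rule at_within_nhd[of _ "{..<s+1}"]) (use s in auto)
    ultimately show ?thesis by simp
  qed
  then show ?thesis by (simp add: continuous_on_eq_continuous_within)
qed

lemma arc_len_deriv:
  assumes "d > 0" "d' > 0" "s > 0"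
  shows "(arc_len d d' has_real_derivative 1 / (2 * sqrt (s * (s + d) * (s + d')))) (at s)"
proof -
  let ?f = "\<lambda>y::real. 1 / sqrt ((y\<^sup>2 + d) * (y\<^sup>2 + d'))"
  have "((\<lambda>x. integral {0..x} ?f) has_real_derivative ?f (sqrt s)) (at (sqrt s) within {0..sqrt s + 1})"
    by (rule integral_has_real_derivative[OF arc_len_integrand_continuous[OF assms(1,2)]]) (use assms in auto)
  moreover have "at (sqrt s) within {0..sqrt s + 1} = at (sqrt s)"
    by (rule at_within_interior) (use assms in auto)
  ultimately have "((\<lambda>x. integral {0..x} ?f) has_real_derivative ?f (sqrt s)) (at (sqrt s))" by simp
  from DERIV_chain2[OF this DERIV_real_sqrt[OF assms(3)]]
  have "(arc_len d d' has_real_derivative ?f (sqrt s) * (inverse (sqrt s) / 2)) (at s)"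
    by (simp add: arc_len_def[abs_def])
  moreover have "?f (sqrt s) * (inverse (sqrt s) / 2) = 1 / (2 * sqrt (s * (s + d) * (s + d')))"
  proof -
    have "(sqrt s)\<^sup>2 = s" using assms by simp
    moreover have "inverse (sqrt s) / 2 = 1 / (2 * sqrt s)" using assms by (simp add: inverse_eq_divide)
    ultimately show ?thesis by (simp add: real_sqrt_mult mult_ac)
  qed
  ultimately show ?thesis by simp
qed

lemma arc_len_mono:
  assumes "d > 0" "d' > 0" "0 \<le> s" "s \<le> t"
  shows "arc_len d d' s \<le> arc_len d d' t"
  unfolding arc_len_def
  by (rule integral_subset_le)
     (use assms in \<open>auto intro!: integrable_continuous_interval arc_len_integrand_continuous
        mult_nonneg_nonneg add_nonneg_nonneg\<close>)

lemma arc_len_nonneg: "d > 0 \<Longrightarrow> d' > 0 \<Longrightarrow> 0 \<le> s \<Longrightarrow> 0 \<le> arc_len d d' s"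
  using arc_len_mono[of d d' 0 s] by simp

text \<open>Scaling both gaps by \<open>c\<close> divides the arc length by \<open>sqrt c\<close>.
  The factor \<open>c\<close> will be the part of a root gap that survives projection.\<close>

lemma arc_len_majorant:
  assumes "d > 0" "d' > 0" "c > 0" and B: "\<And>s. s \<ge> 0 \<Longrightarrow> arc_len d d' s \<le> B"
  shows "majorant (\<lambda>s. arc_len d d' (s / c) / sqrt c) (\<lambda>s. 1 / (2 * sqrt (s * (s + c * d) * (s + c * d')))) (B / sqrt c)"
  unfolding majorant_def
proof (intro conjI allI impI)
  show "continuous_on {0..} (\<lambda>s. arc_len d d' (s / c) / sqrt c)"
    using assms(1-3) by (intro continuous_intros continuous_on_compose2[OF arc_len_continuous]) auto
  fix s :: real assume s: "s > 0"
  have "(arc_len d d' has_real_derivative 1 / (2 * sqrt ((s / c) * (s / c + d) * (s / c + d')))) (at (s / c))"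
    using assms s by (intro arc_len_deriv) auto
  moreover have "((\<lambda>s. s / c) has_real_derivative 1 / c) (at s)" using assms(3) by (auto intro!: derivative_eq_intros)
  ultimately have "((\<lambda>s. arc_len d d' (s / c)) has_real_derivative
      1 / (2 * sqrt ((s / c) * (s / c + d) * (s / c + d'))) * (1 / c)) (at s)"
    by (rule DERIV_chain2[where g = "\<lambda>s. s / c"])
  from DERIV_cdivide[OF this, of "sqrt c"] have "((\<lambda>s. arc_len d d' (s / c) / sqrt c) has_real_derivative
      1 / (2 * sqrt ((s / c) * (s / c + d) * (s / c + d'))) * (1 / c) / sqrt c) (at s)" .
  moreover have "(s / c) * (s / c + d) * (s / c + d') = (s * (s + c * d) * (s + c * d')) / (c * c * c)"
    using assms by (simp add: field_simps)
  then have "sqrt ((s / c) * (s / c + d) * (s / c + d')) = sqrt (s * (s + c * d) * (s + c * d')) / (c * sqrt c)"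
    using assms by (simp add: real_sqrt_divide real_sqrt_mult)
  moreover
  have "1 / (2 * (y / (c * r))) * (1 / c) / r = 1 / (2 * y)" if "r > 0" for y r :: real
    using that assms by (simp add: field_simps)
  from this[of "sqrt c" "sqrt (s * (s + c * d) * (s + c * d'))"]
  have "1 / (2 * (sqrt (s * (s + c * d) * (s + c * d')) / (c * sqrt c))) * (1 / c) / sqrt c =
      1 / (2 * sqrt (s * (s + c * d) * (s + c * d')))" using assms by simp
  ultimately show "((\<lambda>s. arc_len d d' (s / c) / sqrt c) has_real_derivative 1 / (2 * sqrt (s * (s + c * d) * (s + c * d')))) (at s)"
    by (simp only:)
next
  fix s :: real assume "s \<ge> 0"
  then show "0 \<le> arc_len d d' (s / c) / sqrt c" "arc_len d d' (s / c) / sqrt c \<le> B / sqrt c"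
    using assms(1-3) B[of "s / c"] arc_len_nonneg[of d d' "s / c"] by (simp_all add: divide_right_mono)
qed simp

text \<open>The weights \<open>b * c / (a * b + b * c + c * a)\<close> and their cyclic shifts sum to \<open>1\<close>.\<close>

lemma three_term_inequality:
  fixes a b c :: real
  assumes pos: "a > 0" "b > 0" "c > 0" and gap: "0 < gab" "0 < gac" "0 < gbc" "gab \<le> a + b" "gac \<le> a + c" "gbc \<le> b + c"
  shows "1 / (2 * sqrt (a * b * c)) \<le> 1 / (2 * sqrt (a * (a + gab) * (a + gac))) +
     1 / (2 * sqrt (b * (b + gab) * (b + gbc))) + 1 / (2 * sqrt (c * (c + gac) * (c + gbc)))"
proof -
  have key: "y * z / (x * y + y * z + z * x) * (1 / (2 * sqrt (x * y * z))) \<le> 1 / (2 * sqrt (x * (x + g) * (x + g')))"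
    if p: "x > 0" "y > 0" "z > 0" "0 < g" "0 < g'" "g \<le> x + y" "g' \<le> x + z" for x y z g g' :: real
  proof -
    let ?\<sigma> = "x * y + y * z + z * x"
    have \<sigma>: "?\<sigma> > 0" using p by (intro add_pos_pos mult_pos_pos)
    have "(x + g) * (x + g') \<le> (2 * x + y) * (2 * x + z)"
      using p by (intro mult_mono) auto
    then have "y * z * ((x + g) * (x + g')) \<le> y * z * ((2 * x + y) * (2 * x + z))"
      using p by (intro mult_left_mono) auto
    \<comment> \<open>With the gaps replaced by their upper bounds \<open>x + y\<close> and
      \<open>x + z\<close>, the defect is a perfect square.\<close>
    also have "\<dots> = ?\<sigma>\<^sup>2 - (x * (y - z))\<^sup>2" by (simp add: power2_eq_square algebra_simps)
    also have "\<dots> \<le> ?\<sigma>\<^sup>2" by simp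
    finally have le: "y * z * ((x + g) * (x + g')) \<le> ?\<sigma>\<^sup>2" .
    have "(y * z)\<^sup>2 * (x * (x + g) * (x + g')) = (x * y * z) * (y * z * ((x + g) * (x + g')))"
      by (simp add: power2_eq_square)
    also have "\<dots> \<le> (x * y * z) * ?\<sigma>\<^sup>2" using le p by (intro mult_left_mono) auto
    finally have "sqrt ((y * z)\<^sup>2 * (x * (x + g) * (x + g'))) \<le> sqrt ((x * y * z) * ?\<sigma>\<^sup>2)"
      by (rule real_sqrt_le_mono)
    moreover have "sqrt ((y * z)\<^sup>2 * (x * (x + g) * (x + g'))) = y * z * sqrt (x * (x + g) * (x + g'))"
      using p by (simp add: real_sqrt_mult[of "(y * z)\<^sup>2"])
    moreover have "sqrt ((x * y * z) * ?\<sigma>\<^sup>2) = sqrt (x * y * z) * ?\<sigma>"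
      using \<sigma> by (simp only: real_sqrt_mult[of "x * y * z" "?\<sigma>\<^sup>2"] real_sqrt_abs abs_of_pos)
    ultimately have "y * z * sqrt (x * (x + g) * (x + g')) \<le> sqrt (x * y * z) * ?\<sigma>" by simp
    moreover have "sqrt (x * (x + g) * (x + g')) > 0" "sqrt (x * y * z) > 0" using p by simp_all
    moreover have "A / T * (1 / (2 * R)) \<le> 1 / (2 * X)" if "A * X \<le> R * T" "X > 0" "R > 0" "T > 0" for A X R T :: real
      using that by (simp add: field_simps)
    ultimately show ?thesis using \<sigma> by blast
  qed
  let ?\<sigma> = "a * b + b * c + c * a" let ?r = "1 / (2 * sqrt (a * b * c))"
  have \<sigma>: "?\<sigma> > 0" using pos by (intro add_pos_pos mult_pos_pos)
  have "b * c + c * a + a * b = ?\<sigma>" by simp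
  then have "(b * c + c * a + a * b) / ?\<sigma> = 1" using \<sigma> by (simp only: divide_self)
  then have "?r = (b * c + c * a + a * b) / ?\<sigma> * ?r" by (simp only: mult_1)
  also have "\<dots> = b * c / ?\<sigma> * ?r + c * a / ?\<sigma> * ?r + a * b / ?\<sigma> * ?r"
    by (simp only: add_divide_distrib distrib_right)
  also have "b * c / ?\<sigma> * ?r \<le> 1 / (2 * sqrt (a * (a + gab) * (a + gac)))"
    using key[of a b c gab gac] assms by simp
  also have "c * a / ?\<sigma> * ?r \<le> 1 / (2 * sqrt (b * (b + gab) * (b + gbc)))"
    using key[of b a c gab gbc] assms by (simp add: ac_simps)
  also have "a * b / ?\<sigma> * ?r \<le> 1 / (2 * sqrt (c * (c + gac) * (c + gbc)))"
    using key[of c a b gac gbc] assms by (simp add: ac_simps)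
  finally show ?thesis by simp
qed

lemma density_antimono:
  fixes a b c :: real
  assumes "0 < a" "0 < b" "0 < c" "a \<le> a'" "b \<le> b'" "c \<le> c'"
  shows "1 / (2 * sqrt (a' * b' * c')) \<le> 1 / (2 * sqrt (a * b * c))"
proof -
  have "a * b * c \<le> a' * b' * c'" using assms by (intro mult_mono) auto
  moreover have "0 < a * b * c" using assms by simp
  ultimately show ?thesis by (intro divide_left_mono) auto
qed

text \<open>The distance to a root is at least its projection to the line, and \<open>c\<close> is
  the part of each gap that the projection keeps. The product of three singular factors is then
  split by \<open>three_term_inequality\<close> into densities with one singularity each, which
  \<open>arc_len\<close> integrates.\<close>

lemma line_density_bound:
  fixes e1 e2 e3 w0 D :: complex
  assumes D: "cmod D = 1" and c: "c > 0"
    and gap: "\<bar>Re ((e1 - e2) * cnj D)\<bar> \<ge> c * cmod (e1 - e2)" "\<bar>Re ((e1 - e3) * cnj D)\<bar> \<ge> c * cmod (e1 - e3)"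
      "\<bar>Re ((e2 - e3) * cnj D)\<bar> \<ge> c * cmod (e2 - e3)"
    and ne: "e1 \<noteq> e2" "e1 \<noteq> e3" "e2 \<noteq> e3"
    and w: "w = w0 + of_real t * D"
    and c1: "c1 = Re ((e1 - w0) * cnj D)" and c2: "c2 = Re ((e2 - w0) * cnj D)" and c3: "c3 = Re ((e3 - w0) * cnj D)"
    and t: "t \<noteq> c1" "t \<noteq> c2" "t \<noteq> c3"
  shows "1 / (2 * sqrt (cmod (w - e1) * cmod (w - e2) * cmod (w - e3))) \<le>
    1 / (2 * sqrt (\<bar>t - c1\<bar> * (\<bar>t - c1\<bar> + c * cmod (e1 - e2)) * (\<bar>t - c1\<bar> + c * cmod (e1 - e3)))) +
    1 / (2 * sqrt (\<bar>t - c2\<bar> * (\<bar>t - c2\<bar> + c * cmod (e1 - e2)) * (\<bar>t - c2\<bar> + c * cmod (e2 - e3)))) +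
    1 / (2 * sqrt (\<bar>t - c3\<bar> * (\<bar>t - c3\<bar> + c * cmod (e1 - e3)) * (\<bar>t - c3\<bar> + c * cmod (e2 - e3))))"
proof -
  have DD: "D * cnj D = 1" using D by (simp add: complex_norm_square[symmetric])
  have proj: "\<bar>t - Re ((e - w0) * cnj D)\<bar> \<le> cmod (w - e)" for e
  proof -
    have "(w - e) * cnj D = of_real t * (D * cnj D) - (e - w0) * cnj D" unfolding w by (simp add: algebra_simps)
    then have "Re ((w - e) * cnj D) = t - Re ((e - w0) * cnj D)" by (simp add: DD)
    then have "\<bar>t - Re ((e - w0) * cnj D)\<bar> \<le> cmod ((w - e) * cnj D)" by (metis abs_Re_le_cmod)
    then show ?thesis using D by (simp add: norm_mult)
  qed
  have gap': "\<bar>Re ((e - w0) * cnj D) - Re ((e' - w0) * cnj D)\<bar> = \<bar>Re ((e - e') * cnj D)\<bar>" for e e'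
    by (simp add: algebra_simps)
  have tri: "\<bar>a - b\<bar> \<le> \<bar>s - a\<bar> + \<bar>s - b\<bar>" for a b s :: real by linarith
  have "1 / (2 * sqrt (cmod (w - e1) * cmod (w - e2) * cmod (w - e3))) \<le>
      1 / (2 * sqrt (\<bar>t - c1\<bar> * \<bar>t - c2\<bar> * \<bar>t - c3\<bar>))"
    by (rule density_antimono) (use t proj[of e1] proj[of e2] proj[of e3] in \<open>simp_all add: c1 c2 c3\<close>)
  also have "\<dots> \<le> 1 / (2 * sqrt (\<bar>t - c1\<bar> * (\<bar>t - c1\<bar> + c * cmod (e1 - e2)) * (\<bar>t - c1\<bar> + c * cmod (e1 - e3)))) +
    1 / (2 * sqrt (\<bar>t - c2\<bar> * (\<bar>t - c2\<bar> + c * cmod (e1 - e2)) * (\<bar>t - c2\<bar> + c * cmod (e2 - e3)))) +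
    1 / (2 * sqrt (\<bar>t - c3\<bar> * (\<bar>t - c3\<bar> + c * cmod (e1 - e3)) * (\<bar>t - c3\<bar> + c * cmod (e2 - e3))))"
  proof (rule three_term_inequality)
    show "c * cmod (e1 - e2) \<le> \<bar>t - c1\<bar> + \<bar>t - c2\<bar>" "c * cmod (e1 - e3) \<le> \<bar>t - c1\<bar> + \<bar>t - c3\<bar>"
      "c * cmod (e2 - e3) \<le> \<bar>t - c2\<bar> + \<bar>t - c3\<bar>"
      using gap' gap tri[of c1 c2 t] tri[of c1 c3 t] tri[of c2 c3 t] unfolding c1 c2 c3 by (metis order_trans)+
  qed (use t c ne in auto)
  finally show ?thesis .
qed

section \<open>Arc lengths bounded by half periods\<close>

context period_lattice
begin

definition primitive_period :: "complex \<Rightarrow> bool" where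
  "primitive_period p \<longleftrightarrow> p \<in> \<Omega> \<and> (\<forall>s. 0 < s \<and> s < 1 \<longrightarrow> of_real s * p \<notin> \<Omega>)"

text \<open>
  The image of the segment from \<open>0\<close> to \<open>p / 2\<close> runs from infinity to the root \<open>wp (p / 2)\<close>, and
  \<open>cmod p / 2\<close> is its length for the metric \<open>\<bar>dw\<bar> / sqrt \<bar>wp_poly w\<bar>\<close>.
\<close>

lemma arc_len_le_period:
  assumes p: "primitive_period p" and e: "wp (p / 2) = e1" and fac: "\<And>w. wp_poly w = 4 * (w - e1) * (w - e2) * (w - e3)"
    and ne: "e1 \<noteq> e2" "e1 \<noteq> e3" and s: "s \<ge> 0"
  shows "arc_len (cmod (e1 - e2)) (cmod (e1 - e3)) s \<le> cmod p / 2"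
proof -
  let ?d = "cmod (e1 - e2)" and ?d' = "cmod (e1 - e3)"
  have pO: "p \<in> \<Omega>" and tO: "of_real t * p \<notin> \<Omega>" if "0 < t" "t < 1" for t
    using p that by (auto simp: primitive_period_def)
  have half: "p / 2 \<notin> \<Omega>" using tO[of "1/2"] by simp
  have dhalf: "deriv wp (p / 2) = 0" using wp_deriv_zero_iff[OF half] pO[of "1/2"] by simp
  define z where "z = (\<lambda>t. wp (of_real t * p) - e1)"
  define f where "f = (\<lambda>t. arc_len ?d ?d' (cmod (z t)))"
  have zd: "(z has_vector_derivative p * deriv wp (of_real t * p)) (at t)" if "0 < t" "t < 1" for t
  proof -
    have "((\<lambda>t. of_real t * p) has_vector_derivative p) (at t)"
      by (auto intro!: derivative_eq_intros simp: has_vector_derivative_def scaleR_conv_of_real)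
    from field_vector_diff_chain_at[OF this wp_has_deriv[OF tO[OF that]]]
    have "((\<lambda>t. wp (of_real t * p)) has_vector_derivative p * deriv wp (of_real t * p)) (at t)" by (simp add: o_def)
    then show ?thesis unfolding z_def by (auto intro!: derivative_eq_intros)
  qed
  \<comment> \<open>Otherwise \<open>of_real t * p\<close> and \<open>p / 2\<close> would agree in
    value and in the vanishing derivative, and \<open>(1/2 - t) * p\<close> would be a
    period.\<close>
  have z0: "z t \<noteq> 0" if "0 < t" "t < 1/2" for t
  proof
    assume "z t = 0"
    then have eq: "wp (of_real t * p) = wp (p / 2)" by (simp add: z_def e)
    have t: "of_real t * p \<notin> \<Omega>" using that by (intro tO) auto
    have "(deriv wp (of_real t * p))\<^sup>2 = (deriv wp (p / 2))\<^sup>2" unfolding wp_ode[OF t] wp_ode[OF half] eq ..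
    then have "deriv wp (of_real t * p) = deriv wp (p / 2)" using dhalf by simp
    from wp_agree_imp_lattice[OF t half eq this] have "of_real (1/2 - t) * p \<in> \<Omega>" by (simp add: algebra_simps)
    then show False using tO[of "1/2 - t"] that by auto
  qed
  \<comment> \<open>By the triangle inequality the derivative of \<open>wp\<close> is at most
    \<open>2 * sqrt (r * (r + ?d) * (r + ?d'))\<close>, the inverse of the density of
    \<open>arc_len\<close>. So the speed of \<open>f\<close> is at most
    \<open>cmod p\<close>.\<close>
  have fd: "\<exists>f'. (f has_real_derivative f') (at t) \<and> \<bar>f'\<bar> \<le> cmod p" if t: "0 < t" "t < 1/2" for t
  proof -
    define r where "r = cmod (z t)"
    have r: "r > 0" using z0[OF t] by (simp add: r_def)
    define v where "v = p * deriv wp (of_real t * p)"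
    have "GDERIV norm (z t) :> sgn (z t)" by (rule GDERIV_norm[OF z0[OF t]])
    then have "(norm has_derivative (\<lambda>h. h \<bullet> sgn (z t))) (at (z t))" by (simp add: gderiv_def)
    moreover have "(z has_derivative (\<lambda>h. h *\<^sub>R v)) (at t)"
      using zd[of t] t unfolding v_def has_vector_derivative_def by simp
    ultimately have "((\<lambda>t. cmod (z t)) has_derivative (\<lambda>h. (h *\<^sub>R v) \<bullet> sgn (z t))) (at t)"
      using has_derivative_compose by fastforce
    then have "((\<lambda>t. cmod (z t)) has_real_derivative (v \<bullet> sgn (z t))) (at t)"
      by (simp add: has_field_derivative_def mult.commute[of _ "v \<bullet> sgn (z t)"])
    moreover have "(arc_len ?d ?d' has_real_derivative 1 / (2 * sqrt (r * (r + ?d) * (r + ?d')))) (at (cmod (z t)))"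
      using arc_len_deriv[of ?d ?d' r] ne r by (simp add: r_def)
    ultimately have "(f has_real_derivative 1 / (2 * sqrt (r * (r + ?d) * (r + ?d'))) * (v \<bullet> sgn (z t))) (at t)"
      unfolding f_def by (rule DERIV_chain2[rotated])
    moreover have "\<bar>v \<bullet> sgn (z t)\<bar> \<le> cmod v"
      using Cauchy_Schwarz_ineq2[of v "sgn (z t)"] z0[OF t] by (simp add: norm_sgn)
    moreover have "cmod v \<le> cmod p * (2 * sqrt (r * (r + ?d) * (r + ?d')))"
    proof -
      let ?w = "wp (of_real t * p)"
      have "(cmod (deriv wp (of_real t * p)))\<^sup>2 = 4 * (cmod (?w - e1) * cmod (?w - e2) * cmod (?w - e3))"
      proof -
        have "(deriv wp (of_real t * p))\<^sup>2 = 4 * ((?w - e1) * (?w - e2) * (?w - e3))"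
          using wp_ode[OF tO[of t]] t by (simp add: fac mult.assoc)
        then have "cmod ((deriv wp (of_real t * p))\<^sup>2) = cmod (4 * ((?w - e1) * (?w - e2) * (?w - e3)))" by (rule arg_cong)
        then show ?thesis by (simp only: norm_power norm_mult norm_numeral)
      qed
      also have "\<dots> \<le> 4 * (r * (r + ?d) * (r + ?d'))"
      proof -
        have "cmod (?w - e2) \<le> r + ?d" "cmod (?w - e3) \<le> r + ?d'"
          using norm_triangle_ineq[of "?w - e1" "e1 - e2"] norm_triangle_ineq[of "?w - e1" "e1 - e3"]
          by (simp_all add: r_def z_def)
        then show ?thesis by (intro mult_left_mono mult_mono) (auto simp: r_def z_def)
      qed
      finally have "cmod (deriv wp (of_real t * p)) \<le> sqrt (4 * (r * (r + ?d) * (r + ?d')))"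
        by (rule real_le_rsqrt)
      also have "\<dots> = 2 * sqrt (r * (r + ?d) * (r + ?d'))" by (simp add: real_sqrt_mult)
      finally show ?thesis unfolding v_def norm_mult by (intro mult_left_mono) auto
    qed
    moreover have "sqrt (r * (r + ?d) * (r + ?d')) > 0" using r by (simp add: add_pos_nonneg)
    ultimately show ?thesis
      by (intro exI[of _ "1 / (2 * sqrt (r * (r + ?d) * (r + ?d'))) * (v \<bullet> sgn (z t))"])
         (auto simp: abs_mult field_simps)
  qed
  have lip: "f t1 \<le> cmod p / 2 + f t2" if t: "0 < t1" "t1 < t2" "t2 < 1/2" for t1 t2
  proof -
    obtain f' where f': "\<And>t. 0 < t \<Longrightarrow> t < 1/2 \<Longrightarrow> (f has_real_derivative f' t) (at t) \<and> \<bar>f' t\<bar> \<le> cmod p"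
      using fd by metis
    obtain x where x: "t1 < x" "x < t2" "f t2 - f t1 = (t2 - t1) * f' x"
      using MVT2[OF t(2), of f f'] f' t by force
    have "\<bar>f t2 - f t1\<bar> = (t2 - t1) * \<bar>f' x\<bar>" using x t by (simp add: abs_mult)
    also have "\<dots> \<le> (1/2) * cmod p" using f'[of x] x t by (intro mult_mono) auto
    finally show ?thesis by linarith
  qed
  have flim: "(f \<longlongrightarrow> 0) (at_left (1/2))"
  proof -
    have "isCont z (1/2)" using has_vector_derivative_continuous[OF zd[of "1/2"]] by simp
    then have "(z \<longlongrightarrow> z (1/2)) (at_left (1/2))"
      unfolding isCont_def by (rule tendsto_within_subset) auto
    moreover have "z (1/2) = 0" by (simp add: z_def e)
    ultimately have "((\<lambda>t. cmod (z t)) \<longlongrightarrow> 0) (at_left (1/2))" by (metis tendsto_norm_zero)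
    then have "((\<lambda>t. cmod (z t)) \<longlongrightarrow> 0) (at_left (1/2)) \<and> (\<forall>\<^sub>F t in at_left (1/2). cmod (z t) \<in> {0..})" by simp
    then have "(f \<longlongrightarrow> arc_len ?d ?d' 0) (at_left (1/2))"
      unfolding f_def using continuous_on_tendsto_compose[OF arc_len_continuous] ne by (metis atLeast_iff norm_eq_zero norm_zero order_refl right_minus_eq zero_less_norm_iff)
    then show ?thesis by simp
  qed
  \<comment> \<open>The later parameter tends to \<open>1/2\<close>, where the path reaches the root
    and \<open>f\<close> tends to \<open>0\<close>.\<close>
  have fle: "f t1 \<le> cmod p / 2" if t: "0 < t1" "t1 < 1/2" for t1
  proof -
    have "((\<lambda>t. cmod p / 2 + f t) \<longlongrightarrow> cmod p / 2 + 0) (at_left (1/2))" by (intro tendsto_intros flim)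
    then have "f t1 \<le> cmod p / 2 + 0"
    proof (rule tendsto_lowerbound)
      have "\<forall>\<^sub>F t in at_left (1/2). t \<in> {t1<..<1/2}" using t(2) by (rule eventually_at_left_real)
      then show "\<forall>\<^sub>F t in at_left (1/2). f t1 \<le> cmod p / 2 + f t"
        by eventually_elim (use lip t in auto)
    qed (simp add: trivial_limit_at_left_real)
    then show ?thesis by simp
  qed
  \<comment> \<open>The pole at \<open>0\<close> takes the path arbitrarily far from
    \<open>e1\<close>, so every \<open>s\<close> is reached.\<close>
  have "\<exists>t. 0 < t \<and> t < 1/2 \<and> cmod (z t) \<ge> s"
  proof -
    have "p \<noteq> 0" using half by auto
    have "filterlim (\<lambda>t. of_real t * p) (at 0) (at_right (0::real))"
      unfolding filterlim_at using \<open>p \<noteq> 0\<close>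
      by (auto intro!: tendsto_eq_intros simp: eventually_at_right_field) (auto intro!: exI[of _ 1])
    then have "filterlim (\<lambda>t. wp (of_real t * p)) at_infinity (at_right (0::real))"
      by (rule filterlim_compose[OF wp_at_zero])
    then have "\<forall>\<^sub>F t in at_right 0. s + cmod e1 + 1 \<le> cmod (wp (of_real t * p))"
      using s by (subst (asm) filterlim_at_infinity[OF order_refl]) (auto simp: add_nonneg_pos)
    moreover have "\<forall>\<^sub>F t in at_right 0. t \<in> {0<..<1/2::real}" by (rule eventually_at_right_real) simp
    ultimately have "\<forall>\<^sub>F t in at_right 0. 0 < t \<and> t < 1/2 \<and> cmod (z t) \<ge> s"
    proof eventually_elim
      case (elim t)
      have "cmod (wp (of_real t * p)) \<le> cmod e1 + cmod (z t)" unfolding z_def by (rule norm_triangle_sub)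
      then show ?case using elim by auto
    qed
    then show ?thesis using eventually_happens trivial_limit_at_right_real by blast
  qed
  then obtain t where t: "0 < t" "t < 1/2" "cmod (z t) \<ge> s" by blast
  have "arc_len ?d ?d' s \<le> f t" unfolding f_def using ne s t by (intro arc_len_mono) auto
  then show ?thesis using fle[OF t(1,2)] by simp
qed

end

section \<open>Elementary majorants and explicit estimates of arc lengths\<close>

lemma majorant_sqrt:
  assumes "\<alpha> \<ge> 0" "g > 0"
  shows "majorant (\<lambda>s. 2 * \<alpha> / sqrt g * arctan (sqrt s / sqrt g)) (\<lambda>s. \<alpha> / (sqrt s * (s + g))) (\<alpha> * pi / sqrt g)"
  unfolding majorant_def
proof (intro conjI allI impI)
  show "continuous_on {0..} (\<lambda>s. 2 * \<alpha> / sqrt g * arctan (sqrt s / sqrt g))"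
    using assms by (intro continuous_intros) auto
  fix s :: real assume s: "s > 0"
  have "((\<lambda>s. 2 * \<alpha> / sqrt g * arctan (sqrt s / sqrt g)) has_real_derivative
      2 * \<alpha> / sqrt g * (inverse (1 + (sqrt s / sqrt g)\<^sup>2) * (inverse (sqrt s) / 2 / sqrt g))) (at s)"
    using s by (intro DERIV_cmult DERIV_chain2[OF DERIV_arctan] DERIV_cdivide DERIV_real_sqrt)
  moreover have "2 * \<alpha> / q * (inverse (1 + (p / q)\<^sup>2) * (inverse p / 2 / q)) = \<alpha> / (p * (p\<^sup>2 + q\<^sup>2))" if "p > 0" "q > 0" for p q :: real
  proof -
    have "p\<^sup>2 + q\<^sup>2 > 0" using that by (intro add_pos_pos) auto
    moreover have "1 + (p / q)\<^sup>2 = (p\<^sup>2 + q\<^sup>2) / q\<^sup>2" using that by (simp add: field_simps)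
    moreover have "2 * \<alpha> / q * (inverse (S / q\<^sup>2) * (inverse p / 2 / q)) = \<alpha> / (p * S)" if "S > 0" for S
      using that \<open>p > 0\<close> \<open>q > 0\<close> by (simp add: field_simps power2_eq_square)
    ultimately show ?thesis by simp
  qed
  from this[of "sqrt s" "sqrt g"]
  have "2 * \<alpha> / sqrt g * (inverse (1 + (sqrt s / sqrt g)\<^sup>2) * (inverse (sqrt s) / 2 / sqrt g)) = \<alpha> / (sqrt s * (s + g))"
    using s assms by simp
  ultimately show "((\<lambda>s. 2 * \<alpha> / sqrt g * arctan (sqrt s / sqrt g)) has_real_derivative \<alpha> / (sqrt s * (s + g))) (at s)"
    by (simp only:)
next
  fix s :: real assume s: "s \<ge> 0"
  have "0 \<le> arctan (sqrt s / sqrt g)" "arctan (sqrt s / sqrt g) \<le> pi / 2"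
    using s assms arctan_ubound[of "sqrt s / sqrt g"] by (auto intro: less_imp_le)
  then have "2 * \<alpha> / sqrt g * arctan (sqrt s / sqrt g) \<le> 2 * \<alpha> / sqrt g * (pi / 2)"
    "0 \<le> 2 * \<alpha> / sqrt g * arctan (sqrt s / sqrt g)"
    using assms by (intro mult_left_mono mult_nonneg_nonneg divide_nonneg_pos; simp)+
  then show "0 \<le> 2 * \<alpha> / sqrt g * arctan (sqrt s / sqrt g)"
    "2 * \<alpha> / sqrt g * arctan (sqrt s / sqrt g) \<le> \<alpha> * pi / sqrt g" by simp_all
qed simp

text \<open>For \<open>\<beta>\<close> proportional to \<open>g\<close> the bound is independent of
  \<open>g\<close>. This controls the change of argument along a line however close the line passes
  to the point.\<close>

lemma majorant_quadratic:
  assumes "\<beta> \<ge> 0" "g > 0"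
  shows "majorant (\<lambda>s. \<beta> / g * arctan (s / g)) (\<lambda>s. \<beta> / (s\<^sup>2 + g\<^sup>2)) (\<beta> * pi / (2 * g))"
  unfolding majorant_def
proof (intro conjI allI impI)
  show "continuous_on {0..} (\<lambda>s. \<beta> / g * arctan (s / g))"
    using assms by (intro continuous_intros) auto
  fix s :: real assume s: "s > 0"
  have "((\<lambda>s. \<beta> / g * arctan (s / g)) has_real_derivative \<beta> / g * (inverse (1 + (s / g)\<^sup>2) * (1 / g))) (at s)"
    by (intro DERIV_cmult DERIV_chain2[OF DERIV_arctan] DERIV_cdivide DERIV_ident)
  moreover have "\<beta> / g * (inverse (1 + (s / g)\<^sup>2) * (1 / g)) = \<beta> / (s\<^sup>2 + g\<^sup>2)"
  proof -
    have "s\<^sup>2 + g\<^sup>2 > 0" using s assms by (intro add_pos_pos) auto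
    moreover have "1 + (s / g)\<^sup>2 = (s\<^sup>2 + g\<^sup>2) / g\<^sup>2" using assms by (simp add: field_simps)
    ultimately show ?thesis using assms by (simp add: field_simps power2_eq_square)
  qed
  ultimately show "((\<lambda>s. \<beta> / g * arctan (s / g)) has_real_derivative \<beta> / (s\<^sup>2 + g\<^sup>2)) (at s)" by (simp only:)
next
  fix s :: real assume s: "s \<ge> 0"
  have "0 \<le> arctan (s / g)" "arctan (s / g) \<le> pi / 2"
    using s assms arctan_ubound[of "s / g"] by (auto intro: less_imp_le)
  then have "\<beta> / g * arctan (s / g) \<le> \<beta> / g * (pi / 2)" "0 \<le> \<beta> / g * arctan (s / g)"
    using assms by (intro mult_left_mono mult_nonneg_nonneg divide_nonneg_pos; simp)+
  then show "0 \<le> \<beta> / g * arctan (s / g)" "\<beta> / g * arctan (s / g) \<le> \<beta> * pi / (2 * g)" by (simp_all add: mult.commute)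
qed simp

text \<open>Since \<open>k \<ge> 1\<close>, the hypothesis gives
  \<open>y^2 + d'' \<le> k^2 * (y^2 + d')\<close>, so exchanging one gap costs the factor
  \<open>k\<close>.\<close>

lemma arc_len_le_scaled:
  assumes "d > 0" "0 < d''" "k > 0" "d'' \<le> k\<^sup>2 * d'" "k \<ge> 1" "s \<ge> 0"
  shows "arc_len d d' s \<le> k * arc_len d d'' s"
proof -
  have d': "d' > 0" using assms by (metis less_le_trans zero_less_mult_pos zero_less_power)
  have "arc_len d d' s \<le> integral {0..sqrt s} (\<lambda>y. k * (1 / sqrt ((y\<^sup>2 + d) * (y\<^sup>2 + d''))))"
    unfolding arc_len_def
  proof (rule integral_le)
    show "(\<lambda>y. 1 / sqrt ((y\<^sup>2 + d) * (y\<^sup>2 + d'))) integrable_on {0..sqrt s}"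
      by (intro integrable_continuous_interval arc_len_integrand_continuous assms d')
    show "(\<lambda>y. k * (1 / sqrt ((y\<^sup>2 + d) * (y\<^sup>2 + d'')))) integrable_on {0..sqrt s}"
      by (intro integrable_continuous_interval continuous_on_mult continuous_on_const arc_len_integrand_continuous assms)
    fix y assume "y \<in> {0..sqrt s}"
    have p: "0 < (y\<^sup>2 + d) * (y\<^sup>2 + d')" "0 < (y\<^sup>2 + d) * (y\<^sup>2 + d'')"
      using assms d' by (auto intro!: mult_pos_pos add_nonneg_pos)
    have "y\<^sup>2 * 1 \<le> y\<^sup>2 * k\<^sup>2" using assms by (intro mult_left_mono) (auto simp: one_le_power)
    then have "y\<^sup>2 + d'' \<le> k\<^sup>2 * (y\<^sup>2 + d')" using assms by (simp add: algebra_simps)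
    then have "(y\<^sup>2 + d) * (y\<^sup>2 + d'') \<le> (y\<^sup>2 + d) * (k\<^sup>2 * (y\<^sup>2 + d'))" using assms by (intro mult_left_mono) auto
    then have "sqrt ((y\<^sup>2 + d) * (y\<^sup>2 + d'')) \<le> sqrt (k\<^sup>2 * ((y\<^sup>2 + d) * (y\<^sup>2 + d')))"
      by (intro real_sqrt_le_mono) (simp add: mult_ac)
    also have "\<dots> = k * sqrt ((y\<^sup>2 + d) * (y\<^sup>2 + d'))" using assms by (simp add: real_sqrt_mult)
    finally have "sqrt ((y\<^sup>2 + d) * (y\<^sup>2 + d'')) \<le> k * sqrt ((y\<^sup>2 + d) * (y\<^sup>2 + d'))" .
    moreover have inv: "1 / X \<le> k * (1 / Y)" if "Y \<le> k * X" "X > 0" "Y > 0" for X Y :: real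
      using that by (simp add: field_simps)
    ultimately show "1 / sqrt ((y\<^sup>2 + d) * (y\<^sup>2 + d')) \<le> k * (1 / sqrt ((y\<^sup>2 + d) * (y\<^sup>2 + d'')))"
      using p by (intro inv) auto
  qed
  then show ?thesis unfolding arc_len_def by (simp only: integral_mult_right)
qed

lemma arc_len_commute: "arc_len d d' s = arc_len d' d s"
  by (simp add: arc_len_def mult.commute)

text \<open>Enlarging both gaps to \<open>D\<close> makes the integrand elementary. For growing
  \<open>x\<close> the left side tends to \<open>pi / (2 * sqrt D)\<close>, which bounds half a
  period from below.\<close>

lemma arc_len_ge_arctan:
  assumes "0 < d" "d \<le> D" "0 < d'" "d' \<le> D" "x \<ge> 0"
  shows "arctan (x / sqrt D) / sqrt D \<le> arc_len d d' (x\<^sup>2)"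
proof -
  have D: "D > 0" using assms by linarith
  have "((\<lambda>y. 1 / (y\<^sup>2 + D)) has_integral (arctan (x / sqrt D) / sqrt D - arctan (0 / sqrt D) / sqrt D)) {0..x}"
  proof (rule fundamental_theorem_of_calculus[OF assms(5)])
    fix y :: real
    have "((\<lambda>y. arctan (y / sqrt D) / sqrt D) has_real_derivative inverse (1 + (y / sqrt D)\<^sup>2) * (1 / sqrt D) / sqrt D) (at y within {0..x})"
      by (intro DERIV_cdivide DERIV_chain2[OF DERIV_arctan] DERIV_ident has_field_derivative_at_within)
    moreover have "inverse (1 + (y / sqrt D)\<^sup>2) * (1 / sqrt D) / sqrt D = 1 / (y\<^sup>2 + D)"
    proof -
      have "1 + (y / sqrt D)\<^sup>2 = (y\<^sup>2 + D) / D" using D by (simp add: power_divide field_simps)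
      moreover have "y\<^sup>2 + D > 0" using D by (intro add_nonneg_pos) auto
      moreover have "inverse (A / D) * (1 / r) / r = 1 / A" if "A > 0" "r > 0" "r * r = D" for A r
        using that D by (simp add: field_simps)
      from this[of "y\<^sup>2 + D" "sqrt D"]
      have "y\<^sup>2 + D > 0 \<Longrightarrow> inverse ((y\<^sup>2 + D) / D) * (1 / sqrt D) / sqrt D = 1 / (y\<^sup>2 + D)" using D by simp
      ultimately show ?thesis by simp
    qed
    ultimately show "((\<lambda>y. arctan (y / sqrt D) / sqrt D) has_vector_derivative 1 / (y\<^sup>2 + D)) (at y within {0..x})"
      by (simp add: has_real_derivative_iff_has_vector_derivative)
  qed
  then have I: "((\<lambda>y. 1 / (y\<^sup>2 + D)) has_integral (arctan (x / sqrt D) / sqrt D)) {0..x}" by simp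
  have "arctan (x / sqrt D) / sqrt D \<le> integral {0..x} (\<lambda>y. 1 / sqrt ((y\<^sup>2 + d) * (y\<^sup>2 + d')))"
  proof (rule has_integral_le[OF I integrable_integral])
    show "(\<lambda>y. 1 / sqrt ((y\<^sup>2 + d) * (y\<^sup>2 + d'))) integrable_on {0..x}"
      by (intro integrable_continuous_interval arc_len_integrand_continuous assms)
    fix y assume "y \<in> {0..x}"
    have p: "0 < (y\<^sup>2 + d) * (y\<^sup>2 + d')"
      using assms by (auto intro!: mult_pos_pos add_nonneg_pos)
    have "(y\<^sup>2 + d) * (y\<^sup>2 + d') \<le> (y\<^sup>2 + D) * (y\<^sup>2 + D)"
      using assms by (intro mult_mono) (auto intro: add_nonneg_nonneg)
    then have "sqrt ((y\<^sup>2 + d) * (y\<^sup>2 + d')) \<le> sqrt ((y\<^sup>2 + D) * (y\<^sup>2 + D))" by (rule real_sqrt_le_mono)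
    also have "\<dots> = y\<^sup>2 + D" using D by (simp add: abs_of_nonneg)
    finally show "1 / (y\<^sup>2 + D) \<le> 1 / sqrt ((y\<^sup>2 + d) * (y\<^sup>2 + d'))"
      using p by (intro divide_left_mono mult_pos_pos) (use D in \<open>auto intro: add_nonneg_pos\<close>)
  qed
  then show ?thesis using assms by (simp add: arc_len_def)
qed

text \<open>Up to \<open>sqrt D\<close> one has \<open>y^2 + d \<le> 2 * D\<close> and
  \<open>y^2 + d' \<le> (y + sqrt d')^2\<close>. The logarithm records the divergence for small
  \<open>d'\<close>: a period becomes long when its root has a close neighbour.\<close>

lemma arc_len_ge_ln:
  assumes "0 < d" "d \<le> D" "0 < d'"
  shows "ln (1 + sqrt D / sqrt d') / sqrt (2 * D) \<le> arc_len d d' D"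
proof -
  have D: "D > 0" using assms by linarith
  define q where "q = sqrt d'"
  have q: "q > 0" "q\<^sup>2 = d'" using assms by (auto simp: q_def)
  have "((\<lambda>y. 1 / ((y + q) * sqrt (2 * D))) has_integral (ln (sqrt D + q) / sqrt (2 * D) - ln (0 + q) / sqrt (2 * D))) {0..sqrt D}"
  proof (rule fundamental_theorem_of_calculus)
    fix y assume "y \<in> {0..sqrt D}"
    then have "y + q > 0" using q by simp
    then have "((\<lambda>y. ln (y + q)) has_real_derivative 1 / (y + q)) (at y)"
      using DERIV_ln_divide[of "y + q"] by (simp add: DERIV_shift)
    from has_field_derivative_at_within[OF DERIV_cdivide[OF this]]
    have "((\<lambda>y. ln (y + q) / sqrt (2 * D)) has_real_derivative 1 / (y + q) / sqrt (2 * D)) (at y within {0..sqrt D})" .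
    then show "((\<lambda>y. ln (y + q) / sqrt (2 * D)) has_vector_derivative 1 / ((y + q) * sqrt (2 * D))) (at y within {0..sqrt D})"
      by (simp add: has_real_derivative_iff_has_vector_derivative)
  qed (use D in simp)
  moreover have "ln (sqrt D + q) / sqrt (2 * D) - ln (0 + q) / sqrt (2 * D) = ln (1 + sqrt D / q) / sqrt (2 * D)"
  proof -
    have "1 + sqrt D / q = (sqrt D + q) / q" using q by (simp add: field_simps)
    moreover have "sqrt D + q > 0" using q D by (simp add: add_pos_pos)
    ultimately have "ln (1 + sqrt D / q) = ln (sqrt D + q) - ln q" using q by (simp only: ln_div) simp
    then show ?thesis by (simp add: diff_divide_distrib)
  qed
  ultimately have I: "((\<lambda>y. 1 / ((y + q) * sqrt (2 * D))) has_integral (ln (1 + sqrt D / q) / sqrt (2 * D))) {0..sqrt D}" by simp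
  have "ln (1 + sqrt D / q) / sqrt (2 * D) \<le> integral {0..sqrt D} (\<lambda>y. 1 / sqrt ((y\<^sup>2 + d) * (y\<^sup>2 + d')))"
  proof (rule has_integral_le[OF I integrable_integral])
    show "(\<lambda>y. 1 / sqrt ((y\<^sup>2 + d) * (y\<^sup>2 + d'))) integrable_on {0..sqrt D}"
      by (intro integrable_continuous_interval arc_len_integrand_continuous assms)
    fix y assume y: "y \<in> {0..sqrt D}"
    have p: "0 < (y\<^sup>2 + d) * (y\<^sup>2 + d')"
      using assms by (auto intro!: mult_pos_pos add_nonneg_pos)
    have "y\<^sup>2 \<le> (sqrt D)\<^sup>2" using y by (intro power_mono) auto
    then have "y\<^sup>2 + d \<le> 2 * D" using D assms by simp
    moreover have "y\<^sup>2 + d' \<le> (y + q)\<^sup>2" using y q by (simp add: power2_sum flip: q(2))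
    ultimately have "(y\<^sup>2 + d) * (y\<^sup>2 + d') \<le> (2 * D) * (y + q)\<^sup>2"
      using assms by (intro mult_mono) (auto intro: add_nonneg_nonneg)
    then have "sqrt ((y\<^sup>2 + d) * (y\<^sup>2 + d')) \<le> sqrt ((2 * D) * (y + q)\<^sup>2)" by (rule real_sqrt_le_mono)
    also have "\<dots> = (y + q) * sqrt (2 * D)" using y q by (simp add: real_sqrt_mult)
    finally show "1 / ((y + q) * sqrt (2 * D)) \<le> 1 / sqrt ((y\<^sup>2 + d) * (y\<^sup>2 + d'))"
      using p y q D by (intro divide_left_mono mult_pos_pos) auto
  qed
  then show ?thesis by (simp add: arc_len_def q_def)
qed

section \<open>Colliding roots: the vanishing period and the density near a close pair\<close>

lemma cosh_bound:
  fixes z :: complex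
  assumes "\<bar>Re z\<bar> \<le> 1"
  shows "cmod (cosh z) \<le> 3"
proof -
  have "cosh z = (exp z + exp (- z)) / 2" by (simp add: cosh_def scaleR_conv_of_real)
  then have "cmod (cosh z) = cmod (exp z + exp (- z)) / 2" by (simp only: norm_divide norm_numeral)
  also have "\<dots> \<le> (cmod (exp z) + cmod (exp (- z))) / 2"
    by (intro divide_right_mono norm_triangle_ineq) simp
  also have "\<dots> \<le> (exp 1 + exp 1) / 2"
    using assms by (intro divide_right_mono add_mono) (auto simp: norm_exp_eq_Re)
  finally show ?thesis using exp_le by simp
qed

text \<open>For \<open>r = csqrt g\<close> one has \<open>(1 - r) * (1 + r) = 1 - g\<close>, and
  \<open>Re r \<ge> 0\<close> makes the second factor at least 1 in modulus. Dividing by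
  \<open>cmod r \<ge> 9/10\<close> costs 10/9, rounded up to 3/2.\<close>

lemma inverse_csqrt_near_one:
  assumes "cmod (g - 1) \<le> 1 / 100"
  shows "g \<notin> \<real>\<^sub>\<le>\<^sub>0" "csqrt g \<noteq> 0" "cmod (1 / csqrt g - 1) \<le> 3 / 2 * cmod (g - 1)"
proof -
  have re: "Re g \<ge> 99 / 100" using abs_Re_le_cmod[of "g - 1"] assms by simp
  then show "g \<notin> \<real>\<^sub>\<le>\<^sub>0" by (auto simp: complex_nonpos_Reals_iff)
  show nz: "csqrt g \<noteq> 0" using re by auto
  have g: "cmod g \<ge> 99 / 100" using re complex_Re_le_cmod[of g] by linarith
  have "cmod (csqrt g) ^ 2 = cmod g" by (simp flip: norm_power)
  then have "cmod (csqrt g) \<ge> 9 / 10"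
    using g by (intro power2_le_imp_le[of "9/10"]) (auto simp: power2_eq_square)
  have "Re (csqrt g) \<ge> 0" using csqrt_principal[of g] by auto
  moreover have "Re (1 + csqrt g) = 1 + Re (csqrt g)" by (simp only: plus_complex.simps one_complex.simps)
  ultimately have "cmod (1 + csqrt g) \<ge> 1" using complex_Re_le_cmod[of "1 + csqrt g"] by linarith
  moreover have "(1 - csqrt g) * (1 + csqrt g) = 1 - g" by (simp add: algebra_simps flip: power2_eq_square)
  then have "cmod (1 - csqrt g) * cmod (1 + csqrt g) = cmod (1 - g)" by (metis norm_mult)
  moreover have "cmod (1 - csqrt g) * 1 \<le> cmod (1 - csqrt g) * cmod (1 + csqrt g)"
    using calculation(1) by (intro mult_left_mono) auto
  ultimately have "cmod (1 - csqrt g) \<le> cmod (g - 1)" by (simp add: norm_minus_commute)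
  moreover have "1 / csqrt g - 1 = (1 - csqrt g) / csqrt g" using nz by (simp add: field_simps)
  ultimately have "cmod (1 / csqrt g - 1) \<le> cmod (g - 1) / (9 / 10)"
    using \<open>cmod (csqrt g) \<ge> 9 / 10\<close> by (simp only: norm_divide) (rule frac_le, auto)
  moreover have "cmod (g - 1) / (9 / 10) = 10 / 9 * cmod (g - 1)" by simp
  moreover have "x \<le> 3 / 2 * c" if "x \<le> 10 / 9 * c" "0 \<le> c" for x c :: real using that by linarith
  ultimately show "cmod (1 / csqrt g - 1) \<le> 3 / 2 * cmod (g - 1)"
    by (metis norm_ge_zero)
qed

context period_lattice
begin

text \<open>
  When \<open>e2\<close> and \<open>e3\<close> are close, the parametrisation \<open>w = (e2 + e3) / 2 + (e2 - e3) / 2 * cosh \<theta>\<close>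
  absorbs both branch points, and the inverse of \<open>wp\<close> becomes a nearly linear function of \<open>\<theta>\<close> on
  a strip. Its increment over the period \<open>2 * pi * \<i>\<close> is the vanishing period of the pair.
\<close>

lemma vanishing_period:
  assumes fac: "\<And>w. wp_poly w = 4 * (w - e1) * (w - e2) * (w - e3)" and ne: "e1 \<noteq> e2" "e2 \<noteq> e3"
    and h: "h \<notin> \<Omega>" "wp h = e2" and close: "400 * cmod (e2 - e3) < cmod (e1 - e2)"
    and A0: "A0\<^sup>2 = 1 / (4 * (e2 - e1))"
  shows "\<exists>\<mu>\<in>\<Omega>. cmod (\<mu> - 2 * of_real pi * \<i> * A0) \<le> 2 * pi * (3 * cmod (e2 - e3) / cmod (e1 - e2)) * cmod A0"
proof -
  \<comment> \<open>On the strip \<open>cmod (cosh \<theta> - 1) \<le> 4\<close>, which gives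
    \<open>cmod (g \<theta> - 1) \<le> 2/3 * \<eta>\<close>; the factor 3/2 of
    \<open>inverse_csqrt_near_one\<close> completes this to \<open>\<eta>\<close>.\<close>
  define \<eta> where "\<eta> = 3 * cmod (e2 - e3) / cmod (e1 - e2)"
  define a where "a = (e2 - e3) / 2"
  define T where "T = {\<theta>::complex. -1 < Re \<theta> \<and> Re \<theta> < 1}"
  have To: "open T" unfolding T_def by (intro open_Collect_conj open_halfspace_Re_lt open_halfspace_Re_gt)
  have Tc: "convex T" unfolding T_def
    by (intro convex_Int[unfolded Int_def, of "{\<theta>. -1 < Re \<theta>}" "{\<theta>. Re \<theta> < 1}", simplified] convex_halfspace_Re_lt convex_halfspace_Re_gt)
  \<comment> \<open>The parametrisation written from \<open>e2\<close>: \<open>w 0 = e2\<close> and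
    \<open>w\<close> takes the value \<open>e3\<close> at \<open>\<theta> = pi * \<i>\<close>. The
    remaining factor is \<open>w \<theta> - e1 = (e2 - e1) * g \<theta>\<close> with
    \<open>g\<close> close to 1.\<close>
  define w where "w = (\<lambda>\<theta>. e2 + a * (cosh \<theta> - 1))"
  define g where "g = (\<lambda>\<theta>. 1 - a * (cosh \<theta> - 1) / (e1 - e2))"
  have gn: "cmod (g \<theta> - 1) \<le> 2 / 3 * \<eta>" and gs: "cmod (g \<theta> - 1) \<le> 1 / 100" if "\<theta> \<in> T" for \<theta>
  proof -
    have "\<bar>Re \<theta>\<bar> \<le> 1" using that unfolding T_def mem_Collect_eq by linarith
    then have "cmod (cosh \<theta> - 1) \<le> 4" using cosh_bound[of \<theta>] norm_triangle_ineq4[of "cosh \<theta>" 1] by simp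
    then have "cmod (a * (cosh \<theta> - 1)) \<le> cmod a * 4" unfolding norm_mult by (intro mult_left_mono) auto
    then have "cmod (a * (cosh \<theta> - 1)) \<le> 2 * cmod (e2 - e3)" by (simp add: a_def norm_divide)
    then have "cmod (g \<theta> - 1) \<le> 2 * cmod (e2 - e3) / cmod (e1 - e2)"
      by (simp add: g_def norm_divide divide_right_mono)
    then show 1: "cmod (g \<theta> - 1) \<le> 2 / 3 * \<eta>" by (simp add: \<eta>_def)
    have "\<eta> \<le> 3 / 400" using close ne by (simp add: \<eta>_def field_simps)
    with 1 show "cmod (g \<theta> - 1) \<le> 1 / 100" by linarith
  qed
  define U' where "U' = (\<lambda>\<theta>. A0 / csqrt (g \<theta>))"
  note gg = inverse_csqrt_near_one[OF gs]
  have ghol: "g holomorphic_on T" unfolding g_def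
    using ne by (intro holomorphic_intros) (auto simp: cosh_def scaleR_conv_of_real intro!: holomorphic_intros)
  have U'h: "U' holomorphic_on T"
    unfolding U'_def by (intro holomorphic_intros ghol holomorphic_on_csqrt) (use gg in auto)
  have A0nz: "A0 \<noteq> 0" using A0 ne by auto
  have U'near: "cmod (U' \<theta> - A0) \<le> \<eta> * cmod A0" if "\<theta> \<in> T" for \<theta>
  proof -
    have "U' \<theta> - A0 = A0 * (1 / csqrt (g \<theta>) - 1)" by (simp add: U'_def algebra_simps)
    then have "cmod (U' \<theta> - A0) = cmod A0 * cmod (1 / csqrt (g \<theta>) - 1)" by (simp only: norm_mult)
    also have "\<dots> \<le> cmod A0 * \<eta>" using gg(3)[OF that] gn[OF that] by (intro mult_left_mono) auto
    finally show ?thesis by (simp add: mult.commute)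
  qed
  have wd: "(w has_field_derivative a * sinh \<theta>) (at \<theta>)" for \<theta>
    unfolding w_def by (auto intro!: derivative_eq_intros)
  have dw: "deriv w \<theta> = a * sinh \<theta>" for \<theta> using wd by (rule DERIV_imp_deriv)
  have wh: "w holomorphic_on T" using wd To holomorphic_on_open by blast
  have ode: "(U' \<theta>)\<^sup>2 * wp_poly (w \<theta>) = (a * sinh \<theta>)\<^sup>2" if "\<theta> \<in> T" for \<theta>
  proof -
    have gnz: "g \<theta> \<noteq> 0" using gg(2)[OF that] by auto
    have 1: "w \<theta> - e1 = (e2 - e1) * g \<theta>" using ne by (simp add: w_def g_def field_simps)
    have 2: "(w \<theta> - e2) * (w \<theta> - e3) = (a * sinh \<theta>)\<^sup>2"
    proof -
      have "w \<theta> - e2 = a * (cosh \<theta> - 1)" "w \<theta> - e3 = a * (cosh \<theta> + 1)"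
        by (simp_all add: w_def a_def field_simps)
      then have "(w \<theta> - e2) * (w \<theta> - e3) = (a * (cosh \<theta> - 1)) * (a * (cosh \<theta> + 1))" by (simp only:)
      also have "\<dots> = a\<^sup>2 * ((cosh \<theta>)\<^sup>2 - 1)" by (simp add: power2_eq_square algebra_simps)
      finally have "(w \<theta> - e2) * (w \<theta> - e3) = a\<^sup>2 * ((cosh \<theta>)\<^sup>2 - 1)" .
      then show ?thesis by (simp add: cosh_square_eq power_mult_distrib)
    qed
    have "(U' \<theta>)\<^sup>2 * (4 * ((e2 - e1) * g \<theta>)) = 1"
      using gnz ne A0 by (simp add: U'_def power_divide)
    moreover have "wp_poly (w \<theta>) = (4 * ((e2 - e1) * g \<theta>)) * (a * sinh \<theta>)\<^sup>2"
      unfolding fac 1[symmetric] 2[symmetric] by (simp add: mult_ac)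
    ultimately show ?thesis by (metis mult.assoc mult_1)
  qed
  \<comment> \<open>The identity needs a starting point where \<open>deriv w\<close> is nonzero,
    which excludes \<open>\<theta> = 0\<close>. The open mapping theorem provides values of
    \<open>wp\<close> all around \<open>e2 = w 0\<close>, in particular at \<open>w \<theta>\<close>
    for small real \<open>\<theta> > 0\<close>.\<close>
  obtain \<theta>0 z0 where \<theta>0: "\<theta>0 \<in> T" "sinh \<theta>0 \<noteq> 0" and z0: "z0 \<notin> \<Omega>" "wp z0 = w \<theta>0"
  proof -
    have nc: "\<not> wp constant_on - \<Omega>"
    proof
      assume "wp constant_on - \<Omega>"
      then obtain k where k: "\<And>z. z \<in> - \<Omega> \<Longrightarrow> wp z = k" unfolding constant_on_def by blast
      have "wp half1 = wp half2" using k[of half1] k[of half2] halves_not_lattice by simp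
      then show False using roots_distinct by (simp add: root1_def root2_def)
    qed
    have im: "open (wp ` (- \<Omega>))"
      using open_mapping_thm[OF wp_holomorphic open_compl_lattice connected_compl_lattice open_compl_lattice order_refl nc] .
    have "e2 \<in> wp ` (- \<Omega>)" using h by blast
    then have "\<forall>\<^sub>F v in nhds e2. v \<in> wp ` (- \<Omega>)" using im eventually_nhds_in_open by blast
    moreover have "isCont w 0" using wd DERIV_isCont by blast
    then have "filterlim w (nhds e2) (at 0)" by (simp add: isCont_def w_def)
    ultimately have "\<forall>\<^sub>F \<theta> in at 0. w \<theta> \<in> wp ` (- \<Omega>)" by (rule eventually_compose_filterlim)
    then have "\<forall>\<^sub>F t in at_right (0::real). w (of_real t) \<in> wp ` (- \<Omega>)"
    proof (rule eventually_compose_filterlim)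
      show "filterlim complex_of_real (at 0) (at_right 0)"
        unfolding filterlim_at by (auto intro!: tendsto_eq_intros simp: eventually_at_right_field intro!: exI[of _ 1])
    qed
    moreover have "\<forall>\<^sub>F t in at_right 0. t \<in> {0<..<1::real}" by (rule eventually_at_right_real) simp
    ultimately have "\<forall>\<^sub>F t in at_right (0::real). w (of_real t) \<in> wp ` (- \<Omega>) \<and> t \<in> {0<..<1}" by (rule eventually_conj)
    then obtain t :: real where t: "w (of_real t) \<in> wp ` (- \<Omega>)" "0 < t" "t < 1"
      using eventually_happens trivial_limit_at_right_real by fastforce
    then obtain z where z: "z \<notin> \<Omega>" "wp z = w (of_real t)" by (metis ComplD imageE)
    have "sinh (complex_of_real t) = of_real (sinh t)" by (simp add: sinh_def scaleR_conv_of_real flip: exp_of_real of_real_minus)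
    then have "sinh (complex_of_real t) \<noteq> 0" using t by simp
    then show ?thesis using that[of "of_real t" z] t z by (auto simp: T_def)
  qed
  have "(deriv wp z0)\<^sup>2 * (U' \<theta>0)\<^sup>2 = (a * sinh \<theta>0)\<^sup>2"
    using ode[OF \<theta>0(1)] wp_ode[OF z0(1)] z0(2) by (simp add: mult.commute)
  then have "(deriv wp z0 * U' \<theta>0)\<^sup>2 = (a * sinh \<theta>0)\<^sup>2" by (simp add: power_mult_distrib)
  \<comment> \<open>At \<open>z0\<close> and \<open>- z0\<close> the derivatives of
    \<open>wp\<close> are opposite, so one of the two points has the sign required by
    \<open>U'\<close>.\<close>
  then have sgn: "deriv wp z0 * U' \<theta>0 = a * sinh \<theta>0 \<or> deriv wp (- z0) * U' \<theta>0 = a * sinh \<theta>0"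
    unfolding power2_eq_iff wp_deriv_minus[OF z0(1)] by auto
  then obtain z1 where z1: "z1 \<notin> \<Omega>" "wp z1 = w \<theta>0" "deriv wp z1 * U' \<theta>0 = a * sinh \<theta>0"
    using z0 by (metis lattice_uminus_iff wp_minus)
  have fd: "U' field_differentiable at x" if "x \<in> interior T - {}" for x
    using U'h To that holomorphic_on_imp_differentiable_at by (metis Diff_empty interior_open)
  have "\<exists>U. \<forall>x\<in>T. (U has_field_derivative U' x) (at x within T)"
  proof (rule holomorphic_convex_primitive[OF Tc finite.emptyI holomorphic_on_imp_continuous_on[OF U'h] fd])
    fix U assume "\<And>x. x \<in> T \<Longrightarrow> (U has_field_derivative U' x) (at x within T)"
    then show ?thesis by (intro exI[of _ U] ballI)
  qed
  then obtain U0 where U0: "\<And>x. x \<in> T \<Longrightarrow> (U0 has_field_derivative U' x) (at x)"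
    using at_within_open[OF _ To] by metis
  define U where "U = (\<lambda>x. U0 x + (z1 - U0 \<theta>0))"
  have Ud: "(U has_field_derivative U' x) (at x)" if "x \<in> T" for x
    using DERIV_add[OF U0[OF that] DERIV_const[of "z1 - U0 \<theta>0"]] by (simp add: U_def[abs_def])
  have dU: "deriv U x = U' x" if "x \<in> T" for x using Ud[OF that] by (rule DERIV_imp_deriv)
  have Uh: "U holomorphic_on T" using Ud To holomorphic_on_open by blast
  have id: "U \<theta> \<notin> \<Omega> \<and> wp (U \<theta>) = w \<theta>" if "\<theta> \<in> T" for \<theta>
  proof (rule wp_inverse_identity[OF convex_connected[OF Tc] To Uh wh _ \<theta>0(1) _ _ _ _ that])
    show "(deriv U x)\<^sup>2 * wp_poly (w x) = (deriv w x)\<^sup>2" if "x \<in> T" for x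
      using ode[OF that] that by (simp add: dU dw)
    show "deriv wp (U \<theta>0) * deriv U \<theta>0 = deriv w \<theta>0" using z1 \<theta>0 by (simp add: U_def dw dU[unfolded U_def])
    show "deriv w \<theta>0 \<noteq> 0" using \<theta>0 ne by (simp add: dw a_def)
  qed (use z1 in \<open>auto simp: U_def\<close>)
  \<comment> \<open>A full period of \<open>cosh\<close> and \<open>sinh\<close>: \<open>w\<close>
    and \<open>U'\<close> return to their values, so the increment of \<open>U\<close> is a lattice
    vector, while the nearly constant derivative fixes it up to a small error.\<close>
  define \<theta>1 where "\<theta>1 = \<theta>0 + 2 * of_real pi * \<i>"
  have \<theta>1: "\<theta>1 \<in> T" using \<theta>0(1) by (simp add: \<theta>1_def T_def)
  have "exp \<theta>1 = exp \<theta>0" by (simp add: \<theta>1_def exp_add)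
  moreover from this have "exp (- \<theta>1) = exp (- \<theta>0)" by (simp only: exp_minus)
  ultimately have per: "w \<theta>1 = w \<theta>0" "U' \<theta>1 = U' \<theta>0" "sinh \<theta>1 = sinh \<theta>0"
    by (simp_all add: w_def U'_def g_def cosh_def sinh_def)
  have chain: "deriv wp (U \<theta>) * U' \<theta> = a * sinh \<theta>" if \<theta>: "\<theta> \<in> T" for \<theta>
  proof -
    have "((\<lambda>\<theta>. wp (U \<theta>)) has_field_derivative deriv wp (U \<theta>) * U' \<theta>) (at \<theta>)"
      by (rule DERIV_chain2[OF wp_has_deriv Ud]) (use id \<theta> in auto)
    then have "(w has_field_derivative deriv wp (U \<theta>) * U' \<theta>) (at \<theta>)"
      by (rule has_field_derivative_transform_within_open[OF _ To \<theta>]) (use id in auto)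
    then show ?thesis using wd DERIV_unique by blast
  qed
  have "U' \<theta>0 \<noteq> 0" using gg(2)[OF \<theta>0(1)] A0nz by (simp add: U'_def)
  then have "deriv wp (U \<theta>0) = deriv wp (U \<theta>1)"
    using chain[OF \<theta>0(1)] chain[OF \<theta>1] per by (metis mult_cancel_right)
  then have mu: "U \<theta>1 - U \<theta>0 \<in> \<Omega>"
    using id[OF \<theta>0(1)] id[OF \<theta>1] per by (intro wp_agree_imp_lattice) auto
  have "cmod ((U \<theta>1 - A0 * \<theta>1) - (U \<theta>0 - A0 * \<theta>0)) \<le> (\<eta> * cmod A0) * cmod (\<theta>1 - \<theta>0)"
  proof (rule field_differentiable_bound[OF Tc _ _ \<theta>1 \<theta>0(1)])
    show "((\<lambda>x. U x - A0 * x) has_field_derivative U' x - A0) (at x within T)" if "x \<in> T" for x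
      using DERIV_diff[OF Ud[OF that] DERIV_cmult_Id[of A0]] by (rule has_field_derivative_at_within)
  qed (rule U'near)
  moreover have "(U \<theta>1 - A0 * \<theta>1) - (U \<theta>0 - A0 * \<theta>0) = (U \<theta>1 - U \<theta>0) - 2 * of_real pi * \<i> * A0"
    by (simp add: \<theta>1_def algebra_simps)
  moreover have "cmod (\<theta>1 - \<theta>0) = 2 * pi" by (simp add: \<theta>1_def norm_mult)
  ultimately have "cmod ((U \<theta>1 - U \<theta>0) - 2 * of_real pi * \<i> * A0) \<le> 2 * pi * \<eta> * cmod A0" by (simp add: mult_ac)
  then show ?thesis using mu unfolding \<eta>_def by blast
qed

end

text \<open>
  Near the close pair the crude bound on \<open>v\<close> is integrable, far from it as well; in between \<open>v\<close> is
  \<open>A0 / (w - e2)\<close> up to sign and small errors, and the real part of \<open>v / \<omega>1\<close> only sees the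
  change of argument of \<open>w - e2\<close>.
\<close>

lemma degenerate_density:
  fixes w v e1 e2 e3 D0 A0 p :: complex
  defines "\<delta> \<equiv> cmod (e2 - e3)" and "D \<equiv> cmod (e1 - e2)"
  assumes D0: "cmod D0 = 1" and v: "v\<^sup>2 * (4 * (w - e1) * (w - e2) * (w - e3)) = D0\<^sup>2"
    and \<delta>: "\<delta> > 0" "400 * \<delta> < D" and A0: "A0\<^sup>2 = 1 / (4 * (e2 - e1))"
    and p: "cmod p \<ge> pi / sqrt D" "cmod (p - 2 * of_real pi * \<i> * A0) \<le> 2 * pi * (3 * \<delta> / D) * cmod A0"
    and s: "s1 > 0" "s2 > 0" "s3 > 0" "s1 \<le> cmod (w - e1)" "s2 \<le> cmod (w - e2)" "s3 \<le> cmod (w - e3)"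
    and gap: "s2 + s3 \<ge> 7 / 20 * \<delta>"
    and x: "x = Im ((w - e2) * cnj D0)" "(cmod (w - e2))\<^sup>2 = s2\<^sup>2 + x\<^sup>2"
  shows "\<bar>Re (v / p)\<bar> \<le> 3 * sqrt \<delta> / (sqrt s2 * (s2 + \<delta>)) + 3 * sqrt \<delta> / (sqrt s3 * (s3 + \<delta>))
    + 2 * sqrt D / (sqrt s1 * (s1 + D)) + (\<bar>x\<bar> / 6) / (s2\<^sup>2 + \<bar>x\<bar>\<^sup>2)
    + (16 / 25 * \<delta>) / (s2\<^sup>2 + (5 * \<delta>)\<^sup>2) + (2 / 5 * D) / (s2\<^sup>2 + D\<^sup>2)"
    (is "_ \<le> ?A2 + ?A3 + ?A1 + ?X + ?Y + ?Z")
proof -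
  define \<rho>1 \<rho>2 \<rho>3 where "\<rho>1 = cmod (w - e1)" and "\<rho>2 = cmod (w - e2)" and "\<rho>3 = cmod (w - e3)"
  have \<rho>: "s1 \<le> \<rho>1" "s2 \<le> \<rho>2" "s3 \<le> \<rho>3" "\<rho>1 > 0" "\<rho>2 > 0" "\<rho>3 > 0" using s by (auto simp: \<rho>1_def \<rho>2_def \<rho>3_def)
  have D: "D > 0" using \<delta> by linarith
  have pos: "0 \<le> ?A2" "0 \<le> ?A3" "0 \<le> ?A1" "0 \<le> ?X" "0 \<le> ?Y" "0 \<le> ?Z" using s \<delta> D by auto
  have p0: "cmod p > 0" using p(1) D by (metis divide_pos_pos less_le_trans pi_gt_zero real_sqrt_gt_zero)
  have V2: "(cmod v)\<^sup>2 * (4 * \<rho>1 * \<rho>2 * \<rho>3) = 1"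
  proof -
    have "cmod (v\<^sup>2 * (4 * (w - e1) * (w - e2) * (w - e3))) = cmod (D0\<^sup>2)" using v by simp
    then show ?thesis using D0 by (simp only: norm_mult norm_power norm_numeral \<rho>1_def \<rho>2_def \<rho>3_def power_one)
  qed
  have W2: "1 / (cmod p)\<^sup>2 \<le> D / 9"
  proof -
    have "(pi / sqrt D)\<^sup>2 \<le> (cmod p)\<^sup>2" using p(1) D by (intro power_mono) auto
    then have "pi\<^sup>2 / D \<le> (cmod p)\<^sup>2" using D by (simp add: power_divide)
    moreover have "9 \<le> pi\<^sup>2" using pi_gt3 power_mono[of 3 pi 2] by simp
    then have "9 / D \<le> pi\<^sup>2 / D" using D by (intro divide_right_mono) auto
    ultimately have "9 / D \<le> (cmod p)\<^sup>2" by linarith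
    then show ?thesis using D p0 by (simp add: field_simps)
  qed
  have VW: "(cmod (v / p))\<^sup>2 \<le> D / (36 * (\<rho>1 * \<rho>2 * \<rho>3))"
  proof -
    have "(cmod v)\<^sup>2 = 1 / (4 * \<rho>1 * \<rho>2 * \<rho>3)" using V2 \<rho> by (simp add: field_simps)
    then have "(cmod (v / p))\<^sup>2 = 1 / (4 * \<rho>1 * \<rho>2 * \<rho>3) * (1 / (cmod p)\<^sup>2)" by (simp add: norm_divide power_divide)
    also have "\<dots> \<le> 1 / (4 * \<rho>1 * \<rho>2 * \<rho>3) * (D / 9)" using W2 \<rho> by (intro mult_left_mono) auto
    finally show ?thesis by (simp add: mult_ac)
  qed
  \<comment> \<open>Outside the middle zone squared moduli are compared, and only the lower bound
    \<open>q\<close> for the product of the three distances changes.\<close>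
  have crude: "\<bar>Re (v / p)\<bar> \<le> M"
    if "q \<le> \<rho>1 * (\<rho>2 * \<rho>3)" "q > 0" "D / (36 * q) \<le> M\<^sup>2" "M \<ge> 0" for M q
  proof -
    have "q \<le> \<rho>1 * \<rho>2 * \<rho>3" using that(1) by (simp add: mult.assoc)
    then have "D / (36 * (\<rho>1 * \<rho>2 * \<rho>3)) \<le> D / (36 * q)" using D that(2) \<rho> by (intro divide_left_mono) auto
    then have "(cmod (v / p))\<^sup>2 \<le> M\<^sup>2" using VW that(3) by linarith
    then have "cmod (v / p) \<le> M" using that(4) by (rule power2_le_imp_le)
    then show ?thesis using abs_Re_le_cmod order_trans by blast
  qed
  have tri1: "\<rho>1 \<ge> D - \<rho>2" "\<rho>1 \<le> \<rho>2 + D" and tri3: "\<rho>3 \<le> \<rho>2 + \<delta>" "\<rho>3 \<ge> \<rho>2 - \<delta>"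
    using norm_triangle_ineq4[of "w - e2" "w - e1"] norm_triangle_ineq[of "w - e2" "e2 - e1"]
      norm_triangle_ineq[of "w - e2" "e2 - e3"] norm_triangle_ineq4[of "w - e3" "e2 - e3"]
    unfolding \<rho>1_def \<rho>2_def \<rho>3_def \<delta>_def D_def by (simp_all add: norm_minus_commute)
  \<comment> \<open>Close to the pair, with the smaller projected distance deciding which root
    carries the singularity; far away; and in between. The bounds \<open>5 * \<delta>\<close> and
    \<open>D / 5\<close> keep the quotients \<open>X\<close> and \<open>Y\<close> of the last case
    below 1/5.\<close>
  consider "\<rho>2 \<le> 5 * \<delta>" "s2 \<le> s3" | "\<rho>2 \<le> 5 * \<delta>" "s3 \<le> s2" | "\<rho>2 \<ge> D / 5" | "\<rho>2 \<ge> 5 * \<delta>" "\<rho>2 \<le> D / 5" by linarith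
  then show ?thesis
  proof cases
    case 1
    \<comment> \<open>Here \<open>5 * \<delta> < D / 80\<close>, and the larger of \<open>s2\<close>
      and \<open>s3\<close> is at least half of the gap \<open>7/20 * \<delta>\<close>.\<close>
    have "\<rho>1 \<ge> 79 / 80 * D" using tri1 1 \<delta> by linarith
    have a: "79 / 80 * D * (s2 * (7 / 40 * \<delta>)) \<le> \<rho>1 * (\<rho>2 * \<rho>3)"
      using \<open>\<rho>1 \<ge> 79 / 80 * D\<close> \<rho> gap 1 s \<delta> D by (intro mult_mono) auto
    have b: "(3 * sqrt \<delta> / (sqrt s2 * (6 * \<delta>)))\<^sup>2 = 1 / (4 * s2 * \<delta>)"
      using s \<delta> by (simp add: power_divide power_mult_distrib) (simp add: field_simps power2_eq_square)
    have c: "D / (36 * (79 / 80 * D * (s2 * (7 / 40 * \<delta>)))) \<le> 1 / (4 * s2 * \<delta>)"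
      using D s \<delta> by (simp add: field_simps)
    have "3 * sqrt \<delta> / (sqrt s2 * (6 * \<delta>)) \<le> ?A2"
      using s \<delta> \<rho> 1 by (intro divide_left_mono mult_left_mono mult_pos_pos) auto
    moreover have "\<bar>Re (v / p)\<bar> \<le> 3 * sqrt \<delta> / (sqrt s2 * (6 * \<delta>))"
    proof (rule crude[OF a])
      show "0 < 79 / 80 * D * (s2 * (7 / 40 * \<delta>))" using s \<delta> D by simp
      show "D / (36 * (79 / 80 * D * (s2 * (7 / 40 * \<delta>)))) \<le> (3 * sqrt \<delta> / (sqrt s2 * (6 * \<delta>)))\<^sup>2"
        unfolding b by (rule c)
    qed (use s \<delta> in auto)
    ultimately show ?thesis using pos by linarith
  next
    case 2
    have "\<rho>1 \<ge> 79 / 80 * D" using tri1 2 \<delta> by linarith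
    have "79 / 80 * D * (s3 * (7 / 40 * \<delta>)) \<le> \<rho>1 * (\<rho>3 * \<rho>2)"
      using \<open>\<rho>1 \<ge> 79 / 80 * D\<close> \<rho> gap 2 s \<delta> D by (intro mult_mono) auto
    then have a: "79 / 80 * D * (s3 * (7 / 40 * \<delta>)) \<le> \<rho>1 * (\<rho>2 * \<rho>3)" by (simp add: mult.commute[of \<rho>3])
    have b: "(3 * sqrt \<delta> / (sqrt s3 * (7 * \<delta>)))\<^sup>2 = 9 / (49 * s3 * \<delta>)"
      using s \<delta> by (simp add: power_divide power_mult_distrib) (simp add: field_simps power2_eq_square)
    have c: "D / (36 * (79 / 80 * D * (s3 * (7 / 40 * \<delta>)))) \<le> 9 / (49 * s3 * \<delta>)"
      using D s \<delta> by (simp add: field_simps)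
    have "s3 \<le> 6 * \<delta>" using \<rho> tri3 2 by linarith
    then have "3 * sqrt \<delta> / (sqrt s3 * (7 * \<delta>)) \<le> ?A3"
      using s \<delta> by (intro divide_left_mono mult_left_mono mult_pos_pos) auto
    moreover have "\<bar>Re (v / p)\<bar> \<le> 3 * sqrt \<delta> / (sqrt s3 * (7 * \<delta>))"
    proof (rule crude[OF a])
      show "0 < 79 / 80 * D * (s3 * (7 / 40 * \<delta>))" using s \<delta> D by simp
      show "D / (36 * (79 / 80 * D * (s3 * (7 / 40 * \<delta>)))) \<le> (3 * sqrt \<delta> / (sqrt s3 * (7 * \<delta>)))\<^sup>2"
        unfolding b by (rule c)
    qed (use s \<delta> in auto)
    ultimately show ?thesis using pos by linarith
  next
    case 3
    \<comment> \<open>Since \<open>D \<le> 5 * \<rho>2\<close>, the distance \<open>\<rho>2\<close>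
      can be traded for \<open>(\<rho>1 + D) / 11\<close>, which gives a density centred at
      \<open>e1\<close>.\<close>
    have "5 * \<rho>2 \<ge> D" using 3 by simp
    then have "\<rho>1 + D \<le> 11 * \<rho>2" using tri1 by linarith
    then have "(\<rho>1 + D) / 11 \<le> \<rho>2" by simp
    moreover have "49 / 50 * \<rho>2 \<le> \<rho>3" using tri3 3 \<delta> by linarith
    moreover have "(\<rho>1 + D) / 11 \<ge> 0" using \<rho> D by simp
    ultimately have a: "\<rho>1 * ((\<rho>1 + D) / 11 * (49 / 50 * ((\<rho>1 + D) / 11))) \<le> \<rho>1 * (\<rho>2 * \<rho>3)"
      using \<rho> by (intro mult_left_mono mult_mono) auto
    have b: "(2 * sqrt D / (sqrt \<rho>1 * (\<rho>1 + D)))\<^sup>2 = 4 * D / (\<rho>1 * (\<rho>1 + D)\<^sup>2)"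
      using \<rho> D by (simp add: power_divide power_mult_distrib)
    have c: "D / (36 * (\<rho>1 * ((\<rho>1 + D) / 11 * (49 / 50 * ((\<rho>1 + D) / 11))))) \<le> 4 * D / (\<rho>1 * (\<rho>1 + D)\<^sup>2)"
    proof -
      have "D / (36 * (\<rho>1 * ((\<rho>1 + D) / 11 * (49 / 50 * ((\<rho>1 + D) / 11))))) = (6050 / 1764) * (D / (\<rho>1 * (\<rho>1 + D)\<^sup>2))"
      proof -
        have "D / (36 * (r * (S / 11 * (49 / 50 * (S / 11))))) = (6050 / 1764) * (D / (r * S\<^sup>2))" for r S :: real
          by (simp add: power2_eq_square mult_ac)
        then show ?thesis .
      qed
      also have "\<dots> \<le> 4 * (D / (\<rho>1 * (\<rho>1 + D)\<^sup>2))" using D \<rho> by (intro mult_right_mono) auto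
      finally show ?thesis by simp
    qed
    have "2 * sqrt D / (sqrt \<rho>1 * (\<rho>1 + D)) \<le> ?A1"
      using s D \<rho> by (intro divide_left_mono mult_mono mult_pos_pos) (auto simp: add_pos_pos)
    moreover have "\<bar>Re (v / p)\<bar> \<le> 2 * sqrt D / (sqrt \<rho>1 * (\<rho>1 + D))"
    proof (rule crude[OF a])
      show "0 < \<rho>1 * ((\<rho>1 + D) / 11 * (49 / 50 * ((\<rho>1 + D) / 11)))"
        using \<rho> D by (intro mult_pos_pos divide_pos_pos add_pos_pos) auto
      show "D / (36 * (\<rho>1 * ((\<rho>1 + D) / 11 * (49 / 50 * ((\<rho>1 + D) / 11))))) \<le> (2 * sqrt D / (sqrt \<rho>1 * (\<rho>1 + D)))\<^sup>2"
        unfolding b by (rule c)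
    qed (use \<rho> D in auto)
    ultimately show ?thesis using pos by linarith
  next
    case 4
    have w2: "w - e2 \<noteq> 0" "w - e1 \<noteq> 0" "w - e3 \<noteq> 0" using \<rho> by (auto simp: \<rho>1_def \<rho>2_def \<rho>3_def)
    have e12: "e1 - e2 \<noteq> 0" "e2 - e1 \<noteq> 0" using D by (auto simp: D_def)
    have D0nz: "D0 \<noteq> 0" using D0 by auto
    have A0nz: "A0 \<noteq> 0" using A0 e12 by auto
    have pnz: "p \<noteq> 0" using p0 by auto
    define X where "X = (e3 - e2) / (w - e2)"
    define Y where "Y = (w - e2) / (e1 - e2)"
    \<comment> \<open>The quotient of \<open>v\<close> by the model
      \<open>A0 * D0 / (w - e2)\<close>; its square is
      \<open>1 / ((1 - X) * (1 - Y))\<close>.\<close>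
    define r where "r = v * (w - e2) / (A0 * D0)"
    have X: "cmod X = \<delta> / \<rho>2" by (simp add: X_def norm_divide \<delta>_def \<rho>2_def norm_minus_commute)
    have Y: "cmod Y = \<rho>2 / D" by (simp add: Y_def norm_divide D_def \<rho>2_def)
    have X5: "cmod X \<le> 1 / 5" unfolding X using 4 \<rho> by (simp add: field_simps)
    have Y5: "cmod Y \<le> 1 / 5" unfolding Y using 4 D by (simp add: field_simps)
    have r2: "r\<^sup>2 * ((1 - X) * (1 - Y)) = 1"
    proof -
      have a: "1 - X = (w - e3) / (w - e2)" using w2 by (simp add: X_def field_simps)
      have b: "1 - Y = (w - e1) / (e2 - e1)" using e12 by (simp add: Y_def field_simps)
      have "r\<^sup>2 = v\<^sup>2 * (w - e2)\<^sup>2 * (4 * (e2 - e1)) / D0\<^sup>2"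
        using e12 by (simp add: r_def power_divide power_mult_distrib A0)
      then have "r\<^sup>2 * ((1 - X) * (1 - Y)) = (v\<^sup>2 * (4 * (w - e1) * (w - e2) * (w - e3))) / D0\<^sup>2"
      proof -
        have gen: "V * q\<^sup>2 * (4 * m) / E * ((p3 / q) * (p1 / m)) = (V * (4 * p1 * q * p3)) / E"
          if "q \<noteq> 0" "m \<noteq> 0" for V q m E p1 p3 :: complex
          using that by (simp add: power2_eq_square)
        show ?thesis if "r\<^sup>2 = v\<^sup>2 * (w - e2)\<^sup>2 * (4 * (e2 - e1)) / D0\<^sup>2"
          unfolding a b that using w2 e12 by (intro gen) auto
      qed
      then show ?thesis using v D0nz by simp
    qed
    have ge: "cmod ((1 - X) * (1 - Y)) \<ge> 16 / 25"
    proof -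
      have "4 / 5 \<le> cmod (1 - X)" "4 / 5 \<le> cmod (1 - Y)"
        using norm_triangle_ineq2[of 1 X] norm_triangle_ineq2[of 1 Y] X5 Y5 by auto
      then have "4 / 5 * (4 / 5) \<le> cmod (1 - X) * cmod (1 - Y)" by (intro mult_mono) auto
      then show ?thesis by (simp add: norm_mult)
    qed
    have r21: "cmod (r\<^sup>2 - 1) \<le> 15 / 8 * cmod X + 25 / 16 * cmod Y"
    proof -
      have "(r\<^sup>2 - 1) * ((1 - X) * (1 - Y)) = X + Y - X * Y" using r2 by (simp add: algebra_simps)
      then have "cmod (r\<^sup>2 - 1) * cmod ((1 - X) * (1 - Y)) = cmod (X + Y - X * Y)" by (metis norm_mult)
      also have "\<dots> \<le> cmod X + cmod Y + cmod X * cmod Y"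
        using norm_triangle_ineq4[of "X + Y" "X * Y"] norm_triangle_ineq[of X Y] by (simp add: norm_mult)
      also have "\<dots> \<le> cmod X + cmod Y + cmod X * (1 / 5)" using Y5 by (intro add_left_mono mult_left_mono) auto
      finally have "cmod (r\<^sup>2 - 1) * cmod ((1 - X) * (1 - Y)) \<le> 6 / 5 * cmod X + cmod Y" by simp
      moreover have "cmod (r\<^sup>2 - 1) * (16 / 25) \<le> cmod (r\<^sup>2 - 1) * cmod ((1 - X) * (1 - Y))"
        using ge by (intro mult_left_mono) auto
      ultimately show ?thesis by simp
    qed
    \<comment> \<open>With \<open>Re (\<sigma> * r) \<ge> 0\<close> the factor
      \<open>r + \<sigma>\<close> has modulus at least 1, so \<open>r - \<sigma>\<close> inherits
      the bound on \<open>r^2 - 1\<close>.\<close>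
    obtain \<sigma> :: complex where \<sigma>: "\<sigma> = 1 \<or> \<sigma> = - 1" "Re (\<sigma> * r) \<ge> 0"
    proof (cases "Re r \<ge> 0")
      case True then show ?thesis using that[of 1] by simp
    next
      case False then show ?thesis using that[of "-1"] by simp
    qed
    have rs: "cmod (r - \<sigma>) \<le> cmod (r\<^sup>2 - 1)"
    proof -
      have "\<sigma> * \<sigma> = 1" using \<sigma> by auto
      then have "(r - \<sigma>) * (r + \<sigma>) = r\<^sup>2 - 1" by (simp add: algebra_simps power2_eq_square)
      then have eq: "cmod (r - \<sigma>) * cmod (r + \<sigma>) = cmod (r\<^sup>2 - 1)" by (metis norm_mult)
      have "\<sigma> * (r + \<sigma>) = \<sigma> * r + 1" using \<open>\<sigma> * \<sigma> = 1\<close> by (simp add: distrib_left)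
      then have "cmod (r + \<sigma>) = cmod (\<sigma> * r + 1)" using \<sigma>(1) by (metis norm_minus_cancel mult_1 mult_minus1)
      also have "\<dots> \<ge> 1" using complex_Re_le_cmod[of "\<sigma> * r + 1"] \<sigma>(2) by simp
      finally have "cmod (r - \<sigma>) * 1 \<le> cmod (r - \<sigma>) * cmod (r + \<sigma>)" by (intro mult_left_mono) auto
      then show ?thesis using eq by simp
    qed
    \<comment> \<open>Close to \<open>1 / (2 * pi * \<i>)\<close>, because \<open>p\<close> is close
      to the vanishing period \<open>2 * pi * \<i> * A0\<close>.\<close>
    define \<kappa> where "\<kappa> = A0 / p"
    have \<eta>: "3 * \<delta> / D \<le> 3 / 400" using \<delta> D by (simp add: field_simps)
    have \<eta>0: "0 \<le> 3 * \<delta> / D" using \<delta> D by simp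
    have \<kappa>: "cmod \<kappa> \<le> 17 / 100"
    proof -
      have n: "cmod (2 * of_real pi * \<i> * A0) = 2 * pi * cmod A0" by (simp add: norm_mult)
      have "2 * pi * cmod A0 \<le> cmod p + 2 * pi * (3 * \<delta> / D) * cmod A0"
        using norm_triangle_ineq4[of p "p - 2 * of_real pi * \<i> * A0"] p(2) n by simp
      also have "\<dots> \<le> cmod p + 2 * pi * (3 / 400) * cmod A0" using \<eta> \<eta>0 by (intro add_left_mono mult_mono) simp_all
      finally have "(2 * pi * (397 / 400)) * cmod A0 \<le> cmod p" by simp
      moreover have "100 / 17 \<le> 2 * pi * (397 / 400)" using pi_approx by simp
      then have "100 / 17 * cmod A0 \<le> (2 * pi * (397 / 400)) * cmod A0" by (intro mult_right_mono) auto
      ultimately have "100 / 17 * cmod A0 \<le> cmod p" by linarith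
      then show ?thesis using p0 by (simp add: \<kappa>_def norm_divide field_simps)
    qed
    have \<kappa>': "cmod (\<kappa> - 1 / (2 * of_real pi * \<i>)) \<le> 17 / 100 * (3 * \<delta> / D)"
    proof -
      have "\<kappa> - 1 / (2 * of_real pi * \<i>) = - (p - 2 * of_real pi * \<i> * A0) / (2 * of_real pi * \<i> * p)"
        using pnz by (simp add: \<kappa>_def field_simps)
      then have "cmod (\<kappa> - 1 / (2 * of_real pi * \<i>)) = cmod (p - 2 * of_real pi * \<i> * A0) / (2 * pi * cmod p)"
        by (simp only: norm_divide norm_minus_cancel norm_mult) simp
      also have "\<dots> \<le> (2 * pi * (3 * \<delta> / D) * cmod A0) / (2 * pi * cmod p)"
        using p(2) by (intro divide_right_mono) auto
      also have "\<dots> = (3 * \<delta> / D) * cmod \<kappa>" by (simp add: \<kappa>_def norm_divide)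
      also have "\<dots> \<le> (3 * \<delta> / D) * (17 / 100)" using \<kappa> \<delta> D by (intro mult_left_mono) auto
      finally show ?thesis by simp
    qed
    let ?u = "D0 / (w - e2)"
    have nu: "cmod ?u = 1 / \<rho>2" using D0 by (simp add: norm_divide \<rho>2_def)
    \<comment> \<open>A main term and two errors. The factor \<open>1 / (2 * pi * \<i>)\<close>
      turns the real part of the main term into the imaginary part of \<open>D0 / (w - e2)\<close>,
      the rate of change of the argument; the modulus, with its logarithmic growth, drops
      out.\<close>
    have "v / p = \<kappa> * r * ?u" using A0nz D0nz w2 by (simp add: \<kappa>_def r_def)
    also have "\<dots> = \<sigma> * (1 / (2 * of_real pi * \<i>)) * ?u + \<sigma> * (\<kappa> - 1 / (2 * of_real pi * \<i>)) * ?u + \<kappa> * (r - \<sigma>) * ?u"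
      by (simp add: algebra_simps)
    finally have "Re (v / p) = Re (\<sigma> * (1 / (2 * of_real pi * \<i>)) * ?u) + Re (\<sigma> * (\<kappa> - 1 / (2 * of_real pi * \<i>)) * ?u) + Re (\<kappa> * (r - \<sigma>) * ?u)"
      by simp
    moreover have "\<bar>Re (\<sigma> * (1 / (2 * of_real pi * \<i>)) * ?u)\<bar> \<le> ?X"
    proof -
      have u: "?u = D0 * cnj (w - e2) / of_real (\<rho>2\<^sup>2)"
        unfolding \<rho>2_def using w2 by (subst complex_div_cnj) simp
      have "Im (D0 * cnj (w - e2)) = - x" unfolding x(1) by (simp add: algebra_simps)
      then have imu: "Im ?u = - x / \<rho>2\<^sup>2" unfolding u by (simp only: Im_divide_of_real)
      have "1 / (2 * of_real pi * \<i>) = of_real (1 / (2 * pi)) * (- \<i>)"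
        by (simp add: divide_eq_eq)
      then have "1 / (2 * of_real pi * \<i>) * ?u = of_real (1 / (2 * pi)) * (- \<i> * ?u)"
        by (simp only: mult.assoc)
      moreover have "Re (of_real k * (- \<i> * z)) = k * Im z" for k z by simp
      ultimately have "Re (1 / (2 * of_real pi * \<i>) * ?u) = 1 / (2 * pi) * Im ?u" by (simp only:)
      then have "\<bar>Re (\<sigma> * (1 / (2 * of_real pi * \<i>)) * ?u)\<bar> = 1 / (2 * pi) * \<bar>Im ?u\<bar>"
        using \<sigma>(1) by (auto simp: abs_mult)
      also have "\<dots> \<le> 1 / 6 * \<bar>Im ?u\<bar>" using pi_gt3 by (intro mult_right_mono) (auto simp: field_simps)
      also have "\<dots> = (\<bar>x\<bar> / 6) / (s2\<^sup>2 + \<bar>x\<bar>\<^sup>2)" unfolding imu using x(2) by (simp add: \<rho>2_def abs_div)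
      finally show ?thesis .
    qed
    moreover have "\<bar>Re (\<sigma> * (\<kappa> - 1 / (2 * of_real pi * \<i>)) * ?u)\<bar> + \<bar>Re (\<kappa> * (r - \<sigma>) * ?u)\<bar> \<le> ?Y + ?Z"
    proof -
      have n\<sigma>: "cmod \<sigma> = 1" using \<sigma>(1) by auto
      have "\<bar>Re (\<sigma> * (\<kappa> - 1 / (2 * of_real pi * \<i>)) * ?u)\<bar> \<le> cmod (\<sigma> * (\<kappa> - 1 / (2 * of_real pi * \<i>)) * ?u)" by (rule abs_Re_le_cmod)
      also have "\<dots> = cmod (\<kappa> - 1 / (2 * of_real pi * \<i>)) * (1 / \<rho>2)" by (simp only: norm_mult nu n\<sigma> mult_1)
      also have "\<dots> \<le> 17 / 100 * (3 * \<delta> / D) * (1 / \<rho>2)" using \<kappa>' \<rho> by (intro mult_right_mono) auto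
      also have "\<dots> = (51 / 100) * (\<delta> / \<rho>2) * (1 / D)" by simp
      also have "\<dots> \<le> (51 / 100) * (1 / 5) * (1 / D)" using X5 D unfolding X by (intro mult_right_mono mult_left_mono) auto
      finally have b1: "\<bar>Re (\<sigma> * (\<kappa> - 1 / (2 * of_real pi * \<i>)) * ?u)\<bar> \<le> (51 / 500) * (1 / D)" by simp
      have "\<bar>Re (\<kappa> * (r - \<sigma>) * ?u)\<bar> \<le> cmod (\<kappa> * (r - \<sigma>) * ?u)" by (rule abs_Re_le_cmod)
      also have "\<dots> = cmod \<kappa> * cmod (r - \<sigma>) * (1 / \<rho>2)" by (simp only: norm_mult nu)
      also have "\<dots> \<le> 17 / 100 * (15 / 8 * cmod X + 25 / 16 * cmod Y) * (1 / \<rho>2)"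
        using \<kappa> rs r21 \<rho> by (intro mult_right_mono mult_mono) auto
      also have "\<dots> = 51 / 160 * (\<delta> / \<rho>2\<^sup>2) + 17 / 64 * (1 / D)"
        unfolding X Y using \<rho> D by (simp add: field_simps power2_eq_square)
      finally have b2: "\<bar>Re (\<kappa> * (r - \<sigma>) * ?u)\<bar> \<le> 51 / 160 * (\<delta> / \<rho>2\<^sup>2) + 17 / 64 * (1 / D)" .
      have "(5 * \<delta>)\<^sup>2 \<le> \<rho>2\<^sup>2" "s2\<^sup>2 \<le> \<rho>2\<^sup>2" using 4 \<delta> s \<rho> by (intro power_mono; simp)+
      then have "s2\<^sup>2 + (5 * \<delta>)\<^sup>2 \<le> 2 * \<rho>2\<^sup>2" by simp
      then have "\<delta> / (2 * \<rho>2\<^sup>2) \<le> \<delta> / (s2\<^sup>2 + (5 * \<delta>)\<^sup>2)"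
        using \<delta> s \<rho>(5) by (intro divide_left_mono mult_pos_pos) (auto simp: add_pos_pos)
      \<comment> \<open>51/160 is just below half of 16/25, which explains the latter
        constant.\<close>
      then have c1: "51 / 160 * (\<delta> / \<rho>2\<^sup>2) \<le> ?Y"
        using \<delta> s by (simp add: divide_simps mult_ac split: if_splits)
      have "s2\<^sup>2 \<le> (D / 5)\<^sup>2" using 4 s \<rho> by (intro power_mono) auto
      then have "s2\<^sup>2 + D\<^sup>2 \<le> 26 / 25 * D\<^sup>2" by (simp add: power_divide)
      then have "D / (26 / 25 * D\<^sup>2) \<le> D / (s2\<^sup>2 + D\<^sup>2)"
        using D s by (intro divide_left_mono mult_pos_pos) (auto simp: add_pos_pos)
      moreover have "D / (26 / 25 * D\<^sup>2) = 25 / 26 * (1 / D)" using D by (simp add: power2_eq_square)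
      ultimately have c2: "25 / 26 * (1 / D) \<le> D / (s2\<^sup>2 + D\<^sup>2)" by simp
      have "(51 / 500 + 17 / 64) * (1 / D) \<le> 2 / 5 * (25 / 26 * (1 / D))" using D by (simp add: field_simps)
      also have "\<dots> \<le> 2 / 5 * (D / (s2\<^sup>2 + D\<^sup>2))" using c2 by (intro mult_left_mono) auto
      also have "\<dots> = ?Z" by simp
      finally have "(51 / 500 + 17 / 64) * (1 / D) \<le> ?Z" .
      moreover have "(51 / 500 + 17 / 64) * (1 / D) = (51 / 500) * (1 / D) + 17 / 64 * (1 / D)" by (rule distrib_right)
      ultimately show ?thesis using b1 b2 c1 by linarith
    qed
    ultimately show ?thesis using pos by linarith
  qed
qed

section \<open>Reduced bases: displacement along lifted rays\<close>

locale reduced_lattice = period_lattice +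
  assumes Re_le: "\<bar>Re (\<omega>2 / \<omega>1)\<bar> \<le> 1 / 2" and norm_ge: "cmod (\<omega>2 / \<omega>1) \<ge> 1"
begin

text \<open>The argument of \<tau> lies between 60 and 120 degrees, since
  \<open>\<bar>Re \<tau>\<bar> \<le> 1/2 \<le> cmod \<tau> / 2\<close>.\<close>

lemma Im_ratio_ge: "sqrt 3 / 2 * cmod (\<omega>2 / \<omega>1) \<le> Im (\<omega>2 / \<omega>1)"
proof (rule power2_le_imp_le)
  let ?t = "\<omega>2 / \<omega>1"
  have "(Re ?t)\<^sup>2 \<le> (1/2)\<^sup>2" using Re_le by (metis abs_ge_zero power2_abs power_mono)
  moreover have "1 \<le> (cmod ?t)\<^sup>2" using norm_ge by (simp add: one_le_power)
  moreover have "(cmod ?t)\<^sup>2 = (Re ?t)\<^sup>2 + (Im ?t)\<^sup>2" by (rule cmod_power2)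
  ultimately have "3 / 4 * (cmod ?t)\<^sup>2 \<le> (Im ?t)\<^sup>2" by (simp add: power2_eq_square)
  moreover have "(sqrt 3 / 2 * cmod ?t)\<^sup>2 = 3 / 4 * (cmod ?t)\<^sup>2" by (simp add: power_mult_distrib power_divide)
  ultimately show "(sqrt 3 / 2 * cmod ?t)\<^sup>2 \<le> (Im ?t)\<^sup>2" by simp
qed (use Im_pos in simp)

lemma periods_norm: "cmod \<omega>1 \<le> cmod \<omega>2"
  using norm_ge \<omega>1_nonzero by (simp add: norm_divide field_simps)

lemma primitive_periods:
  "primitive_period \<omega>1" "primitive_period \<omega>2" "primitive_period (\<omega>1 + \<omega>2)"
proof -
  have ni: "s \<notin> \<int>" if "0 < s" "s < 1" for s :: real using that by (auto elim!: Ints_cases)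
  have c: "coord1 \<omega>1 = 1" "coord2 \<omega>2 = 1" "coord1 (\<omega>1 + \<omega>2) = 1"
    using coord_comb[of 1 0] coord_comb[of 0 1] coord_comb[of 1 1] by simp_all
  have "of_real s * \<omega>1 \<notin> \<Omega>" "of_real s * \<omega>2 \<notin> \<Omega>" "of_real s * (\<omega>1 + \<omega>2) \<notin> \<Omega>" if "0 < s" "s < 1" for s
    using ni[OF that] by (simp_all only: lattice_iff coord_scale c mult_1_right) auto
  then show "primitive_period \<omega>1" "primitive_period \<omega>2" "primitive_period (\<omega>1 + \<omega>2)"
    unfolding primitive_period_def by (auto intro: lattice_add)
qed

lemma arc_bounds:
  assumes "s \<ge> 0"
  shows "arc_len (cmod (root1 - root2)) (cmod (root1 - root3)) s \<le> cmod \<omega>1 / 2"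
    "arc_len (cmod (root1 - root2)) (cmod (root2 - root3)) s \<le> cmod \<omega>2 / 2"
    "arc_len (cmod (root1 - root3)) (cmod (root2 - root3)) s \<le> cmod (\<omega>1 + \<omega>2) / 2"
proof -
  have f: "wp_poly w = 4 * (w - root2) * (w - root1) * (w - root3)"
    "wp_poly w = 4 * (w - root3) * (w - root1) * (w - root2)" for w
    unfolding wp_poly_factor by (simp_all only: mult_ac)
  have r: "wp (\<omega>1 / 2) = root1" "wp (\<omega>2 / 2) = root2" "wp ((\<omega>1 + \<omega>2) / 2) = root3"
    by (simp_all add: root1_def root2_def root3_def half1_def half2_def half3_def)
  note ne = roots_distinct roots_distinct[symmetric]
  show "arc_len (cmod (root1 - root2)) (cmod (root1 - root3)) s \<le> cmod \<omega>1 / 2"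
    by (rule arc_len_le_period[OF primitive_periods(1) r(1) wp_poly_factor ne(1,2) assms])
  have "arc_len (cmod (root2 - root1)) (cmod (root2 - root3)) s \<le> cmod \<omega>2 / 2"
    by (rule arc_len_le_period[OF primitive_periods(2) r(2) f(1) ne(4,3) assms])
  then show "arc_len (cmod (root1 - root2)) (cmod (root2 - root3)) s \<le> cmod \<omega>2 / 2"
    by (simp add: norm_minus_commute[of root2 root1])
  have "arc_len (cmod (root3 - root1)) (cmod (root3 - root2)) s \<le> cmod (\<omega>1 + \<omega>2) / 2"
    by (rule arc_len_le_period[OF primitive_periods(3) r(3) f(2) ne(5,6) assms])
  then show "arc_len (cmod (root1 - root3)) (cmod (root2 - root3)) s \<le> cmod (\<omega>1 + \<omega>2) / 2"
    by (simp add: norm_minus_commute[of root3])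
qed

text \<open>Projection to the ray direction keeps at least 7/20 of every root gap. The value is
  slightly below \<open>1 / sqrt 8\<close>, the sine of the angle that
  \<open>direction_exists\<close> guarantees.\<close>

definition good_direction :: "complex \<Rightarrow> bool" where
  "good_direction D0 \<longleftrightarrow> cmod D0 = 1 \<and>
     \<bar>Re ((root1 - root2) * cnj D0)\<bar> \<ge> 7/20 * cmod (root1 - root2) \<and>
     \<bar>Re ((root1 - root3) * cnj D0)\<bar> \<ge> 7/20 * cmod (root1 - root3) \<and>
     \<bar>Re ((root2 - root3) * cnj D0)\<bar> \<ge> 7/20 * cmod (root2 - root3)"

text \<open>A lift through \<open>wp\<close> of the ray from \<open>w0\<close> in direction
  \<open>D0\<close>. The velocity is given only through its square, so both signs of the square root
  are treated at once.\<close>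

definition inverse_ray :: "complex \<Rightarrow> complex \<Rightarrow> (real \<Rightarrow> complex) \<Rightarrow> (real \<Rightarrow> complex) \<Rightarrow> bool" where
  "inverse_ray D0 w0 y y' \<longleftrightarrow> good_direction D0 \<and>
     (\<forall>t\<ge>0. y t \<notin> \<Omega> \<and> wp (y t) = w0 + of_real t * D0 \<and> (y has_vector_derivative y' t) (at t) \<and>
        (y' t)\<^sup>2 * wp_poly (w0 + of_real t * D0) = D0\<^sup>2)"

lemma ray_density:
  assumes "inverse_ray D0 w0 y y'" "t \<ge> 0"
  shows "cmod (y' t) = 1 / (2 * sqrt (cmod (w0 + of_real t * D0 - root1) * cmod (w0 + of_real t * D0 - root2) * cmod (w0 + of_real t * D0 - root3)))"
proof -
  let ?w = "w0 + of_real t * D0"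
  let ?P = "cmod (?w - root1) * cmod (?w - root2) * cmod (?w - root3)"
  have "cmod ((y' t)\<^sup>2 * wp_poly ?w) = cmod (D0\<^sup>2)" using assms by (simp add: inverse_ray_def)
  moreover have "cmod D0 = 1" using assms by (simp add: inverse_ray_def good_direction_def)
  ultimately have eq: "(cmod (y' t))\<^sup>2 * (4 * ?P) = 1"
    by (simp only: norm_mult norm_power norm_numeral wp_poly_factor mult_ac power_one)
  then have P: "?P > 0" by (metis mult_zero_right norm_ge_zero less_eq_real_def mult_nonneg_nonneg zero_neq_one)
  have "cmod (y' t) = sqrt ((cmod (y' t))\<^sup>2)" by simp
  also have "(cmod (y' t))\<^sup>2 = 1 / (4 * ?P)"
    using eq P by (subst eq_divide_eq) auto
  also have "sqrt (1 / (4 * ?P)) = 1 / (2 * sqrt ?P)" by (simp only: real_sqrt_divide real_sqrt_mult real_sqrt_one real_sqrt_four)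
  finally show ?thesis .
qed

text \<open>The three summands of \<open>line_density_bound\<close> are \<open>arc_len\<close>
  densities with gaps scaled by 7/20, so one majorant per root gives both convergence and the
  displacement bound. The \<open>B\<close> are kept free because half periods and multiples of
  \<open>cmod \<omega>1\<close> will both be inserted.\<close>

lemma ray_limit:
  assumes ray: "inverse_ray D0 w0 y y'"
    and B: "\<And>s. s \<ge> 0 \<Longrightarrow> arc_len (cmod (root1 - root2)) (cmod (root1 - root3)) s \<le> B1"
      "\<And>s. s \<ge> 0 \<Longrightarrow> arc_len (cmod (root1 - root2)) (cmod (root2 - root3)) s \<le> B2"
      "\<And>s. s \<ge> 0 \<Longrightarrow> arc_len (cmod (root1 - root3)) (cmod (root2 - root3)) s \<le> B3"
  shows "\<exists>l. (y \<longlongrightarrow> l) at_top" "t \<ge> 0 \<Longrightarrow> cmod (y t - y 0) \<le> 2 * (B1 + B2 + B3) / sqrt (7/20)"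
proof -
  define c where "c = (\<lambda>i. Re (([root1, root2, root3] ! i - w0) * cnj D0))"
  define d where "d = [(cmod (root1 - root2), cmod (root1 - root3)), (cmod (root1 - root2), cmod (root2 - root3)), (cmod (root1 - root3), cmod (root2 - root3))]"
  define H where "H = (\<lambda>i s. arc_len (fst (d ! i)) (snd (d ! i)) (s / (7/20)) / sqrt (7/20))"
  define h where "h = (\<lambda>i s. 1 / (2 * sqrt (s * (s + 7/20 * fst (d ! i)) * (s + 7/20 * snd (d ! i)))))"
  define I where "I = {0, 1, 2::nat}"
  have maj: "majorant (H i) (h i) ([B1, B2, B3] ! i / sqrt (7/20))" if "i \<in> I" for i
    unfolding H_def h_def
    by (rule arc_len_majorant) (use that roots_distinct B in \<open>auto simp: I_def d_def\<close>)
  have y: "(y has_vector_derivative y' t) (at t)" if "t \<ge> 0" for t using ray that by (simp add: inverse_ray_def)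
  have good: "good_direction D0" using ray by (simp add: inverse_ray_def)
  have le: "norm (y' t) \<le> (\<Sum>i\<in>I. h i \<bar>t - c i\<bar>)" if t: "t \<ge> 0" "t \<notin> c ` I" for t
  proof -
    have "norm (y' t) \<le> h 0 \<bar>t - c 0\<bar> + h 1 \<bar>t - c 1\<bar> + h 2 \<bar>t - c 2\<bar>"
      unfolding ray_density[OF ray t(1)] h_def d_def
      using line_density_bound[of D0 "7/20" root1 root2 root3 "w0 + of_real t * D0" w0 t "c 0" "c 1" "c 2"] good t(2) roots_distinct
      by (simp add: good_direction_def c_def I_def)
    then show ?thesis by (simp add: I_def)
  qed
  show "\<exists>l. (y \<longlongrightarrow> l) at_top"
    by (rule majorant_path_converges[of I H h "\<lambda>i. [B1, B2, B3] ! i / sqrt (7/20)" y y' c]) (use maj y le in \<open>auto simp: I_def\<close>)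
  show "cmod (y t - y 0) \<le> 2 * (B1 + B2 + B3) / sqrt (7/20)" if "t \<ge> 0"
  proof -
    have "cmod (y t - y 0) \<le> 2 * (\<Sum>i\<in>I. [B1, B2, B3] ! i / sqrt (7/20))"
      by (rule majorant_path_bound[of I 0 t H h _ y y' c]) (use maj y le that in \<open>auto simp: I_def\<close>)
    also have "(\<Sum>i\<in>I. [B1, B2, B3] ! i / sqrt (7/20)) = (B1 + B2 + B3) / sqrt (7/20)"
      by (simp add: I_def add_divide_distrib)
    finally show ?thesis by simp
  qed
qed

text \<open>At a limit outside the lattice \<open>wp\<close> would be continuous, whereas
  \<open>wp (y t)\<close> follows the ray to infinity.\<close>

lemma ray_limit_in_lattice:
  assumes ray: "inverse_ray D0 w0 y y'" and l: "(y \<longlongrightarrow> l) at_top"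
  shows "l \<in> \<Omega>"
proof (rule ccontr)
  assume "l \<notin> \<Omega>"
  then have "isCont wp l" using wp_has_deriv DERIV_isCont by blast
  then have "((\<lambda>t. wp (y t)) \<longlongrightarrow> wp l) at_top" using l isCont_tendsto_compose by blast
  then have ev: "\<forall>\<^sub>F t in at_top. cmod (wp (y t) - wp l) < 1" using tendstoD[of _ _ _ 1] by (fastforce simp: dist_norm)
  have D0: "cmod D0 = 1" using ray by (simp add: inverse_ray_def good_direction_def)
  have "\<forall>\<^sub>F t in at_top. t \<ge> cmod (w0 - wp l) + 1 \<and> t \<ge> 0"
    using eventually_ge_at_top[of "cmod (w0 - wp l) + 1"] by eventually_elim (use norm_ge_zero[of "w0 - wp l"] in linarith)
  with ev have "\<forall>\<^sub>F t in at_top. cmod (wp (y t) - wp l) < 1 \<and> t \<ge> cmod (w0 - wp l) + 1 \<and> t \<ge> 0"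
    by (rule eventually_conj)
  then obtain t :: real where t: "cmod (wp (y t) - wp l) < 1" "t \<ge> cmod (w0 - wp l) + 1" "t \<ge> 0"
    using eventually_happens trivial_limit_at_top_linorder by blast
  have "wp (y t) = w0 + of_real t * D0" using ray t by (simp add: inverse_ray_def)
  then have "of_real t * D0 = (wp (y t) - wp l) - (w0 - wp l)" by simp
  then have "cmod (of_real t * D0) \<le> cmod (wp (y t) - wp l) + cmod (w0 - wp l)" by (metis norm_triangle_ineq4)
  then show False using t D0 by (simp add: norm_mult)
qed

lemma ray_bound:
  assumes ray: "inverse_ray D0 w0 y y'" and l: "(y \<longlongrightarrow> l) at_top"
    and B: "\<And>t. t \<ge> 0 \<Longrightarrow> \<bar>f (y t - y 0)\<bar> \<le> B" and f: "continuous_on UNIV f"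
  shows "\<bar>f (l - y 0)\<bar> \<le> (B :: real)"
proof (rule tendsto_upperbound)
  have "((\<lambda>t. y t - y 0) \<longlongrightarrow> l - y 0) at_top" by (intro tendsto_intros l)
  then have "((\<lambda>t. f (y t - y 0)) \<longlongrightarrow> f (l - y 0)) at_top"
    using f continuous_on_tendsto_compose[of UNIV f] by auto
  then show "((\<lambda>t. \<bar>f (y t - y 0)\<bar>) \<longlongrightarrow> \<bar>f (l - y 0)\<bar>) at_top" by (rule tendsto_rabs)
  show "\<forall>\<^sub>F t in at_top. \<bar>f (y t - y 0)\<bar> \<le> B"
    using eventually_ge_at_top[of 0] by eventually_elim (rule B)
qed simp

text \<open>The three half periods give a displacement of at most
  \<open>4 * cmod \<omega>2 / sqrt (7/20)\<close>, and \<open>Im_ratio_ge\<close> turns this into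
  \<open>8 / sqrt (21/20)\<close>. That this is strictly below 8 leaves 16 integer coordinates
  rather than 17.\<close>

lemma ray_coord2:
  assumes ray: "inverse_ray D0 w0 y y'" and l: "(y \<longlongrightarrow> l) at_top"
  shows "\<bar>coord2 (l - y 0)\<bar> < 8"
proof -
  have "\<bar>cmod (l - y 0)\<bar> \<le> 2 * (cmod \<omega>1 / 2 + cmod \<omega>2 / 2 + cmod (\<omega>1 + \<omega>2) / 2) / sqrt (7/20)"
    by (rule ray_bound[OF ray l]) (use ray_limit(2)[OF ray arc_bounds] in \<open>auto intro!: continuous_intros\<close>)
  also have "\<dots> \<le> (4 * cmod \<omega>2) / sqrt (7/20)"
    using periods_norm norm_triangle_ineq[of \<omega>1 \<omega>2] by (intro divide_right_mono) auto
  finally have n: "cmod (l - y 0) \<le> 4 * cmod \<omega>2 / sqrt (7/20)" by simp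
  have pos: "0 < cmod \<omega>1" "0 < cmod \<omega>2" using \<omega>1_nonzero periods_norm by auto
  let ?t = "\<omega>2 / \<omega>1"
  have "\<bar>coord2 (l - y 0)\<bar> \<le> cmod ((l - y 0) / \<omega>1) / Im ?t"
    unfolding coord2_def using Im_pos abs_Im_le_cmod[of "(l - y 0) / \<omega>1"] by (simp add: divide_right_mono)
  also have "\<dots> \<le> (4 * cmod ?t / sqrt (7/20)) / (sqrt 3 / 2 * cmod ?t)"
  proof (rule frac_le)
    show "cmod ((l - y 0) / \<omega>1) \<le> 4 * cmod ?t / sqrt (7/20)"
      using n pos by (simp add: norm_divide divide_right_mono field_simps)
  qed (use Im_ratio_ge pos in \<open>auto simp: norm_divide\<close>)
  also have "\<dots> = 8 / (sqrt (7/20) * sqrt 3)" using pos by (simp add: norm_divide)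
  also have "sqrt (7/20) * sqrt 3 = sqrt (21/20)" by (simp flip: real_sqrt_mult)
  also have "8 / sqrt (21/20) < 8"
    using real_sqrt_gt_1_iff[of "21/20"] by (simp add: field_simps)
  finally show ?thesis .
qed

text \<open>Measured in units of \<open>\<omega>1\<close>, such a period has height at least that of
  \<tau>. This will force the vanishing period to be a multiple of \<open>\<omega>1\<close>.\<close>

lemma far_periods_norm:
  assumes "\<mu> = of_int a * \<omega>1 + of_int b * \<omega>2" "b \<noteq> 0"
  shows "cmod \<mu> \<ge> sqrt 3 / 2 * cmod \<omega>2"
proof -
  have "\<mu> / \<omega>1 = of_int a + of_int b * (\<omega>2 / \<omega>1)" using \<omega>1_nonzero by (simp add: assms(1) add_divide_distrib)
  moreover have "Im (of_int a + of_int b * z) = of_int b * Im z" for z by simp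
  ultimately have "Im (\<mu> / \<omega>1) = of_int b * Im (\<omega>2 / \<omega>1)" by (simp only:)
  then have "\<bar>of_int b\<bar> * Im (\<omega>2 / \<omega>1) \<le> cmod (\<mu> / \<omega>1)"
    using abs_Im_le_cmod[of "\<mu> / \<omega>1"] Im_pos by (simp add: abs_mult)
  moreover have "1 * Im (\<omega>2 / \<omega>1) \<le> \<bar>of_int b :: real\<bar> * Im (\<omega>2 / \<omega>1)"
    using assms(2) Im_pos by (intro mult_right_mono) linarith+
  ultimately have "sqrt 3 / 2 * cmod (\<omega>2 / \<omega>1) \<le> cmod (\<mu> / \<omega>1)" using Im_ratio_ge by linarith
  then show ?thesis using \<omega>1_nonzero by (simp add: norm_divide field_simps)
qed

text \<open>Since 400 is the square of 20, \<open>arc_len_le_scaled\<close> bounds all three arc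
  lengths by \<open>cmod \<omega>1\<close>, with factors 1/2, 10 and 10. Then
  \<open>41 / sqrt (7/20)\<close> is about 69.3, the origin of the bound 70.\<close>

lemma ray_re_nondegenerate:
  assumes ray: "inverse_ray D0 w0 y y'" and t: "t \<ge> 0"
    and close: "cmod (root1 - root2) \<le> 400 * cmod (root2 - root3)" "cmod (root1 - root3) \<le> 400 * cmod (root2 - root3)"
  shows "\<bar>Re ((y t - y 0) / \<omega>1)\<bar> \<le> 70"
proof -
  have pos: "0 < cmod (root1 - root2)" "0 < cmod (root1 - root3)" "0 < cmod (root2 - root3)" using roots_distinct by auto
  have B2: "arc_len (cmod (root1 - root2)) (cmod (root2 - root3)) s \<le> 10 * cmod \<omega>1" if "s \<ge> 0" for s
  proof -
    have "arc_len (cmod (root1 - root2)) (cmod (root2 - root3)) s \<le> 20 * arc_len (cmod (root1 - root2)) (cmod (root1 - root3)) s"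
      by (rule arc_len_le_scaled) (use pos close that in auto)
    then show ?thesis using arc_bounds(1)[OF that] by linarith
  qed
  have B3: "arc_len (cmod (root1 - root3)) (cmod (root2 - root3)) s \<le> 10 * cmod \<omega>1" if "s \<ge> 0" for s
  proof -
    have "arc_len (cmod (root1 - root3)) (cmod (root2 - root3)) s \<le> 20 * arc_len (cmod (root1 - root3)) (cmod (root1 - root2)) s"
      by (rule arc_len_le_scaled) (use pos close that in auto)
    then show ?thesis using arc_bounds(1)[OF that] by (simp add: arc_len_commute[of "cmod (root1 - root3)"])
  qed
  have "cmod (y t - y 0) \<le> 2 * (cmod \<omega>1 / 2 + 10 * cmod \<omega>1 + 10 * cmod \<omega>1) / sqrt (7/20)"
    by (rule ray_limit(2)[OF ray arc_bounds(1) B2 B3 t])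
  also have "\<dots> = (41 / sqrt (7/20)) * cmod \<omega>1" by simp
  also have "\<dots> \<le> 70 * cmod \<omega>1"
  proof (rule mult_right_mono)
    have "41 / 70 \<le> sqrt (7/20)" by (rule real_le_rsqrt) (simp add: power2_eq_square)
    then show "41 / sqrt (7/20) \<le> 70" by (simp add: field_simps)
  qed simp
  finally have "cmod ((y t - y 0) / \<omega>1) \<le> 70" using \<omega>1_nonzero by (simp add: norm_divide field_simps)
  then show ?thesis using abs_Re_le_cmod order_trans by blast
qed

text \<open>The vanishing period of the pair is identified as \<open>\<omega>1\<close> up to sign,
  so that \<open>degenerate_density\<close> applies with \<open>p = \<omega>1\<close>. The parameter
  \<open>d\<close> is the gap between \<open>root1\<close> and \<open>root2\<close>, which belongs
  to the arc length bounded by \<open>\<omega>2\<close> whichever of the pair is called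
  \<open>e2\<close>.\<close>

lemma ray_re_degenerate:
  assumes ray: "inverse_ray D0 w0 y y'" and t: "t \<ge> 0"
    and fac: "\<And>w. wp_poly w = 4 * (w - root1) * (w - e2) * (w - e3)" and ne: "e2 \<noteq> e3"
    and h: "h \<notin> \<Omega>" "wp h = e2" and close: "400 * cmod (e2 - e3) < cmod (root1 - e2)"
    and D: "cmod (root1 - e3) \<le> cmod (root1 - e2)" and nr: "root1 \<noteq> e2" "root1 \<noteq> e3"
    and arc1: "\<And>s. s \<ge> 0 \<Longrightarrow> arc_len (cmod (root1 - e2)) (cmod (root1 - e3)) s \<le> cmod \<omega>1 / 2"
    and arc2: "0 < d" "d \<le> cmod (root1 - e2)" "\<And>s. s \<ge> 0 \<Longrightarrow> arc_len d (cmod (e2 - e3)) s \<le> cmod \<omega>2 / 2"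
    and gap: "\<bar>Re ((e2 - e3) * cnj D0)\<bar> \<ge> 7/20 * cmod (e2 - e3)"
  shows "\<bar>Re ((y t - y 0) / \<omega>1)\<bar> \<le> 70"
proof -
  define \<delta> where "\<delta> = cmod (e2 - e3)"
  define Dm where "Dm = cmod (root1 - e2)"
  have \<delta>: "\<delta> > 0" "400 * \<delta> < Dm" using ne close by (auto simp: \<delta>_def Dm_def)
  then have Dm: "Dm > 0" by linarith
  define \<eta> where "\<eta> = 3 * \<delta> / Dm"
  have \<eta>: "0 \<le> \<eta>" "\<eta> \<le> 3 / 400" using \<delta> Dm by (auto simp: \<eta>_def field_simps)
  have n1: "pi / sqrt Dm \<le> cmod \<omega>1"
  proof -
    have "arctan x \<le> cmod \<omega>1 / 2 * sqrt Dm" if "x \<ge> 0" for x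
    proof -
      have "arctan (x * sqrt Dm / sqrt Dm) / sqrt Dm \<le> arc_len (cmod (root1 - e2)) (cmod (root1 - e3)) ((x * sqrt Dm)\<^sup>2)"
        by (rule arc_len_ge_arctan) (use nr D Dm that in \<open>auto simp: Dm_def\<close>)
      also have "\<dots> \<le> cmod \<omega>1 / 2" by (rule arc1) simp
      finally show ?thesis using Dm by (simp add: field_simps)
    qed
    then have "\<forall>\<^sub>F x in at_top. arctan x \<le> cmod \<omega>1 / 2 * sqrt Dm"
      by (rule eventually_at_top_linorderI[of 0])
    then have "pi / 2 \<le> cmod \<omega>1 / 2 * sqrt Dm"
      by (rule tendsto_upperbound[OF tendsto_arctan_at_top]) simp
    then show ?thesis using Dm by (simp add: field_simps)
  qed
  \<comment> \<open>The ratio above 400 makes \<open>\<omega>2\<close> long: the logarithm is at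
    least \<open>ln 16 = 4 * ln 2\<close>, hence at least 8/3.\<close>
  have n2: "4 / 3 * 2 * sqrt 2 / sqrt Dm \<le> cmod \<omega>2"
  proof -
    have "ln (1 + sqrt Dm / sqrt \<delta>) / sqrt (2 * Dm) \<le> arc_len d \<delta> Dm"
      by (rule arc_len_ge_ln) (use arc2 \<delta> in \<open>auto simp: Dm_def\<close>)
    also have "\<dots> \<le> cmod \<omega>2 / 2" unfolding \<delta>_def by (rule arc2) (use Dm in simp)
    finally have A: "ln (1 + sqrt Dm / sqrt \<delta>) / sqrt (2 * Dm) \<le> cmod \<omega>2 / 2" .
    have "16 \<le> sqrt (Dm / \<delta>)" using \<delta> by (intro real_le_rsqrt) (simp add: field_simps)
    then have "ln 16 \<le> ln (1 + sqrt Dm / sqrt \<delta>)" using \<delta> Dm by (subst ln_le_cancel_iff) (auto simp: real_sqrt_divide add_pos_pos)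
    moreover have "ln (16::real) = 4 * ln 2" using ln_realpow[of 2 4] by simp
    ultimately have "8 / 3 \<le> ln (1 + sqrt Dm / sqrt \<delta>)" using ln2_ge_two_thirds by linarith
    then have "8 / 3 / sqrt (2 * Dm) \<le> ln (1 + sqrt Dm / sqrt \<delta>) / sqrt (2 * Dm)" using Dm by (intro divide_right_mono) auto
    with A have "8 / 3 / sqrt (2 * Dm) \<le> cmod \<omega>2 / 2" by linarith
    moreover have "8 / 3 / sqrt (2 * Dm) = (4 / 3 * 2 * sqrt 2 / sqrt Dm) / 2"
      using Dm by (simp add: real_sqrt_mult field_simps)
    moreover have "x \<le> z" if "y \<le> z / 2" "y = x / 2" for x y z :: real using that by linarith
    ultimately show ?thesis by blast
  qed
  obtain A :: complex where A: "A\<^sup>2 = 1 / (4 * (e2 - root1))" using power2_csqrt by blast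
  have nA: "cmod A = 1 / (2 * sqrt Dm)"
  proof -
    have "cmod (A\<^sup>2) = 1 / (4 * Dm)" unfolding A by (simp only: norm_divide norm_mult norm_numeral norm_one Dm_def norm_minus_commute[of e2])
    then have "(cmod A)\<^sup>2 = (1 / (2 * sqrt Dm))\<^sup>2" using Dm by (simp add: norm_power power_divide power_mult_distrib)
    then show ?thesis by (rule power2_eq_imp_eq) (use Dm in auto)
  qed
  obtain \<mu> where \<mu>: "\<mu> \<in> \<Omega>" "cmod (\<mu> - 2 * of_real pi * \<i> * A) \<le> 2 * pi * \<eta> * cmod A"
    using vanishing_period[OF fac nr(1) ne h close A] unfolding \<eta>_def \<delta>_def Dm_def by blast
  have n0: "cmod (2 * of_real pi * \<i> * A) = pi / sqrt Dm" using Dm by (simp add: norm_mult nA)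
  have n\<mu>: "cmod \<mu> \<le> (1 + \<eta>) * (pi / sqrt Dm)" "(1 - \<eta>) * (pi / sqrt Dm) \<le> cmod \<mu>"
  proof -
    have "2 * pi * \<eta> * cmod A = \<eta> * (pi / sqrt Dm)" by (simp add: nA)
    then have "cmod (\<mu> - 2 * of_real pi * \<i> * A) \<le> \<eta> * (pi / sqrt Dm)" using \<mu>(2) by simp
    then show "cmod \<mu> \<le> (1 + \<eta>) * (pi / sqrt Dm)" "(1 - \<eta>) * (pi / sqrt Dm) \<le> cmod \<mu>"
      using norm_triangle_sub[of \<mu> "2 * of_real pi * \<i> * A"] norm_triangle_sub[of "2 * of_real pi * \<i> * A" \<mu>] n0
      by (simp_all only: distrib_right left_diff_distrib mult_1 norm_minus_commute[of "2 * of_real pi * \<i> * A" \<mu>]; linarith)+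
  qed
  obtain a b :: int where ab: "\<mu> = of_int a * \<omega>1 + of_int b * \<omega>2" using \<mu>(1) unfolding lattice by blast
  have r: "0 < 1 / sqrt Dm" using Dm by simp
  \<comment> \<open>With a component along \<open>\<omega>2\<close> the length would be at least
    \<open>4/3 * sqrt 6 / sqrt Dm\<close>, about \<open>3.27 / sqrt Dm\<close>, but
    \<open>\<mu>\<close> is no longer than about \<open>3.17 / sqrt Dm\<close>.\<close>
  have b0: "b = 0"
  proof (rule ccontr)
    assume "b \<noteq> 0"
    then have "sqrt 3 / 2 * cmod \<omega>2 \<le> cmod \<mu>" by (rule far_periods_norm[OF ab])
    also have "\<dots> \<le> (1 + 3 / 400) * (pi / sqrt Dm)"
      using n\<mu>(1) \<eta> Dm by (intro order_trans[OF n\<mu>(1)] mult_right_mono) auto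
    finally have u: "sqrt 3 / 2 * cmod \<omega>2 \<le> (1 + 3 / 400) * pi * (1 / sqrt Dm)" by simp
    have eq: "sqrt 3 / 2 * (4 / 3 * 2 * sqrt 2 / q) = (4 / 3 * (sqrt 3 * sqrt 2)) * (1 / q)" for q :: real by simp
    have "sqrt 3 / 2 * (4 / 3 * 2 * sqrt 2 / sqrt Dm) \<le> sqrt 3 / 2 * cmod \<omega>2" using n2 by (intro mult_left_mono) auto
    then have "(4 / 3 * (sqrt 3 * sqrt 2)) * (1 / sqrt Dm) \<le> sqrt 3 / 2 * cmod \<omega>2" unfolding eq .
    from this u have "(4 / 3 * (sqrt 3 * sqrt 2)) * (1 / sqrt Dm) \<le> (1 + 3 / 400) * pi * (1 / sqrt Dm)" by (rule order_trans)
    then have "4 / 3 * (sqrt 3 * sqrt 2) \<le> (1 + 3 / 400) * pi" using r by (rule mult_right_le_imp_le)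
    moreover have "sqrt 3 * sqrt 2 = sqrt 6" by (simp flip: real_sqrt_mult)
    moreover have "244 / 100 \<le> sqrt (6::real)" by (rule real_le_rsqrt) (simp add: power2_eq_square)
    moreover have "pi \<le> 32 / 10" using pi_approx by simp
    ultimately have "4 / 3 * (244 / 100) \<le> (1 + 3 / 400) * (32 / 10 :: real)" by simp
    then have "4 / 3 * (244 / 100) \<le> (1 + 3 / 400) * pi"
      using \<open>4 / 3 * (sqrt 3 * sqrt 2) \<le> (1 + 3 / 400) * pi\<close> \<open>sqrt 3 * sqrt 2 = sqrt 6\<close> \<open>244 / 100 \<le> sqrt (6::real)\<close> by linarith
    moreover have "pi \<le> 315 / 100" using pi_approx by simp
    ultimately show False by simp
  qed
  then have \<mu>a: "\<mu> = of_int a * \<omega>1" using ab by simp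
  have "a \<noteq> 0"
  proof
    assume "a = 0"
    then have "(1 - \<eta>) * (pi / sqrt Dm) \<le> 0" using n\<mu>(2) \<mu>a by simp
    moreover have "0 < (1 - \<eta>) * (pi / sqrt Dm)" using \<eta> Dm by (intro mult_pos_pos) auto
    ultimately show False by linarith
  qed
  \<comment> \<open>By \<open>n1\<close> already twice \<open>\<omega>1\<close> is longer than
    \<open>\<mu>\<close>.\<close>
  moreover have "\<bar>a\<bar> < 2"
  proof (rule ccontr)
    assume "\<not> \<bar>a\<bar> < 2"
    then have "2 \<le> \<bar>of_int a :: real\<bar>" by linarith
    then have "2 * (pi / sqrt Dm) \<le> \<bar>of_int a\<bar> * cmod \<omega>1" using n1 Dm by (intro mult_mono) auto
    also have "\<dots> = cmod \<mu>" by (simp add: \<mu>a norm_mult)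
    also have "\<dots> \<le> (1 + 3 / 400) * (pi / sqrt Dm)" using \<eta> Dm by (intro order_trans[OF n\<mu>(1)] mult_right_mono) auto
    finally have "2 * (pi / sqrt Dm) \<le> (1 + 3 / 400) * (pi / sqrt Dm)" .
    moreover have "0 < pi / sqrt Dm" using Dm by simp
    ultimately show False by (simp only: mult_le_cancel_right_pos)
  qed
  ultimately have "a = 1 \<or> a = - 1" by linarith
  then obtain A0 where A0: "A0\<^sup>2 = 1 / (4 * (e2 - root1))" "cmod (\<omega>1 - 2 * of_real pi * \<i> * A0) \<le> 2 * pi * \<eta> * cmod A0"
  proof
    assume "a = 1"
    then show ?thesis using that[of A] A \<mu> \<mu>a by simp
  next
    assume a: "a = - 1"
    have "\<omega>1 - 2 * of_real pi * \<i> * (- A) = - (\<mu> - 2 * of_real pi * \<i> * A)" using a \<mu>a by simp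
    then have "cmod (\<omega>1 - 2 * of_real pi * \<i> * (- A)) = cmod (\<mu> - 2 * of_real pi * \<i> * A)" by (metis norm_minus_cancel)
    then show ?thesis using that[of "- A"] A \<mu> by simp
  qed
  have D0: "cmod D0 = 1" using ray by (simp add: inverse_ray_def good_direction_def)
  have DD: "D0 * cnj D0 = 1" using D0 by (simp add: complex_norm_square[symmetric])
  define x where "x = Im ((w0 - e2) * cnj D0)"
  define c1 c2 c3 where "c1 = Re ((root1 - w0) * cnj D0)" and "c2 = Re ((e2 - w0) * cnj D0)" and "c3 = Re ((e3 - w0) * cnj D0)"
  \<comment> \<open>Centres of the six majorants, in the order of the summands of
    \<open>degenerate_density\<close>.\<close>
  define c where "c = (\<lambda>i. [c2, c3, c1, c2, c2, c2] ! i)"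
  define h where "h = (\<lambda>i s. [3 * sqrt \<delta> / (sqrt s * (s + \<delta>)), 3 * sqrt \<delta> / (sqrt s * (s + \<delta>)), 2 * sqrt Dm / (sqrt s * (s + Dm)),
     (\<bar>x\<bar> / 6) / (s\<^sup>2 + \<bar>x\<bar>\<^sup>2), (16 / 25 * \<delta>) / (s\<^sup>2 + (5 * \<delta>)\<^sup>2), (2 / 5 * Dm) / (s\<^sup>2 + Dm\<^sup>2)] ! i)"
  define B where "B = (\<lambda>i. [3 * pi, 3 * pi, 2 * pi, pi / 12, 16 / 250 * pi, pi / 5] ! i)"
  define I where "I = {0, 1, 2, 3, 4, 5::nat}"
  have "\<exists>H. majorant H (h i) (B i)" if "i \<in> I" for i
  proof -
    have "i = 0 \<or> i = 1 \<or> i = 2 \<or> i = 3 \<or> i = 4 \<or> i = 5" using that by (auto simp: I_def)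
    then show ?thesis
    proof (elim disjE)
      assume "i = 0" then show ?thesis using majorant_sqrt[of "3 * sqrt \<delta>" \<delta>] \<delta> by (auto simp: h_def B_def)
    next
      assume "i = 1" then show ?thesis using majorant_sqrt[of "3 * sqrt \<delta>" \<delta>] \<delta> by (auto simp: h_def B_def)
    next
      assume "i = 2" then show ?thesis using majorant_sqrt[of "2 * sqrt Dm" Dm] Dm by (auto simp: h_def B_def)
    next
      assume i: "i = 3"
      show ?thesis
      proof (cases "x = 0")
        case True
        \<comment> \<open>The line passes through \<open>e2\<close>; the argument of
          \<open>w - e2\<close> is constant on either side.\<close>
        have "majorant (\<lambda>_. 0) (\<lambda>_. 0) (pi / 12)" by (simp add: majorant_def)
        then show ?thesis using i True by (auto simp: h_def B_def)
      next
        case False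
        then show ?thesis using majorant_quadratic[of "\<bar>x\<bar> / 6" "\<bar>x\<bar>"] i by (auto simp: h_def B_def)
      qed
    next
      assume "i = 4" then show ?thesis using majorant_quadratic[of "16 / 25 * \<delta>" "5 * \<delta>"] \<delta> by (auto simp: h_def B_def)
    next
      assume "i = 5" then show ?thesis using majorant_quadratic[of "2 / 5 * Dm" Dm] Dm by (auto simp: h_def B_def)
    qed
  qed
  then obtain H where maj: "\<And>i. i \<in> I \<Longrightarrow> majorant (H i) (h i) (B i)" by metis
  have "norm (Re (y t / \<omega>1) - Re (y 0 / \<omega>1)) \<le> 2 * (\<Sum>i\<in>I. B i)"
  proof (rule majorant_path_bound[of I 0 t H h B "\<lambda>t. Re (y t / \<omega>1)" "\<lambda>t. Re (y' t / \<omega>1)" c])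
    fix s assume s: "s \<in> {0..t}"
    have "(y has_vector_derivative y' s) (at s)" using ray s by (simp add: inverse_ray_def)
    then have "((\<lambda>t. Re (y t / \<omega>1)) has_vector_derivative Re (y' s / \<omega>1)) (at s)"
      by (rule bounded_linear.has_vector_derivative[OF bounded_linear_compose[OF bounded_linear_Re bounded_linear_divide]])
    then show "((\<lambda>t. Re (y t / \<omega>1)) has_vector_derivative Re (y' s / \<omega>1)) (at s)" .
    assume sc: "s \<notin> c ` I"
    define w where "w = w0 + of_real s * D0"
    have proj: "(w - e) * cnj D0 = of_real s - (e - w0) * cnj D0" for e
    proof -
      have "(w - e) * cnj D0 = of_real s * (D0 * cnj D0) - (e - w0) * cnj D0" unfolding w_def by (simp add: algebra_simps)
      then show ?thesis by (simp add: DD)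
    qed
    have nn: "cmod ((w - e) * cnj D0) = cmod (w - e)" for e using D0 by (simp add: norm_mult)
    have pr: "\<bar>s - Re ((e - w0) * cnj D0)\<bar> \<le> cmod (w - e)" for e
      using abs_Re_le_cmod[of "(w - e) * cnj D0"] nn[of e] unfolding proj by simp
    have xx: "x = Im ((w - e2) * cnj D0)"
      unfolding proj x_def by (simp add: algebra_simps)
    have "\<bar>Re (y' s / \<omega>1)\<bar> \<le> 3 * sqrt \<delta> / (sqrt \<bar>s - c2\<bar> * (\<bar>s - c2\<bar> + \<delta>)) + 3 * sqrt \<delta> / (sqrt \<bar>s - c3\<bar> * (\<bar>s - c3\<bar> + \<delta>))
       + 2 * sqrt Dm / (sqrt \<bar>s - c1\<bar> * (\<bar>s - c1\<bar> + Dm)) + (\<bar>x\<bar> / 6) / (\<bar>s - c2\<bar>\<^sup>2 + \<bar>x\<bar>\<^sup>2)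
       + (16 / 25 * \<delta>) / (\<bar>s - c2\<bar>\<^sup>2 + (5 * \<delta>)\<^sup>2) + (2 / 5 * Dm) / (\<bar>s - c2\<bar>\<^sup>2 + Dm\<^sup>2)"
      unfolding \<delta>_def Dm_def
    proof (rule degenerate_density[OF D0 _ _ _ A0(1)])
      show "(y' s)\<^sup>2 * (4 * (w - root1) * (w - e2) * (w - e3)) = D0\<^sup>2"
        using ray s unfolding w_def fac[symmetric] by (simp add: inverse_ray_def)
      show "7 / 20 * cmod (e2 - e3) \<le> \<bar>s - c2\<bar> + \<bar>s - c3\<bar>"
      proof -
        have "Re ((e2 - e3) * cnj D0) = c2 - c3" by (simp add: c2_def c3_def algebra_simps)
        then show ?thesis using gap by linarith
      qed
      show "(cmod (w - e2))\<^sup>2 = \<bar>s - c2\<bar>\<^sup>2 + x\<^sup>2"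
      proof -
        have "Re ((w - e2) * cnj D0) = s - c2" unfolding proj c2_def by simp
        then have "(cmod ((w - e2) * cnj D0))\<^sup>2 = (s - c2)\<^sup>2 + x\<^sup>2" by (simp only: cmod_power2 xx)
        then show ?thesis by (simp add: nn)
      qed
      show "x = Im ((w - e2) * cnj D0)" by (rule xx)
    qed (use \<delta> n1 A0(2) sc pr in \<open>auto simp: \<delta>_def Dm_def \<eta>_def c_def I_def c1_def c2_def c3_def\<close>)
    then show "norm (Re (y' s / \<omega>1)) \<le> (\<Sum>i\<in>I. h i \<bar>s - c i\<bar>)"
      by (simp add: I_def h_def c_def)
  qed (use maj t in \<open>auto simp: I_def\<close>)
  \<comment> \<open>The masses add up to about \<open>8.35 * pi\<close>, so the left side is below
    53.\<close>
  also have "2 * (\<Sum>i\<in>I. B i) \<le> 70"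
    using pi_approx by (simp add: I_def B_def)
  finally show ?thesis by (simp add: diff_divide_distrib)
qed

text \<open>Only a collision of \<open>root2\<close> with \<open>root3\<close> is exceptional: if
  either meets \<open>root1\<close>, the gap between \<open>root2\<close> and \<open>root3\<close>
  is not the small one and the comparable case applies. In the exceptional cases \<open>e2\<close>
  is the member of the pair that is not nearer to \<open>root1\<close>.\<close>

lemma ray_re:
  assumes ray: "inverse_ray D0 w0 y y'" and t: "t \<ge> 0"
  shows "\<bar>Re ((y t - y 0) / \<omega>1)\<bar> \<le> 70"
proof -
  have gap: "\<bar>Re ((root2 - root3) * cnj D0)\<bar> \<ge> 7/20 * cmod (root2 - root3)"
    using ray by (simp add: inverse_ray_def good_direction_def)
  have pos: "0 < cmod (root1 - root2)" "0 < cmod (root1 - root3)" using roots_distinct by auto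
  consider "cmod (root1 - root2) \<le> 400 * cmod (root2 - root3)" "cmod (root1 - root3) \<le> 400 * cmod (root2 - root3)"
    | "400 * cmod (root2 - root3) < cmod (root1 - root2)" "cmod (root1 - root3) \<le> cmod (root1 - root2)"
    | "400 * cmod (root2 - root3) < cmod (root1 - root3)" "cmod (root1 - root2) \<le> cmod (root1 - root3)"
    by linarith
  then show ?thesis
  proof cases
    case 1 then show ?thesis by (rule ray_re_nondegenerate[OF ray t])
  next
    case 2
    show ?thesis
      by (rule ray_re_degenerate[OF ray t, of root2 root3 half2 "cmod (root1 - root2)"])
         (use 2 pos gap roots_distinct halves_not_lattice arc_bounds in \<open>auto simp: wp_poly_factor root2_def[symmetric]\<close>)
  next
    case 3
    have gap': "7 / 20 * cmod (root3 - root2) \<le> \<bar>Re ((root3 - root2) * cnj D0)\<bar>"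
    proof -
      have "(root3 - root2) * cnj D0 = - ((root2 - root3) * cnj D0)" by (simp add: algebra_simps)
      then show ?thesis using gap by (simp only: uminus_complex.simps abs_minus_cancel norm_minus_commute[of root3])
    qed
    show ?thesis
      by (rule ray_re_degenerate[OF ray t, of root3 root2 half3 "cmod (root1 - root2)"])
         (use 3 pos gap' roots_distinct halves_not_lattice arc_bounds in
           \<open>auto simp: wp_poly_factor root3_def[symmetric] norm_minus_commute[of root3] arc_len_commute[of "cmod (root1 - root3)" "cmod (root1 - root2)"]\<close>)
  qed
qed

end

section \<open>Pfaffian pieces of the graph\<close>

lemma vector_4:
  "(vector [a, b, c, d] :: 'a::zero^4) $ 1 = a" "(vector [a, b, c, d] :: 'a::zero^4) $ 2 = b"
  "(vector [a, b, c, d] :: 'a::zero^4) $ 3 = c" "(vector [a, b, c, d] :: 'a::zero^4) $ 4 = d"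
  unfolding vector_def by simp_all

definition fst_complex :: "real^4 \<Rightarrow> complex" where
  "fst_complex x = of_real (x $ 1) + \<i> * of_real (x $ 2)"

definition snd_complex :: "real^4 \<Rightarrow> complex" where
  "snd_complex x = of_real (x $ 3) + \<i> * of_real (x $ 4)"

definition complex_pair :: "complex \<Rightarrow> complex \<Rightarrow> real^4" where
  "complex_pair z w = vector [Re z, Im z, Re w, Im w]"

lemma complex_pair_simps [simp]:
  "fst_complex (complex_pair z w) = z" "snd_complex (complex_pair z w) = w"
  by (simp_all add: fst_complex_def snd_complex_def complex_pair_def vector_4 complex_eq_iff)

lemma complex_pair_collapse [simp]: "complex_pair (fst_complex x) (snd_complex x) = x"
  by (simp add: vec_eq_iff forall_4 fst_complex_def snd_complex_def complex_pair_def vector_4)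

lemma complex_pair_add: "fst_complex (x + y) = fst_complex x + fst_complex y" "snd_complex (x + y) = snd_complex x + snd_complex y"
  by (simp_all add: fst_complex_def snd_complex_def algebra_simps)

lemma complex_pair_scale: "fst_complex (t *\<^sub>R x) = of_real t * fst_complex x" "snd_complex (t *\<^sub>R x) = of_real t * snd_complex x"
  by (simp_all add: fst_complex_def snd_complex_def algebra_simps)

lemma continuous_on_fst_snd_complex:
  "continuous_on A fst_complex" "continuous_on A snd_complex"
  unfolding fst_complex_def[abs_def] snd_complex_def[abs_def] by (intro continuous_intros)+

definition pfaffian_piece :: "(real^4) set \<Rightarrow> bool" where
  "pfaffian_piece X \<longleftrightarrow> (\<exists>U m f c. simple_domain U \<and> m \<le> 2 \<and> pfaffian_chain 7 9 U c \<and>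
     (\<forall>j\<in>{1..m::nat}. pfaffian 7 9 1 U c (f j)) \<and> X = {x\<in>U. \<forall>j\<in>{1..m}. f j x = 0})"

text \<open>The format asks for exactly \<open>L\<close> domains; surplus indices repeat a piece,
  which is why the family must be nonempty. The shift \<open>i - 1\<close> adapts indices starting
  at 1.\<close>

lemma piecewise_semipfaffian_Union:
  assumes fin: "finite \<X>" "\<X> \<noteq> {}" "card \<X> \<le> L" and pieces: "\<And>X. X \<in> \<X> \<Longrightarrow> pfaffian_piece X"
  shows "piecewise_semipfaffian 7 9 1 4 L 2 (\<Union>\<X>)"
proof -
  obtain g :: "nat \<Rightarrow> (real^4) set" where g: "g ` {1..L} = \<X>"
  proof -
    obtain h where h: "bij_betw h {0..<card \<X>} \<X>" using ex_bij_betw_nat_finite[OF fin(1)] by blast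
    obtain X0 where X0: "X0 \<in> \<X>" using fin(2) by blast
    define g where "g = (\<lambda>i. if i - 1 < card \<X> then h (i - 1) else X0)"
    have him: "h ` {0..<card \<X>} = \<X>" using h by (simp add: bij_betw_def)
    have "g i \<in> \<X>" for i
    proof (cases "i - 1 < card \<X>")
      case True
      then have "h (i - 1) \<in> h ` {0..<card \<X>}" by simp
      then show ?thesis using True him by (simp add: g_def)
    qed (simp add: g_def X0)
    then have "g ` {1..L} \<subseteq> \<X>" by blast
    moreover have "\<X> \<subseteq> g ` {1..L}"
    proof
      fix X assume "X \<in> \<X>"
      then obtain k where k: "k < card \<X>" "X = h k" using him by (metis atLeastLessThan_iff imageE)
      then have "g (Suc k) = X" "Suc k \<in> {1..L}" using fin(3) by (simp_all add: g_def)
      then show "X \<in> g ` {1..L}" by blast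
    qed
    ultimately show ?thesis using that by blast
  qed
  define Q where "Q = (\<lambda>X U m f c. simple_domain U \<and> m \<le> 2 \<and> pfaffian_chain 7 9 U c \<and>
     (\<forall>j\<in>{1..m::nat}. pfaffian 7 9 1 U c (f j)) \<and> X = {x\<in>U. \<forall>j\<in>{1..m}. f j (x::real^4) = 0})"
  have "\<exists>U m f c. Q (g i) U m f c" if "i \<in> {1..L}" for i
    using pieces[of "g i"] g that unfolding pfaffian_piece_def Q_def by blast
  then obtain U m f c where "\<And>i. i \<in> {1..L} \<Longrightarrow> Q (g i) (U i) (m i) (f i) (c i)" by metis
  then have *: "\<And>i. i \<in> {1..L} \<Longrightarrow> simple_domain (U i) \<and> m i \<le> 2 \<and> pfaffian_chain 7 9 (U i) (c i) \<and>
     (\<forall>j\<in>{1..m i}. pfaffian 7 9 1 (U i) (c i) (f i j)) \<and> g i = {x\<in>U i. \<forall>j\<in>{1..m i}. f i j x = 0}"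
    unfolding Q_def by blast
  have "\<Union>\<X> = (\<Union>i\<in>{1..L}. {x\<in>U i. \<forall>j\<in>{1..m i}. f i j x = 0})"
    unfolding g[symmetric] using * by (intro SUP_cong) auto
  moreover have "\<forall>i\<in>{1..L}. simple_domain (U i) \<and> m i \<le> 2 \<and>
     (\<exists>c. pfaffian_chain 7 9 (U i) c \<and> (\<forall>j\<in>{1..m i}. pfaffian 7 9 1 (U i) c (f i j)))"
    using * by blast
  ultimately show ?thesis unfolding piecewise_semipfaffian_def by (intro conjI exI[of _ U] exI[of _ m] exI[of _ f]) simp_all
qed

lemma pfaffian_chain_member:
  assumes "pfaffian_chain l \<alpha> U c" "i \<in> {1..l}" "\<beta> \<ge> 1"
  shows "pfaffian l \<alpha> \<beta> U c (c i)"
proof -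
  have "polyfun (chain_vars l :: ('a + nat) set) \<beta> (\<lambda>v. v (Inr i))"
    by (rule polyfun_var) (use assms in \<open>auto simp: chain_vars_def\<close>)
  then show ?thesis
    using assms(1) unfolding pfaffian_def polyfun_def by (auto simp: chain_point_def)
qed

lemma pfaffian_chainI:
  assumes "open U" "\<And>i. i \<in> {1..l} \<Longrightarrow> real_analytic_on (c i) U"
    and "\<And>i j. i \<in> {1..l} \<Longrightarrow> polyfun (chain_vars i) \<alpha> (g i j)"
    and "\<And>i j x. i \<in> {1..l} \<Longrightarrow> x \<in> U \<Longrightarrow>
      ((\<lambda>t. c i (x + t *\<^sub>R axis j 1)) has_real_derivative g i j (chain_point c x)) (at 0)"
  shows "pfaffian_chain l \<alpha> U c"
  unfolding pfaffian_chain_def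
proof (intro conjI ballI allI)
  fix i j assume i: "i \<in> {1..l}"
  obtain p where "mpoly_in (chain_vars i) p" "mpoly_deg_le \<alpha> p" "\<And>v. mpoly_eval p v = g i j v"
    using assms(3)[OF i, of j] unfolding polyfun_def by blast
  then show "\<exists>p. mpoly_in (chain_vars i) p \<and> mpoly_deg_le \<alpha> p \<and> (\<forall>x\<in>U.
      ((\<lambda>t. c i (x + t *\<^sub>R axis j 1)) has_real_derivative mpoly_eval p (chain_point c x)) (at 0))"
    using assms(4)[OF i] by auto
qed (use assms in auto)

lemma simple_domain_UNIV: "simple_domain (UNIV :: (real^'n) set)"
  unfolding simple_domain_def
  by (rule exI[of _ "\<lambda>_. UNIV"], rule exI[of _ "mat 1"], rule exI[of _ 0])
     (auto simp: open_interval_def invertible_def intro!: exI[of _ "mat 1"])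

lemma expandable_fst_snd_complex: "expandable fst_complex a" "expandable snd_complex a"
  unfolding fst_complex_def[abs_def] snd_complex_def[abs_def]
  by (intro expandable_add expandable_mult expandable_const expandable_coordinate)+

lemma expandable_Im:
  assumes "expandable g a"
  shows "expandable (\<lambda>x. of_real (Im (g x))) a"
  using expandable_Re[OF expandable_mult[OF expandable_const[of "- \<i>"] assms]] by simp

lemma expandable_norm_square:
  assumes "expandable g a"
  shows "expandable (\<lambda>x. of_real ((cmod (g x))\<^sup>2)) a"
proof -
  have "expandable (\<lambda>x. of_real (Re (g x)) * of_real (Re (g x)) + of_real (Im (g x)) * of_real (Im (g x))) a"
    by (intro expandable_add expandable_mult expandable_Re expandable_Im assms)
  moreover have "of_real (Re z) * of_real (Re z) + of_real (Im z) * of_real (Im z) = complex_of_real ((cmod z)\<^sup>2)" for z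
    by (simp add: cmod_power2) (simp add: power2_eq_square)
  ultimately show ?thesis by simp
qed

lemma polyfun_coordinate: "k \<ge> 1 \<Longrightarrow> polyfun (chain_vars i) k (\<lambda>v. v (Inl j))"
  by (rule polyfun_var) (auto simp: chain_vars_def)

lemma polyfun_chain: "k \<ge> 1 \<Longrightarrow> m \<in> {1..i} \<Longrightarrow> polyfun (chain_vars i) k (\<lambda>v. v (Inr m))"
  by (rule polyfun_var) (auto simp: chain_vars_def)

text \<open>The squared distance from \<open>p\<close> has derivatives that are polynomial in the
  coordinates alone, so the same function can fill all seven places of the chain.\<close>

lemma pfaffian_piece_singleton: "pfaffian_piece {p}"
proof -
  define c where "c = (\<lambda>(i::nat) (x::real^4). (\<Sum>k\<in>UNIV. (x $ k - p $ k)\<^sup>2))"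
  have chain: "pfaffian_chain 7 9 UNIV c"
  proof (rule pfaffian_chainI[where g = "\<lambda>i j v. 2 * (v (Inl j) - p $ j)"])
    fix i assume "i \<in> {1..7::nat}"
    show "real_analytic_on (c i) UNIV"
    proof (rule real_analytic_onI)
      fix a :: "real^4"
      have "expandable (\<lambda>x. \<Sum>k\<in>K. (of_real (x $ k) + of_real (- p $ k)) * (of_real (x $ k) + of_real (- p $ k))) a" for K
        by (induction K rule: infinite_finite_induct)
           (simp_all del: of_real_minus add: expandable_add expandable_mult expandable_const expandable_coordinate)
      then show "\<exists>g. expandable g a \<and> (\<forall>x\<in>UNIV. Re (g x) = c i x)"
        by (intro exI conjI ballI) (assumption, simp add: c_def power2_eq_square)
    qed simp
    fix j :: 4
    show "polyfun (chain_vars i) 9 (\<lambda>v. 2 * (v (Inl j) - p $ j))"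
      using polyfun_mult[OF polyfun_const[of _ 1 2] polyfun_diff[OF polyfun_coordinate[of 8] polyfun_const[of _ 8 "p $ j"]], of i j]
      by simp
    fix x :: "real^4"
    have "((\<lambda>t. \<Sum>k\<in>UNIV. ((x + t *\<^sub>R axis j 1) $ k - p $ k)\<^sup>2) has_real_derivative
        (\<Sum>k\<in>UNIV. 2 * (x $ k - p $ k) * (axis j 1 $ k))) (at 0)"
      by (auto intro!: derivative_eq_intros sum.cong)
    moreover have "(\<Sum>k\<in>UNIV. 2 * (x $ k - p $ k) * (axis j 1 $ k)) = 2 * (x $ j - p $ j)"
      by (simp add: axis_def if_distrib[of "\<lambda>u. _ * u"] cong: if_cong)
    ultimately show "((\<lambda>t. c i (x + t *\<^sub>R axis j 1)) has_real_derivative 2 * (chain_point c x (Inl j) - p $ j)) (at 0)"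
      by (simp add: c_def chain_point_def)
  qed simp
  have "c 1 x = 0 \<longleftrightarrow> x = p" for x
    unfolding c_def by (subst sum_nonneg_eq_0_iff) (auto simp: vec_eq_iff)
  then have "{p} = {x\<in>UNIV. \<forall>j\<in>{1..1::nat}. c j x = 0}" by auto
  moreover have "\<forall>j\<in>{1..1::nat}. pfaffian 7 9 1 UNIV c (c j)" using pfaffian_chain_member[OF chain] by simp
  ultimately show ?thesis
    unfolding pfaffian_piece_def using simple_domain_UNIV chain
    by (intro exI[of _ UNIV] exI[of _ 1] exI[of _ c] conjI) auto
qed

text \<open>The argument is measured in the lattice basis and the value in a frame rotated by
  \<open>d\<close>. The linear map acts separately on the two complex coordinates.\<close>

lemma simple_domain_box:
  assumes Im: "Im (\<omega>2 / \<omega>1) \<noteq> 0" and d: "d \<noteq> 0"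
    and I: "open_interval I1" "open_interval I2" "open_interval I3" "open_interval I4"
  shows "simple_domain {complex_pair (of_real r1 * \<omega>1 + of_real r2 * \<omega>2) (d * Complex x y) | r1 r2 x y.
    r1 \<in> I1 \<and> r2 \<in> I2 \<and> x \<in> I3 \<and> y \<in> I4}"
proof -
  define f where "f = (\<lambda>v::real^4. complex_pair (of_real (v $ 1) * \<omega>1 + of_real (v $ 2) * \<omega>2) (d * Complex (v $ 3) (v $ 4)))"
  have lin: "linear f"
    by (rule linearI) (simp_all add: f_def complex_pair_def vec_eq_iff forall_4 vector_4 algebra_simps)
  have w1: "\<omega>1 \<noteq> 0" using Im by auto
  have "inj f"
  proof (rule injI)
    fix u v assume "f u = f v"
    then have 1: "of_real (u $ 1) * \<omega>1 + of_real (u $ 2) * \<omega>2 = of_real (v $ 1) * \<omega>1 + of_real (v $ 2) * \<omega>2"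
      and 2: "d * Complex (u $ 3) (u $ 4) = d * Complex (v $ 3) (v $ 4)"
      unfolding f_def by (metis complex_pair_simps)+
    have "of_real (u $ 1) + of_real (u $ 2) * (\<omega>2 / \<omega>1) = of_real (v $ 1) + of_real (v $ 2) * (\<omega>2 / \<omega>1)"
      using arg_cong[OF 1, of "\<lambda>z. z / \<omega>1"] w1 by (simp add: add_divide_distrib)
    moreover have "Im (of_real a + of_real b * t) = b * Im t" "Re (of_real a + of_real b * t) = a + b * Re t" for a b t
      by simp_all
    ultimately have "u $ 2 * Im (\<omega>2 / \<omega>1) = v $ 2 * Im (\<omega>2 / \<omega>1)" "u $ 1 + u $ 2 * Re (\<omega>2 / \<omega>1) = v $ 1 + v $ 2 * Re (\<omega>2 / \<omega>1)"
      by metis+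
    then have "u $ 2 = v $ 2" "u $ 1 = v $ 1" using Im by auto
    moreover have "u $ 3 = v $ 3" "u $ 4 = v $ 4" using 2 d by auto
    ultimately show "u = v" by (simp add: vec_eq_iff forall_4)
  qed
  moreover have fm: "matrix f *v x = f x" for x using matrix_works lin by (simp add: linear_matrix_vector_mul_eq)
  ultimately have "inj ((*v) (matrix f))" by (simp add: fm inj_def)
  then have inv: "invertible (matrix f)" using matrix_left_invertible_injective invertible_left_inverse by blast
  define I where "I = (\<lambda>k::4. if k = 1 then I1 else if k = 2 then I2 else if k = 3 then I3 else I4)"
  have "{complex_pair (of_real r1 * \<omega>1 + of_real r2 * \<omega>2) (d * Complex x y) | r1 r2 x y.
      r1 \<in> I1 \<and> r2 \<in> I2 \<and> x \<in> I3 \<and> y \<in> I4} = (\<lambda>x. matrix f *v x + 0) ` {x. \<forall>k. x $ k \<in> I k}"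
    (is "?A = ?B")
  proof
    show "?A \<subseteq> ?B"
    proof clarify
      fix r1 r2 x y assume "r1 \<in> I1" "r2 \<in> I2" "x \<in> I3" "y \<in> I4"
      then have "vector [r1, r2, x, y] \<in> {x :: real^4. \<forall>k. x $ k \<in> I k}" by (simp add: forall_4 vector_4 I_def)
      moreover have "complex_pair (of_real r1 * \<omega>1 + of_real r2 * \<omega>2) (d * Complex x y) = matrix f *v vector [r1, r2, x, y] + 0"
        unfolding fm by (simp add: f_def vector_4)
      ultimately show "complex_pair (of_real r1 * \<omega>1 + of_real r2 * \<omega>2) (d * Complex x y) \<in> ?B" by (rule rev_image_eqI)
    qed
    show "?B \<subseteq> ?A"
    proof clarify
      fix v :: "real^4" assume "\<forall>k. v $ k \<in> I k"
      then have "v $ 1 \<in> I1" "v $ 2 \<in> I2" "v $ 3 \<in> I3" "v $ 4 \<in> I4" by (auto simp: forall_4 I_def)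
      then show "\<exists>r1 r2 x y. matrix f *v v + 0 = complex_pair (of_real r1 * \<omega>1 + of_real r2 * \<omega>2) (d * Complex x y) \<and>
          r1 \<in> I1 \<and> r2 \<in> I2 \<and> x \<in> I3 \<and> y \<in> I4"
        unfolding fm by (intro exI[of _ "v $ 1"] exI[of _ "v $ 2"] exI[of _ "v $ 3"] exI[of _ "v $ 4"]) (simp add: f_def)
    qed
  qed
  moreover have "\<forall>k. open_interval (I k)" using I by (simp add: I_def)
  ultimately show ?thesis unfolding simple_domain_def using inv by blast
qed

lemma polyfun_mult_le: "polyfun V d f \<Longrightarrow> polyfun V e g \<Longrightarrow> d + e \<le> k \<Longrightarrow> polyfun V k (\<lambda>v. f v * g v)"
  by (rule polyfun_mono[OF polyfun_mult]) auto

lemma polyfun_cmult: "polyfun V d f \<Longrightarrow> polyfun V d (\<lambda>v. c * f v)"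
  using polyfun_mult[OF polyfun_const[of V 0 c]] by simp

lemma cpolyfun_mult_le: "cpolyfun V d f \<Longrightarrow> cpolyfun V e g \<Longrightarrow> d + e \<le> k \<Longrightarrow> cpolyfun V k (\<lambda>v. f v * g v)"
  using cpolyfun_mult[of V d f e g] polyfun_mono[of V "d + e" _ V k] by (auto simp: cpolyfun_def)

section \<open>The pfaffian chain attached to an inverse branch\<close>

lemma has_real_derivative_Re_line:
  assumes "(f has_field_derivative D) (at w)"
  shows "((\<lambda>t. Re (f (w + of_real t * \<eta>))) has_real_derivative Re (D * \<eta>)) (at 0)"
    "((\<lambda>t. Im (f (w + of_real t * \<eta>))) has_real_derivative Im (D * \<eta>)) (at 0)"
proof -
  have l: "((\<lambda>t. w + of_real t * \<eta>) has_vector_derivative \<eta>) (at 0)"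
    by (auto intro!: derivative_eq_intros simp: has_vector_derivative_def scaleR_conv_of_real)
  have "(f has_field_derivative D) (at (w + of_real 0 * \<eta>))" using assms by simp
  from field_vector_diff_chain_at[OF l this]
  have "((\<lambda>t. f (w + of_real t * \<eta>)) has_vector_derivative \<eta> * D) (at 0)" by (simp add: o_def)
  from bounded_linear.has_vector_derivative[OF bounded_linear_Re this]
    bounded_linear.has_vector_derivative[OF bounded_linear_Im this]
  show "((\<lambda>t. Re (f (w + of_real t * \<eta>))) has_real_derivative Re (D * \<eta>)) (at 0)"
    "((\<lambda>t. Im (f (w + of_real t * \<eta>))) has_real_derivative Im (D * \<eta>)) (at 0)"
    by (simp_all add: has_real_derivative_iff_has_vector_derivative mult.commute)
qed

text \<open>A branch of the logarithm of \<open>1 / sqrt ((w - e1) * (w - e2) * (w - e3))\<close>, up to a constant,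
  on a set where \<open>n * (w - e)\<close> lies in the right half plane for each factor.\<close>

definition log_root :: "complex \<Rightarrow> complex \<Rightarrow> complex \<Rightarrow> complex \<Rightarrow> complex \<Rightarrow> complex \<Rightarrow> complex \<Rightarrow> complex" where
  "log_root n1 n2 n3 e1 e2 e3 w = - (Ln (n1 * (w - e1)) + Ln (n2 * (w - e2)) + Ln (n3 * (w - e3))) / 2"

definition half_planes :: "complex \<Rightarrow> complex \<Rightarrow> complex \<Rightarrow> complex \<Rightarrow> complex \<Rightarrow> complex \<Rightarrow> complex set \<Rightarrow> bool" where
  "half_planes n1 n2 n3 e1 e2 e3 S \<longleftrightarrow> cmod n1 = 1 \<and> cmod n2 = 1 \<and> cmod n3 = 1 \<and>
     (\<forall>w\<in>S. Re (n1 * (w - e1)) > 0 \<and> Re (n2 * (w - e2)) > 0 \<and> Re (n3 * (w - e3)) > 0)"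

context
  fixes n1 n2 n3 e1 e2 e3 :: complex and S :: "complex set"
  assumes half: "half_planes n1 n2 n3 e1 e2 e3 S"
begin

abbreviation "L \<equiv> log_root n1 n2 n3 e1 e2 e3"

lemma half_planes_nonzero:
  assumes "w \<in> S"
  shows "w - e1 \<noteq> 0" "w - e2 \<noteq> 0" "w - e3 \<noteq> 0"
  using half assms by (auto simp: half_planes_def)

lemma half_planes_units: "n1 \<noteq> 0" "n2 \<noteq> 0" "n3 \<noteq> 0"
  using half by (auto simp: half_planes_def)

lemma log_root_deriv:
  assumes "w \<in> S"
  shows "(L has_field_derivative - (1 / (w - e1) + 1 / (w - e2) + 1 / (w - e3)) / 2) (at w)"
proof -
  have *: "((\<lambda>w. Ln (n * (w - e))) has_field_derivative 1 / (w - e)) (at w)" if "Re (n * (w - e)) > 0" "n \<noteq> 0" for n e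
  proof -
    have "n * (w - e) \<notin> \<real>\<^sub>\<le>\<^sub>0" using that(1) by (auto simp: complex_nonpos_Reals_iff)
    then show ?thesis using that by (auto intro!: derivative_eq_intros simp: divide_simps)
  qed
  have "Re (n1 * (w - e1)) > 0" "Re (n2 * (w - e2)) > 0" "Re (n3 * (w - e3)) > 0"
    using half assms by (auto simp: half_planes_def)
  then show ?thesis
    unfolding log_root_def using half_planes_units
    by (intro DERIV_cdivide DERIV_minus DERIV_add *)
qed

text \<open>Half the sum of three angles below \<open>pi / 2\<close>. Being below \<open>pi\<close>,
  it keeps \<open>Im (L w) / 2\<close> where the cosine is positive.\<close>

lemma log_root_Im:
  assumes "w \<in> S"
  shows "\<bar>Im (L w)\<bar> < 3 / 4 * pi"
proof -
  have "\<bar>Im (Ln z)\<bar> < pi / 2" if "Re z > 0" for z using Re_Ln_pos_lt_imp[OF that] .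
  then have "\<bar>Im (Ln (n1 * (w - e1)))\<bar> < pi / 2" "\<bar>Im (Ln (n2 * (w - e2)))\<bar> < pi / 2" "\<bar>Im (Ln (n3 * (w - e3)))\<bar> < pi / 2"
    using half assms by (auto simp: half_planes_def)
  moreover have "Im (L w) = - (Im (Ln (n1 * (w - e1))) + Im (Ln (n2 * (w - e2))) + Im (Ln (n3 * (w - e3)))) / 2"
    by (simp add: log_root_def)
  moreover have "\<bar>- (a + b + c) / 2\<bar> < 3 / 4 * p" if "\<bar>a\<bar> < p / 2" "\<bar>b\<bar> < p / 2" "\<bar>c\<bar> < p / 2" for a b c p :: real
  proof -
    have "\<bar>- (a + b + c) / 2\<bar> = \<bar>a + b + c\<bar> / 2" by simp
    also have "\<bar>a + b + c\<bar> \<le> \<bar>a\<bar> + \<bar>b\<bar> + \<bar>c\<bar>" by linarith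
    finally show ?thesis using that by simp
  qed
  ultimately show ?thesis by (simp only:)
qed

lemma log_root_exp:
  assumes "w \<in> S"
  shows "(exp (L w))\<^sup>2 * ((n1 * (w - e1)) * (n2 * (w - e2)) * (n3 * (w - e3))) = 1"
proof -
  have nz: "n1 * (w - e1) \<noteq> 0" "n2 * (w - e2) \<noteq> 0" "n3 * (w - e3) \<noteq> 0"
    using half_planes_nonzero[OF assms] half_planes_units by auto
  have "(exp (L w))\<^sup>2 = exp (2 * L w)" by (simp add: exp_double)
  also have "2 * L w = - (Ln (n1 * (w - e1)) + Ln (n2 * (w - e2)) + Ln (n3 * (w - e3)))"
    by (simp add: log_root_def)
  finally have "(exp (L w))\<^sup>2 = inverse ((n1 * (w - e1)) * (n2 * (w - e2)) * (n3 * (w - e3)))"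
    by (simp only: exp_minus exp_add exp_Ln[OF nz(1)] exp_Ln[OF nz(2)] exp_Ln[OF nz(3)])
  moreover have "(n1 * (w - e1)) * (n2 * (w - e2)) * (n3 * (w - e3)) \<noteq> 0" using nz by (simp only: mult_eq_0_iff) simp
  moreover have "x * y = 1" if "x = inverse y" "y \<noteq> 0" for x y :: complex using that by simp
  ultimately show ?thesis by blast
qed

lemma log_root_density:
  assumes "w \<in> S"
  shows "exp (4 * Re (L w)) * (cmod ((w - e1) * (w - e2) * (w - e3)))\<^sup>2 = 1"
proof -
  have n: "cmod n1 = 1" "cmod n2 = 1" "cmod n3 = 1" using half by (auto simp: half_planes_def)
  have "cmod ((exp (L w))\<^sup>2 * ((n1 * (w - e1)) * (n2 * (w - e2)) * (n3 * (w - e3)))) = 1"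
    unfolding log_root_exp[OF assms] by simp
  then have a: "(exp (Re (L w)))\<^sup>2 * cmod ((w - e1) * (w - e2) * (w - e3)) = 1"
    by (simp only: norm_mult norm_power n norm_exp_eq_Re mult_1)
  have "exp (4 * Re (L w)) = ((exp (Re (L w)))\<^sup>2)\<^sup>2"
    by (simp flip: power_mult exp_of_nat_mult)
  then have "exp (4 * Re (L w)) * (cmod ((w - e1) * (w - e2) * (w - e3)))\<^sup>2 = ((exp (Re (L w)))\<^sup>2 * cmod ((w - e1) * (w - e2) * (w - e3)))\<^sup>2"
    by (simp only: power_mult_distrib)
  then show ?thesis using a by simp
qed

text \<open>Minus half the product of \<open>Q'\<close> and \<open>cnj Q\<close> for the cubic
  \<open>Q\<close> with roots \<open>e1, e2, e3\<close>: the numerator of the derivative of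
  \<open>L\<close> over the denominator \<open>(cmod Q)^2\<close>. Its degree in the real
  coordinates is 2 + 3.\<close>

definition log_root_num :: "complex \<Rightarrow> complex" where
  "log_root_num w = - (((w - e2) * (w - e3) + (w - e1) * (w - e3) + (w - e1) * (w - e2)) * cnj ((w - e1) * (w - e2) * (w - e3))) / 2"

lemma log_root_deriv_num:
  assumes "w \<in> S"
  shows "(L has_field_derivative log_root_num w * of_real (exp (4 * Re (L w)))) (at w)"
proof -
  let ?Q = "(w - e1) * (w - e2) * (w - e3)"
  note nz = half_planes_nonzero[OF assms]
  have "of_real (exp (4 * Re (L w)) * (cmod ?Q)\<^sup>2) = (1 :: complex)" using log_root_density[OF assms] by simp
  then have "of_real (exp (4 * Re (L w))) * (?Q * cnj ?Q) = (1 :: complex)"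
    by (simp only: of_real_mult complex_norm_square)
  moreover have "c * r = 1 / Q" if "r * (Q * c) = 1" "Q \<noteq> 0" for Q c r :: complex
    using that by (simp add: field_simps)
  moreover have "?Q \<noteq> 0" using nz by simp
  ultimately have "cnj ?Q * of_real (exp (4 * Re (L w))) = 1 / ?Q" by blast
  then have "log_root_num w * of_real (exp (4 * Re (L w))) = - (((w - e2) * (w - e3) + (w - e1) * (w - e3) + (w - e1) * (w - e2)) * (1 / ?Q)) / 2"
    unfolding log_root_num_def by (simp add: mult.assoc)
  also have "\<dots> = - (1 / (w - e1) + 1 / (w - e2) + 1 / (w - e3)) / 2"
    using nz by (simp add: divide_simps) (simp add: algebra_simps)
  finally show ?thesis using log_root_deriv[OF assms] by (simp only:)
qed

text \<open>Double angle formulas, with the sine written through \<open>tan\<close> and the squared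
  cosine, make \<open>exp (L w)\<close> a polynomial of degree at most 3 in the chain functions 2, 3
  and 4.\<close>

lemma exp_log_root_half_angle:
  assumes "w \<in> S"
  shows "exp (L w) = Complex (exp (Re (L w)) * (2 * (cos (Im (L w) / 2))\<^sup>2 - 1))
     (exp (Re (L w)) * (2 * (tan (Im (L w) / 2) * (cos (Im (L w) / 2))\<^sup>2)))" "cos (Im (L w) / 2) \<noteq> 0"
proof -
  let ?\<phi> = "Im (L w)"
  have "\<bar>?\<phi> / 2\<bar> < pi / 2" using log_root_Im[OF assms] pi_gt_zero by simp
  then have c: "cos (?\<phi> / 2) > 0" by (intro cos_gt_zero_pi) auto
  then show "cos (?\<phi> / 2) \<noteq> 0" by simp
  have "cos ?\<phi> = 2 * (cos (?\<phi> / 2))\<^sup>2 - 1" using cos_double_cos[of "?\<phi> / 2"] by simp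
  moreover have "sin ?\<phi> = 2 * (tan (?\<phi> / 2) * (cos (?\<phi> / 2))\<^sup>2)"
    using sin_double[of "?\<phi> / 2"] c by (simp add: tan_def power2_eq_square)
  ultimately show "exp (L w) = Complex (exp (Re (L w)) * (2 * (cos (?\<phi> / 2))\<^sup>2 - 1))
     (exp (Re (L w)) * (2 * (tan (?\<phi> / 2) * (cos (?\<phi> / 2))\<^sup>2)))"
    by (simp add: complex_eq_iff Re_exp Im_exp)
qed

text \<open>The order makes every derivative depend only on functions up to its own index. In the
  last function the real linear form is zero for the interior of the fundamental domain and cuts out
  a line for its edges.\<close>

definition branch_chain :: "(complex \<Rightarrow> complex) \<Rightarrow> real \<Rightarrow> real \<Rightarrow> nat \<Rightarrow> real^4 \<Rightarrow> real" where
  "branch_chain u A B i x = (let z = fst_complex x; w = snd_complex x in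
     if i = 1 then exp (4 * Re (L w)) else if i = 2 then exp (Re (L w)) else if i = 3 then tan (Im (L w) / 2)
     else if i = 4 then (cos (Im (L w) / 2))\<^sup>2 else if i = 5 then Re (u w) else if i = 6 then Im (u w)
     else (cmod (z - u w))\<^sup>2 + (A * Re z + B * Im z)\<^sup>2)"

text \<open>\<open>\<zeta>\<close> and \<open>\<eta>\<close> are the motions of \<open>z\<close> and
  \<open>w\<close> along the \<open>j\<close>-th axis, and \<open>E\<close> is the resulting motion
  of \<open>u w\<close>. The factor \<open>v (Inr 1)\<close> supplies the denominator of the
  derivative of \<open>L\<close>.\<close>

definition branch_poly :: "complex \<Rightarrow> real \<Rightarrow> real \<Rightarrow> nat \<Rightarrow> 4 \<Rightarrow> (4 + nat \<Rightarrow> real) \<Rightarrow> real" where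
  "branch_poly \<epsilon> A B i j v = (
     let w = Complex (v (Inl 3)) (v (Inl 4)); z = Complex (v (Inl 1)) (v (Inl 2));
       \<zeta> = fst_complex (axis j 1); \<eta> = snd_complex (axis j 1); N = log_root_num w * \<eta>;
       E = \<epsilon> * Complex (v (Inr 2) * (2 * v (Inr 4) - 1)) (v (Inr 2) * (2 * (v (Inr 3) * v (Inr 4)))) * \<eta> in
     if i = 1 then 4 * (v (Inr 1) * (v (Inr 1) * Re N)) else if i = 2 then v (Inr 2) * (v (Inr 1) * Re N)
     else if i = 3 then 1/2 * ((1 + v (Inr 3) * v (Inr 3)) * (v (Inr 1) * Im N))
     else if i = 4 then - (v (Inr 3) * (v (Inr 4) * (v (Inr 1) * Im N)))
     else if i = 5 then Re E else if i = 6 then Im E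
     else 2 * Re (cnj (z - Complex (v (Inr 5)) (v (Inr 6))) * (\<zeta> - E))
       + 2 * ((A * v (Inl 1) + B * v (Inl 2)) * (A * Re \<zeta> + B * Im \<zeta>)))"

text \<open>The bound counts 5 for \<open>log_root_num\<close>, 1 for its denominator and the degree
  of the outer derivative; it is largest for the tangent and the squared cosine, namely 8.\<close>

lemma branch_poly_polyfun:
  assumes i: "i \<in> {1..7}"
  shows "polyfun (chain_vars i) 9 (branch_poly \<epsilon> A B i j)"
proof -
  let ?V = "chain_vars i :: (4 + nat) set"
  have w: "cpolyfun ?V 1 (\<lambda>v. Complex (v (Inl 3)) (v (Inl 4)) - e)" for e
    by (intro cpolyfun_diff cpolyfun_Complex polyfun_coordinate cpolyfun_const) auto
  have Q: "cpolyfun ?V 3 (\<lambda>v. (Complex (v (Inl 3)) (v (Inl 4)) - e1) * (Complex (v (Inl 3)) (v (Inl 4)) - e2) * (Complex (v (Inl 3)) (v (Inl 4)) - e3))"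
    by (rule cpolyfun_mult_le[OF cpolyfun_mult_le[OF w w, of 2] w]) auto
  have w2: "cpolyfun ?V 2 (\<lambda>v. (Complex (v (Inl 3)) (v (Inl 4)) - e) * (Complex (v (Inl 3)) (v (Inl 4)) - e'))" for e e'
    by (rule cpolyfun_mult_le[OF w w]) auto
  have "cpolyfun ?V 5 (\<lambda>v. (- 1 / 2) * (((Complex (v (Inl 3)) (v (Inl 4)) - e2) * (Complex (v (Inl 3)) (v (Inl 4)) - e3)
      + (Complex (v (Inl 3)) (v (Inl 4)) - e1) * (Complex (v (Inl 3)) (v (Inl 4)) - e3)
      + (Complex (v (Inl 3)) (v (Inl 4)) - e1) * (Complex (v (Inl 3)) (v (Inl 4)) - e2)) *
      cnj ((Complex (v (Inl 3)) (v (Inl 4)) - e1) * (Complex (v (Inl 3)) (v (Inl 4)) - e2) * (Complex (v (Inl 3)) (v (Inl 4)) - e3))))"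
    by (rule cpolyfun_mult_le[OF cpolyfun_const[of _ 0] cpolyfun_mult_le[OF cpolyfun_add[OF cpolyfun_add[OF w2 w2] w2] cpolyfun_cnj[OF Q], of 5]]) auto
  then have log_root_num: "cpolyfun ?V 5 (\<lambda>v. log_root_num (Complex (v (Inl 3)) (v (Inl 4))))"
    unfolding log_root_num_def by (rule back_subst[of "cpolyfun ?V 5"]) (simp add: fun_eq_iff)
  have N: "cpolyfun ?V 5 (\<lambda>v. log_root_num (Complex (v (Inl 3)) (v (Inl 4))) * \<eta>)" for \<eta>
    by (rule cpolyfun_mult_le[OF log_root_num cpolyfun_const[of _ 0]]) auto
  have NRe: "polyfun ?V 5 (\<lambda>v. Re (log_root_num (Complex (v (Inl 3)) (v (Inl 4))) * \<eta>))"
    and NIm: "polyfun ?V 5 (\<lambda>v. Im (log_root_num (Complex (v (Inl 3)) (v (Inl 4))) * \<eta>))" for \<eta>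
    using N[of \<eta>] by (auto simp: cpolyfun_def)
  have c: "m \<in> {1..i} \<Longrightarrow> polyfun ?V 1 (\<lambda>v. v (Inr m))" for m by (rule polyfun_chain) auto
  have E: "cpolyfun ?V 3 (\<lambda>v. \<epsilon> * Complex (v (Inr 2) * (2 * v (Inr 4) - 1)) (v (Inr 2) * (2 * (v (Inr 3) * v (Inr 4)))) * \<eta>)"
    if "i \<ge> 4" for \<eta>
  proof -
    have m: "2 \<in> {1..i}" "3 \<in> {1..i}" "4 \<in> {1..i}" using that by auto
    have a: "polyfun ?V 3 (\<lambda>v. v (Inr 2) * (2 * v (Inr 4) - 1))"
      by (rule polyfun_mult_le[OF c[OF m(1)] polyfun_diff[OF polyfun_cmult[OF c[OF m(3)]] polyfun_const]]) auto
    have b: "polyfun ?V 3 (\<lambda>v. v (Inr 2) * (2 * (v (Inr 3) * v (Inr 4))))"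
      by (rule polyfun_mult_le[OF c[OF m(1)] polyfun_cmult[OF polyfun_mult_le[OF c[OF m(2)] c[OF m(3)], of 2]]]) auto
    show ?thesis
      by (rule cpolyfun_mult_le[OF cpolyfun_mult_le[OF cpolyfun_const[of _ 0] cpolyfun_Complex[OF a b], of 3] cpolyfun_const[of _ 0]]) auto
  qed
  have EE: "polyfun ?V 3 (\<lambda>v. Re (\<epsilon> * Complex (v (Inr 2) * (2 * v (Inr 4) - 1)) (v (Inr 2) * (2 * (v (Inr 3) * v (Inr 4)))) * \<eta>))"
    "polyfun ?V 3 (\<lambda>v. Im (\<epsilon> * Complex (v (Inr 2) * (2 * v (Inr 4) - 1)) (v (Inr 2) * (2 * (v (Inr 3) * v (Inr 4)))) * \<eta>))"
    if "i \<ge> 4" for \<eta>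
    using E[OF that, of \<eta>] by (simp_all only: cpolyfun_def)
  let ?\<eta> = "snd_complex (axis j 1)" and ?\<zeta> = "fst_complex (axis j 1)"
  have eq1: "branch_poly \<epsilon> A B 1 j = (\<lambda>v. 4 * (v (Inr 1) * (v (Inr 1) * Re (log_root_num (Complex (v (Inl 3)) (v (Inl 4))) * snd_complex (axis j 1)))))"
    by (simp only: fun_eq_iff branch_poly_def Let_def) simp
  have eq2: "branch_poly \<epsilon> A B 2 j = (\<lambda>v. v (Inr 2) * (v (Inr 1) * Re (log_root_num (Complex (v (Inl 3)) (v (Inl 4))) * snd_complex (axis j 1))))"
    by (simp only: fun_eq_iff branch_poly_def Let_def) simp
  have eq3: "branch_poly \<epsilon> A B 3 j = (\<lambda>v. 1/2 * ((1 + v (Inr 3) * v (Inr 3)) * (v (Inr 1) * Im (log_root_num (Complex (v (Inl 3)) (v (Inl 4))) * snd_complex (axis j 1)))))"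
    by (simp only: fun_eq_iff branch_poly_def Let_def) simp
  have eq4: "branch_poly \<epsilon> A B 4 j = (\<lambda>v. - (v (Inr 3) * (v (Inr 4) * (v (Inr 1) * Im (log_root_num (Complex (v (Inl 3)) (v (Inl 4))) * snd_complex (axis j 1))))))"
    by (simp only: fun_eq_iff branch_poly_def Let_def) simp
  have eq5: "branch_poly \<epsilon> A B 5 j = (\<lambda>v. Re (\<epsilon> * Complex (v (Inr 2) * (2 * v (Inr 4) - 1)) (v (Inr 2) * (2 * (v (Inr 3) * v (Inr 4)))) * ?\<eta>))"
    by (simp only: fun_eq_iff branch_poly_def Let_def) simp
  have eq6: "branch_poly \<epsilon> A B 6 j = (\<lambda>v. Im (\<epsilon> * Complex (v (Inr 2) * (2 * v (Inr 4) - 1)) (v (Inr 2) * (2 * (v (Inr 3) * v (Inr 4)))) * ?\<eta>))"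
    by (simp only: fun_eq_iff branch_poly_def Let_def) simp
  have eq7: "branch_poly \<epsilon> A B 7 j = (\<lambda>v. 2 * Re (cnj (Complex (v (Inl 1)) (v (Inl 2)) - Complex (v (Inr 5)) (v (Inr 6))) * (?\<zeta> - \<epsilon> * Complex (v (Inr 2) * (2 * v (Inr 4) - 1)) (v (Inr 2) * (2 * (v (Inr 3) * v (Inr 4)))) * ?\<eta>)) + 2 * ((A * v (Inl 1) + B * v (Inl 2)) * (A * Re ?\<zeta> + B * Im ?\<zeta>)))"
    by (simp only: fun_eq_iff branch_poly_def Let_def) simp
  have mono: "polyfun ?V d f \<Longrightarrow> d \<le> 9 \<Longrightarrow> polyfun ?V 9 f" for d f by (rule polyfun_mono) auto
  consider "i = 1" | "i = 2" | "i = 3" | "i = 4" | "i = 5" | "i = 6" | "i = 7" using i by force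
  then show ?thesis
  proof cases
    case 1
    then have m: "1 \<in> {1..i}" by auto
    have "polyfun ?V 7 (\<lambda>v. 4 * (v (Inr 1) * (v (Inr 1) * Re (log_root_num (Complex (v (Inl 3)) (v (Inl 4))) * snd_complex (axis j 1)))))"
      by (rule polyfun_cmult[OF polyfun_mult_le[OF c[OF m] polyfun_mult_le[OF c[OF m] NRe, of 6]]]) auto
    from mono[OF this] show ?thesis using 1 by (simp only: eq1)
  next
    case 2
    then have m: "1 \<in> {1..i}" "2 \<in> {1..i}" by auto
    have "polyfun ?V 7 (\<lambda>v. v (Inr 2) * (v (Inr 1) * Re (log_root_num (Complex (v (Inl 3)) (v (Inl 4))) * snd_complex (axis j 1))))"
      by (rule polyfun_mult_le[OF c[OF m(2)] polyfun_mult_le[OF c[OF m(1)] NRe, of 6]]) auto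
    from mono[OF this] show ?thesis using 2 by (simp only: eq2)
  next
    case 3
    then have m: "1 \<in> {1..i}" "3 \<in> {1..i}" by auto
    have "polyfun ?V 8 (\<lambda>v. 1/2 * ((1 + v (Inr 3) * v (Inr 3)) * (v (Inr 1) * Im (log_root_num (Complex (v (Inl 3)) (v (Inl 4))) * snd_complex (axis j 1)))))"
      by (rule polyfun_cmult[OF polyfun_mult_le[OF polyfun_add[OF polyfun_const polyfun_mult_le[OF c[OF m(2)] c[OF m(2)], of 2]] polyfun_mult_le[OF c[OF m(1)] NIm, of 6]]]) auto
    from mono[OF this] show ?thesis using 3 by (simp only: eq3)
  next
    case 4
    then have m: "1 \<in> {1..i}" "3 \<in> {1..i}" "4 \<in> {1..i}" by auto
    have "polyfun ?V 8 (\<lambda>v. - (v (Inr 3) * (v (Inr 4) * (v (Inr 1) * Im (log_root_num (Complex (v (Inl 3)) (v (Inl 4))) * snd_complex (axis j 1))))))"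
      by (rule polyfun_minus[OF polyfun_mult_le[OF c[OF m(2)] polyfun_mult_le[OF c[OF m(3)] polyfun_mult_le[OF c[OF m(1)] NIm, of 6], of 7]]]) auto
    from mono[OF this] show ?thesis using 4 by (simp only: eq4)
  next
    case 5
    then have "4 \<le> i" by simp
    from mono[OF EE(1)[OF this, of ?\<eta>]] show ?thesis using 5 by (simp only: eq5)
  next
    case 6
    then have "4 \<le> i" by simp
    from mono[OF EE(2)[OF this, of ?\<eta>]] show ?thesis using 6 by (simp only: eq6)
  next
    case 7
    then have m: "5 \<in> {1..i}" "6 \<in> {1..i}" by auto
    have a: "cpolyfun ?V 1 (\<lambda>v. cnj (Complex (v (Inl 1)) (v (Inl 2)) - Complex (v (Inr 5)) (v (Inr 6))))"
      by (intro cpolyfun_cnj cpolyfun_diff cpolyfun_Complex polyfun_coordinate c m) auto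
    have b: "cpolyfun ?V 3 (\<lambda>v. ?\<zeta> - \<epsilon> * Complex (v (Inr 2) * (2 * v (Inr 4) - 1)) (v (Inr 2) * (2 * (v (Inr 3) * v (Inr 4)))) * ?\<eta>)"
      using 7 by (intro cpolyfun_diff cpolyfun_const E) auto
    have "cpolyfun ?V 4 (\<lambda>v. cnj (Complex (v (Inl 1)) (v (Inl 2)) - Complex (v (Inr 5)) (v (Inr 6))) * (?\<zeta> - \<epsilon> * Complex (v (Inr 2) * (2 * v (Inr 4) - 1)) (v (Inr 2) * (2 * (v (Inr 3) * v (Inr 4)))) * ?\<eta>))"
      by (rule cpolyfun_mult_le[OF a b]) auto
    then have d: "polyfun ?V 4 (\<lambda>v. Re (cnj (Complex (v (Inl 1)) (v (Inl 2)) - Complex (v (Inr 5)) (v (Inr 6))) * (?\<zeta> - \<epsilon> * Complex (v (Inr 2) * (2 * v (Inr 4) - 1)) (v (Inr 2) * (2 * (v (Inr 3) * v (Inr 4)))) * ?\<eta>)))"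
      by (simp only: cpolyfun_def)
    have "polyfun ?V 4 (\<lambda>v. (A * v (Inl 1) + B * v (Inl 2)) * (A * Re ?\<zeta> + B * Im ?\<zeta>))"
      by (rule polyfun_mult_le[OF polyfun_add[OF polyfun_cmult[OF polyfun_coordinate[of 1]] polyfun_cmult[OF polyfun_coordinate[of 1]]] polyfun_const[of _ 0]]) auto
    from mono[OF polyfun_add[OF polyfun_cmult[OF d, of 2] polyfun_cmult[OF this, of 2]]]
    show ?thesis using 7 by (simp only: eq7)
  qed
qed

lemma branch_chain_deriv:
  assumes u: "\<And>w. w \<in> S \<Longrightarrow> (u has_field_derivative \<epsilon> * exp (L w)) (at w)"
    and i: "i \<in> {1..7}" and x: "snd_complex x \<in> S"
  shows "((\<lambda>t. branch_chain u A B i (x + t *\<^sub>R axis j 1)) has_real_derivative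
     branch_poly \<epsilon> A B i j (chain_point (branch_chain u A B) x)) (at 0)"
proof -
  define w where "w = snd_complex x"
  define z where "z = fst_complex x"
  define \<eta> where "\<eta> = snd_complex (axis j 1)"
  define \<zeta> where "\<zeta> = fst_complex (axis j 1)"
  define q where "q = exp (4 * Re (L w))"
  have wS: "w \<in> S" using x by (simp add: w_def)
  have cw: "Complex (x $ 3) (x $ 4) = w" and cz: "Complex (x $ 1) (x $ 2) = z"
    by (simp_all add: w_def z_def snd_complex_def fst_complex_def complex_eq_iff)
  have line: "snd_complex (x + t *\<^sub>R axis j 1) = w + of_real t * \<eta>" "fst_complex (x + t *\<^sub>R axis j 1) = z + of_real t * \<zeta>" for t
    by (simp_all add: complex_pair_add complex_pair_scale w_def z_def \<eta>_def \<zeta>_def)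
  have Re_L: "((\<lambda>t. Re (L (w + of_real t * \<eta>))) has_real_derivative q * Re (log_root_num w * \<eta>)) (at 0)"
    and Im_L: "((\<lambda>t. Im (L (w + of_real t * \<eta>))) has_real_derivative q * Im (log_root_num w * \<eta>)) (at 0)"
    using has_real_derivative_Re_line[OF log_root_deriv_num[OF wS], of \<eta>]
    by (simp_all add: q_def mult.commute[of _ "of_real _"] mult.assoc)
  have cs: "cos (Im (L w) / 2) \<noteq> 0" by (rule exp_log_root_half_angle(2)[OF wS])
  define E where "E = \<epsilon> * exp (L w) * \<eta>"
  have E: "E = \<epsilon> * Complex (exp (Re (L w)) * (2 * (cos (Im (L w) / 2))\<^sup>2 - 1))
     (exp (Re (L w)) * (2 * (tan (Im (L w) / 2) * (cos (Im (L w) / 2))\<^sup>2))) * \<eta>"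
    unfolding E_def exp_log_root_half_angle(1)[OF wS] ..
  have Re_u: "((\<lambda>t. Re (u (w + of_real t * \<eta>))) has_real_derivative Re E) (at 0)"
    and Im_u: "((\<lambda>t. Im (u (w + of_real t * \<eta>))) has_real_derivative Im E) (at 0)"
    using has_real_derivative_Re_line[OF u[OF wS], of \<eta>] by (simp_all add: E_def)
  have cp: "chain_point (branch_chain u A B) x (Inl k) = x $ k" "chain_point (branch_chain u A B) x (Inr m) = branch_chain u A B m x" for k m
    by (simp_all add: chain_point_def)
  have bc: "branch_chain u A B 1 x = q" "branch_chain u A B 2 x = exp (Re (L w))" "branch_chain u A B 3 x = tan (Im (L w) / 2)"
    "branch_chain u A B 4 x = (cos (Im (L w) / 2))\<^sup>2" "branch_chain u A B 5 x = Re (u w)" "branch_chain u A B 6 x = Im (u w)"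
    by (simp_all add: branch_chain_def Let_def w_def q_def)
  note simps = branch_poly_def Let_def cp bc cw cz \<eta>_def[symmetric] \<zeta>_def[symmetric] E[symmetric] branch_chain_def line
  consider "i = 1" | "i = 2" | "i = 3" | "i = 4" | "i = 5" | "i = 6" | "i = 7" using i by force
  then show ?thesis
  proof cases
    case 1
    have "((\<lambda>t. exp (4 * Re (L (w + of_real t * \<eta>)))) has_real_derivative 4 * (q * (q * Re (log_root_num w * \<eta>)))) (at 0)"
      by (rule derivative_eq_intros Re_L refl)+ (simp add: q_def)
    then show ?thesis unfolding simps using 1 by (simp add: q_def w_def)
  next
    case 2
    have "((\<lambda>t. exp (Re (L (w + of_real t * \<eta>)))) has_real_derivative exp (Re (L w)) * (q * Re (log_root_num w * \<eta>))) (at 0)"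
      by (rule derivative_eq_intros Re_L refl)+ simp
    then show ?thesis unfolding simps using 2 by (simp add: q_def w_def z_def)
  next
    case 3
    have "((\<lambda>t. Im (L (w + of_real t * \<eta>)) / 2) has_real_derivative (q * Im (log_root_num w * \<eta>)) / 2) (at 0)"
      by (rule DERIV_cdivide[OF Im_L])
    moreover have "(tan has_real_derivative inverse ((cos (Im (L w) / 2))\<^sup>2)) (at (Im (L (w + of_real 0 * \<eta>)) / 2))"
      using DERIV_tan[OF cs] by simp
    ultimately have "((\<lambda>t. tan (Im (L (w + of_real t * \<eta>)) / 2)) has_real_derivative inverse ((cos (Im (L w) / 2))\<^sup>2) * ((q * Im (log_root_num w * \<eta>)) / 2)) (at 0)"
      by (rule DERIV_chain2[rotated])
    moreover have "inverse ((cos (Im (L w) / 2))\<^sup>2) = 1 + tan (Im (L w) / 2) * tan (Im (L w) / 2)"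
      using tan_sec[OF cs] by (simp add: power2_eq_square)
    ultimately have "((\<lambda>t. tan (Im (L (w + of_real t * \<eta>)) / 2)) has_real_derivative
        1/2 * ((1 + tan (Im (L w) / 2) * tan (Im (L w) / 2)) * (q * Im (log_root_num w * \<eta>)))) (at 0)"
      by (simp only: mult_ac times_divide_eq_right times_divide_eq_left mult_1 mult_1_right)
    then show ?thesis unfolding simps using 3 by (simp add: q_def w_def z_def)
  next
    case 4
    have "((\<lambda>t. (cos (Im (L (w + of_real t * \<eta>)) / 2))\<^sup>2) has_real_derivative
        - (sin (Im (L w) / 2) * cos (Im (L w) / 2) * (q * Im (log_root_num w * \<eta>)))) (at 0)"
      by (rule derivative_eq_intros Im_L refl | simp)+
    moreover have "sin (Im (L w) / 2) * cos (Im (L w) / 2) = tan (Im (L w) / 2) * (cos (Im (L w) / 2))\<^sup>2"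
      using cs by (simp add: tan_def power2_eq_square)
    ultimately have "((\<lambda>t. (cos (Im (L (w + of_real t * \<eta>)) / 2))\<^sup>2) has_real_derivative
        - (tan (Im (L w) / 2) * ((cos (Im (L w) / 2))\<^sup>2 * (q * Im (log_root_num w * \<eta>))))) (at 0)"
      by (simp only: mult.assoc)
    then show ?thesis unfolding simps using 4 by (simp add: q_def w_def z_def)
  next
    case 5
    have "branch_poly \<epsilon> A B 5 j (chain_point (branch_chain u A B) x) = Re E"
      by (simp only: branch_poly_def Let_def cp bc E \<eta>_def) simp
    then show ?thesis using 5 Re_u by (simp add: branch_chain_def Let_def line)
  next
    case 6
    have "branch_poly \<epsilon> A B 6 j (chain_point (branch_chain u A B) x) = Im E"
      by (simp only: branch_poly_def Let_def cp bc E \<eta>_def) simp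
    then show ?thesis using 6 Im_u by (simp add: branch_chain_def Let_def line)
  next
    case 7
    have cu: "Complex (Re (u w)) (Im (u w)) = u w" by simp
    define a b where "a = (\<lambda>t. Re z + t * Re \<zeta> - Re (u (w + of_real t * \<eta>)))" and "b = (\<lambda>t. Im z + t * Im \<zeta> - Im (u (w + of_real t * \<eta>)))"
    have da: "(a has_real_derivative Re \<zeta> - Re E) (at 0)" "(b has_real_derivative Im \<zeta> - Im E) (at 0)"
      unfolding a_def b_def by (rule derivative_eq_intros Re_u Im_u refl | simp)+
    have "((\<lambda>t. (a t)\<^sup>2 + (b t)\<^sup>2 + (A * (Re z + t * Re \<zeta>) + B * (Im z + t * Im \<zeta>))\<^sup>2) has_real_derivative
        2 * (a 0 * (Re \<zeta> - Re E)) + 2 * (b 0 * (Im \<zeta> - Im E)) + 2 * ((A * Re z + B * Im z) * (A * Re \<zeta> + B * Im \<zeta>))) (at 0)"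
      by (rule derivative_eq_intros da refl | simp)+
    moreover have "2 * (a 0 * (Re \<zeta> - Re E)) + 2 * (b 0 * (Im \<zeta> - Im E)) = 2 * Re (cnj (z - u w) * (\<zeta> - E))"
      by (simp add: a_def b_def algebra_simps)
    moreover have "(a t)\<^sup>2 + (b t)\<^sup>2 = (cmod (z + of_real t * \<zeta> - u (w + of_real t * \<eta>)))\<^sup>2" for t
      unfolding a_def b_def cmod_power2 by simp
    moreover have xz: "x $ 1 = Re z" "x $ 2 = Im z" by (simp_all add: cz[symmetric])
    moreover have "branch_poly \<epsilon> A B 7 j (chain_point (branch_chain u A B) x)
        = 2 * Re (cnj (z - u w) * (\<zeta> - E)) + 2 * ((A * Re z + B * Im z) * (A * Re \<zeta> + B * Im \<zeta>))"
      by (simp only: branch_poly_def Let_def cp bc E \<eta>_def \<zeta>_def cz cu xz) simp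
    moreover have "Re (z + of_real t * \<zeta>) = Re z + t * Re \<zeta>" "Im (z + of_real t * \<zeta>) = Im z + t * Im \<zeta>" for t
      by simp_all
    ultimately show ?thesis using 7 by (simp only:) (simp add: branch_chain_def Let_def line)
  qed
qed

text \<open>\<open>L\<close> and \<open>u\<close> are holomorphic in \<open>w\<close>. Their real
  and imaginary parts, regarded as complex numbers, are inserted into complex \<open>exp\<close>,
  \<open>cos\<close> and \<open>tan\<close>, the last on the open set where the cosine is
  nonzero.\<close>

lemma branch_chain_analytic:
  assumes u: "\<And>w. w \<in> S \<Longrightarrow> (u has_field_derivative \<epsilon> * exp (L w)) (at w)" and S: "open S"
    and U: "open U" "\<And>x. x \<in> U \<Longrightarrow> snd_complex x \<in> S" and i: "i \<in> {1..7}"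
  shows "real_analytic_on (branch_chain u A B i) U"
proof (rule real_analytic_onI[OF _ U(1)])
  fix a assume a: "a \<in> U"
  have Lh: "L holomorphic_on S" using log_root_deriv S holomorphic_on_open by blast
  have uh: "u holomorphic_on S" using u S holomorphic_on_open by blast
  have La: "expandable (\<lambda>x. L (snd_complex x)) a"
    by (rule expandable_compose[OF expandable_fst_snd_complex(2) Lh S U(2)[OF a]])
  have ua: "expandable (\<lambda>x. u (snd_complex x)) a"
    by (rule expandable_compose[OF expandable_fst_snd_complex(2) uh S U(2)[OF a]])
  have expR: "expandable (\<lambda>x. exp (k * of_real (Re (L (snd_complex x))))) a" for k
    by (rule expandable_compose[OF expandable_mult[OF expandable_const expandable_Re[OF La]] holomorphic_on_exp open_UNIV]) simp
  have half: "expandable (\<lambda>x. of_real (Im (L (snd_complex x))) * (1/2)) a"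
    by (intro expandable_mult expandable_Im La expandable_const)
  let ?C = "{z :: complex. cos z \<noteq> 0}"
  have oC: "open ?C" by (intro open_Collect_neq continuous_intros)
  have cosin: "of_real (Im (L (snd_complex a))) * (1/2) \<in> ?C"
  proof -
    have "of_real (Im (L (snd_complex a))) * (1/2) = complex_of_real (Im (L (snd_complex a)) / 2)" by simp
    then show ?thesis using exp_log_root_half_angle(2)[OF U(2)[OF a]] by (simp only: mem_Collect_eq cos_of_real of_real_eq_0_iff) simp
  qed
  have "(\<lambda>z. sin z / cos z) holomorphic_on ?C" by (intro holomorphic_intros) auto
  then have tanh: "tan holomorphic_on ?C" by (simp add: tan_def[abs_def])
  note tana = expandable_compose[OF half tanh oC cosin]
  have cosa: "expandable (\<lambda>x. cos (of_real (Im (L (snd_complex x))) * (1/2))) a"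
    by (rule expandable_compose[OF half holomorphic_on_cos open_UNIV]) simp
  consider "i = 1" | "i = 2" | "i = 3" | "i = 4" | "i = 5" | "i = 6" | "i = 7" using i by force
  then show "\<exists>g. expandable g a \<and> (\<forall>x\<in>U. Re (g x) = branch_chain u A B i x)"
  proof cases
    case 1
    then show ?thesis using expR[of 4] by (intro exI[of _ "\<lambda>x. exp (4 * of_real (Re (L (snd_complex x))))"]) (simp add: branch_chain_def Let_def Re_exp)
  next
    case 2
    then show ?thesis using expR[of 1] by (intro exI[of _ "\<lambda>x. exp (1 * of_real (Re (L (snd_complex x))))"]) (simp add: branch_chain_def Let_def Re_exp)
  next
    case 3
    have "tan (of_real y * (1/2)) = complex_of_real (tan (y / 2))" for y
      using tan_of_real[of "y / 2", where 'a = complex] by simp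
    then show ?thesis using tana 3 by (intro exI[of _ "\<lambda>x. tan (of_real (Im (L (snd_complex x))) * (1/2))"]) (simp add: branch_chain_def Let_def)
  next
    case 4
    have "cos (of_real y * (1/2)) = complex_of_real (cos (y / 2))" for y
      using cos_of_real[of "y / 2", where 'a = complex] by simp
    then show ?thesis using expandable_mult[OF cosa cosa] 4
      by (intro exI conjI ballI) (assumption, simp add: branch_chain_def Let_def power2_eq_square)
  next
    case 5
    then show ?thesis using ua by (intro exI[of _ "\<lambda>x. u (snd_complex x)"]) (simp add: branch_chain_def Let_def)
  next
    case 6
    then show ?thesis using expandable_Im[OF ua] by (intro exI conjI ballI) (assumption, simp add: branch_chain_def Let_def)
  next
    case 7
    have "expandable (\<lambda>x. fst_complex x + (-1) * u (snd_complex x)) a"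
      by (intro expandable_add expandable_mult expandable_const ua expandable_fst_snd_complex)
    then have 1: "expandable (\<lambda>x. of_real ((cmod (fst_complex x + (-1) * u (snd_complex x)))\<^sup>2)) a"
      by (rule expandable_norm_square)
    have l: "expandable (\<lambda>x. of_real A * of_real (Re (fst_complex x)) + of_real B * of_real (Im (fst_complex x))) a"
      by (intro expandable_add expandable_mult expandable_const expandable_Re expandable_Im expandable_fst_snd_complex)
    show ?thesis using expandable_add[OF 1 expandable_mult[OF l l]] 7
      by (intro exI conjI ballI) (assumption, simp add: branch_chain_def Let_def power2_eq_square)
  qed
qed

end

context period_lattice
begin

lemma coord_eq: "z = of_real r1 * \<omega>1 + of_real r2 * \<omega>2 \<longleftrightarrow> coord1 z = r1 \<and> coord2 z = r2"
  using coord_decomp[of z] by auto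

lemma continuous_on_coord [continuous_intros]:
  assumes "continuous_on A f"
  shows "continuous_on A (\<lambda>x. coord1 (f x))" "continuous_on A (\<lambda>x. coord2 (f x))"
  using \<omega>1_nonzero Im_pos unfolding coord1_def coord2_def by (auto intro!: continuous_intros assms)

text \<open>Both summands of the last chain function are squares, so its vanishing says
  \<open>z = u w\<close> together with the linear equation; the remaining conditions are open and go
  into the box.\<close>

lemma pfaffian_piece_branch:
  assumes S: "S = {d * Complex x y | x y. x \<in> I3 \<and> y \<in> I4}" "open S" and d: "d \<noteq> 0"
    and I: "open_interval I1" "open_interval I2" "open_interval I3" "open_interval I4"
    and half: "half_planes n1 n2 n3 e1 e2 e3 S"
    and u: "\<And>w. w \<in> S \<Longrightarrow> (u has_field_derivative \<epsilon> * exp (log_root n1 n2 n3 e1 e2 e3 w)) (at w)"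
  shows "pfaffian_piece {complex_pair z w | z w. coord1 z \<in> I1 \<and> coord2 z \<in> I2 \<and> w \<in> S \<and> z = u w \<and>
    A * Re z + B * Im z = 0}"
proof -
  define U where "U = {x. coord1 (fst_complex x) \<in> I1 \<and> coord2 (fst_complex x) \<in> I2 \<and> snd_complex x \<in> S}"
  define c where "c = branch_chain n1 n2 n3 e1 e2 e3 u A B"
  have "U = {complex_pair (of_real r1 * \<omega>1 + of_real r2 * \<omega>2) (d * Complex x y) | r1 r2 x y.
    r1 \<in> I1 \<and> r2 \<in> I2 \<and> x \<in> I3 \<and> y \<in> I4}" (is "_ = ?B")
  proof
    show "U \<subseteq> ?B"
    proof
      fix p assume p: "p \<in> U"
      then obtain x y where xy: "snd_complex p = d * Complex x y" "x \<in> I3" "y \<in> I4"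
        unfolding U_def S(1) by blast
      have "p = complex_pair (fst_complex p) (snd_complex p)" by simp
      also have "\<dots> = complex_pair (of_real (coord1 (fst_complex p)) * \<omega>1 + of_real (coord2 (fst_complex p)) * \<omega>2) (d * Complex x y)"
        unfolding coord_decomp xy(1) ..
      finally show "p \<in> ?B" using p xy(2,3) unfolding U_def by blast
    qed
    show "?B \<subseteq> U" unfolding U_def S(1) by clarsimp blast
  qed
  then have box: "simple_domain U" using simple_domain_box[of \<omega>2 \<omega>1 d] Im_pos d I by simp
  have "U = (\<lambda>x. coord1 (fst_complex x)) -` I1 \<inter> (\<lambda>x. coord2 (fst_complex x)) -` I2 \<inter> snd_complex -` S"
    by (auto simp: U_def)
  then have oU: "open U"
    using I S(2) by (auto simp: open_interval_def intro!: open_Int open_vimage continuous_intros continuous_on_fst_snd_complex)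
  have chain: "pfaffian_chain 7 9 U c"
    unfolding c_def
  proof (rule pfaffian_chainI[OF oU])
    fix i :: nat assume i: "i \<in> {1..7}"
    show "real_analytic_on (branch_chain n1 n2 n3 e1 e2 e3 u A B i) U"
      by (rule branch_chain_analytic[OF half u S(2) oU _ i]) (auto simp: U_def)
    show "polyfun (chain_vars i) 9 (branch_poly e1 e2 e3 \<epsilon> A B i j)" for j
      by (rule branch_poly_polyfun[OF half i])
    fix j x assume "x \<in> U"
    then have "snd_complex x \<in> S" by (simp add: U_def)
    from branch_chain_deriv[OF half u i this]
    show "((\<lambda>t. branch_chain n1 n2 n3 e1 e2 e3 u A B i (x + t *\<^sub>R axis j 1)) has_real_derivative
       branch_poly e1 e2 e3 \<epsilon> A B i j (chain_point (branch_chain n1 n2 n3 e1 e2 e3 u A B) x)) (at 0)" by blast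
  qed
  have zero: "c 7 x = 0 \<longleftrightarrow> fst_complex x = u (snd_complex x) \<and> A * Re (fst_complex x) + B * Im (fst_complex x) = 0" for x
    by (simp add: c_def branch_chain_def[OF half] Let_def add_nonneg_eq_0_iff)
  have "{complex_pair z w | z w. coord1 z \<in> I1 \<and> coord2 z \<in> I2 \<and> w \<in> S \<and> z = u w \<and> A * Re z + B * Im z = 0}
      = {x\<in>U. \<forall>j\<in>{1..1::nat}. c 7 x = 0}" (is "?X = ?Y")
  proof
    show "?X \<subseteq> ?Y" by (auto simp: U_def zero)
    show "?Y \<subseteq> ?X"
    proof
      fix p assume p: "p \<in> ?Y"
      have "p = complex_pair (fst_complex p) (snd_complex p)" by simp
      moreover have "coord1 (fst_complex p) \<in> I1 \<and> coord2 (fst_complex p) \<in> I2 \<and> snd_complex p \<in> S \<and>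
          fst_complex p = u (snd_complex p) \<and> A * Re (fst_complex p) + B * Im (fst_complex p) = 0"
        using p unfolding U_def zero by auto
      ultimately show "p \<in> ?X" by blast
    qed
  qed
  moreover have "\<forall>j\<in>{1..1::nat}. pfaffian 7 9 1 U c (c 7)" using pfaffian_chain_member[OF chain] by simp
  ultimately show ?thesis
    unfolding pfaffian_piece_def using box chain
    by (intro exI[of _ U] exI[of _ 1] exI[of _ "\<lambda>_. c 7"] exI[of _ c] conjI) auto
qed

section \<open>Branches over a strip and the number of those that meet the fundamental
  domain\<close>

definition wp_branch :: "complex set \<Rightarrow> (complex \<Rightarrow> complex) \<Rightarrow> (complex \<Rightarrow> complex) \<Rightarrow> bool" where
  "wp_branch S d u \<longleftrightarrow> (\<forall>w\<in>S. (u has_field_derivative d w) (at w) \<and> u w \<notin> \<Omega> \<and> wp (u w) = w)"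

lemma wp_branch_translate:
  assumes "wp_branch S d u" "p \<in> \<Omega>"
  shows "wp_branch S d (\<lambda>w. u w + p)"
  unfolding wp_branch_def
proof (intro ballI conjI)
  fix w assume "w \<in> S"
  then have "(u has_field_derivative d w) (at w)" "u w \<notin> \<Omega>" "wp (u w) = w" using assms(1) by (auto simp: wp_branch_def)
  then show "((\<lambda>w. u w + p) has_field_derivative d w) (at w)" "u w + p \<notin> \<Omega>" "wp (u w + p) = w"
    using assms(2) by (auto intro!: derivative_eq_intros simp: lattice_add_iff wp_periodic)
qed

end

context reduced_lattice
begin

abbreviation "F \<equiv> fundamental_domain \<omega>1 \<omega>2"

lemma fundamental_domain_coord:
  "z \<in> F \<longleftrightarrow> coord1 z \<in> {0..<1} \<and> coord2 z \<in> {0..<1} \<and> (coord1 z \<noteq> 0 \<or> coord2 z \<noteq> 0)"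
  unfolding fundamental_domain_def by (auto simp: coord_eq)

lemma fundamental_domain_not_lattice:
  assumes "z \<in> F"
  shows "z \<notin> \<Omega>"
proof
  assume "z \<in> \<Omega>"
  moreover have "x = 0" if "x \<in> \<int>" "x \<in> {0..<1}" for x :: real using that by (auto elim!: Ints_cases)
  ultimately show False using assms unfolding lattice_iff fundamental_domain_coord by metis
qed

text \<open>The possible limits of branches that meet the fundamental domain. No strip and no sign
  occurs here, so one count serves all cases.\<close>

definition near_periods :: "complex set" where
  "near_periods = {l\<in>\<Omega>. \<exists>z\<in>F. \<bar>coord2 (l - z)\<bar> < 8 \<and> \<bar>Re ((l - z) / \<omega>1)\<bar> \<le> 70}"

text \<open>With \<open>coord2 z\<close> in \<open>[0, 1)\<close> the
  \<open>\<omega>2\<close>-coordinate \<open>b\<close> runs from -7 to 8. For fixed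
  \<open>b\<close>, the bound 70 together with \<open>coord1 z < 1\<close> and
  \<open>\<bar>coord2 z * Re \<tau>\<bar> \<le> 1/2\<close> confines the other coordinate to an
  interval of length 142, hence to at most 143 integers.\<close>

lemma near_periods_card: "finite near_periods" "card near_periods \<le> 2288"
proof -
  define m where "m = (\<lambda>b::int. \<lceil>- 141 / 2 - of_int b * Re (\<omega>2 / \<omega>1)\<rceil>)"
  define T where "T = Sigma {-7..8::int} (\<lambda>b. {m b..m b + 142})"
  have T: "finite T" unfolding T_def by (intro finite_SigmaI) auto
  have "card T = (\<Sum>b\<in>{-7..8::int}. card {m b..m b + 142})"
    unfolding T_def by (rule card_SigmaI) auto
  also have "\<dots> = (\<Sum>b\<in>{-7..8::int}. 143)" by (intro sum.cong refl) (simp add: algebra_simps)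
  also have "\<dots> = 2288" by (simp only: sum_constant card_atLeastAtMost_int) simp
  finally have cT: "card T = 2288" .
  have re: "Re (z / \<omega>1) = coord1 z + coord2 z * Re (\<omega>2 / \<omega>1)" for z
    unfolding coord1_def coord2_def by simp
  have "near_periods \<subseteq> (\<lambda>(b, a). of_int a * \<omega>1 + of_int b * \<omega>2) ` T"
  proof
    fix l assume "l \<in> near_periods"
    then obtain z where z: "z \<in> F" "\<bar>coord2 (l - z)\<bar> < 8" "\<bar>Re ((l - z) / \<omega>1)\<bar> \<le> 70" and l: "l \<in> \<Omega>"
      by (auto simp: near_periods_def)
    obtain a b :: int where ab: "coord1 l = of_int a" "coord2 l = of_int b"
      using l unfolding lattice_iff by (auto elim!: Ints_cases)
    have r: "0 \<le> coord1 z" "coord1 z < 1" "0 \<le> coord2 z" "coord2 z < 1" using z(1) by (auto simp: fundamental_domain_coord)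
    have "\<bar>of_int b - coord2 z\<bar> < 8" using z(2) by (simp add: coord_diff ab)
    then have b: "-7 \<le> b" "b \<le> 8" using r by linarith+
    let ?t = "Re (\<omega>2 / \<omega>1)"
    have "Re ((l - z) / \<omega>1) = of_int a - coord1 z + (of_int b - coord2 z) * ?t" unfolding re[of "l - z"] coord_diff ab ..
    moreover have "\<bar>coord2 z * ?t\<bar> \<le> 1 * (1/2)"
      unfolding abs_mult using r Re_le by (intro mult_mono) auto
    ultimately have "- 141 / 2 - of_int b * ?t \<le> of_int a" "of_int a \<le> 143 / 2 - of_int b * ?t"
      using z(3) r unfolding left_diff_distrib by linarith+
    then have "m b \<le> a" "a \<le> m b + 142" unfolding m_def by linarith+
    then have "(b, a) \<in> T" using b by (simp add: T_def)
    moreover have "l = of_int a * \<omega>1 + of_int b * \<omega>2" using coord_decomp[of l] by (simp add: ab)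
    ultimately show "l \<in> (\<lambda>(b, a). of_int a * \<omega>1 + of_int b * \<omega>2) ` T" by (auto intro: rev_image_eqI)
  qed
  moreover have "card ((\<lambda>(b, a). of_int a * \<omega>1 + of_int b * \<omega>2) ` T) \<le> 2288" using card_image_le[OF T] cT by metis
  ultimately show "finite near_periods" "card near_periods \<le> 2288"
    using T by (meson finite_imageI finite_subset card_mono le_trans)+
qed

definition ray_closed :: "complex \<Rightarrow> complex set \<Rightarrow> bool" where
  "ray_closed D0 S \<longleftrightarrow> good_direction D0 \<and> convex S \<and> open S \<and> (\<forall>w\<in>S. \<forall>t\<ge>0. w + of_real t * D0 \<in> S)"

lemma branch_inverse_ray:
  assumes S: "ray_closed D0 S" and u: "wp_branch S d u" and d: "\<And>w. w \<in> S \<Longrightarrow> (d w)\<^sup>2 * wp_poly w = 1" and w: "w \<in> S"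
  shows "inverse_ray D0 w (\<lambda>t. u (w + of_real t * D0)) (\<lambda>t. D0 * d (w + of_real t * D0))"
  unfolding inverse_ray_def
proof (intro conjI allI impI)
  fix t :: real assume "t \<ge> 0"
  then have wt: "w + of_real t * D0 \<in> S" using S w by (auto simp: ray_closed_def)
  then have b: "(u has_field_derivative d (w + of_real t * D0)) (at (w + of_real t * D0))" 
    and "u (w + of_real t * D0) \<notin> \<Omega>" "wp (u (w + of_real t * D0)) = w + of_real t * D0"
    using u by (auto simp: wp_branch_def)
  then show "u (w + of_real t * D0) \<notin> \<Omega>" "wp (u (w + of_real t * D0)) = w + of_real t * D0" by auto
  have "((\<lambda>t. w + of_real t * D0) has_vector_derivative D0) (at t)"
    by (auto intro!: derivative_eq_intros simp: has_vector_derivative_def scaleR_conv_of_real)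
  from field_vector_diff_chain_at[OF this b]
  show "((\<lambda>t. u (w + of_real t * D0)) has_vector_derivative D0 * d (w + of_real t * D0)) (at t)" by (simp add: o_def)
  show "(D0 * d (w + of_real t * D0))\<^sup>2 * wp_poly (w + of_real t * D0) = D0\<^sup>2"
    using d[OF wt] by (simp add: power_mult_distrib mult.assoc)
qed (use S in \<open>simp add: ray_closed_def\<close>)

text \<open>The two rays keep a constant distance while the derivative \<open>d\<close> tends to
  \<open>0\<close> far out, so the branch has the same limit along all parallel rays.\<close>

lemma branch_limit_unique:
  assumes S: "ray_closed D0 S" and u: "wp_branch S d u" and d: "\<And>w. w \<in> S \<Longrightarrow> (d w)\<^sup>2 * wp_poly w = 1"
    and w: "w \<in> S" "w' \<in> S"
  shows "((\<lambda>t. u (w' + of_real t * D0) - u (w + of_real t * D0)) \<longlongrightarrow> 0) at_top"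
proof (rule tendstoI)
  fix e :: real assume e: "e > 0"
  \<comment> \<open>\<open>M \<ge> 1\<close>, so a product of three distances that are at least
    \<open>M\<close> is again at least \<open>M\<close>; the second summand converts this into the
    wanted bound on \<open>d\<close>. \<open>R\<close> collects everything that stays fixed.\<close>
  define M where "M = 1 + 1 / (e / (1 + cmod (w' - w)))\<^sup>2"
  define R where "R = cmod w + cmod w' + cmod root1 + cmod root2 + cmod root3"
  have pos: "e / (1 + cmod (w' - w)) > 0" using e by (simp add: add_pos_nonneg)
  have M: "M \<ge> 1" by (simp add: M_def)
  have D0: "cmod D0 = 1" using S by (simp add: ray_closed_def good_direction_def)
  have far: "cmod (d s) \<le> e / (1 + cmod (w' - w))" if t: "t \<ge> M + R" and s: "s \<in> closed_segment (w + of_real t * D0) (w' + of_real t * D0)" "s \<in> S" for t s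
  proof -
    obtain k where k: "0 \<le> k" "k \<le> 1" "s = (1 - k) *\<^sub>R (w + of_real t * D0) + k *\<^sub>R (w' + of_real t * D0)"
      using s(1) by (auto simp: closed_segment_def)
    have s': "s = ((1 - k) *\<^sub>R w + k *\<^sub>R w') + of_real t * D0"
      by (simp add: k(3) scaleR_conv_of_real algebra_simps)
    have "cmod ((1 - k) *\<^sub>R w + k *\<^sub>R w') \<le> cmod ((1 - k) *\<^sub>R w) + cmod (k *\<^sub>R w')" by (rule norm_triangle_ineq)
    also have "\<dots> \<le> cmod w + cmod w'"
      using k by (auto intro!: add_mono mult_left_le_one_le)
    finally have a: "cmod ((1 - k) *\<^sub>R w + k *\<^sub>R w') \<le> cmod w + cmod w'" .
    have "R \<ge> 0" by (simp add: R_def)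
    then have tD: "cmod (of_real t * D0) = t" using t M D0 by (simp add: norm_mult)
    have fr: "cmod (s - r) \<ge> M" if "r \<in> {root1, root2, root3}" for r
    proof -
      have "cmod (of_real t * D0) \<le> cmod (s - r) + cmod r + cmod ((1 - k) *\<^sub>R w + k *\<^sub>R w')"
        using norm_triangle_ineq4[of s "(1 - k) *\<^sub>R w + k *\<^sub>R w'"] norm_triangle_ineq[of "s - r" r]
        by (simp add: s')
      moreover have "cmod r \<le> cmod root1 + cmod root2 + cmod root3" using that by auto
      ultimately show ?thesis using a t tD unfolding R_def by linarith
    qed
    have "M * 1 * 1 \<le> cmod (s - root1) * cmod (s - root2) * cmod (s - root3)"
      using fr M by (intro mult_mono) (auto intro: order_trans)
    then have "M \<le> cmod (wp_poly s)" unfolding wp_poly_factor norm_mult using M by simp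
    then have "1 / (e / (1 + cmod (w' - w)))\<^sup>2 \<le> cmod (wp_poly s)" by (simp add: M_def)
    moreover have "(cmod (d s))\<^sup>2 * cmod (wp_poly s) = 1" using arg_cong[OF d[OF s(2)], of cmod] by (simp add: norm_mult norm_power)
    ultimately have "(cmod (d s))\<^sup>2 * (1 / (e / (1 + cmod (w' - w)))\<^sup>2) \<le> 1"
      by (metis mult_left_mono zero_le_power2)
    moreover have "a \<le> b" if "a * (1 / b) \<le> 1" "b > 0" for a b :: real using that by (simp add: field_simps)
    ultimately have "(cmod (d s))\<^sup>2 \<le> (e / (1 + cmod (w' - w)))\<^sup>2" using zero_less_power[OF pos] by blast
    then show ?thesis using less_imp_le[OF pos] by (rule power2_le_imp_le)
  qed
  have "cmod (u (w' + of_real t * D0) - u (w + of_real t * D0)) < e" if t: "t \<ge> M + R" for t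
  proof -
    have "R \<ge> 0" by (simp add: R_def)
    then have "t \<ge> 0" using t M by linarith
    then have wS: "w + of_real t * D0 \<in> S" "w' + of_real t * D0 \<in> S" using S w by (auto simp: ray_closed_def)
    then have seg: "closed_segment (w + of_real t * D0) (w' + of_real t * D0) \<subseteq> S"
      using S by (simp add: ray_closed_def closed_segment_subset)
    have "cmod (u (w' + of_real t * D0) - u (w + of_real t * D0))
        \<le> e / (1 + cmod (w' - w)) * cmod ((w' + of_real t * D0) - (w + of_real t * D0))"
    proof (rule field_differentiable_bound[where S = "closed_segment (w + of_real t * D0) (w' + of_real t * D0)" and f' = d])
      fix s assume s: "s \<in> closed_segment (w + of_real t * D0) (w' + of_real t * D0)"
      then show "(u has_field_derivative d s) (at s within closed_segment (w + of_real t * D0) (w' + of_real t * D0))"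
        using u seg by (auto simp: wp_branch_def intro: has_field_derivative_at_within)
      show "cmod (d s) \<le> e / (1 + cmod (w' - w))" using far[OF t s] s seg by blast
    qed simp_all
    also have "\<dots> < e"
      using e by (simp add: divide_simps add_pos_nonneg)
    finally show ?thesis .
  qed
  then show "\<forall>\<^sub>F t in at_top. dist (u (w' + of_real t * D0) - u (w + of_real t * D0)) 0 < e"
    by (auto simp: eventually_at_top_linorder intro!: exI[of _ "M + R"])
qed

text \<open>The limit does not depend on the ray, so the estimates started at any \<open>w\<close>
  refer to the same lattice point.\<close>

lemma branch_lattice_limit:
  assumes S: "ray_closed D0 S" and u: "wp_branch S d u" and d: "\<And>w. w \<in> S \<Longrightarrow> (d w)\<^sup>2 * wp_poly w = 1"
  obtains l where "l \<in> \<Omega>" "\<And>w. w \<in> S \<Longrightarrow> \<bar>coord2 (l - u w)\<bar> < 8 \<and> \<bar>Re ((l - u w) / \<omega>1)\<bar> \<le> 70"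
proof (cases "S = {}")
  case True
  then show ?thesis using that[OF lattice_zero] by blast
next
  case False
  then obtain w0 where w0: "w0 \<in> S" by blast
  note ray = branch_inverse_ray[OF S u d]
  obtain l where l: "((\<lambda>t. u (w0 + of_real t * D0)) \<longlongrightarrow> l) at_top"
    using ray_limit(1)[OF ray[OF _ w0] arc_bounds] by blast
  have lw: "((\<lambda>t. u (w + of_real t * D0)) \<longlongrightarrow> l) at_top" if w: "w \<in> S" for w
    using tendsto_add[OF branch_limit_unique[OF S u d w0 w] l] by simp
  show ?thesis
  proof (rule that)
    show "l \<in> \<Omega>" using ray_limit_in_lattice[OF ray[OF _ w0] l] by blast
    fix w assume w: "w \<in> S"
    have r: "inverse_ray D0 w (\<lambda>t. u (w + of_real t * D0)) (\<lambda>t. D0 * d (w + of_real t * D0))"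
      using ray[OF _ w] by blast
    have "\<bar>Re ((l - u (w + of_real 0 * D0)) / \<omega>1)\<bar> \<le> 70"
      by (rule ray_bound[OF r lw[OF w], where f = "\<lambda>z. Re (z / \<omega>1)"])
         (use ray_re[OF r] \<omega>1_nonzero in \<open>auto intro!: continuous_intros\<close>)
    moreover have "\<bar>coord2 (l - u (w + of_real 0 * D0))\<bar> < 8" by (rule ray_coord2[OF r lw[OF w]])
    ultimately show "\<bar>coord2 (l - u w)\<bar> < 8 \<and> \<bar>Re ((l - u w) / \<omega>1)\<bar> \<le> 70" by simp
  qed
qed

text \<open>All branches are translates \<open>u0 + p\<close> of one branch and have limit
  \<open>l + p\<close>. If such a branch takes a value in the fundamental domain, then
  \<open>l + p\<close> is a near period, so translations by \<open>k - l\<close> suffice.\<close>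

lemma branches_card:
  assumes S: "ray_closed D0 S" and d: "\<And>w. w \<in> S \<Longrightarrow> (d w)\<^sup>2 * wp_poly w = 1"
  obtains \<U> where "finite \<U>" "card \<U> \<le> 2288" "\<And>u. u \<in> \<U> \<Longrightarrow> wp_branch S d u"
    "\<And>z u. z \<in> F \<Longrightarrow> wp z \<in> S \<Longrightarrow> wp_branch S d u \<Longrightarrow> u (wp z) = z \<Longrightarrow> \<exists>u\<in>\<U>. u (wp z) = z"
proof (cases "\<exists>u. wp_branch S d u")
  case False
  then show ?thesis using that[of "{}"] by auto
next
  case True
  then obtain u0 where u0: "wp_branch S d u0" by blast
  obtain l where l: "l \<in> \<Omega>" "\<And>w. w \<in> S \<Longrightarrow> \<bar>coord2 (l - u0 w)\<bar> < 8 \<and> \<bar>Re ((l - u0 w) / \<omega>1)\<bar> \<le> 70"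
    using branch_lattice_limit[OF S u0 d] by blast
  show ?thesis
  proof (rule that[of "(\<lambda>k w. u0 w + (k - l)) ` near_periods"])
    show "finite ((\<lambda>k w. u0 w + (k - l)) ` near_periods)" using near_periods_card by simp
    show "card ((\<lambda>k w. u0 w + (k - l)) ` near_periods) \<le> 2288"
      using card_image_le[OF near_periods_card(1)] near_periods_card(2) le_trans by blast
    show "wp_branch S d u" if "u \<in> (\<lambda>k w. u0 w + (k - l)) ` near_periods" for u
      using that u0 l(1) lattice_diff by (auto simp: near_periods_def intro!: wp_branch_translate)
    fix z u assume z: "z \<in> F" "wp z \<in> S" and u: "wp_branch S d u" "u (wp z) = z"
    have "\<exists>p\<in>\<Omega>. \<forall>w\<in>S. u w = u0 w + p"
      by (rule wp_branch_unique[of S "wp z" u0 d]) (use S z u u0 in \<open>auto simp: ray_closed_def wp_branch_def\<close>)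
    then obtain p where p: "p \<in> \<Omega>" "z = u0 (wp z) + p" using z u by metis
    have "l + p - z = l - u0 (wp z)" using p(2) by (simp add: algebra_simps)
    then have "\<bar>coord2 (l + p - z)\<bar> < 8 \<and> \<bar>Re ((l + p - z) / \<omega>1)\<bar> \<le> 70" using l(2)[OF z(2)] by (simp only:)
    then have "l + p \<in> near_periods" using z(1) lattice_add[OF l(1) p(1)] by (auto simp: near_periods_def)
    then show "\<exists>u\<in>(\<lambda>k w. u0 w + (k - l)) ` near_periods. u (wp z) = z"
      using p(2) by (auto intro!: bexI[of _ "l + p"])
  qed
qed

end

section \<open>Rotated strips and the choice of the direction\<close>

lemma Im_mult_cnj: "Im (z * cnj w) = - Im w * Re z + Re w * Im z"
  by (simp add: algebra_simps)

lemma open_interval_simps [simp]: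
  "open_interval UNIV" "open_interval {a<..}" "open_interval {..<a}" "open_interval {a<..<b} \<longleftrightarrow> a < b"
  by (auto simp: open_interval_def is_interval_1 gt_ex lt_ex)

lemma interval_avoids:
  assumes "open_interval I" "a \<notin> I"
  shows "(\<forall>x\<in>I. a < x) \<or> (\<forall>x\<in>I. x < a)"
  using assms unfolding open_interval_def is_interval_1 by (metis linorder_neqE_linordered_idom order_less_imp_le)

definition strip :: "complex \<Rightarrow> real set \<Rightarrow> real set \<Rightarrow> complex set" where
  "strip d I J = {d * Complex x y | x y. x \<in> I \<and> y \<in> J}"

lemma unit_mult_cnj: "cmod d = 1 \<Longrightarrow> d * cnj d = 1" "cmod d = 1 \<Longrightarrow> cnj d * d = 1"
  using complex_norm_square[of d] by (simp_all add: mult.commute)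

lemma strip_iff:
  assumes d: "cmod d = 1"
  shows "w \<in> strip d I J \<longleftrightarrow> Re (w * cnj d) \<in> I \<and> Im (w * cnj d) \<in> J"
proof
  assume "w \<in> strip d I J"
  then obtain x y where w: "w = d * Complex x y" "x \<in> I" "y \<in> J" by (auto simp: strip_def)
  have "w * cnj d = (d * cnj d) * Complex x y" unfolding w(1) by (simp only: mult_ac)
  then show "Re (w * cnj d) \<in> I \<and> Im (w * cnj d) \<in> J" using w(2,3) by (simp only: unit_mult_cnj[OF d] mult_1 complex.sel)
next
  assume *: "Re (w * cnj d) \<in> I \<and> Im (w * cnj d) \<in> J"
  have "w = w * (d * cnj d)" by (simp only: unit_mult_cnj[OF d] mult_1_right)
  also have "\<dots> = d * Complex (Re (w * cnj d)) (Im (w * cnj d))" by (simp only: complex_surj mult_ac)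
  finally show "w \<in> strip d I J" unfolding strip_def using * by blast
qed

lemma strip_open_convex:
  assumes d: "cmod d = 1" and I: "open_interval I" "open_interval J"
  shows "open (strip d I J)" "convex (strip d I J)"
proof -
  have eq: "strip d I J = (\<lambda>w. Re (w * cnj d)) -` I \<inter> (\<lambda>w. Im (w * cnj d)) -` J"
    using strip_iff[OF d] by blast
  have "linear (\<lambda>w. Re (w * cnj d))" "linear (\<lambda>w. Im (w * cnj d))"
    by (auto intro!: linearI simp: algebra_simps)
  then show "convex (strip d I J)"
    unfolding eq using I by (auto simp: open_interval_def is_interval_convex_1 intro!: convex_Int convex_linear_vimage)
  show "open (strip d I J)"
    unfolding eq using I by (auto simp: open_interval_def intro!: open_Int open_vimage continuous_intros)
qed

text \<open>A point outside the product region is separated from it in one of the four axis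
  directions of the rotated frame; \<open>n\<close> is the corresponding unit.\<close>

lemma strip_half_plane:
  assumes d: "cmod d = 1" and I: "open_interval I" "open_interval J"
    and e: "Re (e * cnj d) \<notin> I \<or> Im (e * cnj d) \<notin> J"
  obtains n where "cmod n = 1" "\<And>w. w \<in> strip d I J \<Longrightarrow> Re (n * (w - e)) > 0"
proof -
  have R: "Re (cnj d * (w - e)) = Re (w * cnj d) - Re (e * cnj d)" "Im (cnj d * (w - e)) = Im (w * cnj d) - Im (e * cnj d)" for w
    by (simp_all add: algebra_simps)
  have M: "Re (- cnj d * (w - e)) = - Re (cnj d * (w - e))" "Re (- \<i> * cnj d * (w - e)) = Im (cnj d * (w - e))"
    "Re (\<i> * cnj d * (w - e)) = - Im (cnj d * (w - e))" for w
    by (simp_all add: algebra_simps)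
  have n: "cmod (cnj d) = 1" "cmod (- cnj d) = 1" "cmod (- \<i> * cnj d) = 1" "cmod (\<i> * cnj d) = 1"
    using d by (simp_all add: norm_mult)
  consider "\<forall>x\<in>I. Re (e * cnj d) < x" | "\<forall>x\<in>I. x < Re (e * cnj d)" | "\<forall>x\<in>J. Im (e * cnj d) < x" | "\<forall>x\<in>J. x < Im (e * cnj d)"
    using e interval_avoids[OF I(1)] interval_avoids[OF I(2)] by blast
  then show ?thesis
  proof cases
    case 1
    show ?thesis by (rule that[OF n(1)]) (use 1 in \<open>simp only: R strip_iff[OF d], simp\<close>)
  next
    case 2
    show ?thesis by (rule that[OF n(2)]) (use 2 in \<open>simp only: M R strip_iff[OF d], simp\<close>)
  next
    case 3
    show ?thesis by (rule that[OF n(3)]) (use 3 in \<open>simp only: M R strip_iff[OF d], simp\<close>)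
  next
    case 4
    show ?thesis by (rule that[OF n(4)]) (use 4 in \<open>simp only: M R strip_iff[OF d], simp\<close>)
  qed
qed

lemma three_reals_sorted:
  fixes x y z :: real
  assumes "x \<noteq> y" "x \<noteq> z" "y \<noteq> z"
  obtains a b c where "a < b" "b < c" "{a, b, c} = {x, y, z}"
proof -
  have "x < y \<and> y < z \<or> x < z \<and> z < y \<or> y < x \<and> x < z \<or> y < z \<and> z < x \<or> z < x \<and> x < y \<or> z < y \<and> y < x"
    using assms by linarith
  then show ?thesis using that[of x y z] that[of x z y] that[of y x z] that[of y z x] that[of z x y] that[of z y x] by auto
qed

text \<open>Four directions at mutual angles of 45 degrees; a line \<open>E\<close> can be within 20.7 degrees of only
  one of them.\<close>

lemma direction_exists:
  assumes E: "E1 \<noteq> 0" "E2 \<noteq> 0" "E3 \<noteq> 0"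
  obtains d where "cmod d = 1" "\<And>E. E \<in> {E1, E2, E3} \<Longrightarrow> \<bar>Im (E * cnj d)\<bar> \<ge> 7/20 * cmod E \<and> Re (E * cnj d) \<noteq> 0"
proof -
  \<comment> \<open>The angle between the lines of \<open>E\<close> and \<open>d\<close> is below
    about 20.7 degrees, whose sine is \<open>1 / sqrt 8\<close>. The form is homogeneous because the
    diagonal directions are not unit vectors.\<close>
  define bad where "bad = (\<lambda>d E. 8 * (Im (E * cnj d))\<^sup>2 < (cmod E * cmod d)\<^sup>2)"
  have bad_iff: "bad 1 E \<longleftrightarrow> 8 * (Im E)\<^sup>2 < (Re E)\<^sup>2 + (Im E)\<^sup>2" "bad \<i> E \<longleftrightarrow> 8 * (Re E)\<^sup>2 < (Re E)\<^sup>2 + (Im E)\<^sup>2"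
    "bad (Complex 1 1) E \<longleftrightarrow> 8 * (Im E - Re E)\<^sup>2 < 2 * ((Re E)\<^sup>2 + (Im E)\<^sup>2)"
    "bad (Complex (-1) 1) E \<longleftrightarrow> 8 * (- Im E - Re E)\<^sup>2 < 2 * ((Re E)\<^sup>2 + (Im E)\<^sup>2)" for E
    unfolding bad_def power_mult_distrib cmod_power2 by (simp_all add: mult.commute minus_diff_commute[of "Im E" "Re E"])
  have excl: "\<not> (8 * b\<^sup>2 < a\<^sup>2 + b\<^sup>2 \<and> 8 * a\<^sup>2 < a\<^sup>2 + b\<^sup>2)" 
    "\<not> (8 * (b - a)\<^sup>2 < 2 * (a\<^sup>2 + b\<^sup>2) \<and> 8 * (- b - a)\<^sup>2 < 2 * (a\<^sup>2 + b\<^sup>2))" for a b :: real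
  proof -
    show "\<not> (8 * b\<^sup>2 < a\<^sup>2 + b\<^sup>2 \<and> 8 * a\<^sup>2 < a\<^sup>2 + b\<^sup>2)" 
      using zero_le_power2[of a] zero_le_power2[of b] by linarith
    have "(b - a)\<^sup>2 + (- b - a)\<^sup>2 = 2 * a\<^sup>2 + 2 * b\<^sup>2" by (simp add: power2_eq_square algebra_simps)
    then show "\<not> (8 * (b - a)\<^sup>2 < 2 * (a\<^sup>2 + b\<^sup>2) \<and> 8 * (- b - a)\<^sup>2 < 2 * (a\<^sup>2 + b\<^sup>2))"
      using zero_le_power2[of a] zero_le_power2[of b] by argo
  qed
  \<comment> \<open>Directions 45 degrees apart; the other such pairs arise by exchanging or
    negating coordinates.\<close>
  have excl2: "\<not> (8 * b\<^sup>2 < a\<^sup>2 + b\<^sup>2 \<and> 8 * (b - a)\<^sup>2 < 2 * (a\<^sup>2 + b\<^sup>2))" for a b :: real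
  proof
    assume *: "8 * b\<^sup>2 < a\<^sup>2 + b\<^sup>2 \<and> 8 * (b - a)\<^sup>2 < 2 * (a\<^sup>2 + b\<^sup>2)"
    have "0 \<le> (a - 2 * b)\<^sup>2" by simp
    then have "4 * (a * b) \<le> a\<^sup>2 + 4 * b\<^sup>2" by (simp add: power2_eq_square algebra_simps)
    moreover have "(b - a)\<^sup>2 = a\<^sup>2 + b\<^sup>2 - 2 * (a * b)" by (simp add: power2_eq_square algebra_simps)
    moreover have False if "4 * p \<le> x + 4 * y" "q = x + y - 2 * p" "8 * y < x + y" "8 * q < 2 * (x + y)" "0 \<le> y" for p q x y :: real
    proof -
      have "6 * x + 6 * y < 16 * p" using that(2,4) by simp
      then have "x < 5 * y" using that(1) by simp
      then show False using that(3,5) by simp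
    qed
    ultimately show False using * zero_le_power2[of b] by blast
  qed
  have sum_sq: "(- Im E - Re E)\<^sup>2 = (Im E + Re E)\<^sup>2" for E
    by (simp add: power2_eq_square algebra_simps)
  have one: "\<not> (bad 1 E \<and> bad \<i> E)" "\<not> (bad (Complex 1 1) E \<and> bad (Complex (-1) 1) E)"
    "\<not> (bad 1 E \<and> bad (Complex 1 1) E)" "\<not> (bad 1 E \<and> bad (Complex (-1) 1) E)"
    "\<not> (bad \<i> E \<and> bad (Complex 1 1) E)" "\<not> (bad \<i> E \<and> bad (Complex (-1) 1) E)" for E
    unfolding bad_iff
    using excl[of "Im E" "Re E"] excl2[of "Im E" "Re E"] excl2[of "Im E" "- Re E"] excl2[of "Re E" "Im E"] excl2[of "- Re E" "Im E"]
    by (auto simp: sum_sq power2_commute[of "Im E" "Re E"] power2_commute[of "- Re E" "Im E"] add.commute)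
  \<comment> \<open>Three vectors spoil at most three of the four directions.\<close>
  have "\<exists>d\<in>{1, \<i>, Complex 1 1, Complex (-1) 1}. \<not> bad d E1 \<and> \<not> bad d E2 \<and> \<not> bad d E3"
    using one[of E1] one[of E2] one[of E3] by (simp only: bex_simps) argo
  then obtain d where "d \<in> {1, \<i>, Complex 1 1, Complex (-1) 1}" and d': "\<not> bad d E1" "\<not> bad d E2" "\<not> bad d E3"
    by blast
  then have "d \<noteq> 0" by (auto simp: complex_eq_iff)
  note d = this d'
  \<comment> \<open>The real parts may still vanish for \<open>d\<close>. A small rotation by
    \<open>Complex 1 s\<close> removes this and is paid for by the slack between
    \<open>1 / sqrt 8\<close> and 7/20.\<close>
  have ev: "\<forall>\<^sub>F s in at_right 0. \<bar>Im (E * cnj (d * Complex 1 s))\<bar> > 7/20 * cmod E * cmod (d * Complex 1 s) \<and> Re (E * cnj (d * Complex 1 s)) \<noteq> 0"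
    if "E \<noteq> 0" "\<not> bad d E" for E
  proof (rule eventually_conj)
    have c: "Complex 1 s = 1 + \<i> * of_real s" for s by (simp add: complex_eq_iff)
    define f where "f = (\<lambda>s. \<bar>Im (E * cnj (d * Complex 1 s))\<bar> - 7/20 * cmod E * cmod (d * Complex 1 s))"
    have pos: "0 < cmod E * cmod d" using that(1) d(1) by simp
    have "(7/20 * (cmod E * cmod d))\<^sup>2 < (Im (E * cnj d))\<^sup>2"
    proof -
      have "(7/20 * n)\<^sup>2 < t" if "\<not> 8 * t < n\<^sup>2" "0 < n\<^sup>2" for n t :: real
      proof -
        have "(7/20 * n)\<^sup>2 = 49/400 * n\<^sup>2" by (simp add: power_mult_distrib power_divide)
        then show ?thesis using that by linarith
      qed
      then show ?thesis using that(2) zero_less_power[OF pos, of 2] unfolding bad_def by blast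
    qed
    then have "7/20 * (cmod E * cmod d) < \<bar>Im (E * cnj d)\<bar>"
      by (metis abs_ge_zero power2_abs power2_less_imp_less)
    then have f0: "f 0 > 0" by (simp add: f_def c mult.assoc)
    have "continuous_on UNIV f" unfolding f_def c by (intro continuous_intros)
    then have "isCont f 0" by (simp add: continuous_on_eq_continuous_at)
    then have "(f \<longlongrightarrow> f 0) (at_right 0)" by (simp add: isCont_def filterlim_at_split)
    from order_tendstoD(1)[OF this f0]
    show "\<forall>\<^sub>F s in at_right 0. \<bar>Im (E * cnj (d * Complex 1 s))\<bar> > 7/20 * cmod E * cmod (d * Complex 1 s)"
      by (simp add: f_def)
    define p where "p = E * cnj d"
    have "Im p \<noteq> 0" using \<open>7/20 * (cmod E * cmod d) < \<bar>Im (E * cnj d)\<bar>\<close> pos by (auto simp: p_def)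
    moreover have "Re (E * cnj (d * Complex 1 s)) = Re p + s * Im p" for s
    proof -
      have "E * cnj (d * Complex 1 s) = p * Complex 1 (- s)" by (simp add: p_def complex_cnj[of 1 s] mult.assoc)
      then show ?thesis by (simp only:) simp
    qed
    ultimately have "Re (E * cnj (d * Complex 1 s)) \<noteq> 0" if "s \<noteq> - Re p / Im p" for s
      using that by (auto simp: field_simps eq_neg_iff_add_eq_0)
    moreover have "\<forall>\<^sub>F s in at_right (0::real). s \<noteq> - Re p / Im p" by (rule eventually_neq_at_within)
    ultimately show "\<forall>\<^sub>F s in at_right 0. Re (E * cnj (d * Complex 1 s)) \<noteq> 0"
      by (auto elim: eventually_mono)
  qed
  from eventually_conj[OF ev[OF E(1) d(2)] eventually_conj[OF ev[OF E(2) d(3)] ev[OF E(3) d(4)]]]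
  obtain s where s: "\<And>E. E \<in> {E1, E2, E3} \<Longrightarrow> \<bar>Im (E * cnj (d * Complex 1 s))\<bar> > 7/20 * cmod E * cmod (d * Complex 1 s) \<and> Re (E * cnj (d * Complex 1 s)) \<noteq> 0"
    using eventually_happens'[OF trivial_limit_at_right_real] by blast
  define D where "D = d * Complex 1 s"
  have "Complex 1 s \<noteq> 0" by (simp add: complex_eq_iff)
  then have D: "D \<noteq> 0" using d(1) by (simp only: D_def mult_eq_0_iff) blast
  have eq: "E * cnj (D / of_real (cmod D)) = E * cnj D / of_real (cmod D)" for E by simp
  show ?thesis
  proof (rule that[of "D / of_real (cmod D)"])
    show "cmod (D / of_real (cmod D)) = 1" using D by (simp add: norm_divide)
    fix E assume "E \<in> {E1, E2, E3}"
    from s[OF this] have "7/20 * cmod E * cmod D < \<bar>Im (E * cnj D)\<bar>" "Re (E * cnj D) \<noteq> 0" by (simp_all add: D_def)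
    then show "\<bar>Im (E * cnj (D / of_real (cmod D)))\<bar> \<ge> 7/20 * cmod E \<and> Re (E * cnj (D / of_real (cmod D))) \<noteq> 0"
      unfolding eq Re_divide_of_real Im_divide_of_real using D by (simp add: pos_le_divide_eq)
  qed
qed

section \<open>Pieces over a strip, the covering by strips, and the union\<close>

context reduced_lattice
begin

text \<open>The sign \<open>s\<close> selects upward or downward rays. Projection to
  \<open>s * \<i> * d\<close> is, up to sign, the imaginary part in the frame of \<open>d\<close>,
  so \<open>dir\<close> is the condition of \<open>good_direction\<close>.\<close>

lemma strip_ray_closed:
  assumes d: "cmod d = 1" and I: "open_interval I" "open_interval J"
    and s: "s \<in> {1, -1}" and J: "\<And>y t. y \<in> J \<Longrightarrow> t \<ge> 0 \<Longrightarrow> y + s * t \<in> J"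
    and dir: "\<And>E. E \<in> {root1 - root2, root1 - root3, root2 - root3} \<Longrightarrow> \<bar>Im (E * cnj d)\<bar> \<ge> 7/20 * cmod E"
  shows "ray_closed (of_real s * \<i> * d) (strip d I J)"
  unfolding ray_closed_def
proof (intro conjI ballI allI impI strip_open_convex d I)
  have "\<bar>Re (E * cnj (of_real s * \<i> * d))\<bar> = \<bar>Im (E * cnj d)\<bar>" for E
  proof -
    have "E * cnj (of_real s * \<i> * d) = of_real (- s) * (\<i> * (E * cnj d))" by simp
    then have "Re (E * cnj (of_real s * \<i> * d)) = s * Im (E * cnj d)" by (simp only:) (simp add: algebra_simps)
    then show ?thesis using s by (auto simp: abs_mult)
  qed
  then have "\<bar>Re (E * cnj (of_real s * \<i> * d))\<bar> \<ge> 7/20 * cmod E" if "E \<in> {root1 - root2, root1 - root3, root2 - root3}" for E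
    using dir[OF that] by (simp only:)
  moreover have "cmod (of_real s * \<i> * d) = 1" using s d by (auto simp: norm_mult)
  ultimately show "good_direction (of_real s * \<i> * d)"
    unfolding good_direction_def by blast
  fix w t assume w: "w \<in> strip d I J" and t: "t \<ge> (0::real)"
  have "(w + of_real t * (of_real s * \<i> * d)) * cnj d = w * cnj d + of_real (s * t) * \<i> * (d * cnj d)"
    by (simp add: algebra_simps)
  then have "(w + of_real t * (of_real s * \<i> * d)) * cnj d = w * cnj d + of_real (s * t) * \<i>"
    by (simp only: unit_mult_cnj[OF d] mult_1_right)
  then have "Re ((w + of_real t * (of_real s * \<i> * d)) * cnj d) = Re (w * cnj d)"
    "Im ((w + of_real t * (of_real s * \<i> * d)) * cnj d) = Im (w * cnj d) + s * t"
    by (simp_all only:, simp_all?)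
  then show "w + of_real t * (of_real s * \<i> * d) \<in> strip d I J"
    using w J[OF _ t] by (simp only: strip_iff[OF d])
qed

definition region :: "nat \<Rightarrow> complex \<Rightarrow> bool" where
  "region k z \<longleftrightarrow> (if k = 0 then coord1 z \<in> {0<..<1} \<and> coord2 z \<in> {0<..<1}
     else if k = 1 then coord1 z \<in> {0<..<1} \<and> coord2 z = 0 else coord1 z = 0 \<and> coord2 z \<in> {0<..<1})"

lemma region_fundamental_domain: "z \<in> F \<longleftrightarrow> (\<exists>k\<in>{0, 1, 2}. region k z)"
  by (auto simp: region_def fundamental_domain_coord)

text \<open>A coordinate vanishes iff \<open>z\<close> is a real multiple of the other basis vector,
  that is, iff the imaginary part of \<open>z\<close> times its conjugate vanishes. This is the
  linear form that \<open>pfaffian_piece_branch\<close> expects.\<close>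

lemma coord_zero_iff:
  "coord2 z = 0 \<longleftrightarrow> - Im \<omega>1 * Re z + Re \<omega>1 * Im z = 0"
  "coord1 z = 0 \<longleftrightarrow> - Im \<omega>2 * Re z + Re \<omega>2 * Im z = 0"
proof -
  show "coord2 z = 0 \<longleftrightarrow> - Im \<omega>1 * Re z + Re \<omega>1 * Im z = 0"
    unfolding Im_mult_cnj[symmetric] Im_complex_div_eq_0[symmetric] using Im_pos by (auto simp: coord2_def)
  have "\<omega>2 \<noteq> 0" using Im_pos by auto
  then have "z / \<omega>2 = of_real (coord1 z) * (\<omega>1 / \<omega>2) + of_real (coord2 z)"
    using coord_decomp[of z] by (simp add: field_simps)
  moreover have "Im (of_real a * x + of_real b) = a * Im x" for a b x by simp
  ultimately have "Im (z / \<omega>2) = coord1 z * Im (\<omega>1 / \<omega>2)" by metis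
  moreover have "Im (\<omega>1 / \<omega>2) \<noteq> 0"
  proof -
    have "\<omega>1 / \<omega>2 = inverse (\<omega>2 / \<omega>1)" by simp
    moreover have "Im (inverse x) \<noteq> 0" if "Im x > 0" for x using that by (auto simp: power2_eq_square sum_squares_eq_zero_iff)
    ultimately show ?thesis using Im_pos by metis
  qed
  ultimately show "coord1 z = 0 \<longleftrightarrow> - Im \<omega>2 * Re z + Re \<omega>2 * Im z = 0"
    unfolding Im_mult_cnj[symmetric] Im_complex_div_eq_0[symmetric] by simp
qed

lemma pfaffian_piece_region:
  assumes d: "cmod d = 1" and I: "open_interval I" "open_interval J"
    and half: "half_planes n1 n2 n3 e1 e2 e3 (strip d I J)"
    and u: "\<And>w. w \<in> strip d I J \<Longrightarrow> (u has_field_derivative \<epsilon> * exp (log_root n1 n2 n3 e1 e2 e3 w)) (at w)"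
  shows "pfaffian_piece {complex_pair z w | z w. region k z \<and> w \<in> strip d I J \<and> z = u w}"
proof -
  have d0: "d \<noteq> 0" using d by auto
  note piece = pfaffian_piece_branch[OF strip_def strip_open_convex(1)[OF d I] d0 _ _ I half u]
  consider "k = 0" | "k = 1" | "k \<noteq> 0" "k \<noteq> 1" by blast
  then show ?thesis
  proof cases
    case 1
    then show ?thesis using piece[of "{0<..<1}" "{0<..<1}" 0 0] by (simp add: region_def conj_ac)
  next
    case 2
    \<comment> \<open>An edge is not open: the vanishing coordinate gets the interval from -1 to 1,
      and the linear form does the restricting.\<close>
    have "region k z \<and> w \<in> W \<and> z = u w \<longleftrightarrow> coord1 z \<in> {0<..<1} \<and> coord2 z \<in> {-1<..<1} \<and> w \<in> W \<and> z = u w \<and> - Im \<omega>1 * Re z + Re \<omega>1 * Im z = 0" for z w W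
      unfolding coord_zero_iff(1)[symmetric] using 2 by (auto simp: region_def)
    then show ?thesis using piece[of "{0<..<1}" "{-1<..<1}" "- Im \<omega>1" "Re \<omega>1"] by (simp only: open_interval_simps, simp?)
  next
    case 3
    have "region k z \<and> w \<in> W \<and> z = u w \<longleftrightarrow> coord1 z \<in> {-1<..<1} \<and> coord2 z \<in> {0<..<1} \<and> w \<in> W \<and> z = u w \<and> - Im \<omega>2 * Re z + Re \<omega>2 * Im z = 0" for z w W
      unfolding coord_zero_iff(2)[symmetric] using 3 by (auto simp: region_def)
    then show ?thesis using piece[of "{-1<..<1}" "{0<..<1}" "- Im \<omega>2" "Re \<omega>2"] by (simp only: open_interval_simps, simp?)
  qed
qed

lemma real_graph_eq: "real_graph f A = (\<lambda>z. complex_pair z (f z)) ` A"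
  by (simp add: real_graph_def complex_pair_def)

text \<open>13728 = 3 * 2 * 2288: three regions, two signs of the square root, and the branches
  counted by \<open>near_periods\<close>.\<close>

lemma strip_pieces:
  assumes d: "cmod d = 1" and I: "open_interval I" "open_interval J"
    and e: "\<And>e. e \<in> {root1, root2, root3} \<Longrightarrow> Re (e * cnj d) \<notin> I \<or> Im (e * cnj d) \<notin> J"
    and closed: "ray_closed D0 (strip d I J)"
  shows "\<exists>\<X>. finite \<X> \<and> card \<X> \<le> 13728 \<and> (\<forall>X\<in>\<X>. pfaffian_piece X \<and> X \<subseteq> real_graph wp F) \<and>
    (\<forall>z\<in>F. wp z \<in> strip d I J \<longrightarrow> complex_pair z (wp z) \<in> \<Union>\<X>)"
proof -
  let ?S = "strip d I J"
  obtain n1 where n1: "cmod n1 = 1" "\<And>w. w \<in> ?S \<Longrightarrow> Re (n1 * (w - root1)) > 0"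
    using strip_half_plane[OF d I e[of root1]] by auto
  obtain n2 where n2: "cmod n2 = 1" "\<And>w. w \<in> ?S \<Longrightarrow> Re (n2 * (w - root2)) > 0"
    using strip_half_plane[OF d I e[of root2]] by auto
  obtain n3 where n3: "cmod n3 = 1" "\<And>w. w \<in> ?S \<Longrightarrow> Re (n3 * (w - root3)) > 0"
    using strip_half_plane[OF d I e[of root3]] by auto
  have half: "half_planes n1 n2 n3 root1 root2 root3 ?S" using n1 n2 n3 by (simp add: half_planes_def)
  define E where "E = (\<lambda>w. exp (log_root n1 n2 n3 root1 root2 root3 w))"
  \<comment> \<open>The square root undoes the rotations inside \<open>log_root\<close>, and the 2
    accounts for the leading coefficient 4 of \<open>wp_poly\<close>.\<close>
  define \<epsilon> where "\<epsilon> = csqrt (n1 * n2 * n3) / 2"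
  have sq: "((\<sigma> * \<epsilon>) * E w)\<^sup>2 * wp_poly w = 1" if "w \<in> ?S" "\<sigma> \<in> {1, -1}" for w \<sigma>
  proof -
    have "((\<sigma> * \<epsilon>) * E w)\<^sup>2 = n1 * n2 * n3 / 4 * (E w)\<^sup>2"
      using that(2) by (auto simp: \<epsilon>_def power_mult_distrib power_divide)
    have "((\<sigma> * \<epsilon>) * E w)\<^sup>2 * wp_poly w
        = (E w)\<^sup>2 * ((n1 * (w - root1)) * (n2 * (w - root2)) * (n3 * (w - root3)))"
    proof -
      have "a * b * c / 4 * X * (4 * x * y * z) = X * ((a * x) * (b * y) * (c * z))" for a b c x y z X :: complex by simp
      then show ?thesis unfolding wp_poly_factor \<open>((\<sigma> * \<epsilon>) * E w)\<^sup>2 = _\<close> .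
    qed
    also have "\<dots> = 1" unfolding E_def by (rule log_root_exp[OF half that(1)])
    finally show ?thesis .
  qed
  have "\<exists>\<U>. finite \<U> \<and> card \<U> \<le> 2288 \<and> (\<forall>u\<in>\<U>. wp_branch ?S (\<lambda>w. (\<sigma> * \<epsilon>) * E w) u) \<and>
     (\<forall>z u. z \<in> F \<and> wp z \<in> ?S \<and> wp_branch ?S (\<lambda>w. (\<sigma> * \<epsilon>) * E w) u \<and> u (wp z) = z \<longrightarrow> (\<exists>u\<in>\<U>. u (wp z) = z))"
    if "\<sigma> \<in> {1, -1}" for \<sigma>
  proof -
    obtain \<U> where "finite \<U>" "card \<U> \<le> 2288" "\<And>u. u \<in> \<U> \<Longrightarrow> wp_branch ?S (\<lambda>w. (\<sigma> * \<epsilon>) * E w) u"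
      "\<And>z u. z \<in> F \<Longrightarrow> wp z \<in> ?S \<Longrightarrow> wp_branch ?S (\<lambda>w. (\<sigma> * \<epsilon>) * E w) u \<Longrightarrow> u (wp z) = z \<Longrightarrow> \<exists>u\<in>\<U>. u (wp z) = z"
      by (rule branches_card[OF closed, of "\<lambda>w. (\<sigma> * \<epsilon>) * E w"]) (use sq \<open>\<sigma> \<in> {1, -1}\<close> in blast)+
    then show ?thesis by blast
  qed
  then obtain \<U> where \<U>: "\<And>\<sigma>. \<sigma> \<in> {1, -1} \<Longrightarrow> finite (\<U> \<sigma>) \<and> card (\<U> \<sigma>) \<le> 2288 \<and>
     (\<forall>u\<in>\<U> \<sigma>. wp_branch ?S (\<lambda>w. (\<sigma> * \<epsilon>) * E w) u) \<and>
     (\<forall>z u. z \<in> F \<and> wp z \<in> ?S \<and> wp_branch ?S (\<lambda>w. (\<sigma> * \<epsilon>) * E w) u \<and> u (wp z) = z \<longrightarrow> (\<exists>u\<in>\<U> \<sigma>. u (wp z) = z))"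
    by metis
  define P where "P = (\<lambda>(k, u). {complex_pair z w | z w. region k z \<and> w \<in> ?S \<and> z = u w})"
  define T where "T = {0, 1, 2::nat} \<times> (\<U> 1 \<union> \<U> (-1))"
  have fin: "finite (\<U> 1)" "finite (\<U> (-1))" and cU: "card (\<U> 1) \<le> 2288" "card (\<U> (-1)) \<le> 2288" using \<U> by auto
  have br: "\<exists>\<sigma>\<in>{1, -1}. wp_branch ?S (\<lambda>w. (\<sigma> * \<epsilon>) * E w) u" if "(k, u) \<in> T" for k u
    using that \<U>[of 1] \<U>[of "-1"] unfolding T_def by blast
  have "card (\<U> 1 \<union> \<U> (-1)) \<le> 4576" using card_Un_le[of "\<U> 1" "\<U> (-1)"] cU by linarith
  then have cT: "finite T" "card T \<le> 13728" using fin by (simp_all add: T_def card_cartesian_product)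
  show ?thesis
  proof (intro exI[of _ "P ` T"] conjI ballI impI)
    show "finite (P ` T)" using cT by simp
    show "card (P ` T) \<le> 13728" using card_image_le[OF cT(1), of P] cT(2) by linarith
    fix X assume "X \<in> P ` T"
    then obtain k u where X: "X = P (k, u)" "(k, u) \<in> T" by auto
    obtain \<sigma> where b: "\<sigma> \<in> {1, -1}" "wp_branch ?S (\<lambda>w. (\<sigma> * \<epsilon>) * E w) u" using br[OF X(2)] by blast
    show "pfaffian_piece X"
      unfolding X(1) P_def prod.case
      by (rule pfaffian_piece_region[OF d I half, where \<epsilon> = "\<sigma> * \<epsilon>"]) (use b(2) in \<open>auto simp: wp_branch_def E_def\<close>)
    have k: "k \<in> {0, 1, 2}" using X(2) by (simp add: T_def)
    show "X \<subseteq> real_graph wp F"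
    proof
      fix p assume "p \<in> X"
      then obtain z w where p: "p = complex_pair z w" "region k z" "w \<in> ?S" "z = u w"
        unfolding X(1) P_def by auto
      then have "z \<in> F" "wp z = w" using k region_fundamental_domain b(2) by (blast, simp add: wp_branch_def)
      then show "p \<in> real_graph wp F" unfolding p(1) real_graph_eq by blast
    qed
  next
    fix z assume z: "z \<in> F" "wp z \<in> ?S"
    obtain k where k: "k \<in> {0, 1, 2}" "region k z" using z(1) region_fundamental_domain by blast
    have "log_root n1 n2 n3 root1 root2 root3 holomorphic_on ?S"
      using log_root_deriv[OF half] strip_open_convex(1)[OF d I] holomorphic_on_open by blast
    then have Eh: "(\<lambda>w. \<epsilon> * E w) holomorphic_on ?S" unfolding E_def by (intro holomorphic_intros)
    have "\<exists>\<sigma>\<in>{1, -1}. \<exists>u. u holomorphic_on ?S \<and> (\<forall>w\<in>?S. (u has_field_derivative \<sigma> * (\<epsilon> * E w)) (at w)) \<and>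
           u (wp z) = z \<and> (\<forall>w\<in>?S. u w \<notin> \<Omega> \<and> wp (u w) = w)"
      using sq[of _ 1] by (intro wp_branch_exists strip_open_convex d I Eh fundamental_domain_not_lattice z) auto
    then obtain \<sigma> u where u: "\<sigma> \<in> {1, -1}" "wp_branch ?S (\<lambda>w. (\<sigma> * \<epsilon>) * E w) u" "u (wp z) = z"
      unfolding wp_branch_def mult.assoc by blast
    then obtain u' where u': "u' \<in> \<U> \<sigma>" "u' (wp z) = z" using \<U>[OF u(1)] z by blast
    then have "(k, u') \<in> T" using k u(1) by (auto simp: T_def)
    moreover have "complex_pair z (wp z) \<in> P (k, u')" unfolding P_def prod.case using k(2) z(2) u'(2)[symmetric] by blast
    ultimately show "complex_pair z (wp z) \<in> \<Union>(P ` T)" by blast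
  qed
qed

text \<open>The vertical lines through the three roots leave four strips. What remains of each line
  after removing its root is covered by two half strips around it, one above and one below.\<close>

lemma strips_cover:
  obtains \<S> where "finite \<S>" "card \<S> \<le> 10" "- {root1, root2, root3} \<subseteq> \<Union>\<S>"
    "\<forall>S\<in>\<S>. \<exists>d I J D0. S = strip d I J \<and> cmod d = 1 \<and> open_interval I \<and> open_interval J \<and>
       (\<forall>e\<in>{root1, root2, root3}. Re (e * cnj d) \<notin> I \<or> Im (e * cnj d) \<notin> J) \<and> ray_closed D0 S"
proof -
  obtain d where d: "cmod d = 1" and dir: "\<And>E. E \<in> {root1 - root2, root1 - root3, root2 - root3} \<Longrightarrow>
      \<bar>Im (E * cnj d)\<bar> \<ge> 7/20 * cmod E \<and> Re (E * cnj d) \<noteq> 0"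
    using direction_exists[of "root1 - root2" "root1 - root3" "root2 - root3"] roots_distinct by auto
  define x where "x = (\<lambda>e. Re (e * cnj d))"
  define y where "y = (\<lambda>e. Im (e * cnj d))"
  have x_diff: "x e - x e' = Re ((e - e') * cnj d)" for e e' by (simp add: x_def left_diff_distrib)
  have "x root1 - x root2 \<noteq> 0" "x root1 - x root3 \<noteq> 0" "x root2 - x root3 \<noteq> 0" unfolding x_diff using dir by blast+
  then have distinct: "x root1 \<noteq> x root2" "x root1 \<noteq> x root3" "x root2 \<noteq> x root3" by simp_all
  obtain a b c where abc: "a < b" "b < c" "{a, b, c} = {x root1, x root2, x root3}"
    using three_reals_sorted[OF distinct] by blast
  \<comment> \<open>The smaller gap, so that the window around the abscissa of one root contains no
    other.\<close>
  define \<eta> where "\<eta> = min (b - a) (c - b)"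
  have \<eta>: "\<eta> > 0" using abc by (simp add: \<eta>_def)
  have apart: "s \<notin> {r - \<eta><..<r + \<eta>}" if "s \<noteq> r" "s \<in> {a, b, c}" "r \<in> {a, b, c}" for r s
    using that abc(1,2) unfolding \<eta>_def by auto
  have xe: "x e \<in> {a, b, c}" if "e \<in> {root1, root2, root3}" for e using that abc(3) by auto
  have xinj: "e = e'" if "e \<in> {root1, root2, root3}" "e' \<in> {root1, root2, root3}" "x e = x e'" for e e'
    using that distinct by auto
  define up where "up = (\<lambda>e. strip d {x e - \<eta><..<x e + \<eta>} {y e<..})"
  define down where "down = (\<lambda>e. strip d {x e - \<eta><..<x e + \<eta>} {..<y e})"
  define \<S> where "\<S> = set [strip d {..<a} UNIV, strip d {a<..<b} UNIV, strip d {b<..<c} UNIV, strip d {c<..} UNIV,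
    up root1, up root2, up root3, down root1, down root2, down root3]"
  have ok: "\<exists>d I J D0. strip d1 I1 J1 = strip d I J \<and> cmod d = 1 \<and> open_interval I \<and> open_interval J \<and>
       (\<forall>e\<in>{root1, root2, root3}. Re (e * cnj d) \<notin> I \<or> Im (e * cnj d) \<notin> J) \<and> ray_closed D0 (strip d1 I1 J1)"
    if "d1 = d" "open_interval I1" "open_interval J1" "\<And>e. e \<in> {root1, root2, root3} \<Longrightarrow> x e \<notin> I1 \<or> y e \<notin> J1"
      "s \<in> {1, -1}" "\<And>y t. y \<in> J1 \<Longrightarrow> t \<ge> 0 \<Longrightarrow> y + s * t \<in> J1" for d1 I1 J1 s
  proof -
    have "ray_closed (of_real s * \<i> * d) (strip d I1 J1)"
      using dir by (intro strip_ray_closed d that) auto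
    moreover have "\<forall>e\<in>{root1, root2, root3}. Re (e * cnj d) \<notin> I1 \<or> Im (e * cnj d) \<notin> J1"
      using that(4) unfolding x_def y_def by blast
    ultimately show ?thesis using d that(1,2,3) by blast
  qed
  show ?thesis
  proof (rule that)
    show "finite \<S>" by (simp add: \<S>_def)
    show "card \<S> \<le> 10" unfolding \<S>_def by (rule order_trans[OF card_length]) simp
    show "- {root1, root2, root3} \<subseteq> \<Union>\<S>"
    proof
      fix w assume w: "w \<in> - {root1, root2, root3}"
      show "w \<in> \<Union>\<S>"
      proof (cases "x w \<in> {a, b, c}")
        case False
        then have "x w < a \<or> a < x w \<and> x w < b \<or> b < x w \<and> x w < c \<or> c < x w" by auto
        then show ?thesis by (auto simp: \<S>_def strip_iff[OF d] x_def)
      next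
        case True
        then obtain e where e: "e \<in> {root1, root2, root3}" "x w = x e" using abc(3) by auto
        have "y w \<noteq> y e"
        proof
          assume "y w = y e"
          then have "w * cnj d = e * cnj d" using e(2) by (simp add: complex_eq_iff x_def y_def)
          then show False using w e(1) d by auto
        qed
        then have "w \<in> up e \<or> w \<in> down e"
          using e(2) \<eta> unfolding up_def down_def strip_iff[OF d] x_def y_def by auto
        then show ?thesis using e(1) unfolding \<S>_def by auto
      qed
    qed
    show "\<forall>S\<in>\<S>. \<exists>d I J D0. S = strip d I J \<and> cmod d = 1 \<and> open_interval I \<and> open_interval J \<and>
       (\<forall>e\<in>{root1, root2, root3}. Re (e * cnj d) \<notin> I \<or> Im (e * cnj d) \<notin> J) \<and> ray_closed D0 S"
    proof
      fix S assume "S \<in> \<S>"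
      then consider I where "S = strip d I UNIV" "I \<in> {{..<a}, {a<..<b}, {b<..<c}, {c<..}}"
        | e where "e \<in> {root1, root2, root3}" "S = up e" | e where "e \<in> {root1, root2, root3}" "S = down e"
        unfolding \<S>_def by auto
      then show "\<exists>d I J D0. S = strip d I J \<and> cmod d = 1 \<and> open_interval I \<and> open_interval J \<and>
         (\<forall>e\<in>{root1, root2, root3}. Re (e * cnj d) \<notin> I \<or> Im (e * cnj d) \<notin> J) \<and> ray_closed D0 S"
      proof cases
        case 1
        have "open_interval I" using 1(2) abc(1,2) by auto
        moreover have "r \<notin> I" if "r \<in> {a, b, c}" for r using that 1(2) abc(1,2) by auto
        ultimately show ?thesis unfolding 1(1) using xe by (intro ok[where s = 1]) auto
      next
        case 2
        have "x e' \<notin> {x e - \<eta><..<x e + \<eta>} \<or> y e' \<notin> {y e<..}" if "e' \<in> {root1, root2, root3}" for e'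
          using apart[of "x e'" "x e"] xe[OF that] xe[OF 2(1)] xinj[OF that 2(1)] by auto
        then show ?thesis unfolding 2(2) up_def using \<eta> by (intro ok[where s = 1]) auto
      next
        case 3
        have "x e' \<notin> {x e - \<eta><..<x e + \<eta>} \<or> y e' \<notin> {..<y e}" if "e' \<in> {root1, root2, root3}" for e'
          using apart[of "x e'" "x e"] xe[OF that] xe[OF 3(1)] xinj[OF that 3(1)] by auto
        then show ?thesis unfolding 3(2) down_def using \<eta> by (intro ok[where s = "-1"]) auto
      qed
    qed
  qed
qed

text \<open>Congruent points whose coordinates all lie in \<open>[0, 1)\<close> coincide.\<close>

lemma root_in_fundamental_domain:
  assumes "z \<in> F" "wp z \<in> {root1, root2, root3}"
  shows "z \<in> {half1, half2, half3}"
proof -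
  have "z = h" if "z - h \<in> \<Omega>" "h \<in> {half1, half2, half3}" for h
  proof -
    have *: "a = b" if "a - b \<in> \<int>" "a \<in> {0..<1}" "b \<in> {0..<1}" for a b :: real
    proof -
      obtain n where n: "a - b = of_int n" using \<open>a - b \<in> \<int>\<close> by (auto elim!: Ints_cases)
      moreover have "-1 < a - b" "a - b < 1" using that by auto
      ultimately have "n = 0" by linarith
      then show ?thesis using n by simp
    qed
    have "coord1 h \<in> {0..<1}" "coord2 h \<in> {0..<1}" using that(2) by auto
    moreover have "coord1 z \<in> {0..<1}" "coord2 z \<in> {0..<1}" using assms(1) unfolding fundamental_domain_coord by blast+
    moreover have "coord1 z - coord1 h \<in> \<int>" "coord2 z - coord2 h \<in> \<int>" using that(1) unfolding lattice_iff coord_diff by blast+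
    ultimately have "coord1 z = coord1 h" "coord2 z = coord2 h" using * by blast+
    then show ?thesis using coord_decomp[of z] coord_decomp[of h] by metis
  qed
  moreover have "z - half1 \<in> \<Omega> \<or> z - half2 \<in> \<Omega> \<or> z - half3 \<in> \<Omega>"
    using wp_eq_root[OF fundamental_domain_not_lattice[OF assms(1)]] assms(2) by auto
  ultimately show ?thesis by blast
qed

text \<open>No strip contains a root, so the points over the half periods enter as singletons; every
  other point of the graph lies over one of the strips.\<close>

lemma real_graph_piecewise_semipfaffian: "piecewise_semipfaffian 7 9 1 4 144503 2 (real_graph wp F)"
proof -
  obtain \<S> where \<S>: "finite \<S>" "card \<S> \<le> 10" "- {root1, root2, root3} \<subseteq> \<Union>\<S>"
    "\<forall>S\<in>\<S>. \<exists>d I J D0. S = strip d I J \<and> cmod d = 1 \<and> open_interval I \<and> open_interval J \<and>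
       (\<forall>e\<in>{root1, root2, root3}. Re (e * cnj d) \<notin> I \<or> Im (e * cnj d) \<notin> J) \<and> ray_closed D0 S"
    by (rule strips_cover)
  have "\<exists>\<X>. finite \<X> \<and> card \<X> \<le> 13728 \<and> (\<forall>X\<in>\<X>. pfaffian_piece X \<and> X \<subseteq> real_graph wp F) \<and>
    (\<forall>z\<in>F. wp z \<in> S \<longrightarrow> complex_pair z (wp z) \<in> \<Union>\<X>)" if S: "S \<in> \<S>" for S
    using bspec[OF \<S>(4) S] strip_pieces by metis
  then obtain \<X> where \<X>: "\<And>S. S \<in> \<S> \<Longrightarrow> finite (\<X> S) \<and> card (\<X> S) \<le> 13728 \<and>
      (\<forall>X\<in>\<X> S. pfaffian_piece X \<and> X \<subseteq> real_graph wp F) \<and>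
      (\<forall>z\<in>F. wp z \<in> S \<longrightarrow> complex_pair z (wp z) \<in> \<Union>(\<X> S))"
    by metis
  define H where "H = (\<lambda>h. {complex_pair h (wp h)}) ` {half1, half2, half3}"
  have HF: "h \<in> F" if "h \<in> {half1, half2, half3}" for h using that by (auto simp: fundamental_domain_coord)
  have "card H \<le> card {half1, half2, half3}" unfolding H_def by (rule card_image_le) simp
  also have "\<dots> \<le> 3" by (simp add: card_insert_if)
  finally have cH: "card H \<le> 3" .
  have "card (\<Union>S\<in>\<S>. \<X> S) \<le> (\<Sum>S\<in>\<S>. card (\<X> S))" by (rule card_UN_le[OF \<S>(1)])
  also have "\<dots> \<le> (\<Sum>S\<in>\<S>. 13728)" using \<X> by (intro sum_mono) auto
  also have "\<dots> \<le> 137280" using \<S>(2) by simp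
  finally have c: "card (H \<union> (\<Union>S\<in>\<S>. \<X> S)) \<le> 144503"
    using card_Un_le[of H "\<Union>S\<in>\<S>. \<X> S"] cH by linarith
  have "piecewise_semipfaffian 7 9 1 4 144503 2 (\<Union>(H \<union> (\<Union>S\<in>\<S>. \<X> S)))"
  proof (rule piecewise_semipfaffian_Union[OF _ _ c])
    show "finite (H \<union> (\<Union>S\<in>\<S>. \<X> S))" using \<S>(1) \<X> by (simp add: H_def)
    show "H \<union> (\<Union>S\<in>\<S>. \<X> S) \<noteq> {}" by (simp add: H_def)
    fix X assume "X \<in> H \<union> (\<Union>S\<in>\<S>. \<X> S)"
    then show "pfaffian_piece X"
    proof
      assume "X \<in> H"
      then show ?thesis using pfaffian_piece_singleton unfolding H_def by blast
    next
      assume "X \<in> (\<Union>S\<in>\<S>. \<X> S)"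
      then show ?thesis using \<X> by blast
    qed
  qed
  moreover have "\<Union>(H \<union> (\<Union>S\<in>\<S>. \<X> S)) = real_graph wp F"
  proof
    show "\<Union>(H \<union> (\<Union>S\<in>\<S>. \<X> S)) \<subseteq> real_graph wp F"
    proof (rule Union_least)
      fix X assume "X \<in> H \<union> (\<Union>S\<in>\<S>. \<X> S)"
      then show "X \<subseteq> real_graph wp F"
      proof
        assume "X \<in> H"
        then show ?thesis using HF unfolding H_def real_graph_eq by blast
      next
        assume "X \<in> (\<Union>S\<in>\<S>. \<X> S)"
        then show ?thesis using \<X> by blast
      qed
    qed
    show "real_graph wp F \<subseteq> \<Union>(H \<union> (\<Union>S\<in>\<S>. \<X> S))"
    proof
      fix p assume "p \<in> real_graph wp F"
      then obtain z where z: "z \<in> F" "p = complex_pair z (wp z)" unfolding real_graph_eq by blast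
      show "p \<in> \<Union>(H \<union> (\<Union>S\<in>\<S>. \<X> S))"
      proof (cases "wp z \<in> {root1, root2, root3}")
        case True
        then show ?thesis using root_in_fundamental_domain[OF z(1)] z(2) unfolding H_def by blast
      next
        case False
        then have "wp z \<in> \<Union>\<S>" using \<S>(3) by (meson ComplI subsetD)
        then obtain S where S: "S \<in> \<S>" "wp z \<in> S" by (rule UnionE)
        have "complex_pair z (wp z) \<in> \<Union>(\<X> S)"
          using \<X>[OF S(1), THEN conjunct2, THEN conjunct2, THEN conjunct2] z(1) S(2) by (simp only:)
        then show ?thesis unfolding z(2) using S(1) by (simp only: Union_Un_distrib Union_iff Un_iff UN_iff) blast
      qed
    qed
  qed
  ultimately show ?thesis by simp
qed

end

theorem theorem1:
  fixes \<Omega> :: "complex set" and \<omega>1 \<omega>2 :: complex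
  assumes "complex_lattice \<Omega>"
    and "lattice_basis \<Omega> \<omega>1 \<omega>2"
    and "Im (\<omega>2 / \<omega>1) > 0"
    and "\<bar>Re (\<omega>2 / \<omega>1)\<bar> \<le> 1 / 2"
    and "cmod (\<omega>2 / \<omega>1) \<ge> 1"
  shows "piecewise_semipfaffian 7 9 1 4 144503 2
           (real_graph (weierstrass_p \<Omega>) (fundamental_domain \<omega>1 \<omega>2))"
proof -
  interpret reduced_lattice \<Omega> \<omega>1 \<omega>2
    using assms by unfold_locales (simp_all add: lattice_basis_def)
  show ?thesis by (rule real_graph_piecewise_semipfaffian)
qed

end
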